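(* The boundary of $\mathcal G_R$ is the union of $\mathcal E_{RS}^{(\ell)}$, $\ell=1,\dots,k'-1$, and $\mathcal E_{FR}$. The curve $\mathcal E_{FR}$ separates $\mathcal G_R$ and $\mathcal G_F$, and the curves $\mathcal E_{RS}^{(\ell)}$, $\ell=1,\dots,k'-1$, separate $\mathcal G_R$ and $\mathcal G_S$. Moreover, every $(\chi,\eta)\in(-1,1)^2$ belongs to one of the sets $\mathcal G_F,\mathcal G_R,\mathcal G_S,\mathcal E_{FR},\mathcal E_{RS}^{(1)},\dots,\mathcal E_{RS}^{(k'-1)}$. (All sets are defined in the context.)
   Context: Let $k\ge1$ be an integer and $\alpha_1,\dots,\alpha_k,\beta_1,\dots,\beta_k>0$ with $\alpha_1\cdots\alpha_k=\beta_1\cdots\beta_k$. Let (ordered product, $m=1$ leftmost) \[ \Phi(z) = \frac{1}{(1-z^{-1})^k}\prod_{m=1}^k \begin{pmatrix}1 & \alpha_m z^{-1}\\ \alpha_m^{-1} & 1\end{pmatrix} \begin{pmatrix}1 & \beta_mz^{-1}\\ \beta_m^{-1} & 1\end{pmatrix}, \qquad p(z)=\big((z-1)^k\operatorname{Tr}\Phi(z)\big)^2-4(z-1)^{2k}. \] $p$ is a real polynomial of degree $2k-1$ whose zeros $s_0,\dots,s_{2(k-1)}$ (with multiplicity) satisfy $0=s_0>s_1\ge s_2>s_3\ge s_4>\dots>s_{2k-3}\ge s_{2(k-1)}$. Write $p=q^2p_0$ with $q,p_0$ polynomials with only simple zeros and $q$ monic; let $0=x_0>x_1>\dots>x_{2(k'-1)}$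 be the zeros of $p_0$, so $1\le k'\le k$, $\deg p_0=2k'-1$, $\deg q=k-k'$. $\mathcal R$ is the compact Riemann surface $\{(z,w)\in\mathbb C^2: w^2=p_0(z)\}$ together with the point $y_{2k'-1}=(\infty,\infty)$. For $\ell=1,\dots,k'-1$ let $I_\ell=(x_{2\ell},x_{2\ell-1})$ and $C_\ell^+=\{(z,w)\in\mathcal R: z\in\overline{I_\ell}\}$; let $C_0^+=\{(z,w)\in\mathcal R: z\in[0,\infty)\}\cup\{y_{2k'-1}\}$ and $C^+=\bigcup_{\ell=0}^{k'-1}C_\ell^+$. On $\mathcal R$ let $\rho(z,w)=\frac12\operatorname{Tr}\Phi(z)+\frac{q(z)w}{2(z-1)^k}$ (meromorphic) and, for $(\chi,\eta)\in(-1,1)^2$, \[ F(z,w;\chi,\eta)=\frac k4(\eta+1)\log z-\frac k2\log(z-1)-\frac\chi2\log\rho(z,w). \] $F$ is multivalued but its differential is a well-defined meromorphic differential on $\mathcal R$; a critical point of $F$ is a zero of this differential (in local coordinates), and its order is the order of the zero. Regions: $(\chi,\eta)\in(-1,1)^2$ is in - $\mathcal G_F$ (frozen) if $F$ has two distinct critical points in $C_0^+$; - $\mathcal G_R$ (rough) if $F$ has critical points in $\mathcal R\setminus C^+$; - $\mathcal G_S$ (smooth) if $F$ has four distinct critical points in $C_\ell^+$ for some $\ell=1,\dots,k'-1$; - $\mathcal E_{FR}$ if $F$ has a critical point of order two in $C_0^+$; - $\mathcal E_{RS}^{(\ell)}$ ($\ell=1,\dots,k'-1$) if $F$ has a critical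 point of order at least two in $C_\ell^+$. By convention the four points $(0,\pm1)$ and $\left(\pm1,\frac1k\frac{p'(1)}{p(1)}-1\right)$ are added to $\mathcal E_{FR}$; with this convention $\mathcal E_{FR}$ and the $\mathcal E_{RS}^{(\ell)}$ are disjoint simple closed curves in $[-1,1]^2$. *)

theory Defs
  imports "HOL-Complex_Analysis.Complex_Analysis"
begin

definition transition_factor :: "real \<Rightarrow> complex \<Rightarrow> complex^2^2" where
  "transition_factor a z =
     vector [vector [1, of_real a * inverse z], vector [inverse (of_real a), 1]]"

text \<open>The weights are \<open>\<alpha> 1, \<dots>, \<alpha> k\<close> and \<open>\<beta> 1, \<dots>, \<beta> k\<close>; the pair with index 1 is leftmost.\<close>

definition Phi :: "nat \<Rightarrow> (nat \<Rightarrow> real) \<Rightarrow> (nat \<Rightarrow> real) \<Rightarrow> complex \<Rightarrow> complex^2^2" where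
  "Phi k \<alpha> \<beta> z =
     mat (1 / (1 - inverse z) ^ k) **
     foldr (\<lambda>m A. transition_factor (\<alpha> m) z ** transition_factor (\<beta> m) z ** A)
       [1..<Suc k] (mat 1)"

definition rho ::
  "nat \<Rightarrow> (nat \<Rightarrow> real) \<Rightarrow> (nat \<Rightarrow> real) \<Rightarrow> complex poly \<Rightarrow> complex \<Rightarrow> complex \<Rightarrow> complex" where
  "rho k \<alpha> \<beta> q z w = trace (Phi k \<alpha> \<beta> z) / 2 + poly q z * w / (2 * (z - 1) ^ k)"

datatype surface_point = Affine complex complex | At_Infinity

definition spectral_surface :: "complex poly \<Rightarrow> surface_point set" where
  "spectral_surface p0 = {Affine z w | z w. w ^ 2 = poly p0 z} \<union> {At_Infinity}"

text \<open>
  \<open>local_parametrization p0 P Z W\<close>: the map \<open>t \<mapsto> (Z t, W t)\<close> is the inverse of a local coordinate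
  of the surface \<open>w\<^sup>2 = p0(z)\<close> centred at \<open>P\<close>. When \<open>p0\<close> has odd degree and simple zeros,
  the surface is smooth, with a single point at infinity, so that an injective holomorphic
  map from a disc into it is biholomorphic onto an open set. At infinity the functions \<open>Z\<close> and \<open>W\<close>
  have poles at \<open>0\<close>, and their values at \<open>0\<close> are irrelevant.
\<close>

fun local_parametrization ::
  "complex poly \<Rightarrow> surface_point \<Rightarrow> (complex \<Rightarrow> complex) \<Rightarrow> (complex \<Rightarrow> complex) \<Rightarrow> bool" where
  "local_parametrization p0 (Affine z w) Z W \<longleftrightarrow>
     Z 0 = z \<and> W 0 = w \<and>
     (\<exists>r>0. Z holomorphic_on ball 0 r \<and> W holomorphic_on ball 0 r \<and>
        (\<forall>t\<in>ball 0 r. (W t) ^ 2 = poly p0 (Z t)) \<and>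
        inj_on (\<lambda>t. (Z t, W t)) (ball 0 r))"
| "local_parametrization p0 At_Infinity Z W \<longleftrightarrow>
     filterlim Z at_infinity (at 0) \<and>
     (\<exists>r>0. Z holomorphic_on (ball 0 r - {0}) \<and> W holomorphic_on (ball 0 r - {0}) \<and>
        (\<forall>t\<in>ball 0 r - {0}. (W t) ^ 2 = poly p0 (Z t)) \<and>
        inj_on (\<lambda>t. (Z t, W t)) (ball 0 r - {0}))"

text \<open>
  The coefficient of \<open>dt\<close> in the pullback under \<open>t \<mapsto> (Z t, W t)\<close> of
  \[ dF = \frac{k}{4}(\eta+1)\frac{dz}{z} - \frac{k}{2}\frac{dz}{z-1}
          - \frac{\chi}{2}\frac{d\rho}{\rho}. \]
\<close>

definition dF_pullback ::
  "nat \<Rightarrow> (complex \<Rightarrow> complex \<Rightarrow> complex) \<Rightarrow> real \<Rightarrow> real \<Rightarrow>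
   (complex \<Rightarrow> complex) \<Rightarrow> (complex \<Rightarrow> complex) \<Rightarrow> complex \<Rightarrow> complex" where
  "dF_pullback k \<rho> chi eta Z W t =
     of_nat k / 4 * of_real (eta + 1) * (deriv Z t / Z t)
     - of_nat k / 2 * (deriv Z t / (Z t - 1))
     - of_real chi / 2 * (deriv (\<lambda>s. \<rho> (Z s) (W s)) t / \<rho> (Z t) (W t))"

text \<open>
  \<open>zorder\<close> depends only on the germ on a punctured neighbourhood of \<open>0\<close>, so it is the order of the
  meromorphic differential even where \<open>dF_pullback\<close> is evaluated at a removable singularity or a
  pole. \<open>zorder\<close> is meaningful only for a germ that does not vanish identically.
\<close>

definition critical_point_of_order ::
  "nat \<Rightarrow> (complex \<Rightarrow> complex \<Rightarrow> complex) \<Rightarrow> complex poly \<Rightarrow> real \<Rightarrow> real \<Rightarrow>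
   surface_point \<Rightarrow> nat \<Rightarrow> bool" where
  "critical_point_of_order k \<rho> p0 chi eta P n \<longleftrightarrow>
     P \<in> spectral_surface p0 \<and> n \<ge> 1 \<and>
     (\<exists>Z W. local_parametrization p0 P Z W \<and>
        (\<exists>\<^sub>F t in at 0. dF_pullback k \<rho> chi eta Z W t \<noteq> 0) \<and>
        zorder (dF_pullback k \<rho> chi eta Z W) 0 = int n)"

definition critical_point ::
  "nat \<Rightarrow> (complex \<Rightarrow> complex \<Rightarrow> complex) \<Rightarrow> complex poly \<Rightarrow> real \<Rightarrow> real \<Rightarrow>
   surface_point \<Rightarrow> bool" where
  "critical_point k \<rho> p0 chi eta P \<longleftrightarrow> (\<exists>n. critical_point_of_order k \<rho> p0 chi eta P n)"

text \<open>
  The cycles \<open>C\<^sub>l\<^sup>+\<close>, where \<open>x 0 > x 1 > \<dots> > x (2 * (k' - 1))\<close> are the zeros of \<open>p0\<close>.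
\<close>

definition real_cycle :: "complex poly \<Rightarrow> (nat \<Rightarrow> real) \<Rightarrow> nat \<Rightarrow> surface_point set" where
  "real_cycle p0 x l =
     (if l = 0
      then {Affine z w | z w. w ^ 2 = poly p0 z \<and> z \<in> of_real ` {0..}} \<union> {At_Infinity}
      else {Affine z w | z w. w ^ 2 = poly p0 z \<and>
              z \<in> of_real ` closure {x (2 * l) <..< x (2 * l - 1)}})"

definition real_cycles :: "complex poly \<Rightarrow> (nat \<Rightarrow> real) \<Rightarrow> nat \<Rightarrow> surface_point set" where
  "real_cycles p0 x k' = (\<Union>l\<in>{0..k' - 1}. real_cycle p0 x l)"

definition open_square :: "(real \<times> real) set" where
  "open_square = {-1<..<1} \<times> {-1<..<1}"

definition frozen_region ::
  "nat \<Rightarrow> (complex \<Rightarrow> complex \<Rightarrow> complex) \<Rightarrow> complex poly \<Rightarrow> (nat \<Rightarrow> real) \<Rightarrow>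
   (real \<times> real) set" where
  "frozen_region k \<rho> p0 x =
     {(chi, eta) \<in> open_square.
        \<exists>S \<subseteq> real_cycle p0 x 0. card S = 2 \<and> (\<forall>P\<in>S. critical_point k \<rho> p0 chi eta P)}"

definition rough_region ::
  "nat \<Rightarrow> (complex \<Rightarrow> complex \<Rightarrow> complex) \<Rightarrow> complex poly \<Rightarrow> (nat \<Rightarrow> real) \<Rightarrow> nat \<Rightarrow>
   (real \<times> real) set" where
  "rough_region k \<rho> p0 x k' =
     {(chi, eta) \<in> open_square.
        \<exists>P \<in> spectral_surface p0 - real_cycles p0 x k'. critical_point k \<rho> p0 chi eta P}"

definition smooth_region ::
  "nat \<Rightarrow> (complex \<Rightarrow> complex \<Rightarrow> complex) \<Rightarrow> complex poly \<Rightarrow> (nat \<Rightarrow> real) \<Rightarrow> nat \<Rightarrow>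
   (real \<times> real) set" where
  "smooth_region k \<rho> p0 x k' =
     {(chi, eta) \<in> open_square.
        \<exists>l\<in>{1..k' - 1}. \<exists>S \<subseteq> real_cycle p0 x l.
          card S = 4 \<and> (\<forall>P\<in>S. critical_point k \<rho> p0 chi eta P)}"

text \<open>
  The points of tangency with the boundary of the square are included by convention. The
  polynomial \<open>p\<close> has complex coefficients as a HOL term, but these are real, so \<open>Re\<close> only changes
  the type.
\<close>

definition frozen_rough_curve ::
  "nat \<Rightarrow> (complex \<Rightarrow> complex \<Rightarrow> complex) \<Rightarrow> complex poly \<Rightarrow> complex poly \<Rightarrow> (nat \<Rightarrow> real) \<Rightarrow>
   (real \<times> real) set" where
  "frozen_rough_curve k \<rho> p p0 x =
     {(chi, eta) \<in> open_square.
        \<exists>P \<in> real_cycle p0 x 0. critical_point_of_order k \<rho> p0 chi eta P 2}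
     \<union> (let eta0 = 1 / real k * Re (poly (pderiv p) 1 / poly p 1) - 1
        in {(0, 1), (0, -1), (1, eta0), (-1, eta0)})"

definition rough_smooth_curve ::
  "nat \<Rightarrow> (complex \<Rightarrow> complex \<Rightarrow> complex) \<Rightarrow> complex poly \<Rightarrow> (nat \<Rightarrow> real) \<Rightarrow> nat \<Rightarrow>
   (real \<times> real) set" where
  "rough_smooth_curve k \<rho> p0 x l =
     {(chi, eta) \<in> open_square.
        \<exists>P \<in> real_cycle p0 x l. \<exists>n\<ge>2. critical_point_of_order k \<rho> p0 chi eta P n}"

text \<open>
  \<open>X\<close> separates \<open>A\<close> from \<open>B\<close>: it is disjoint from both, no component of its complement meets
  both, and \<open>X\<close> is an interface, i.e. each of its points is adjacent to both \<open>A\<close> and \<open>B\<close>. For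
  a union of curves the last clause says that each single curve borders on both regions.
\<close>

definition separates :: "'a::topological_space set \<Rightarrow> 'a set \<Rightarrow> 'a set \<Rightarrow> bool" where
  "separates X A B \<longleftrightarrow>
     X \<inter> A = {} \<and> X \<inter> B = {} \<and>
     (\<forall>a\<in>A. \<forall>b\<in>B. \<not> connected_component (- X) a b) \<and>
     X \<subseteq> frontier A \<inter> frontier B"

end

theory Submission
  imports Defs "HOL-Computational_Algebra.Fundamental_Theorem_Algebra"
begin

text \<open>
  Put \<open>P = (z - 1)\<^sup>k Tr \<Phi>\<close> and \<open>q N = (z - 1) P' - k P\<close>. Then \<open>d \<rho> / \<rho> = N dz / (w (z - 1))\<close>, so
  the critical points of \<open>F\<close> are the zeros of \<open>G = L w + 2 \<chi> z N\<close> on \<open>w\<^sup>2 = p0\<close>, where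
  \<open>L = k ((1 - \<eta>) z + 1 + \<eta>)\<close>, and their \<open>z\<close>-coordinates are the \<open>2 k'\<close> zeros of
  \<open>Q = (L\<^sup>2 p0 - 4 \<chi>\<^sup>2 z\<^sup>2 N\<^sup>2) / z\<close>. By Rolle's theorem for \<open>\<rho>\<^sup>2\<close>, \<open>N\<close> has one zero in each
  interval, which forces two critical points on each of the \<open>k' - 1\<close> compact cycles. Only two
  remain, and parity puts them both on the oval over \<open>z \<ge> 0\<close>, both on one other cycle, or both off
  the cycles.

  Over \<open>z \<ge> 0\<close> the equation \<open>G = 0\<close> is \<open>1 + \<eta> (1 - 2 s) = \<bar>\<chi>\<bar> H s\<close> with \<open>s = z / (1 + z)\<close>. The
  minimum \<open>m (\<chi>, \<eta>)\<close> of the difference of the two sides is continuous, and \<open>m - 1\<close> is homogeneous,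
  so that \<open>m < 0\<close>, \<open>m = 0\<close> and \<open>m > 0\<close> describe the frozen region, its boundary curve, and the rest.

  The points with four critical points on one cycle form a closed set inside \<open>m > 0\<close>. At a
  boundary point of it a pair of conjugate critical points merges into a double critical point.
  Conversely a double critical point splits under suitable perturbations: into a nonreal pair by
  Hurwitz's theorem, and into real ones by the intermediate value theorem.
\<close>

section \<open>Roots of real polynomials\<close>

text \<open>Two difficulties shape the proof. First, zeros of \<open>Q\<close> and critical points
  do not correspond one to one: the multiplicity of a zero of \<open>Q\<close> is the sum of the
  orders of \<open>G\<close> on the two sheets above it, so a double zero over a compact cycle may
  be one double critical point or two simple ones. The counting is done with \<open>Q\<close>, and
  the smooth region is then told apart from its boundary curve on the surface itself, through
  \<open>E2\<close>. Over the positive axis \<open>N\<close> has no zero, which confines each zero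
  to one sheet. Second, on the line \<open>chi = 0\<close> the branch points of the cycles are
  critical themselves, parity of zero counts is no longer controlled at the ends of the intervals,
  and critical points off the cycles may lie over real \<open>z\<close>. There \<open>Q\<close>
  factors explicitly, and the position of \<open>zeta eta\<close> decides everything. In the
  perturbation of a double point, the Hurwitz argument needs an even difference between the orders
  of the function and of the perturbation. For odd order the perturbation therefore keeps the point
  critical.\<close>

definition cpoly :: "real poly \<Rightarrow> complex poly" where
  "cpoly p = map_poly complex_of_real p"

lemma coeff_cpoly [simp]: "coeff (cpoly p) i = of_real (coeff p i)"
  by (simp add: cpoly_def coeff_map_poly)

lemma cpoly_0 [simp]: "cpoly 0 = 0"
  and cpoly_1 [simp]: "cpoly 1 = 1"
  and cpoly_pCons [simp]: "cpoly (pCons a p) = pCons (of_real a) (cpoly p)"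
  by (simp_all add: cpoly_def map_poly_pCons)

lemma cpoly_add [simp]: "cpoly (p + q) = cpoly p + cpoly q"
  and cpoly_diff [simp]: "cpoly (p - q) = cpoly p - cpoly q"
  and cpoly_minus [simp]: "cpoly (- p) = - cpoly p"
  and cpoly_smult [simp]: "cpoly (smult c p) = smult (of_real c) (cpoly p)"
  and cpoly_mult [simp]: "cpoly (p * q) = cpoly p * cpoly q"
  by (rule poly_eqI; simp add: coeff_mult)+

lemma cpoly_power [simp]: "cpoly (p ^ n) = cpoly p ^ n"
  by (induction n) auto

lemma cpoly_prod [simp]: "cpoly (\<Prod>i\<in>A. f i) = (\<Prod>i\<in>A. cpoly (f i))"
  by (induction A rule: infinite_finite_induct) auto

lemma cpoly_pderiv [simp]: "cpoly (pderiv p) = pderiv (cpoly p)"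
  by (rule poly_eqI) (simp add: coeff_pderiv)

lemma degree_cpoly [simp]: "degree (cpoly p) = degree p"
  by (simp add: cpoly_def degree_map_poly)

lemma cpoly_eq_iff [simp]: "cpoly p = cpoly q \<longleftrightarrow> p = q"
  by (auto simp: poly_eq_iff)

lemma cpoly_eq_0_iff [simp]: "cpoly p = 0 \<longleftrightarrow> p = 0"
  using cpoly_eq_iff[of p 0] by (simp del: cpoly_eq_iff)

lemma poly_cpoly_of_real [simp]: "poly (cpoly p) (of_real x) = of_real (poly p x)"
  by (induction p) auto

lemma poly_cpoly_1 [simp]: "poly (cpoly p) 1 = of_real (poly p 1)"
  using poly_cpoly_of_real[of p 1] by (simp del: poly_cpoly_of_real)

lemma cnj_poly_cpoly: "cnj (poly (cpoly p) z) = poly (cpoly p) (cnj z)"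
  by (induction p) auto

lemma cpoly_of_cnj_closed:
  assumes "\<And>i. coeff p i \<in> \<real>"
  obtains r where "p = cpoly r"
proof -
  have "p = cpoly (map_poly Re p)"
    by (rule poly_eqI) (use assms in \<open>auto simp: coeff_map_poly elim!: Reals_cases\<close>)
  thus ?thesis using that by blast
qed

lemma order_cpoly:
  assumes "p \<noteq> 0"
  shows "order (of_real x) (cpoly p) = order x p"
proof -
  obtain q where q: "p = [:- x, 1:] ^ order x p * q" "\<not> [:- x, 1:] dvd q"
    using order_decomp[OF assms] by blast
  have "poly q x \<noteq> 0" using q(2) by (simp add: poly_eq_0_iff_dvd)
  hence "poly (cpoly q) (of_real x) \<noteq> 0" by simp
  hence "\<not> [:- of_real x, 1:] dvd cpoly q" by (simp only: poly_eq_0_iff_dvd not_False_eq_True)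
  hence "\<not> [:- of_real x, 1:] ^ Suc (order x p) dvd [:- of_real x, 1:] ^ order x p * cpoly q"
    by (simp only: power_Suc2 dvd_mult_cancel_left) simp
  moreover have "cpoly p = [:- of_real x, 1:] ^ order x p * cpoly q"
    by (subst q(1)) simp
  ultimately show ?thesis
    by (intro order_unique_lemma) (simp_all only: dvd_triv_left not_False_eq_True)
qed

section \<open>Counting zeros with multiplicity in a set\<close>

definition roots_in :: "'a set \<Rightarrow> 'a :: idom poly \<Rightarrow> nat" where
  "roots_in A p = size (filter_mset (\<lambda>r. r \<in> A) (proots p))"

lemma roots_in_mult_linear:
  "roots_in A ([:-r, 1:] * p) = roots_in A p + (if r \<in> A then 1 else 0)" if "p \<noteq> 0"
  using that by (simp add: roots_in_def proots_mult del: mult_pCons_left)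

lemma roots_in_mono: "A \<subseteq> B \<Longrightarrow> roots_in A p \<le> roots_in B p"
  unfolding roots_in_def
  by (intro size_mset_mono) (auto simp: subseteq_mset_def)

lemma roots_in_UNIV: "roots_in UNIV p = size (proots p)"
  by (simp add: roots_in_def)

lemma roots_in_Un_disjoint:
  "A \<inter> B = {} \<Longrightarrow> roots_in (A \<union> B) p = roots_in A p + roots_in B p"
  unfolding roots_in_def
  by (subst size_union[symmetric]) (rule arg_cong[where f = size], rule multiset_eqI, auto)

lemma roots_in_UN_disjoint:
  assumes "finite I" "\<And>i j. i \<in> I \<Longrightarrow> j \<in> I \<Longrightarrow> i \<noteq> j \<Longrightarrow> A i \<inter> A j = {}"
  shows "roots_in (\<Union>i\<in>I. A i) p = (\<Sum>i\<in>I. roots_in (A i) p)"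
  using assms
proof (induction I)
  case empty
  thus ?case by (simp add: roots_in_def)
next
  case (insert i I)
  have "A i \<inter> (\<Union>i\<in>I. A i) = {}" using insert by fastforce
  thus ?case using insert by (simp add: roots_in_Un_disjoint)
qed

lemma roots_in_cong:
  assumes "p \<noteq> 0" "\<And>r. poly p r = 0 \<Longrightarrow> r \<in> A \<longleftrightarrow> r \<in> B"
  shows "roots_in A p = roots_in B p"
  unfolding roots_in_def
  by (rule arg_cong[where f = size], rule filter_mset_cong) (use assms in auto)

lemma roots_in_pos_iff: "p \<noteq> 0 \<Longrightarrow> roots_in A p > 0 \<longleftrightarrow> (\<exists>r\<in>A. poly p r = 0)"
  unfolding roots_in_def by (auto simp: nonempty_has_size[symmetric] filter_mset_eq_conv)

lemma roots_in_ge_order: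
  assumes "p \<noteq> 0" "r \<in> A"
  shows "order r p \<le> roots_in A p"
proof -
  have "replicate_mset (order r p) r \<subseteq># filter_mset (\<lambda>r. r \<in> A) (proots p)"
    using assms by (auto simp: subseteq_mset_def)
  from size_mset_mono[OF this] show ?thesis by (simp add: roots_in_def)
qed

lemma roots_in_ge_order2:
  assumes "p \<noteq> 0" "r \<in> A" "s \<in> A" "r \<noteq> s"
  shows "order r p + order s p \<le> roots_in A p"
proof -
  have "roots_in A p \<ge> roots_in ({r} \<union> {s}) p" using assms by (intro roots_in_mono) auto
  also have "roots_in ({r} \<union> {s}) p = roots_in {r} p + roots_in {s} p"
    using assms by (intro roots_in_Un_disjoint) auto
  finally show ?thesis using roots_in_ge_order[OF assms(1), of r "{r}"] roots_in_ge_order[OF assms(1), of s "{s}"]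
    by simp
qed

lemma roots_in_eq_sum_order:
  assumes "p \<noteq> 0"
  shows "roots_in A p = (\<Sum>r\<in>{r\<in>A. poly p r = 0}. order r p)"
proof -
  have "roots_in A p = sum (count (filter_mset (\<lambda>r. r \<in> A) (proots p))) (set_mset (filter_mset (\<lambda>r. r \<in> A) (proots p)))"
    unfolding roots_in_def by (simp add: size_multiset_overloaded_eq)
  also have "\<dots> = (\<Sum>r\<in>{r\<in>A. poly p r = 0}. order r p)"
    using assms by (intro sum.cong) auto
  finally show ?thesis .
qed

lemma poly_same_sign_of_no_root:
  fixes p :: "real poly"
  assumes "u < v" "\<And>r. u < r \<Longrightarrow> r < v \<Longrightarrow> poly p r \<noteq> 0" "poly p u \<noteq> 0" "poly p v \<noteq> 0"
  shows "poly p u * poly p v > 0"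
  using assms poly_IVT[of u v p] by (metis linorder_neqE_linordered_idom mult_eq_0_iff)

text \<open>Dividing out a zero \<open>r\<close> inside the interval changes the count by one and
  multiplies the product of the end values by a factor of the sign of
  \<open>(u - r) * (v - r) < 0\<close>, so parity and sign flip together.\<close>

lemma even_roots_in_iff:
  fixes p :: "real poly"
  assumes "u < v" "poly p u \<noteq> 0" "poly p v \<noteq> 0"
  shows "even (roots_in {u<..<v} p) \<longleftrightarrow> poly p u * poly p v > 0"
  using assms
proof (induction "degree p" arbitrary: p rule: less_induct)
  case less
  hence p0: "p \<noteq> 0" by auto
  show ?case
  proof (cases "\<exists>r. u < r \<and> r < v \<and> poly p r = 0")
    case False
    hence "\<not> (\<exists>r\<in>{u<..<v}. poly p r = 0)" by auto
    hence "roots_in {u<..<v} p = 0" using roots_in_pos_iff[OF p0, of "{u<..<v}"] by simp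
    moreover have "poly p u * poly p v > 0"
      using False less.prems by (intro poly_same_sign_of_no_root) auto
    ultimately show ?thesis by simp
  next
    case True
    then obtain r where r: "u < r" "r < v" "poly p r = 0" by blast
    obtain q where q: "p = [:-r, 1:] * q" using r(3) unfolding poly_eq_0_iff_dvd dvd_def by blast
    have q0: "q \<noteq> 0" using p0 q by auto
    have "degree q < degree p" using q0 unfolding q by (subst degree_mult_eq) auto
    moreover have "poly q u \<noteq> 0" "poly q v \<noteq> 0" using less.prems by (auto simp: q)
    ultimately have IH: "even (roots_in {u<..<v} q) \<longleftrightarrow> poly q u * poly q v > 0"
      using less by blast
    have "poly p u * poly p v = ((u - r) * (v - r)) * (poly q u * poly q v)"
      by (simp add: q) (simp add: algebra_simps)
    moreover have "(u - r) * (v - r) < 0" using r by (simp add: mult_neg_pos)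
    moreover have "0 < a * b \<longleftrightarrow> b < 0" if "a < 0" for a b :: real
      using that by (simp add: zero_less_mult_iff)
    ultimately have "poly p u * poly p v > 0 \<longleftrightarrow> poly q u * poly q v < 0"
      by metis
    moreover have "poly q u * poly q v \<noteq> 0" using \<open>poly q u \<noteq> 0\<close> \<open>poly q v \<noteq> 0\<close> by simp
    moreover have "roots_in {u<..<v} p = Suc (roots_in {u<..<v} q)"
      unfolding q using roots_in_mult_linear[OF q0, of "{u<..<v}" r] r by simp
    ultimately show ?thesis using IH by (simp only: even_Suc) linarith
  qed
qed

text \<open>Division by a linear factor with real zero lowers both sides of the inequality by one.
  When no real zero is left, a nonconstant polynomial still has a complex zero, which must be
  nonreal.\<close>

lemma nonreal_root_iff:
  fixes p :: "real poly"
  assumes "p \<noteq> 0"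
  shows "(\<exists>z. z \<notin> \<real> \<and> poly (cpoly p) z = 0) \<longleftrightarrow> size (proots p) < degree p"
  using assms
proof (induction "degree p" arbitrary: p rule: less_induct)
  case less
  show ?case
  proof (cases "\<exists>r. poly p r = 0")
    case True
    then obtain r where "poly p r = 0" by blast
    then obtain q where q: "p = [:-r, 1:] * q" unfolding poly_eq_0_iff_dvd dvd_def by blast
    have q0: "q \<noteq> 0" using less.prems q by auto
    have deg: "degree p = Suc (degree q)" using q0 unfolding q by (subst degree_mult_eq) auto
    have "(\<exists>z. z \<notin> \<real> \<and> poly (cpoly p) z = 0) \<longleftrightarrow> (\<exists>z. z \<notin> \<real> \<and> poly (cpoly q) z = 0)"
      by (auto simp: q algebra_simps)
    also have "\<dots> \<longleftrightarrow> size (proots q) < degree q" using less deg q0 by simp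
    finally show ?thesis using q0 deg by (simp add: q proots_mult del: mult_pCons_left)
  next
    case False
    hence 1: "proots p = {#}" using less.prems by (metis (mono_tags, lifting) empty_Collect_eq set_count_proots set_mset_eq_empty_iff)
    have 2: "z \<notin> \<real>" if "poly (cpoly p) z = 0" for z
      using that False by (auto elim!: Reals_cases)
    show ?thesis
    proof (cases "degree p = 0")
      case True
      then obtain c where "p = [:c:]" using degree_eq_zeroE by blast
      thus ?thesis using less.prems by auto
    next
      case nz: False
      hence "\<exists>z. poly (cpoly p) z = 0"
        by (intro fundamental_theorem_of_algebra) (simp add: constant_degree)
      thus ?thesis using 1 2 nz by auto
    qed
  qed
qed

text \<open>Zeros in a compact set can merge in the limit but cannot escape. A convergent
  subsequence of zeros is divided out and the quotients converge again. Only a common degree bound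
  is asked for, because the leading coefficient of \<open>Q chi eta\<close> tends to 0 as
  \<open>eta\<close> tends to 1.\<close>

lemma roots_in_limit:
  fixes P :: "nat \<Rightarrow> real poly"
  assumes "compact K" "Q \<noteq> 0" "\<And>i. (\<lambda>n. coeff (P n) i) \<longlonglongrightarrow> coeff Q i"
    and "\<And>n. degree (P n) \<le> d" "\<And>n. P n \<noteq> 0" "\<And>n. m \<le> roots_in K (P n)"
  shows "m \<le> roots_in K Q"
  using assms(2-)
proof (induction m arbitrary: P Q d)
  case (Suc m)
  have "\<exists>r\<in>K. poly (P n) r = 0" for n
    using Suc.prems(4,5)[of n] roots_in_pos_iff[of "P n" K] by fastforce
  then obtain r where r: "\<And>n. r n \<in> K" "\<And>n. poly (P n) (r n) = 0" by metis
  obtain s f where sf: "s \<in> K" "strict_mono (f :: nat \<Rightarrow> nat)" "(r \<circ> f) \<longlonglongrightarrow> s"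
    using assms(1) r(1) unfolding compact_def by metis
  define D where "D n = synthetic_div (P (f n)) (r (f n))" for n
  have eqD: "P (f n) = [:- r (f n), 1:] * D n" for n
    using synthetic_div_correct'[of "r (f n)" "P (f n)"] r by (simp add: D_def)
  have D0: "D n \<noteq> 0" for n using eqD[of n] Suc.prems(4)[of "f n"] by auto
  have coD: "coeff (D n) i = coeff (P (f n)) (Suc i) + r (f n) * coeff (D n) (Suc i)" for n i
    by (subst eqD[of n]) (simp add: coeff_pCons)
  have degD: "degree (D n) \<le> d" for n
    using Suc.prems(3)[of "f n"] by (simp add: D_def degree_synthetic_div)
  have degQ: "degree Q \<le> d"
  proof (rule degree_le, safe)
    fix i assume "d < i"
    hence "coeff (P n) i = 0" for n using Suc.prems(3)[of n] by (intro coeff_eq_0) auto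
    with Suc.prems(2)[of i] show "coeff Q i = 0" by (simp add: LIMSEQ_const_iff)
  qed
  define R where "R = synthetic_div Q s"
  have coR: "coeff R i = coeff Q (Suc i) + s * coeff R (Suc i)" for i
    using arg_cong[OF synthetic_div_correct[of Q s], of "\<lambda>p. coeff p (Suc i)"] by (simp add: R_def)
  \<comment> \<open>The recursion \<open>coD\<close> determines the quotient from the top: it starts
    with zero coefficients beyond index \<open>d\<close> and runs downward, so limits pass from one
    coefficient to the next.\<close>
  have lim: "(\<lambda>n. coeff (D n) i) \<longlonglongrightarrow> coeff R i" for i
  proof (cases "i \<le> d")
    case True
    thus ?thesis
    proof (induction i rule: inc_induct)
      case base
      have "coeff R (Suc d) = 0" "coeff R d = 0 \<or> d = 0"
        using degQ by (auto simp: R_def intro!: coeff_eq_0 simp: degree_synthetic_div)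
      have a: "coeff (D n) (Suc d) = 0" for n using degD[of n] by (intro coeff_eq_0) auto
      have b: "coeff R (Suc d) = 0" using degQ by (intro coeff_eq_0) (auto simp: R_def degree_synthetic_div)
      have "(\<lambda>n. coeff (P (f n)) (Suc d)) \<longlonglongrightarrow> coeff Q (Suc d)"
        using LIMSEQ_subseq_LIMSEQ[OF Suc.prems(2)[of "Suc d"] sf(2)] by (simp add: o_def)
      thus ?case by (subst coD, subst coR) (simp add: a b)
    next
      case (step i)
      have "(\<lambda>n. coeff (P (f n)) (Suc i)) \<longlonglongrightarrow> coeff Q (Suc i)"
        using LIMSEQ_subseq_LIMSEQ[OF Suc.prems(2)[of "Suc i"] sf(2)] by (simp add: o_def)
      thus ?case using step sf(3) by (subst coD, subst coR) (auto intro!: tendsto_intros simp: o_def)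
    qed
  next
    case False
    have "coeff (D n) i = 0" for n using degD[of n] False by (intro coeff_eq_0) auto
    moreover have "coeff R i = 0" using degQ False by (intro coeff_eq_0) (auto simp: R_def degree_synthetic_div)
    ultimately show ?thesis by simp
  qed
  have "poly Q s = 0"
  proof -
    have "coeff (P (f n)) 0 + r (f n) * coeff (D n) 0 = 0" for n
      by (subst eqD[of n]) simp
    moreover have "(\<lambda>n. coeff (P (f n)) 0 + r (f n) * coeff (D n) 0) \<longlonglongrightarrow> coeff Q 0 + s * coeff R 0"
      using LIMSEQ_subseq_LIMSEQ[OF Suc.prems(2)[of 0] sf(2)] lim[of 0] sf(3)
      by (auto intro!: tendsto_intros simp: o_def)
    ultimately have "coeff Q 0 + s * coeff R 0 = 0" by (simp add: LIMSEQ_const_iff)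
    thus ?thesis
      using arg_cong[OF synthetic_div_correct[of Q s], of "\<lambda>p. coeff p 0"] by (simp add: R_def)
  qed
  hence QR: "Q = [:-s, 1:] * R" using synthetic_div_correct'[of s Q] by (simp add: R_def)
  hence R0: "R \<noteq> 0" using Suc.prems(1) by auto
  have "m \<le> roots_in K R"
  proof (rule Suc.IH[OF R0 lim degD D0])
    fix n
    show "m \<le> roots_in K (D n)"
      using Suc.prems(5)[of "f n", unfolded eqD[of n]] roots_in_mult_linear[OF D0[of n], of K "r (f n)"] r(1)
      by (simp del: mult_pCons_left)
  qed
  thus ?case unfolding QR using roots_in_mult_linear[OF R0, of K s] sf(1) by (simp del: mult_pCons_left)
qed auto

lemma poly_pderiv_nonzero_if_root:
  fixes p :: "real poly"
  assumes "p \<noteq> 0" "poly p r = 0"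
  shows "pderiv p \<noteq> 0"
proof
  assume "pderiv p = 0"
  then obtain c where "p = [:c:]" by (auto simp: pderiv_eq_0_iff elim: degree_eq_zeroE)
  thus False using assms by simp
qed

text \<open>Applied where \<open>Q\<close> is nonnegative on the positive axis: every zero there is
  a local minimum and hence multiple.\<close>

lemma double_root_at_min:
  fixes p :: "real poly"
  assumes "p \<noteq> 0" "poly p r = 0" "e > 0" "\<And>y. \<bar>y - r\<bar> < e \<Longrightarrow> poly p y \<ge> 0"
  shows "order r p \<ge> 2" "poly (pderiv p) r = 0"
proof -
  show d: "poly (pderiv p) r = 0"
    by (rule DERIV_local_min[OF poly_DERIV[of p r] assms(3)])
       (use assms(2,4) in \<open>auto simp: abs_minus_commute\<close>)
  show "order r p \<ge> 2"
  proof (rule ccontr)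
    assume "\<not> order r p \<ge> 2"
    moreover have "order r p \<noteq> 0" using assms by (simp add: order_root)
    ultimately have "order r p = 1" by simp
    moreover have "pderiv p \<noteq> 0"
      using assms(1,2) by (metis poly_pderiv_nonzero_if_root)
    ultimately have "order r (pderiv p) = 0" using order_pderiv[of p r] assms(1,2)
      by (simp add: order_root)
    thus False using d \<open>pderiv p \<noteq> 0\<close> by (simp add: order_root)
  qed
qed

lemma order_ge_2I:
  fixes p :: "real poly"
  assumes "p \<noteq> 0" "poly p r = 0" "poly (pderiv p) r = 0"
  shows "order r p \<ge> 2"
proof (rule ccontr)
  assume "\<not> order r p \<ge> 2"
  moreover have "order r p \<noteq> 0" using assms by (simp add: order_root)
  ultimately have "order r p = 1" by simp
  moreover have "pderiv p \<noteq> 0"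
    using assms(1,2) by (metis poly_pderiv_nonzero_if_root)
  ultimately have "order r (pderiv p) = 0" using order_pderiv[of p r] assms(1,2)
    by (simp add: order_root)
  thus False using assms(3) \<open>pderiv p \<noteq> 0\<close> by (simp add: order_root)
qed

text \<open>The difference quotient extends continuously over the diagonal. This allows passing to
  the limit in equations for two conjugate points that merge.\<close>

lemma divided_difference:
  fixes p :: "'a::real_normed_field poly"
  obtains F where "continuous_on UNIV (\<lambda>u. F (fst u) (snd u))"
    and "\<And>a b. poly p a - poly p b = (a - b) * F a b" "\<And>a. F a a = poly (pderiv p) a"
proof -
  have "\<exists>F. continuous_on UNIV (\<lambda>u::'a\<times>'a. F (fst u) (snd u)) \<and>
     (\<forall>a b. poly p a - poly p b = (a - b) * F a b) \<and> (\<forall>a. F a a = poly (pderiv p) a)"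
  proof (induction p)
    case 0
    show ?case by (rule exI[of _ "\<lambda>a b. 0"]) simp
  next
    case (pCons c p)
    then obtain F where F: "continuous_on UNIV (\<lambda>u::'a\<times>'a. F (fst u) (snd u))"
      "\<And>a b. poly p a - poly p b = (a - b) * F a b" "\<And>a. F a a = poly (pderiv p) a" by blast
    show ?case
    \<comment> \<open>The Horner step:
      \<open>a * p(a) - b * p(b) = (a - b) * p(a) + b * (p(a) - p(b))\<close>.\<close>
    proof (rule exI[of _ "\<lambda>a b. poly p a + b * F a b"], intro conjI allI)
      show "continuous_on UNIV (\<lambda>u::'a\<times>'a. poly p (fst u) + snd u * F (fst u) (snd u))"
        by (intro continuous_intros F(1))
      show "poly (pCons c p) a - poly (pCons c p) b = (a - b) * (poly p a + b * F a b)" for a b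
        using F(2)[of a b] by (simp add: algebra_simps) (metis (no_types, opaque_lifting) add.commute diff_add_cancel distrib_left mult.commute right_diff_distrib)
      show "poly p a + a * F a a = poly (pderiv (pCons c p)) a" for a
        by (simp add: F(3) pderiv_pCons)
    qed
  qed
  thus ?thesis using that by blast
qed

section \<open>The polynomial of critical points\<close>

text \<open>\<open>g = k' - 1\<close>, \<open>P0\<close> is the real form of \<open>p0\<close>, and \<open>a l\<close>, \<open>b l\<close> are its zeros \<open>x (2 * l)\<close>,
  \<open>x (2 * l - 1)\<close>.\<close>

locale spectral_base =
  fixes g :: nat and a b :: "nat \<Rightarrow> real" and c :: real and P1 P0 :: "real poly"
  assumes c_pos: "c > 0"
    and ab: "\<And>l. l \<in> {1..g} \<Longrightarrow> a l < b l"
    and b_neg: "\<And>l. l \<in> {1..g} \<Longrightarrow> b l < 0"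
    and disj: "\<And>l l'. l \<in> {1..g} \<Longrightarrow> l' \<in> {1..g} \<Longrightarrow> l \<noteq> l' \<Longrightarrow> {a l..b l} \<inter> {a l'..b l'} = {}"
    and P1_def: "P1 = smult c (\<Prod>l\<in>{1..g}. [:- a l, 1:] * [:- b l, 1:])"
    and P0_def: "P0 = pCons 0 P1"
begin

lemma poly_P1: "poly P1 z = c * (\<Prod>l\<in>{1..g}. (z - a l) * (z - b l))"
  by (simp add: P1_def poly_prod algebra_simps)

lemma poly_P0: "poly P0 z = z * poly P1 z"
  by (simp add: P0_def)

lemma a_neg: "l \<in> {1..g} \<Longrightarrow> a l < 0"
  using ab b_neg by fastforce

lemma degree_P1 [simp]: "degree P1 = 2 * g"
proof -
  have "degree (\<Prod>l\<in>{1..g}. [:- a l, 1:] * [:- b l, 1:]) = (\<Sum>l\<in>{1..g}. degree ([:- a l, 1:] * [:- b l, 1:]))"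
    by (rule degree_prod_eq_sum_degree) auto
  also have "\<dots> = (\<Sum>l\<in>{1..g}. 2)" by (intro sum.cong refl) (subst degree_mult_eq, auto)
  finally show ?thesis using c_pos by (simp add: P1_def)
qed

lemma lead_P1 [simp]: "coeff P1 (2 * g) = c"
proof -
  have "lead_coeff P1 = c"
    unfolding P1_def by (simp only: lead_coeff_smult lead_coeff_prod lead_coeff_mult) simp
  thus ?thesis by simp
qed

lemma P1_zero_iff: "poly P1 z = 0 \<longleftrightarrow> (\<exists>l\<in>{1..g}. z = a l \<or> z = b l)"
  using c_pos by (auto simp: poly_P1)

lemma P1_pos: "(\<And>l. l \<in> {1..g} \<Longrightarrow> z \<notin> {a l..b l}) \<Longrightarrow> poly P1 z > 0"
  unfolding poly_P1 using c_pos ab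
  by (intro mult_pos_pos[of c] prod_pos) (fastforce simp: zero_less_mult_iff)+

lemma P1_neg:
  assumes "l \<in> {1..g}" "a l < z" "z < b l"
  shows "poly P1 z < 0"
proof -
  have "(\<Prod>j\<in>{1..g}-{l}. (z - a j) * (z - b j)) > 0"
  proof (rule prod_pos)
    fix j assume j: "j \<in> {1..g} - {l}"
    hence "z \<notin> {a j..b j}" using disj[of j l] assms by fastforce
    thus "(z - a j) * (z - b j) > 0" using ab[of j] j by (auto simp: zero_less_mult_iff)
  qed
  moreover have "(z - a l) * (z - b l) < 0" using assms by (simp add: mult_pos_neg)
  moreover have "(\<Prod>j\<in>{1..g}. (z - a j) * (z - b j)) =
     ((z - a l) * (z - b l)) * (\<Prod>j\<in>{1..g}-{l}. (z - a j) * (z - b j))"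
    using assms by (intro prod.remove) auto
  ultimately show ?thesis using c_pos by (simp only: poly_P1 mult_pos_neg mult_neg_pos)
qed

lemma P1_pos_nonneg: "z \<ge> 0 \<Longrightarrow> poly P1 z > 0"
  using b_neg by (intro P1_pos) fastforce

lemma P0_pos: "z > 0 \<Longrightarrow> poly P0 z > 0"
  using P1_pos_nonneg[of z] by (simp add: poly_P0)

lemma P0_pos_cycle: "l \<in> {1..g} \<Longrightarrow> a l < z \<Longrightarrow> z < b l \<Longrightarrow> poly P0 z > 0"
  using P1_neg[of l z] b_neg[of l] by (simp add: poly_P0 mult_neg_neg)

lemma P0_ab [simp]: "l \<in> {1..g} \<Longrightarrow> poly P0 (a l) = 0" "l \<in> {1..g} \<Longrightarrow> poly P0 (b l) = 0"
  by (auto simp: poly_P0 P1_zero_iff)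

lemma P0_nonneg_cycle: "l \<in> {1..g} \<Longrightarrow> z \<in> {a l..b l} \<Longrightarrow> poly P0 z \<ge> 0"
  using P0_pos_cycle[of l z] by (cases "z = a l \<or> z = b l") (auto simp: less_le)

lemma P0_neg: "z < 0 \<Longrightarrow> (\<And>l. l \<in> {1..g} \<Longrightarrow> z \<notin> {a l..b l}) \<Longrightarrow> poly P0 z < 0"
  using P1_pos[of z] by (simp add: poly_P0 mult_neg_pos)

lemma cycle_unique: "l \<in> {1..g} \<Longrightarrow> l' \<in> {1..g} \<Longrightarrow> z \<in> {a l..b l} \<Longrightarrow> z \<in> {a l'..b l'} \<Longrightarrow> l = l'"
  using disj by blast

end

text \<open>\<open>N1\<close> and \<open>eta0_eq\<close> say that the polynomial \<open>Q\<close> below has a double zero at \<open>1\<close> when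
  \<open>(chi, eta) = (1, eta0)\<close> or \<open>(-1, eta0)\<close>.\<close>

locale spectral_polynomials = spectral_base +
  fixes k :: nat and n :: "nat \<Rightarrow> real" and d eta0 :: real and N :: "real poly"
  assumes k_pos: "k \<ge> 1" and d_nz: "d \<noteq> 0"
    and an: "\<And>l. l \<in> {1..g} \<Longrightarrow> a l < n l" and nb: "\<And>l. l \<in> {1..g} \<Longrightarrow> n l < b l"
    and N_def: "N = smult d (\<Prod>l\<in>{1..g}. [:- n l, 1:])"
    and N1: "(poly N 1)\<^sup>2 = (real k)\<^sup>2 * poly P1 1"
    and eta0_bound: "\<bar>eta0\<bar> < 1"
    and eta0_eq: "(real k)\<^sup>2 * poly (pderiv P1) 1 - 2 * poly N 1 * poly (pderiv N) 1
                    = (real k)\<^sup>2 * eta0 * poly P1 1"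
begin

text \<open>The first two terms of \<open>dF\<close> add up to
  \<open>- L dz / (4 z (z - 1))\<close>.\<close>

definition L :: "real \<Rightarrow> real \<Rightarrow> real" where
  "L eta z = real k * ((1 - eta) * z + (1 + eta))"

text \<open>Up to sign, \<open>z * Q\<close> is the norm of the function \<open>L w + 2 chi z N\<close> on the curve, so its zeros are the
  first coordinates of the critical points.\<close>

definition Q :: "real \<Rightarrow> real \<Rightarrow> real poly" where
  "Q chi eta = [:real k * (1 + eta), real k * (1 - eta):]\<^sup>2 * P1 - smult (4 * chi\<^sup>2) (pCons 0 (N\<^sup>2))"

lemma poly_N: "poly N z = d * (\<Prod>l\<in>{1..g}. (z - n l))"
  by (simp add: N_def poly_prod)

lemma poly_Q: "poly (Q chi eta) z = (L eta z)\<^sup>2 * poly P1 z - 4 * chi\<^sup>2 * z * (poly N z)\<^sup>2"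
  by (simp add: Q_def L_def algebra_simps)

lemma poly_Q_factor: "z * poly (Q chi eta) z = (L eta z)\<^sup>2 * poly P0 z - (2 * chi * z * poly N z)\<^sup>2"
  by (simp add: poly_Q poly_P0 power2_eq_square algebra_simps)

lemma degree_N [simp]: "degree N = g"
proof -
  have "degree (\<Prod>l\<in>{1..g}. [:- n l, 1:]) = (\<Sum>l\<in>{1..g}. degree [:- n l, 1:])"
    by (rule degree_prod_eq_sum_degree) auto
  thus ?thesis using d_nz by (simp add: N_def)
qed

lemma degree_Q_le: "degree (Q chi eta) \<le> 2 * g + 2"
proof -
  have "degree ([:real k * (1 + eta), real k * (1 - eta):]\<^sup>2) \<le> 2 * 1"
    using degree_power_le[of "[:real k * (1 + eta), real k * (1 - eta):]" 2]
    by (rule order_trans) auto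
  hence 1: "degree ([:real k * (1 + eta), real k * (1 - eta):]\<^sup>2 * P1) \<le> 2 * g + 2"
    using degree_mult_le[of "[:real k * (1 + eta), real k * (1 - eta):]\<^sup>2" P1] by simp
  have "degree (N\<^sup>2) \<le> 2 * g" using degree_power_le[of N 2] by (simp add: mult.commute)
  hence "degree (smult (4 * chi\<^sup>2) (pCons 0 (N\<^sup>2))) \<le> 2 * g + 2"
    by (intro order_trans[OF degree_smult_le] order_trans[OF degree_pCons_le]) simp
  with 1 show ?thesis unfolding Q_def by (intro degree_diff_le)
qed

lemma coeff_Q_top: "coeff (Q chi eta) (2 * g + 2) = (real k * (1 - eta))\<^sup>2 * c"
proof -
  have "degree (N\<^sup>2) \<le> 2 * g" using degree_power_le[of N 2] by (simp add: mult.commute)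
  hence "coeff (N\<^sup>2) (2 * g + 1) = 0" by (intro coeff_eq_0) simp
  moreover have "coeff P1 (2 * g + 1) = 0" "coeff P1 (2 * g + 2) = 0" by (intro coeff_eq_0; simp)+
  moreover have "coeff P1 (g * 2) = c" using lead_P1 by (simp only: mult.commute)
  ultimately show ?thesis
    by (simp add: Q_def power2_eq_square coeff_pCons algebra_simps)
qed

lemma degree_Q:
  assumes "eta \<noteq> 1"
  shows "degree (Q chi eta) = 2 * g + 2" "lead_coeff (Q chi eta) = (real k * (1 - eta))\<^sup>2 * c"
proof -
  have "coeff (Q chi eta) (2 * g + 2) \<noteq> 0" unfolding coeff_Q_top using assms k_pos c_pos by auto
  hence "degree (Q chi eta) \<ge> 2 * g + 2" by (rule le_degree)
  thus "degree (Q chi eta) = 2 * g + 2" using degree_Q_le[of chi eta] by linarith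
  thus "lead_coeff (Q chi eta) = (real k * (1 - eta))\<^sup>2 * c" using coeff_Q_top by simp
qed

lemma Q_nz: "eta \<noteq> 1 \<Longrightarrow> Q chi eta \<noteq> 0"
  using degree_Q(1)[of eta chi] by auto

lemma lead_Q_pos: "eta \<noteq> 1 \<Longrightarrow> lead_coeff (Q chi eta) > 0"
  using degree_Q(2)[of eta chi] k_pos c_pos by simp

lemma N_zero_iff: "poly N z = 0 \<longleftrightarrow> (\<exists>l\<in>{1..g}. z = n l)"
  using d_nz by (auto simp: poly_N)

lemma N_nz_nonneg: "z \<ge> 0 \<Longrightarrow> poly N z \<noteq> 0"
  using nb b_neg by (fastforce simp: N_zero_iff)

lemma N_nz_outside: "(\<And>l. l \<in> {1..g} \<Longrightarrow> \<not> (a l < z \<and> z < b l)) \<Longrightarrow> poly N z \<noteq> 0"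
  using an nb by (metis N_zero_iff)

lemma N_nz_end:
  assumes "l \<in> {1..g}"
  shows "poly N (a l) \<noteq> 0" "poly N (b l) \<noteq> 0"
proof -
  have "\<not> (a j < a l \<and> a l < b j)" if "j \<in> {1..g}" for j
    using cycle_unique[of j l "a l"] assms that ab[of l] by fastforce
  thus "poly N (a l) \<noteq> 0" by (rule N_nz_outside)
  have "\<not> (a j < b l \<and> b l < b j)" if "j \<in> {1..g}" for j
    using cycle_unique[of j l "b l"] assms that ab[of l] by fastforce
  thus "poly N (b l) \<noteq> 0" by (rule N_nz_outside)
qed

text \<open>Exactly one zero of \<open>N\<close>, namely \<open>n l\<close>, lies between the two
  ends; every other factor keeps its sign across the interval.\<close>

lemma N_sign_change:
  assumes "l \<in> {1..g}"
  shows "poly N (a l) * poly N (b l) < 0"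
proof -
  have "(\<Prod>j\<in>{1..g}-{l}. (a l - n j) * (b l - n j)) > 0"
  proof (rule prod_pos)
    fix j assume j: "j \<in> {1..g} - {l}"
    hence "n j \<notin> {a l..b l}" using disj[of j l] assms an[of j] nb[of j] by fastforce
    thus "(a l - n j) * (b l - n j) > 0" using ab[of l] assms by (auto simp: zero_less_mult_iff)
  qed
  moreover have "(a l - n l) * (b l - n l) < 0" using an[of l] nb[of l] assms by (simp add: mult_neg_pos)
  moreover have "(\<Prod>j\<in>{1..g}. (a l - n j) * (b l - n j)) =
     ((a l - n l) * (b l - n l)) * (\<Prod>j\<in>{1..g}-{l}. (a l - n j) * (b l - n j))"
    using assms by (intro prod.remove) auto
  ultimately have "(\<Prod>j\<in>{1..g}. (a l - n j) * (b l - n j)) < 0" by (simp only: mult_neg_pos)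
  moreover have "poly N (a l) * poly N (b l) = d\<^sup>2 * (\<Prod>j\<in>{1..g}. (a l - n j) * (b l - n j))"
    by (simp only: poly_N prod.distrib) (simp add: power2_eq_square)
  ultimately show ?thesis using d_nz by (simp add: mult_pos_neg)
qed

text \<open>With \<open>s = 1\<close> or \<open>s = -1\<close> the function is \<open>G\<close>
  along one of the two arcs of the oval. The square root vanishes at both ends, leaving
  \<open>2 chi z N\<close>, and \<open>N\<close> has opposite signs there. So each arc carries a
  critical point.\<close>

lemma arc_root:
  assumes l: "l \<in> {1..g}"
  shows "\<exists>z\<in>{a l..b l}. L eta z * (s * sqrt (poly P0 z)) + 2 * chi * z * poly N z = 0"
proof -
  define f where "f z = L eta z * (s * sqrt (poly P0 z)) + 2 * chi * z * poly N z" for z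
  have cont: "continuous_on {a l..b l} f" unfolding f_def L_def by (intro continuous_intros)
  have fa: "f (a l) = 2 * chi * a l * poly N (a l)" "f (b l) = 2 * chi * b l * poly N (b l)"
    using l by (auto simp: f_def)
  have "f (a l) * f (b l) = (2 * chi)\<^sup>2 * (a l * b l) * (poly N (a l) * poly N (b l))"
    by (simp add: fa power2_eq_square)
  also have "\<dots> \<le> 0"
  proof (rule mult_nonneg_nonpos)
    show "(2 * chi)\<^sup>2 * (a l * b l) \<ge> 0"
      using a_neg[OF l] b_neg[OF l] by (intro mult_nonneg_nonneg less_imp_le[OF mult_neg_neg]) auto
    show "poly N (a l) * poly N (b l) \<le> 0" using N_sign_change[OF l] by simp
  qed
  finally have "f (a l) \<le> 0 \<and> 0 \<le> f (b l) \<or> f (b l) \<le> 0 \<and> 0 \<le> f (a l)"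
    by (auto simp: mult_le_0_iff)
  then obtain z where "z \<in> {a l..b l}" "f z = 0"
    using IVT'[of f "a l" 0 "b l"] IVT2'[of f "b l" 0 "a l"] cont ab[OF l] by fastforce
  thus ?thesis unfolding f_def by blast
qed

lemma Q_root_if:
  assumes "w\<^sup>2 = poly P0 z" "L eta z * w + 2 * chi * z * poly N z = 0" "z \<noteq> 0"
  shows "poly (Q chi eta) z = 0"
proof -
  have "z * poly (Q chi eta) z = (L eta z * w)\<^sup>2 - (2 * chi * z * poly N z)\<^sup>2"
    by (simp add: poly_Q_factor power_mult_distrib assms(1))
  also have "L eta z * w = - (2 * chi * z * poly N z)" using assms(2) by simp
  finally show ?thesis using assms(3) by simp
qed

lemma Q_0: "poly (Q chi eta) 0 = (real k * (1 + eta))\<^sup>2 * poly P1 0"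
  by (simp add: poly_Q L_def)

lemma Q_0_pos: "eta \<noteq> -1 \<Longrightarrow> poly (Q chi eta) 0 > 0"
  using P1_pos_nonneg[of 0] k_pos by (auto simp: Q_0)

lemma Q_at_ends:
  assumes "l \<in> {1..g}" "chi \<noteq> 0"
  shows "poly (Q chi eta) (a l) > 0" "poly (Q chi eta) (b l) > 0"
proof -
  have "poly P1 (a l) = 0" "poly P1 (b l) = 0" using assms by (auto simp: P1_zero_iff)
  thus "poly (Q chi eta) (a l) > 0" "poly (Q chi eta) (b l) > 0"
    using N_nz_end[OF assms(1)] assms(2) a_neg[OF assms(1)] b_neg[OF assms(1)]
    by (auto simp: poly_Q mult_less_0_iff)
qed

text \<open>At a negative \<open>r\<close> outside the intervals \<open>P0\<close> is negative and
  \<open>N\<close> is nonzero, so \<open>r * Q(r)\<close> is a nonpositive number minus a positive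
  square. At the ends of the intervals only the term with \<open>N\<close> survives.\<close>

lemma Q_root_location:
  assumes "chi \<noteq> 0" "eta \<noteq> -1" "poly (Q chi eta) r = 0"
  shows "r > 0 \<or> (\<exists>l\<in>{1..g}. a l < r \<and> r < b l)"
proof (rule ccontr)
  assume *: "\<not> ?thesis"
  have "r \<noteq> 0" using Q_0_pos[OF assms(2), of chi] assms(3) by auto
  with * have "r < 0" by auto
  have nK: "r \<notin> {a l..b l}" if "l \<in> {1..g}" for l
  proof -
    have "r \<noteq> a l" "r \<noteq> b l" using Q_at_ends[OF that assms(1), of eta] assms(3) by auto
    moreover have "\<not> (a l < r \<and> r < b l)" using * that by blast
    ultimately show ?thesis by auto
  qed
  hence "poly P0 r < 0" using \<open>r < 0\<close> by (intro P0_neg)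
  moreover have "poly N r \<noteq> 0" using * by (intro N_nz_outside) auto
  ultimately have "(L eta r)\<^sup>2 * poly P0 r \<le> 0" "(2 * chi * r * poly N r)\<^sup>2 > 0"
    using assms(1) \<open>r < 0\<close> by (auto intro: mult_nonneg_nonpos)
  hence "(L eta r)\<^sup>2 * poly P0 r - (2 * chi * r * poly N r)\<^sup>2 < 0" by linarith
  thus False using poly_Q_factor[of r chi eta] assms(3) by simp
qed

text \<open>The interval is closed for two reasons: its ends are zeros of \<open>Q\<close> when
  \<open>chi = 0\<close>, and compactness lets zeros be followed to a limit.\<close>

definition nK :: "real \<Rightarrow> real \<Rightarrow> nat \<Rightarrow> nat" where
  "nK chi eta l = roots_in {a l..b l} (Q chi eta)"

definition n0 :: "real \<Rightarrow> real \<Rightarrow> nat" where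
  "n0 chi eta = roots_in {0<..} (Q chi eta)"

lemma Q_pos_large:
  assumes "eta \<noteq> 1"
  obtains B where "B > 0" "\<And>z. z \<ge> B \<Longrightarrow> poly (Q chi eta) z > 0"
proof -
  obtain B where "\<And>z. z \<ge> B \<Longrightarrow> poly (Q chi eta) z \<ge> lead_coeff (Q chi eta)"
    using poly_pinfty_gt_lc[OF lead_Q_pos[OF assms, of chi]] by blast
  hence "poly (Q chi eta) z > 0" if "z \<ge> max B 1" for z
    using that lead_Q_pos[OF assms, of chi] by (meson less_le_trans max.boundedE)
  thus ?thesis using that[of "max B 1"] by simp
qed

text \<open>\<open>Q\<close> is positive at 0, where its value is a multiple of
  \<open>(1 + eta)^2\<close>, and positive far out, where its leading coefficient is a multiple of
  \<open>(1 - eta)^2\<close>.\<close>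

lemma n0_even:
  assumes "\<bar>eta\<bar> < 1"
  shows "even (n0 chi eta)"
proof -
  have e: "eta \<noteq> 1" "eta \<noteq> -1" using assms by auto
  obtain B where B: "B > 0" "\<And>z. z \<ge> B \<Longrightarrow> poly (Q chi eta) z > 0"
    using Q_pos_large[OF e(1)] by blast
  have "n0 chi eta = roots_in {0<..<B} (Q chi eta)"
    unfolding n0_def by (rule roots_in_cong[OF Q_nz[OF e(1)]]) (use B(2) in \<open>auto simp: not_le[symmetric], fastforce\<close>)
  moreover have "even (roots_in {0<..<B} (Q chi eta))"
    using even_roots_in_iff[of 0 B "Q chi eta"] B(1) B(2)[of B] Q_0_pos[OF e(2), of chi] by fastforce
  ultimately show ?thesis by simp
qed

lemma nK_even:
  assumes "l \<in> {1..g}" "chi \<noteq> 0" "eta \<noteq> 1"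
  shows "even (nK chi eta l)"
proof -
  note Q_at_ends[OF assms(1,2), of eta]
  moreover have "nK chi eta l = roots_in {a l<..<b l} (Q chi eta)"
    unfolding nK_def
    by (rule roots_in_cong[OF Q_nz[OF assms(3)]]) (use calculation in \<open>force simp: less_le\<close>)
  ultimately show ?thesis using even_roots_in_iff[of "a l" "b l" "Q chi eta"] ab[OF assms(1)] by fastforce
qed

text \<open>One arc already supplies a zero of \<open>Q\<close>, and the count is even.\<close>

lemma nK_ge_2:
  assumes "l \<in> {1..g}" "chi \<noteq> 0" "eta \<noteq> 1"
  shows "nK chi eta l \<ge> 2"
proof -
  obtain z where z: "z \<in> {a l..b l}" "L eta z * (1 * sqrt (poly P0 z)) + 2 * chi * z * poly N z = 0"
    using arc_root[OF assms(1)] by blast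
  have "poly (Q chi eta) z = 0"
    by (rule Q_root_if[OF _ z(2)]) (use P0_nonneg_cycle[OF assms(1) z(1)] b_neg[OF assms(1)] z in auto)
  hence "nK chi eta l > 0" unfolding nK_def using z(1) roots_in_pos_iff[OF Q_nz[OF assms(3)]] by blast
  thus ?thesis using nK_even[OF assms] by (cases "nK chi eta l = 1") auto
qed

section \<open>Distribution of the \<open>2 * g + 2\<close> zeros of \<open>Q\<close>\<close>

lemma size_proots_Q:
  assumes "chi \<noteq> 0" "\<bar>eta\<bar> < 1"
  shows "size (proots (Q chi eta)) = n0 chi eta + (\<Sum>l\<in>{1..g}. nK chi eta l)"
proof -
  have e: "eta \<noteq> 1" "eta \<noteq> -1" using assms by auto
  have "size (proots (Q chi eta)) = roots_in ({0<..} \<union> (\<Union>l\<in>{1..g}. {a l..b l})) (Q chi eta)"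
    unfolding roots_in_UNIV[symmetric]
    by (rule roots_in_cong[OF Q_nz[OF e(1)]]) (use Q_root_location[OF assms(1) e(2)] in force)
  also have "\<dots> = n0 chi eta + roots_in (\<Union>l\<in>{1..g}. {a l..b l}) (Q chi eta)"
    unfolding n0_def by (rule roots_in_Un_disjoint) (use b_neg in fastforce)
  also have "roots_in (\<Union>l\<in>{1..g}. {a l..b l}) (Q chi eta) = (\<Sum>l\<in>{1..g}. nK chi eta l)"
    unfolding nK_def by (rule roots_in_UN_disjoint) (use disj in auto)
  finally show ?thesis .
qed

text \<open>Every cycle not singled out contributes at least 2. The constants 2 and 4 stand on the
  larger side so that natural numbers need no subtraction.\<close>

lemma sum_nK_ge_cycle:
  assumes "chi \<noteq> 0" "eta \<noteq> 1" "l \<in> {1..g}"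
  shows "(\<Sum>l\<in>{1..g}. nK chi eta l) + 2 \<ge> 2 * g + nK chi eta l"
    "l' \<in> {1..g} \<Longrightarrow> l' \<noteq> l \<Longrightarrow> (\<Sum>l\<in>{1..g}. nK chi eta l) + 4 \<ge> 2 * g + nK chi eta l + nK chi eta l'"
proof -
  have s: "(\<Sum>l\<in>A. nK chi eta l) \<ge> 2 * card A" if "A \<subseteq> {1..g}" for A
  proof -
    have "2 \<le> nK chi eta i" if "i \<in> A" for i using nK_ge_2[OF _ assms(1,2)] that \<open>A \<subseteq> {1..g}\<close> by blast
    from sum_bounded_below[of A 2, OF this] show ?thesis by (simp add: mult.commute)
  qed
  have e: "(\<Sum>l\<in>{1..g}. nK chi eta l) = nK chi eta l + (\<Sum>l\<in>{1..g}-{l}. nK chi eta l)"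
    using assms by (intro sum.remove) auto
  have "2 * card ({1..g} - {l}) + 2 = 2 * g" using assms(3) by (auto simp: card_Diff_singleton)
  with s[of "{1..g}-{l}"] e show "(\<Sum>l\<in>{1..g}. nK chi eta l) + 2 \<ge> 2 * g + nK chi eta l" by auto
  assume l': "l' \<in> {1..g}" "l' \<noteq> l"
  have e': "(\<Sum>l\<in>{1..g}-{l}. nK chi eta l) = nK chi eta l' + (\<Sum>l\<in>{1..g}-{l}-{l'}. nK chi eta l)"
    using l' by (intro sum.remove) auto
  have "card ({1..g} - {l} - {l'}) + 2 = g" using assms(3) l'
    by (subst card_Diff_singleton) (auto simp: card_Diff_singleton)
  moreover have "{1..g} - {l} - {l'} \<subseteq> {1..g}" by auto
  note s[OF this]
  ultimately show "(\<Sum>l\<in>{1..g}. nK chi eta l) + 4 \<ge> 2 * g + nK chi eta l + nK chi eta l'"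
    using e e' by linarith
qed

lemma count_total:
  assumes "chi \<noteq> 0" "\<bar>eta\<bar> < 1"
  shows "n0 chi eta + (\<Sum>l\<in>{1..g}. nK chi eta l) \<le> 2 * g + 2"
    "(\<exists>z. z \<notin> \<real> \<and> poly (cpoly (Q chi eta)) z = 0) \<longleftrightarrow>
      n0 chi eta + (\<Sum>l\<in>{1..g}. nK chi eta l) < 2 * g + 2"
proof -
  have e: "eta \<noteq> 1" "eta \<noteq> -1" using assms by auto
  show "n0 chi eta + (\<Sum>l\<in>{1..g}. nK chi eta l) \<le> 2 * g + 2"
    using size_proots_le[of "Q chi eta"] degree_Q(1)[OF e(1), of chi] size_proots_Q[OF assms] by simp
  show "(\<exists>z. z \<notin> \<real> \<and> poly (cpoly (Q chi eta)) z = 0) \<longleftrightarrow>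
      n0 chi eta + (\<Sum>l\<in>{1..g}. nK chi eta l) < 2 * g + 2"
    using nonreal_root_iff[OF Q_nz[OF e(1)], of chi] degree_Q(1)[OF e(1), of chi] size_proots_Q[OF assms] by simp
qed

lemma sum_nK_ge:
  assumes "chi \<noteq> 0" "eta \<noteq> 1"
  shows "(\<Sum>l\<in>{1..g}. nK chi eta l) \<ge> 2 * g"
  using sum_bounded_below[of "{1..g}" 2 "nK chi eta"] nK_ge_2[OF _ assms] by (auto simp: mult.commute)

lemma count_n0_le:
  assumes "chi \<noteq> 0" "\<bar>eta\<bar> < 1"
  shows "n0 chi eta \<le> 2"
proof -
  have "eta \<noteq> 1" using assms by auto
  thus ?thesis using count_total(1)[OF assms] sum_nK_ge[of chi eta] assms by linarith
qed

lemma count_n0_pos: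
  assumes "chi \<noteq> 0" "\<bar>eta\<bar> < 1" "n0 chi eta > 0"
  shows "n0 chi eta = 2" "l \<in> {1..g} \<Longrightarrow> nK chi eta l = 2"
    "z \<notin> \<real> \<Longrightarrow> poly (cpoly (Q chi eta)) z \<noteq> 0"
proof -
  have e: "eta \<noteq> 1" using assms by auto
  have "n0 chi eta \<ge> 2" using n0_even[OF assms(2), of chi] assms(3) by presburger
  thus n2: "n0 chi eta = 2" using count_n0_le[OF assms(1,2)] by simp
  show "l \<in> {1..g} \<Longrightarrow> nK chi eta l = 2"
    using sum_nK_ge_cycle(1)[OF assms(1) e, of l] count_total(1)[OF assms(1,2)] n2 nK_ge_2[of l, OF _ assms(1) e] by auto
  show "poly (cpoly (Q chi eta)) z \<noteq> 0" if "z \<notin> \<real>"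
    using count_total(2)[OF assms(1,2)] n2 sum_nK_ge[OF assms(1) e] that by auto
qed

lemma count_nK_big:
  assumes "chi \<noteq> 0" "\<bar>eta\<bar> < 1" "l \<in> {1..g}" "nK chi eta l > 2"
  shows "nK chi eta l = 4" "n0 chi eta = 0" "l' \<in> {1..g} \<Longrightarrow> l' \<noteq> l \<Longrightarrow> nK chi eta l' = 2"
    "z \<notin> \<real> \<Longrightarrow> poly (cpoly (Q chi eta)) z \<noteq> 0"
proof -
  have e: "eta \<noteq> 1" using assms by auto
  have "nK chi eta l \<ge> 4" using nK_even[OF assms(3,1) e] assms(4) by (auto elim!: evenE)
  thus n4: "nK chi eta l = 4" and n00: "n0 chi eta = 0"
    using sum_nK_ge_cycle(1)[OF assms(1) e assms(3)] count_total(1)[OF assms(1,2)] by auto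
  show "l' \<in> {1..g} \<Longrightarrow> l' \<noteq> l \<Longrightarrow> nK chi eta l' = 2"
    using sum_nK_ge_cycle(2)[OF assms(1) e assms(3), of l'] n4 count_total(1)[OF assms(1,2)]
      nK_ge_2[of l', OF _ assms(1) e] by auto
  show "poly (cpoly (Q chi eta)) z \<noteq> 0" if "z \<notin> \<real>"
    using count_total(2)[OF assms(1,2)] n4 n00 sum_nK_ge_cycle(1)[OF assms(1) e assms(3)] that by auto
qed

lemma count_nonreal:
  assumes "chi \<noteq> 0" "\<bar>eta\<bar> < 1"
  shows "(\<exists>z. z \<notin> \<real> \<and> poly (cpoly (Q chi eta)) z = 0) \<longleftrightarrow>
    n0 chi eta = 0 \<and> (\<forall>l\<in>{1..g}. nK chi eta l \<le> 2)"
proof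
  assume "\<exists>z. z \<notin> \<real> \<and> poly (cpoly (Q chi eta)) z = 0"
  thus "n0 chi eta = 0 \<and> (\<forall>l\<in>{1..g}. nK chi eta l \<le> 2)"
    using count_n0_pos(3)[OF assms] count_nK_big(4)[OF assms] by (meson gr0I not_le_imp_less)
next
  assume *: "n0 chi eta = 0 \<and> (\<forall>l\<in>{1..g}. nK chi eta l \<le> 2)"
  hence "(\<Sum>l\<in>{1..g}. nK chi eta l) \<le> 2 * g"
    using sum_bounded_above[of "{1..g}" "nK chi eta" 2] by (auto simp: mult.commute)
  thus "\<exists>z. z \<notin> \<real> \<and> poly (cpoly (Q chi eta)) z = 0" using * count_total(2)[OF assms] by simp
qed

section \<open>The oval over the nonnegative axis\<close>

text \<open>In the coordinate \<open>s = z / (1 + z)\<close> the oval over \<open>z \<ge> 0\<close> becomes compact, including the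
  point at infinity \<open>s = 1\<close>. The function \<open>psi\<close> is a factor of \<open>Q\<close> there, the other factor being
  positive, and it is affine in \<open>(\<bar>chi\<bar>, eta)\<close>.\<close>

definition N_hom :: "real \<Rightarrow> real" where
  "N_hom s = d * (\<Prod>l\<in>{1..g}. s - n l * (1 - s))"

definition P_hom :: "real \<Rightarrow> real" where
  "P_hom s = c * (\<Prod>l\<in>{1..g}. (s - a l * (1 - s)) * (s - b l * (1 - s)))"

text \<open>For \<open>z > 0\<close> and \<open>s = z / (1 + z)\<close> this is the modulus of
  \<open>2 z N / w\<close> divided by \<open>k (1 + z)\<close>, while
  \<open>1 + eta * (1 - 2 * s)\<close> is \<open>L eta z\<close> divided by the same factor.\<close>

definition H :: "real \<Rightarrow> real" where
  "H s = 2 / real k * sqrt (s * (1 - s) / P_hom s) * \<bar>N_hom s\<bar>"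

definition psi :: "real \<Rightarrow> real \<Rightarrow> real \<Rightarrow> real" where
  "psi chi eta s = 1 + eta * (1 - 2 * s) - \<bar>chi\<bar> * H s"

definition m :: "real \<Rightarrow> real \<Rightarrow> real" where
  "m chi eta = Inf (psi chi eta ` {0..1})"

lemma hom_factor: "z \<ge> 0 \<Longrightarrow> z / (1 + z) - u * (1 - z / (1 + z)) = (z - u) / (1 + z)" for z u :: real
proof -
  assume "z \<ge> 0"
  hence "1 - z / (1 + z) = 1 / (1 + z)" by (simp add: field_simps)
  thus ?thesis by (simp add: diff_divide_distrib)
qed

lemma N_hom_eq: "z \<ge> 0 \<Longrightarrow> N_hom (z / (1 + z)) = poly N z / (1 + z) ^ g"
  unfolding N_hom_def by (simp only: hom_factor) (simp add: poly_N prod_dividef)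

lemma P_hom_eq: "z \<ge> 0 \<Longrightarrow> P_hom (z / (1 + z)) = poly P1 z / (1 + z) ^ (2 * g)"
  unfolding P_hom_def
  by (simp only: hom_factor) (simp add: poly_P1 prod_dividef prod.distrib power_mult power2_eq_square power_mult_distrib)

lemma P_hom_pos:
  assumes "s \<in> {0..1}"
  shows "P_hom s > 0"
proof -
  have pos: "s - u * (1 - s) > 0" if "u < 0" for u
    using assms that by (cases "s = 0") (auto intro!: add_pos_nonneg mult_nonpos_nonneg simp: diff_conv_add_uminus simp del: add_uminus_conv_diff)
  show ?thesis unfolding P_hom_def
    by (intro mult_pos_pos prod_pos c_pos ballI pos a_neg b_neg)
qed

lemma H_nonneg: "s \<in> {0..1} \<Longrightarrow> H s \<ge> 0"
  using P_hom_pos[of s] by (auto simp: H_def)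

lemma H_squared: "s \<in> {0..1} \<Longrightarrow> (real k)\<^sup>2 * P_hom s * (H s)\<^sup>2 = 4 * s * (1 - s) * (N_hom s)\<^sup>2"
proof -
  assume s: "s \<in> {0..1}"
  have "(H s)\<^sup>2 = 4 / (real k)\<^sup>2 * (s * (1 - s) / P_hom s) * (N_hom s)\<^sup>2"
    using P_hom_pos[OF s] s by (simp add: H_def power_mult_distrib power_divide)
  thus ?thesis using P_hom_pos[OF s] k_pos by simp
qed

lemma continuous_H: "continuous_on {0..1} H"
proof -
  have "continuous_on {0..1} P_hom" "continuous_on {0..1} N_hom"
    unfolding P_hom_def[abs_def] N_hom_def[abs_def] by (intro continuous_intros)+
  moreover have "\<forall>s\<in>{0..1}. P_hom s \<noteq> 0" using P_hom_pos by (metis less_irrefl)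
  moreover have "\<forall>s\<in>{0..1}. real k \<noteq> 0" using k_pos by simp
  ultimately show ?thesis unfolding H_def[abs_def] by (intro continuous_intros) auto
qed

lemma continuous_psi: "continuous_on {0..1} (psi chi eta)"
  unfolding psi_def by (intro continuous_intros continuous_H)

lemma psi_0 [simp]: "psi chi eta 0 = 1 + eta"
  and psi_1 [simp]: "psi chi eta 1 = 1 - eta"
  by (simp_all add: psi_def H_def)

text \<open>The point \<open>s = 1/2\<close> is \<open>z = 1\<close>, where \<open>N1\<close>
  normalizes \<open>H\<close>. Together with the values of \<open>psi\<close> at 0 and 1 it confines
  \<open>m >= 0\<close> to the closed square.\<close>

lemma H_half: "H (1/2) = 1"
proof -
  have P: "poly P1 1 > 0" by (rule P1_pos_nonneg) simp
  have "N_hom (1/2) = poly N 1 / 2 ^ g" "P_hom (1/2) = poly P1 1 / 2 ^ (2 * g)"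
    using N_hom_eq[of 1] P_hom_eq[of 1] by simp_all
  hence "(real k)\<^sup>2 * (poly P1 1 / 2 ^ (2 * g)) * (H (1/2))\<^sup>2 = 1 * (poly N 1)\<^sup>2 / 2 ^ (2 * g)"
    using H_squared[of "1/2"] by (simp add: power_divide power_mult[symmetric] mult.commute)
  hence "(real k)\<^sup>2 * poly P1 1 * (H (1/2))\<^sup>2 = (real k)\<^sup>2 * poly P1 1"
    using N1 by simp
  hence "(H (1/2))\<^sup>2 = 1" using P k_pos by simp
  thus ?thesis using H_nonneg[of "1/2"] by (simp add: power2_eq_1_iff)
qed

lemma psi_half [simp]: "psi chi eta (1/2) = 1 - \<bar>chi\<bar>"
  by (simp add: psi_def H_half)

lemma sgn_diff_squares: "u \<ge> 0 \<Longrightarrow> v \<ge> 0 \<Longrightarrow> sgn (u - v) = sgn (u\<^sup>2 - v\<^sup>2)" for u v :: real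
proof -
  assume "u \<ge> 0" "v \<ge> 0"
  moreover have "u\<^sup>2 - v\<^sup>2 = (u - v) * (u + v)" by (simp add: power2_eq_square algebra_simps)
  ultimately show ?thesis by (cases "u + v = 0") (auto simp: sgn_mult add_nonneg_eq_0_iff)
qed

text \<open>\<open>psi\<close> is a difference of two nonnegative numbers and so has the sign of the
  difference of their squares. Multiplied by the positive factor \<open>k^2 P_hom\<close>, that
  difference is \<open>Q / (1 + z)^(2 g + 2)\<close>.\<close>

lemma sgn_psi:
  assumes "z \<ge> 0" "\<bar>eta\<bar> \<le> 1"
  shows "sgn (psi chi eta (z / (1 + z))) = sgn (poly (Q chi eta) z)"
proof -
  define s where "s = z / (1 + z)"
  have s: "s \<in> {0..1}" "1 - s = 1 / (1 + z)" using assms by (auto simp: s_def field_simps)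
  define X where "X = 1 + eta * (1 - 2 * s)"
  have X: "X = L eta z / real k / (1 + z)"
  proof -
    have "1 - 2 * s = (1 - z) / (1 + z)" using assms by (simp add: s_def field_simps)
    moreover have "1 = (1 + z) / (1 + z)" using assms by simp
    ultimately have "X = ((1 + z) + eta * (1 - z)) / (1 + z)" unfolding X_def by (metis add_divide_distrib times_divide_eq_right)
    thus ?thesis using k_pos by (simp add: L_def) (simp add: algebra_simps)
  qed
  have "(1 - eta) * z \<ge> 0" "1 + eta \<ge> 0" using assms by auto
  hence "L eta z \<ge> 0" unfolding L_def by simp
  hence X0: "X \<ge> 0" using X assms by simp
  have "sgn (psi chi eta s) = sgn (X\<^sup>2 - (\<bar>chi\<bar> * H s)\<^sup>2)"
    unfolding psi_def X_def[symmetric] by (rule sgn_diff_squares[OF X0]) (use H_nonneg[OF s(1)] in auto)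
  also have "\<dots> = sgn ((real k)\<^sup>2 * P_hom s * (X\<^sup>2 - (\<bar>chi\<bar> * H s)\<^sup>2))"
    using k_pos P_hom_pos[OF s(1)] by (simp add: sgn_mult)
  also have "(real k)\<^sup>2 * P_hom s * (X\<^sup>2 - (\<bar>chi\<bar> * H s)\<^sup>2) =
      (real k)\<^sup>2 * P_hom s * X\<^sup>2 - chi\<^sup>2 * ((real k)\<^sup>2 * P_hom s * (H s)\<^sup>2)"
    by (simp add: power_mult_distrib algebra_simps)
  also have "\<dots> = (real k)\<^sup>2 * P_hom s * X\<^sup>2 - chi\<^sup>2 * (4 * s * (1 - s) * (N_hom s)\<^sup>2)"
    by (simp only: H_squared[OF s(1)])
  also have "\<dots> = poly (Q chi eta) z / (1 + z) ^ (2 * g + 2)"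
  proof -
    have e: "(1 + z) ^ (2 * g + 2) = (1 + z) ^ (2 * g) * (1 + z)\<^sup>2" "(1 + z) ^ (2 * g) = ((1 + z) ^ g)\<^sup>2"
      by (simp_all only: power_add) (simp add: power_mult[symmetric] mult.commute)
    have nz: "(1 + z) \<noteq> 0" "(1 + z) ^ g \<noteq> 0" using assms by auto
    define u v where "u = 1 + z" and "v = (1 + z) ^ g"
    have "(real k)\<^sup>2 * (poly P1 z / v\<^sup>2) * (L eta z / real k / u)\<^sup>2 - chi\<^sup>2 * (4 * (z / u) * (1 / u) * (poly N z / v)\<^sup>2)
      = ((L eta z)\<^sup>2 * poly P1 z - 4 * chi\<^sup>2 * z * (poly N z)\<^sup>2) / (v\<^sup>2 * u\<^sup>2)"
      using k_pos nz[folded u_def v_def]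
      by (simp add: power_divide power2_eq_square diff_divide_distrib) (simp add: mult_ac)
    thus ?thesis unfolding X s(2) N_hom_eq[OF assms(1), folded s_def] P_hom_eq[OF assms(1), folded s_def] e poly_Q u_def v_def
      by (simp add: s_def)
  qed
  also have "sgn \<dots> = sgn (poly (Q chi eta) z)"
    using assms by (simp add: sgn_divide)
  finally show ?thesis by (simp add: s_def)
qed

section \<open>The sign of the minimum \<open>m\<close> and the zeros of \<open>Q\<close>\<close>

lemma m_attained: obtains s where "s \<in> {0..1}" "m chi eta = psi chi eta s" "\<And>t. t \<in> {0..1} \<Longrightarrow> m chi eta \<le> psi chi eta t"
proof -
  obtain s where s: "s \<in> {0..1}" "\<And>t. t \<in> {0..1} \<Longrightarrow> psi chi eta s \<le> psi chi eta t"
    using continuous_attains_inf[OF compact_Icc _ continuous_psi[of chi eta]] by fastforce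
  hence "m chi eta = psi chi eta s" unfolding m_def by (intro cInf_eq_minimum) auto
  thus ?thesis using that s by auto
qed

lemma m_le: "s \<in> {0..1} \<Longrightarrow> m chi eta \<le> psi chi eta s"
  using m_attained[of chi eta] by metis

lemma m_pos_iff_psi: "m chi eta > 0 \<longleftrightarrow> (\<forall>s\<in>{0..1}. psi chi eta s > 0)"
  using m_attained[of chi eta] by (metis less_le_trans)

lemma m_nonneg_iff_psi: "m chi eta \<ge> 0 \<longleftrightarrow> (\<forall>s\<in>{0..1}. psi chi eta s \<ge> 0)"
  using m_attained[of chi eta] by (metis order_trans)

lemma m_pos_square: "m chi eta > 0 \<Longrightarrow> \<bar>chi\<bar> < 1 \<and> \<bar>eta\<bar> < 1"
  using m_pos_iff_psi[THEN iffD1, THEN bspec, of chi eta 0] m_pos_iff_psi[THEN iffD1, THEN bspec, of chi eta 1]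
    m_pos_iff_psi[THEN iffD1, THEN bspec, of chi eta "1/2"] by (auto simp del: One_nat_def)

lemma m_nonneg_square: "m chi eta \<ge> 0 \<Longrightarrow> \<bar>chi\<bar> \<le> 1 \<and> \<bar>eta\<bar> \<le> 1"
  using m_nonneg_iff_psi[THEN iffD1, THEN bspec, of chi eta 0] m_nonneg_iff_psi[THEN iffD1, THEN bspec, of chi eta 1]
    m_nonneg_iff_psi[THEN iffD1, THEN bspec, of chi eta "1/2"] by (auto simp del: One_nat_def)

lemma m_scale: "t \<ge> 0 \<Longrightarrow> m (t * chi) (t * eta) = 1 - t + t * m chi eta"
proof -
  assume t: "t \<ge> 0"
  have *: "psi (t * chi) (t * eta) s = 1 - t + t * psi chi eta s" for s
    using t by (simp add: psi_def abs_mult algebra_simps)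
  obtain s where s: "s \<in> {0..1}" "m chi eta = psi chi eta s" by (rule m_attained)
  obtain s' where s': "s' \<in> {0..1}" "m (t * chi) (t * eta) = psi (t * chi) (t * eta) s'" by (rule m_attained)
  show ?thesis
  proof (rule antisym)
    show "m (t * chi) (t * eta) \<le> 1 - t + t * m chi eta"
      using m_le[OF s(1), of "t * chi" "t * eta"] by (simp add: * s(2))
    show "1 - t + t * m chi eta \<le> m (t * chi) (t * eta)"
      using mult_left_mono[OF m_le[OF s'(1), of chi eta] t] by (simp add: * s'(2))
  qed
qed

text \<open>An infimum of functions with common Lipschitz constants inherits them: 1 in
  \<open>eta\<close>, because \<open>1 - 2 * s\<close> is at most 1 in modulus, and a bound
  \<open>B\<close> of \<open>H\<close> in \<open>chi\<close>.\<close>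

lemma continuous_m: "continuous_on UNIV (\<lambda>p. m (fst p) (snd p))"
proof -
  obtain B where B: "\<And>s. s \<in> {0..1} \<Longrightarrow> H s \<le> B" "B > 0"
  proof -
    have "bounded (H ` {0..1})" by (intro compact_imp_bounded compact_continuous_image continuous_H compact_Icc)
    then obtain B where "\<forall>s\<in>{0..1}. norm (H s) \<le> B" unfolding bounded_iff by blast
    hence "H s \<le> max B 1" if "s \<in> {0..1}" for s using that by fastforce
    thus ?thesis using that[of "max B 1"] by auto
  qed
  have one: "m chi eta \<le> m chi' eta' + (\<bar>eta - eta'\<bar> + B * \<bar>chi - chi'\<bar>)" for chi eta chi' eta'
  proof -
    obtain s where s: "s \<in> {0..1}" "m chi' eta' = psi chi' eta' s" by (rule m_attained)
    have 1: "(eta - eta') * (1 - 2 * s) \<le> \<bar>eta - eta'\<bar> * 1"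
    proof -
      have "(eta - eta') * (1 - 2 * s) \<le> \<bar>(eta - eta') * (1 - 2 * s)\<bar>" by simp
      also have "\<dots> = \<bar>eta - eta'\<bar> * \<bar>1 - 2 * s\<bar>" by (simp add: abs_mult)
      also have "\<dots> \<le> \<bar>eta - eta'\<bar> * 1" using s by (intro mult_left_mono) auto
      finally show ?thesis .
    qed
    have 2: "(\<bar>chi'\<bar> - \<bar>chi\<bar>) * H s \<le> \<bar>chi - chi'\<bar> * B"
    proof -
      have "(\<bar>chi'\<bar> - \<bar>chi\<bar>) * H s \<le> \<bar>chi - chi'\<bar> * H s"
        using H_nonneg[OF s(1)] by (intro mult_right_mono) auto
      also have "\<dots> \<le> \<bar>chi - chi'\<bar> * B" using B(1)[OF s(1)] by (intro mult_left_mono) auto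
      finally show ?thesis .
    qed
    have "psi chi eta s = psi chi' eta' s + (eta - eta') * (1 - 2 * s) + (\<bar>chi'\<bar> - \<bar>chi\<bar>) * H s"
      by (simp add: psi_def algebra_simps)
    thus ?thesis using 1 2 m_le[OF s(1), of chi eta] s(2) by (simp add: mult.commute)
  qed
  show ?thesis
  proof (rule continuous_on_eq_continuous_at[THEN iffD2], simp, rule ballI)
    fix p :: "real \<times> real"
    let ?e = "\<lambda>q. \<bar>snd q - snd p\<bar> + B * \<bar>fst q - fst p\<bar>"
    have "((\<lambda>q. ?e q) \<longlongrightarrow> \<bar>snd p - snd p\<bar> + B * \<bar>fst p - fst p\<bar>) (at p)"
      by (intro tendsto_intros)
    hence "((\<lambda>q. ?e q) \<longlongrightarrow> 0) (at p)" by simp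
    hence "((\<lambda>q. m (fst q) (snd q) - m (fst p) (snd p)) \<longlongrightarrow> 0) (at p)"
      by (rule Lim_null_comparison[rotated])
         (intro always_eventually allI, simp only: real_norm_def abs_le_iff,
          use one[of "fst p" "snd p"] one[of _ _ "fst p" "snd p"] in
          \<open>auto simp: abs_minus_commute algebra_simps\<close>)
    thus "isCont (\<lambda>p. m (fst p) (snd p)) p"
      unfolding isCont_def by (rule LIM_zero_cancel)
  qed
qed

lemma s_of_z: "z > 0 \<Longrightarrow> z / (1 + z) \<in> {0<..<1}" for z :: real
  by (simp add: field_simps)

lemma z_of_s: "s \<in> {0<..<1} \<Longrightarrow> s / (1 - s) > 0 \<and> (s / (1 - s)) / (1 + s / (1 - s)) = s" for s :: real
  by (simp add: field_simps)

lemma m_neg_iff: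
  assumes "\<bar>chi\<bar> \<le> 1" "\<bar>eta\<bar> \<le> 1"
  shows "m chi eta < 0 \<longleftrightarrow> (\<exists>z>0. poly (Q chi eta) z < 0)"
proof
  assume "m chi eta < 0"
  then obtain s where s: "s \<in> {0..1}" "psi chi eta s < 0" using m_nonneg_iff_psi by (metis not_le)
  hence "s \<noteq> 0" "s \<noteq> 1" using assms by (auto simp: psi_0 psi_1)
  hence "s \<in> {0<..<1}" using s by auto
  note z = z_of_s[OF this]
  show "\<exists>z>0. poly (Q chi eta) z < 0"
    using z sgn_psi[of "s / (1 - s)" eta chi] assms s(2) by (metis less_imp_le sgn_less)
next
  assume "\<exists>z>0. poly (Q chi eta) z < 0"
  then obtain z where z: "z > 0" "poly (Q chi eta) z < 0" by blast
  hence "psi chi eta (z / (1 + z)) < 0" using sgn_psi[of z eta chi] assms by (metis less_imp_le sgn_less)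
  thus "m chi eta < 0" using m_le[of "z / (1 + z)" chi eta] s_of_z[OF z(1)] by fastforce
qed

lemma m_nonneg_iff:
  assumes "\<bar>chi\<bar> \<le> 1" "\<bar>eta\<bar> \<le> 1"
  shows "m chi eta \<ge> 0 \<longleftrightarrow> (\<forall>z>0. poly (Q chi eta) z \<ge> 0)"
  using m_neg_iff[OF assms] by (meson not_le)

lemma m_pos_iff:
  assumes "\<bar>chi\<bar> < 1" "\<bar>eta\<bar> < 1"
  shows "m chi eta > 0 \<longleftrightarrow> (\<forall>z>0. poly (Q chi eta) z > 0)"
proof
  assume m: "m chi eta > 0"
  show "\<forall>z>0. poly (Q chi eta) z > 0"
  proof safe
    fix z :: real assume z: "z > 0"
    hence "psi chi eta (z / (1 + z)) > 0" using m s_of_z[OF z] unfolding m_pos_iff_psi by force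
    thus "poly (Q chi eta) z > 0" using sgn_psi[of z eta chi] assms z by (metis less_imp_le sgn_greater)
  qed
next
  assume *: "\<forall>z>0. poly (Q chi eta) z > 0"
  show "m chi eta > 0"
    unfolding m_pos_iff_psi
  proof
    fix s :: real assume s: "s \<in> {0..1}"
    consider "s = 0" | "s = 1" | "s \<in> {0<..<1}" using s by fastforce
    thus "psi chi eta s > 0"
    proof cases
      case 3
      note z = z_of_s[OF 3]
      thus ?thesis using sgn_psi[of "s / (1 - s)" eta chi] assms * by (metis less_imp_le sgn_greater)
    qed (use assms in \<open>auto simp: psi_0 psi_1\<close>)
  qed
qed

lemma m_pos_iff_n0:
  assumes "\<bar>chi\<bar> < 1" "\<bar>eta\<bar> < 1"
  shows "m chi eta > 0 \<longleftrightarrow> n0 chi eta = 0"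
proof -
  have e: "eta \<noteq> 1" "eta \<noteq> -1" using assms by auto
  have 1: "n0 chi eta = 0 \<longleftrightarrow> (\<forall>z>0. poly (Q chi eta) z \<noteq> 0)"
    using roots_in_pos_iff[OF Q_nz[OF e(1)], of "{0<..}" chi] unfolding n0_def by auto
  have "poly (Q chi eta) z > 0" if "\<forall>z>0. poly (Q chi eta) z \<noteq> 0" "z > 0" for z
    using poly_same_sign_of_no_root[of 0 z "Q chi eta"] that Q_0_pos[OF e(2), of chi]
    by (auto simp: zero_less_mult_iff)
  thus ?thesis unfolding 1 m_pos_iff[OF assms] by (metis less_irrefl)
qed

lemma m_chi_0: "\<bar>eta\<bar> < 1 \<Longrightarrow> m 0 eta > 0"
  unfolding m_pos_iff_psi
proof
  fix s :: real assume "\<bar>eta\<bar> < 1" "s \<in> {0..1}"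
  have "\<bar>eta * (1 - 2 * s)\<bar> \<le> \<bar>eta\<bar> * 1"
    unfolding abs_mult using \<open>s \<in> {0..1}\<close> by (intro mult_left_mono) auto
  thus "psi 0 eta s > 0" using \<open>\<bar>eta\<bar> < 1\<close> by (auto simp: psi_def abs_if split: if_splits)
qed

text \<open>A double zero exhausts the at most two zeros on the positive axis. Hence
  \<open>Q\<close> keeps its positive sign from 0 up to \<open>z0\<close> and, coming back from
  infinity, down to \<open>z0\<close>.\<close>

lemma m_nonneg_of_double_root:
  assumes "chi \<noteq> 0" "\<bar>chi\<bar> \<le> 1" "\<bar>eta\<bar> < 1" "z0 > 0" "order z0 (Q chi eta) \<ge> 2"
  shows "m chi eta \<ge> 0"
proof -
  have e: "eta \<noteq> 1" "eta \<noteq> -1" using assms by auto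
  have Q1: "poly (Q chi eta) z0 = 0" using assms(5) Q_nz[OF e(1), of chi] by (simp add: order_root)
  have no: "poly (Q chi eta) z \<noteq> 0" if "z > 0" "z \<noteq> z0" for z
  proof
    assume "poly (Q chi eta) z = 0"
    hence "order z (Q chi eta) \<noteq> 0" using Q_nz[OF e(1), of chi] by (simp add: order_root)
    thus False using roots_in_ge_order2[OF Q_nz[OF e(1)], of z0 "{0<..}" z chi] that assms(4,5)
        count_n0_le[OF assms(1,3)] by (simp add: n0_def)
  qed
  obtain B where B: "B > 0" "\<And>z. z \<ge> B \<Longrightarrow> poly (Q chi eta) z > 0" using Q_pos_large[OF e(1)] by blast
  have "poly (Q chi eta) z > 0" if z: "0 < z" "z \<noteq> z0" for z
  proof (cases "z < z0")
    case True
    hence "poly (Q chi eta) 0 * poly (Q chi eta) z > 0"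
      using z no Q_0_pos[OF e(2), of chi] by (intro poly_same_sign_of_no_root) auto
    thus ?thesis using Q_0_pos[OF e(2), of chi] by (auto simp: zero_less_mult_iff)
  next
    case False
    hence "poly (Q chi eta) z * poly (Q chi eta) (max B (z + 1)) > 0"
      using z no by (intro poly_same_sign_of_no_root) auto
    thus ?thesis using B(2)[of "max B (z + 1)"] by (auto simp: zero_less_mult_iff)
  qed
  hence "\<forall>z>0. poly (Q chi eta) z \<ge> 0" using Q1 by (metis less_imp_le order_refl)
  thus ?thesis using m_nonneg_iff assms(2,3) by simp
qed

text \<open>For \<open>chi^2 = 1\<close> the point \<open>z = 1\<close> is always a zero of
  \<open>Q\<close>, so nonnegativity forces a vanishing derivative there. By \<open>eta0_eq\<close>
  this derivative is a nonzero multiple of \<open>eta0 - eta\<close>.\<close>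

lemma m_side_point:
  assumes "\<bar>chi\<bar> = 1" "\<bar>eta\<bar> < 1"
  shows "m chi eta \<ge> 0 \<longleftrightarrow> eta = eta0" "eta = eta0 \<Longrightarrow> order 1 (Q chi eta) \<ge> 2"
proof -
  have e: "eta \<noteq> 1" "eta \<noteq> -1" using assms by auto
  have chi2: "chi\<^sup>2 = 1" using assms(1) by (metis one_power2 power2_abs)
  have P: "poly P1 1 > 0" by (rule P1_pos_nonneg) simp
  have Q1: "poly (Q chi eta) 1 = 0" using N1 chi2 by (simp add: poly_Q L_def power_mult_distrib)
  have "poly (pderiv (Q chi eta)) 1 =
     4 * (real k)\<^sup>2 * (1 - eta) * poly P1 1 + 4 * (real k)\<^sup>2 * poly (pderiv P1) 1
      - 4 * (poly N 1)\<^sup>2 - 8 * poly N 1 * poly (pderiv N) 1"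
  proof -
    define l where "l = [:real k * (1 + eta), real k * (1 - eta):]"
    have l: "poly l 1 = 2 * real k" "poly (pderiv l) 1 = real k * (1 - eta)"
      by (simp_all add: l_def pderiv_pCons algebra_simps)
    have "Q chi eta = l * l * P1 - smult 4 (pCons 0 (N * N))"
      using chi2 by (simp add: Q_def l_def) (simp add: power2_eq_square)
    thus ?thesis
      by (simp add: pderiv_mult pderiv_diff pderiv_smult pderiv_pCons l power2_eq_square)
  qed
  also have "\<dots> = 4 * (real k)\<^sup>2 * poly P1 1 * (eta0 - eta)"
    using eta0_eq N1 by (simp add: algebra_simps)
  finally have d: "poly (pderiv (Q chi eta)) 1 = 0 \<longleftrightarrow> eta = eta0" using P k_pos by auto
  show o: "order 1 (Q chi eta) \<ge> 2" if "eta = eta0"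
    using order_ge_2I[OF Q_nz[OF e(1)] Q1] d that by blast
  show "m chi eta \<ge> 0 \<longleftrightarrow> eta = eta0"
  proof
    assume "m chi eta \<ge> 0"
    hence "\<forall>z>0. poly (Q chi eta) z \<ge> 0" using m_nonneg_iff assms by simp
    hence "poly (pderiv (Q chi eta)) 1 = 0"
      by (intro double_root_at_min(2)[OF Q_nz[OF e(1)] Q1, of 1]) auto
    thus "eta = eta0" using d by blast
  next
    assume "eta = eta0"
    thus "m chi eta \<ge> 0"
      using m_nonneg_of_double_root[of chi eta 1] o assms by auto
  qed
qed

text \<open>For \<open>chi\<close> nonzero \<open>Q\<close> becomes negative at one end of the axis.
  At \<open>eta = 1\<close> the top coefficient vanishes and the negative coefficient of
  \<open>z N^2\<close> leads. At \<open>eta = -1\<close> one has \<open>Q = z R\<close> with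
  \<open>R(0) = -4 chi^2 N(0)^2\<close>.\<close>

lemma m_top_bottom:
  assumes "\<bar>eta\<bar> = 1" "\<bar>chi\<bar> \<le> 1"
  shows "m chi eta \<ge> 0 \<longleftrightarrow> chi = 0"
proof
  assume "m chi eta \<ge> 0"
  hence nn: "\<forall>z>0. poly (Q chi eta) z \<ge> 0" using m_nonneg_iff assms by simp
  show "chi = 0"
  proof (rule ccontr)
    assume chi: "chi \<noteq> 0"
    consider "eta = 1" | "eta = -1" using assms(1) by linarith
    thus False
    proof cases
      case 1
      have N0: "N \<noteq> 0" using N_nz_nonneg[of 0] by auto
      hence "degree (N\<^sup>2) = 2 * g" by (simp add: degree_power_eq)
      hence dN: "coeff (pCons 0 (N\<^sup>2)) (2 * g + 1) > 0"
        using lead_coeff_power[of N 2] leading_coeff_0_iff[of N] N0 by (simp add: coeff_pCons)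
      have dP: "coeff P1 (2 * g + 1) = 0" by (intro coeff_eq_0) simp
      have "Q chi eta = smult (4 * (real k)\<^sup>2) P1 - smult (4 * chi\<^sup>2) (pCons 0 (N\<^sup>2))"
        unfolding poly_eq_poly_eq_iff[symmetric]
        by (rule ext) (simp add: poly_Q 1 L_def power2_eq_square algebra_simps)
      hence cQ: "coeff (Q chi eta) (2 * g + 1) < 0"
        using dN dP chi by simp
      have dQ: "degree (Q chi eta) = 2 * g + 1"
      proof (rule antisym)
        have "coeff (Q chi eta) (2 * g + 2) = 0" using coeff_Q_top[of chi eta] 1 by simp
        moreover have "degree (Q chi eta) \<noteq> 2 * g + 2" using calculation by (metis coeff_0 degree_0 leading_coeff_0_iff add_2_eq_Suc' nat.distinct(1))
        ultimately show "degree (Q chi eta) \<le> 2 * g + 1" using degree_Q_le[of chi eta] by linarith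
        show "2 * g + 1 \<le> degree (Q chi eta)" using cQ by (intro le_degree) simp
      qed
      hence "lead_coeff (- Q chi eta) > 0" using cQ by simp
      then obtain B where B: "\<And>z. z \<ge> B \<Longrightarrow> poly (- Q chi eta) z \<ge> lead_coeff (- Q chi eta)"
        using poly_pinfty_gt_lc by blast
      have "poly (- Q chi eta) (max B 1) > 0"
        using B[of "max B 1"] \<open>lead_coeff (- Q chi eta) > 0\<close> by linarith
      moreover have "max B 1 > 0" by (simp add: less_max_iff_disj)
      ultimately show False using nn[rule_format, of "max B 1"] by simp
    next
      case 2
      define R where "R = smult (4 * (real k)\<^sup>2) (pCons 0 P1) - smult (4 * chi\<^sup>2) (N\<^sup>2)"
      have QR: "poly (Q chi eta) z = z * poly R z" for z
        by (simp add: poly_Q 2 L_def R_def power2_eq_square algebra_simps)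
      have "poly R z \<ge> 0" if "z > 0" for z using nn that by (simp add: QR zero_le_mult_iff)
      moreover have "((\<lambda>z. poly R z) \<longlongrightarrow> poly R 0) (at_right 0)"
        by (intro tendsto_poly tendsto_ident_at)
      ultimately have "poly R 0 \<ge> 0"
        by (intro tendsto_lowerbound[of "\<lambda>z. poly R z" "poly R 0" "at_right 0" 0]) (auto simp: eventually_at_right_less intro: eventually_mono[OF eventually_at_right_less])
      moreover have "chi\<^sup>2 * (poly N 0)\<^sup>2 > 0" using chi N_nz_nonneg[of 0] by simp
      ultimately show False by (simp add: R_def)
    qed
  qed
next
  assume "chi = 0"
  show "m chi eta \<ge> 0"
    unfolding m_nonneg_iff_psi
  proof
    fix s :: real assume "s \<in> {0..1}"
    hence "\<bar>eta * (1 - 2 * s)\<bar> \<le> 1" using assms by (auto simp: abs_mult)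
    thus "psi chi eta s \<ge> 0" using \<open>chi = 0\<close> unfolding psi_def abs_le_iff by simp
  qed
qed

lemma m_nonpos_of_boundary: "\<bar>chi\<bar> \<ge> 1 \<or> \<bar>eta\<bar> \<ge> 1 \<Longrightarrow> m chi eta \<le> 0"
  using m_pos_square[of chi eta] by (meson not_le)

text \<open>The four points added by convention are exactly the zeros of \<open>m\<close> on the
  boundary of the square.\<close>

lemma m_zero_iff:
  "m chi eta = 0 \<longleftrightarrow> \<bar>chi\<bar> < 1 \<and> \<bar>eta\<bar> < 1 \<and> m chi eta = 0 \<or>
     (chi, eta) \<in> {(0, 1), (0, -1), (1, eta0), (-1, eta0)}"
proof
  assume m0: "m chi eta = 0"
  hence sq: "\<bar>chi\<bar> \<le> 1" "\<bar>eta\<bar> \<le> 1" using m_nonneg_square[of chi eta] by auto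
  show "\<bar>chi\<bar> < 1 \<and> \<bar>eta\<bar> < 1 \<and> m chi eta = 0 \<or>
     (chi, eta) \<in> {(0, 1), (0, -1), (1, eta0), (-1, eta0)}"
    using m_side_point(1)[of chi eta] m_top_bottom[of eta chi] m0 sq
    by (cases "\<bar>eta\<bar> = 1"; cases "\<bar>chi\<bar> = 1") (auto simp: abs_if split: if_splits)
next
  assume *: "\<bar>chi\<bar> < 1 \<and> \<bar>eta\<bar> < 1 \<and> m chi eta = 0 \<or>
     (chi, eta) \<in> {(0, 1), (0, -1), (1, eta0), (-1, eta0)}"
  have "m 0 1 \<ge> 0" "m 0 (-1) \<ge> 0" "m 1 eta0 \<ge> 0" "m (-1) eta0 \<ge> 0"
    using m_side_point(1)[of _ eta0] m_top_bottom[of _ 0] eta0_bound by auto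
  thus "m chi eta = 0"
    using * m_nonpos_of_boundary[of chi eta] by auto
qed

end

section \<open>Critical points and their orders\<close>

text \<open>Differentiation lowers the order of a zero by one. What has to be excluded is a
  derivative vanishing identically near \<open>z\<close>, since then \<open>f\<close> would be
  constant and equal to \<open>f z = 0\<close>.\<close>

lemma deriv_nz_iff_zorder_1:
  assumes "f analytic_on {z}" "f z = 0" "frequently (\<lambda>w. f w \<noteq> 0) (at z)"
  shows "zorder f z \<ge> 2 \<longleftrightarrow> deriv f z = 0"
proof -
  obtain S where S: "open S" "z \<in> S" "f holomorphic_on S" using assms(1) analytic_at by blast
  have pos: "zorder f z > 0" using zorder_pos_iff'[OF assms(1,3)] assms(2) by simp
  have iso: "isolated_singularity_at f z" and ness: "not_essential f z"
    using assms(1) by (auto intro: isolated_singularity_at_analytic not_essential_analytic)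
  have d: "zorder (deriv f) z = zorder f z - 1"
    by (rule zorder_deriv_minus_1[OF iso ness assms(3)]) (use pos in auto)
  have an: "deriv f analytic_on {z}" using assms(1) by (rule analytic_deriv)
  have fr: "frequently (\<lambda>w. deriv f w \<noteq> 0) (at z)"
  proof (rule ccontr)
    assume "\<not> frequently (\<lambda>w. deriv f w \<noteq> 0) (at z)"
    hence "eventually (\<lambda>w. deriv f w = 0) (at z)" by (simp add: frequently_def)
    moreover have "eventually (\<lambda>w. w \<in> S) (at z)" using S by (intro eventually_at_in_open') auto
    ultimately have "eventually (\<lambda>w. deriv f w = 0 \<and> w \<in> S) (at z)" by eventually_elim auto
    then obtain e where e: "e > 0" "\<And>w. w \<noteq> z \<Longrightarrow> dist w z < e \<Longrightarrow> deriv f w = 0 \<and> w \<in> S"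
      unfolding eventually_at by auto
    have der: "(f has_field_derivative 0) (at w within ball z e)" if "w \<in> ball z e" for w
    proof -
      have wS: "w \<in> S" using e(2)[of w] that S by (cases "w = z") (auto simp: dist_commute)
      have contd: "isCont (deriv f) z" using an by (rule analytic_at_imp_isCont)
      have "deriv f z = 0"
      proof (rule tendsto_unique[of "at z"])
        show "(deriv f \<longlongrightarrow> deriv f z) (at z)" using contd by (simp add: isCont_def)
        show "(deriv f \<longlongrightarrow> 0) (at z)"
          by (rule tendsto_eventually) (use e in \<open>auto simp: eventually_at\<close>)
      qed simp
      hence "deriv f w = 0" using e(2)[of w] that by (cases "w = z") (auto simp: dist_commute)
      thus ?thesis using holomorphic_derivI[OF S(3,1) wS] by (metis has_field_derivative_at_within)
    qed
    have "f w = f z" if "w \<in> ball z e" for w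
      using has_field_derivative_zero_constant[OF convex_ball der] that e(1)
      by (metis centre_in_ball)
    hence "eventually (\<lambda>w. f w = 0) (at z)"
      using assms(2) e(1) by (auto simp: eventually_at dist_commute intro!: exI[of _ e])
    with assms(3) show False by (simp add: frequently_def)
  qed
  from zorder_eq_0_iff[OF an fr] zorder_ge_0[OF an fr] show ?thesis using d by linarith
qed

text \<open>The equation \<open>d rho / rho = N dz / (w (z - 1))\<close> reads \<open>(z - 1) (P' w
  + q' P0 + q P0' / 2) - k w (P + q w) = N (P + q w)\<close>. Its coefficient at \<open>w\<close> is
  the definition of \<open>N\<close>; this is the part free of \<open>w\<close>. It results from
  differentiating \<open>P^2 - q^2 P0 = 4 (z - 1)^(2 k)\<close>, inserting \<open>qN\<close> and
  cancelling \<open>2 q\<close>.\<close>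

lemma log_derivative_identity:
  fixes P q N P0 :: "real poly"
  assumes k_pos: "k \<ge> 1" and PqP0: "P\<^sup>2 - q\<^sup>2 * P0 = smult 4 ([:-1, 1:] ^ (2 * k))" and q_nz: "q \<noteq> 0"
    and qN: "q * N = pderiv P * [:-1, 1:] - smult (real k) P"
  shows "N * P = (pderiv q * P0 + smult (1/2) (q * pderiv P0)) * [:-1, 1:] - smult (real k) (q * P0)"
proof -
  define X :: "real poly" where "X = [:-1, 1:]"
  have dX: "pderiv X = 1" by (simp add: X_def pderiv_pCons)
  have "pderiv (X ^ (2 * k)) * X = smult (2 * real k) (X ^ (2 * k))"
  proof -
    obtain j where j: "2 * k = Suc j" using k_pos by (cases "2 * k") auto
    hence "2 * real k = 1 + real j" by linarith
    thus ?thesis unfolding j pderiv_power_Suc dX by (simp add: mult_ac)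
  qed
  hence dp: "pderiv (P\<^sup>2 - q\<^sup>2 * P0) * X = smult (2 * real k) (P\<^sup>2 - q\<^sup>2 * P0)"
    unfolding PqP0 X_def[symmetric] by (simp add: pderiv_smult)
  have "smult 2 q * (N * P) = smult 2 q * ((pderiv q * P0 + smult (1/2) (q * pderiv P0)) * X - smult (real k) (q * P0))"
    unfolding poly_eq_poly_eq_iff[symmetric]
  proof
    fix x
    define x1 where "x1 = poly X x"
    have 1: "poly (pderiv (P\<^sup>2 - q\<^sup>2 * P0) * X) x = poly (smult (2 * real k) (P\<^sup>2 - q\<^sup>2 * P0)) x" by (simp only: dp)
    have 2: "poly (q * N) x = poly (pderiv P * X - smult (real k) P) x" by (simp only: qN X_def)
    have 3: "poly q x * poly N x = poly (pderiv P) x * x1 - real k * poly P x"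
      using 2 by (simp add: x1_def)
    have "poly (smult 2 q * (N * P)) x = 2 * poly P x * (poly q x * poly N x)" by simp
    also have "\<dots> = 2 * poly P x * poly (pderiv P) x * x1 - 2 * real k * (poly P x)\<^sup>2"
      by (simp only: 3) (simp add: algebra_simps power2_eq_square)
    also have "\<dots> = (2 * poly q x * poly (pderiv q) x * poly P0 x + (poly q x)\<^sup>2 * poly (pderiv P0) x) * x1
        - 2 * real k * (poly q x)\<^sup>2 * poly P0 x"
      using 1 unfolding power2_eq_square
      by (simp add: pderiv_diff pderiv_mult x1_def[symmetric] power2_eq_square) (simp add: algebra_simps)
    finally show "poly (smult 2 q * (N * P)) x =
      poly (smult 2 q * ((pderiv q * P0 + smult (1/2) (q * pderiv P0)) * X - smult (real k) (q * P0))) x"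
      by (simp add: x1_def[symmetric] power2_eq_square) (simp add: algebra_simps)
  qed
  thus ?thesis using q_nz unfolding X_def by (simp only: mult_cancel_left smult_eq_0_iff) simp
qed

locale spectral_curve = spectral_polynomials +
  fixes P q :: "real poly" and \<rho> :: "complex \<Rightarrow> complex \<Rightarrow> complex"
  assumes PqP0: "P\<^sup>2 - q\<^sup>2 * P0 = smult 4 ([:-1, 1:] ^ (2 * k))"
    and q_nz: "q \<noteq> 0" and P0_rsquarefree: "rsquarefree (cpoly P0)"
    and qN: "q * N = pderiv P * [:-1, 1:] - smult (real k) P"
    and rho_eq: "\<And>z w. z \<noteq> 0 \<Longrightarrow> z \<noteq> 1 \<Longrightarrow>
        \<rho> z w = (poly (cpoly P) z + poly (cpoly q) z * w) / (2 * (z - 1) ^ k)"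
begin

abbreviation cN :: "complex \<Rightarrow> complex" where "cN z \<equiv> poly (cpoly N) z"
abbreviation cP0 :: "complex \<Rightarrow> complex" where "cP0 z \<equiv> poly (cpoly P0) z"

definition Lc :: "real \<Rightarrow> complex \<Rightarrow> complex" where
  "Lc eta z = of_nat k * ((1 - of_real eta) * z + (1 + of_real eta))"

text \<open>Up to a nonvanishing factor, \<open>dF\<close> is \<open>G dz / (z (z - 1) w)\<close>.\<close>

definition G :: "real \<Rightarrow> real \<Rightarrow> complex \<Rightarrow> complex \<Rightarrow> complex" where
  "G chi eta z w = Lc eta z * w + 2 * of_real chi * z * cN z"

lemma NP: "N * P = (pderiv q * P0 + smult (1/2) (q * pderiv P0)) * [:-1, 1:] - smult (real k) (q * P0)"
  by (rule log_derivative_identity[OF k_pos PqP0 q_nz qN])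

abbreviation dF :: "real \<Rightarrow> real \<Rightarrow> (complex \<Rightarrow> complex) \<Rightarrow> (complex \<Rightarrow> complex) \<Rightarrow> complex \<Rightarrow> complex" where
  "dF \<equiv> dF_pullback k \<rho>"

lemma dF_eq:
  assumes A: "open A" "t \<in> A" and hol: "Z holomorphic_on A" "W holomorphic_on A"
    and curve: "\<And>u. u \<in> A \<Longrightarrow> (W u)\<^sup>2 = cP0 (Z u)"
    and nz: "Z t \<noteq> 0" "Z t \<noteq> 1" "W t \<noteq> 0"
  shows "dF chi eta Z W t = - deriv Z t * G chi eta (Z t) (W t) / (4 * Z t * (Z t - 1) * W t)"
proof -
  define Z' W' where "Z' = deriv Z t" and "W' = deriv W t"
  have DZ: "(Z has_field_derivative Z') (at t)" and DW: "(W has_field_derivative W') (at t)"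
    unfolding Z'_def W'_def using holomorphic_derivI[OF hol(1) A] holomorphic_derivI[OF hol(2) A] by auto
  define p r qq n p' r' q' where
    "p = poly (cpoly P) (Z t)" and "r = cP0 (Z t)" and "qq = poly (cpoly q) (Z t)" and "n = cN (Z t)"
    and "p' = poly (pderiv (cpoly P)) (Z t)" and "r' = poly (pderiv (cpoly P0)) (Z t)"
    and "q' = poly (pderiv (cpoly q)) (Z t)"
  note defs = p_def r_def qq_def n_def p'_def r'_def q'_def
  define x1 where "x1 = Z t - 1"
  have x1: "x1 \<noteq> 0" using nz by (simp add: x1_def)
  have W2: "(W t)\<^sup>2 = r" using curve A by (simp add: r_def)
  have WW': "2 * W t * W' = r' * Z'"
  proof -
    have "((\<lambda>u. (W u)\<^sup>2) has_field_derivative 2 * W t * W') (at t)"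
      by (auto intro!: derivative_eq_intros DW)
    moreover have "((\<lambda>u. cP0 (Z u)) has_field_derivative r' * Z') (at t)"
      unfolding r'_def by (rule DERIV_chain2[OF poly_DERIV DZ])
    hence "((\<lambda>u. (W u)\<^sup>2) has_field_derivative r' * Z') (at t)"
      by (rule has_field_derivative_transform_within_open[OF _ A]) (simp add: curve)
    ultimately show ?thesis by (rule DERIV_unique)
  qed
  have qN': "qq * n = p' * x1 - of_nat k * p"
    using arg_cong[OF qN, of "\<lambda>f. poly (cpoly f) (Z t)"] by (simp add: defs x1_def algebra_simps)
  have NP': "n * p = (q' * r + qq * r' / 2) * x1 - of_nat k * (qq * r)"
    using arg_cong[OF NP, of "\<lambda>f. poly (cpoly f) (Z t)"] by (simp add: defs x1_def) (simp add: field_simps)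
  have PQ': "p\<^sup>2 - qq\<^sup>2 * r = 4 * x1 ^ (2 * k)"
    using arg_cong[OF PqP0, of "\<lambda>f. poly (cpoly f) (Z t)"] by (simp add: defs x1_def)
  define F where "F = p + qq * W t"
  \<comment> \<open>The product with the value on the other sheet is \<open>4 (z - 1)^(2 k)\<close>,
    so \<open>rho\<close> has no zero over this point.\<close>
  have "F * (p - qq * W t) = p\<^sup>2 - qq\<^sup>2 * (W t)\<^sup>2" by (simp add: F_def power2_eq_square algebra_simps)
  also have "\<dots> = 4 * x1 ^ (2 * k)" unfolding W2 by (rule PQ')
  finally have F0: "F \<noteq> 0" using x1 by auto
  define F' where "F' = (p' + q' * W t) * Z' + qq * W'"
  \<comment> \<open>The logarithmic derivative of \<open>rho\<close> with denominators cleared. The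
    terms with \<open>W t\<close> are governed by \<open>qN'\<close>, the others by
    \<open>NP'\<close>.\<close>
  have key: "F' * W t * x1 - of_nat k * Z' * W t * F = n * Z' * F"
  proof -
    have "F' * W t * x1 = ((p' * W t + q' * (W t)\<^sup>2) * Z' + qq * (2 * W t * W') / 2) * x1"
      by (simp add: F'_def power2_eq_square algebra_simps)
    also have "\<dots> = Z' * (W t * (p' * x1) + (q' * r + qq * r' / 2) * x1)"
      unfolding W2 WW' by (simp add: algebra_simps)
    also have "\<dots> = Z' * (W t * (qq * n + of_nat k * p) + (n * p + of_nat k * (qq * r)))"
      by (simp only: qN' NP') simp
    also have "\<dots> = n * Z' * F + of_nat k * Z' * (W t * p + qq * (W t)\<^sup>2)"
      by (simp add: F_def W2[symmetric] power2_eq_square algebra_simps)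
    also have "\<dots> = n * Z' * F + of_nat k * Z' * W t * F"
      by (simp add: F_def power2_eq_square algebra_simps)
    finally show ?thesis by simp
  qed
  have isC: "isCont Z t" using DZ by (rule DERIV_isCont)
  have ev: "eventually (\<lambda>s. Z s \<noteq> 0 \<and> Z s \<noteq> 1) (nhds t)"
  proof -
    have "eventually (\<lambda>s. Z s \<in> - {0, 1}) (nhds t)"
      using isC nz by (intro topological_tendstoD[where S = "- {0, 1}"]) (auto simp: continuous_at tendsto_nhds_iff intro: isCont_tendsto_compose)
    thus ?thesis by eventually_elim auto
  qed
  define f where "f s = (poly (cpoly P) (Z s) + poly (cpoly q) (Z s) * W s) / (2 * (Z s - 1) ^ k)" for s
  have ev_eq: "eventually (\<lambda>s. \<rho> (Z s) (W s) = f s) (nhds t)"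
    using ev by eventually_elim (simp add: rho_eq f_def)
  have Df: "(f has_field_derivative (F' * (2 * x1 ^ k) - F * (2 * (of_nat k * x1 ^ (k - 1) * Z'))) / (2 * x1 ^ k)\<^sup>2) (at t)"
    unfolding f_def
    by (rule derivative_eq_intros DERIV_chain2[OF poly_DERIV DZ] DZ DW refl)+
       (use x1 in \<open>simp_all add: F_def F'_def x1_def defs power2_eq_square algebra_simps\<close>)
  have ft: "f t = F / (2 * x1 ^ k)" by (simp add: f_def F_def defs x1_def)
  have D: "deriv (\<lambda>s. \<rho> (Z s) (W s)) t = (F' * (2 * x1 ^ k) - F * (2 * (of_nat k * x1 ^ (k - 1) * Z'))) / (2 * x1 ^ k)\<^sup>2"
    using deriv_cong_ev[OF ev_eq refl] DERIV_imp_deriv[OF Df] by simp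
  have R: "\<rho> (Z t) (W t) = F / (2 * x1 ^ k)" using eventually_nhds_x_imp_x[OF ev_eq] ft by simp
  define y where "y = x1 ^ (k - 1)"
  have y: "y \<noteq> 0" "x1 ^ k = x1 * y" using k_pos x1 by (cases k; simp add: y_def)+
  have "deriv (\<lambda>s. \<rho> (Z s) (W s)) t / \<rho> (Z t) (W t) = F' / F - of_nat k * Z' / x1"
    unfolding D R y(2) y_def[symmetric] using F0 x1 y(1) by (simp add: field_simps power2_eq_square)
  also have "\<dots> = n * Z' / (W t * x1)"
    using key F0 x1 nz by (simp add: field_simps)
  finally have dlog: "deriv (\<lambda>s. \<rho> (Z s) (W s)) t / \<rho> (Z t) (W t) = n * Z' / (W t * x1)" .
  show ?thesis
    unfolding dF_pullback_def dlog G_def Lc_def Z'_def[symmetric] n_def[symmetric] x1_def[symmetric]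
    using nz x1 by (simp add: field_simps) (simp add: x1_def algebra_simps)
qed

lemma poly_cQ: "poly (cpoly (Q chi eta)) z = (Lc eta z)\<^sup>2 * poly (cpoly P1) z - 4 * (of_real chi)\<^sup>2 * z * (cN z)\<^sup>2"
  by (simp add: Q_def Lc_def algebra_simps)

lemma cP0_eq: "cP0 z = z * poly (cpoly P1) z"
  by (simp add: P0_def)

lemma cQ_factor: "z * poly (cpoly (Q chi eta)) z = (Lc eta z)\<^sup>2 * cP0 z - (2 * of_real chi * z * cN z)\<^sup>2"
  by (simp add: poly_cQ cP0_eq power2_eq_square algebra_simps)

lemma cQ_factor_G:
  assumes "w\<^sup>2 = cP0 z"
  shows "z * poly (cpoly (Q chi eta)) z = - (G chi eta z w * G chi eta z (- w))"
  unfolding cQ_factor assms[symmetric] by (simp add: G_def power2_eq_square algebra_simps)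

lemma cQ_root_if_G:
  assumes "w\<^sup>2 = cP0 z" "G chi eta z w = 0" "z \<noteq> 0"
  shows "poly (cpoly (Q chi eta)) z = 0"
  using cQ_factor_G[OF assms(1), of chi eta] assms(2,3) by simp

lemma G_root_of_cQ:
  assumes "poly (cpoly (Q chi eta)) z = 0"
  obtains w where "w\<^sup>2 = cP0 z" "G chi eta z w = 0"
proof -
  have c: "(csqrt (cP0 z))\<^sup>2 = cP0 z" by simp
  from cQ_factor_G[OF c, of chi eta] assms
  have "G chi eta z (csqrt (cP0 z)) = 0 \<or> G chi eta z (- csqrt (cP0 z)) = 0" by auto
  thus ?thesis using that[of "csqrt (cP0 z)"] that[of "- csqrt (cP0 z)"] c by auto
qed

lemma P0_nz: "P0 \<noteq> 0"
  using P0_pos[of 1] by auto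

section \<open>Local coordinates on the curve\<close>

lemma finite_square_roots: "finite {w::complex. w\<^sup>2 = y}"
proof -
  have "{w. w\<^sup>2 = y} \<subseteq> {csqrt y, - csqrt y}"
    using power2_eq_iff[of _ "csqrt y"] by auto
  thus ?thesis using finite_subset by blast
qed

text \<open>Only finitely many points of the curve lie over the zeros of \<open>R\<close>, and an
  injective parametrization meets each of them at most once. So \<open>0\<close> is not an
  accumulation point of zeros.\<close>

lemma ev_poly_nz:
  fixes Z W :: "complex \<Rightarrow> complex"
  assumes "r > 0" "\<And>u. u \<in> ball 0 r - {0} \<Longrightarrow> (W u)\<^sup>2 = cP0 (Z u)"
    and inj: "inj_on (\<lambda>t. (Z t, W t)) (ball 0 r - {0})" and R: "R \<noteq> 0"
  shows "eventually (\<lambda>t. poly R (Z t) \<noteq> 0) (at (0::complex))"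
proof -
  define B where "B = {t \<in> ball 0 r - {0}. poly R (Z t) = 0}"
  have "(\<lambda>t. (Z t, W t)) ` B \<subseteq> (SIGMA z:{z. poly R z = 0}. {w. w\<^sup>2 = cP0 z})"
    using assms(2) by (auto simp: B_def)
  moreover have "finite (SIGMA z:{z. poly R z = 0}. {w. w\<^sup>2 = cP0 z})"
    using R by (intro finite_SigmaI poly_roots_finite finite_square_roots)
  ultimately have "finite ((\<lambda>t. (Z t, W t)) ` B)" by (rule finite_subset)
  moreover have "inj_on (\<lambda>t. (Z t, W t)) B" by (rule inj_on_subset[OF inj]) (auto simp: B_def)
  ultimately have "finite B" by (simp add: finite_image_iff)
  hence "open (ball 0 r - (B - {0}))" by (intro open_Diff finite_imp_closed) auto
  hence "eventually (\<lambda>t. t \<in> ball 0 r - (B - {0}) - {0}) (at 0)"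
    by (rule eventually_at_in_open) (use assms(1) in auto)
  thus ?thesis by eventually_elim (auto simp: B_def)
qed

lemma ev_param:
  fixes Z W :: "complex \<Rightarrow> complex"
  assumes "r > 0" "\<And>u. u \<in> ball 0 r - {0} \<Longrightarrow> (W u)\<^sup>2 = cP0 (Z u)"
    and inj: "inj_on (\<lambda>t. (Z t, W t)) (ball 0 r - {0})" and "eta \<noteq> 1"
  shows "eventually (\<lambda>t. t \<in> ball 0 r - {0} \<and> Z t \<noteq> 0 \<and> Z t \<noteq> 1 \<and> W t \<noteq> 0 \<and> G chi eta (Z t) (W t) \<noteq> 0) (at 0)"
proof -
  have ev: "eventually (\<lambda>t. poly R (Z t) \<noteq> 0) (at 0)" if "R \<noteq> 0" for R
    using ev_poly_nz[OF assms(1-3)] that by blast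
  have "eventually (\<lambda>t. t \<in> ball 0 r - {0}) (at 0)"
    using assms(1) by (intro eventually_at_in_open) auto
  moreover have "eventually (\<lambda>t. poly [:0, 1:] (Z t) \<noteq> 0) (at 0)" by (rule ev) simp
  moreover have "eventually (\<lambda>t. poly [:-1, 1:] (Z t) \<noteq> 0) (at 0)" by (rule ev) simp
  moreover have "eventually (\<lambda>t. cP0 (Z t) \<noteq> 0) (at 0)" by (rule ev) (simp add: P0_nz)
  moreover have "eventually (\<lambda>t. poly (cpoly (Q chi eta)) (Z t) \<noteq> 0) (at 0)"
    by (rule ev) (simp add: Q_nz[OF assms(4)])
  ultimately show ?thesis
  proof eventually_elim
    case (elim t)
    have w: "(W t)\<^sup>2 = cP0 (Z t)" using assms(2) elim by blast
    have "Z t \<noteq> 0" "Z t \<noteq> 1" "W t \<noteq> 0" using elim w by auto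
    moreover have "G chi eta (Z t) (W t) \<noteq> 0" using cQ_root_if_G[OF w] elim by auto
    ultimately show ?case using elim by blast
  qed
qed

lemma dF_ev:
  fixes Z W :: "complex \<Rightarrow> complex"
  assumes "r > 0" "Z holomorphic_on (ball 0 r - {0})" "W holomorphic_on (ball 0 r - {0})"
    "\<And>u. u \<in> ball 0 r - {0} \<Longrightarrow> (W u)\<^sup>2 = cP0 (Z u)"
    and inj: "inj_on (\<lambda>t. (Z t, W t)) (ball 0 r - {0})" and "eta \<noteq> 1"
  shows "eventually (\<lambda>t. t \<in> ball 0 r - {0} \<and> Z t \<noteq> 0 \<and> Z t \<noteq> 1 \<and> W t \<noteq> 0 \<and> G chi eta (Z t) (W t) \<noteq> 0 \<and>
      dF chi eta Z W t = - deriv Z t * G chi eta (Z t) (W t) / (4 * Z t * (Z t - 1) * W t)) (at 0)"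
proof -
  have "eventually (\<lambda>t. t \<in> ball 0 r - {0} \<and> Z t \<noteq> 0 \<and> Z t \<noteq> 1 \<and> W t \<noteq> 0 \<and> G chi eta (Z t) (W t) \<noteq> 0) (at 0)"
    by (rule ev_param) (use assms in auto)
  thus ?thesis
  proof eventually_elim
    case (elim t)
    have "open (ball 0 r - {0 :: complex})" by auto
    from dF_eq[OF this _ assms(2,3), of t chi eta] assms(4) elim show ?case by blast
  qed
qed

lemma dF_isolated:
  fixes Z W :: "complex \<Rightarrow> complex"
  assumes "r > 0" "Z holomorphic_on (ball 0 r - {0})" "W holomorphic_on (ball 0 r - {0})"
    "\<And>u. u \<in> ball 0 r - {0} \<Longrightarrow> (W u)\<^sup>2 = cP0 (Z u)"
    and inj: "inj_on (\<lambda>t. (Z t, W t)) (ball 0 r - {0})" and "eta \<noteq> 1"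
  shows "isolated_singularity_at (dF chi eta Z W) 0"
proof -
  define f where "f t = - deriv Z t * G chi eta (Z t) (W t) / (4 * Z t * (Z t - 1) * W t)" for t
  have "eventually (\<lambda>t. t \<in> ball 0 r - {0} \<and> Z t \<noteq> 0 \<and> Z t \<noteq> 1 \<and> W t \<noteq> 0 \<and> G chi eta (Z t) (W t) \<noteq> 0 \<and>
      dF chi eta Z W t = f t) (at 0)"
    unfolding f_def by (rule dF_ev) (use assms in auto)
  then obtain e where e: "e > 0" "\<And>t. t \<noteq> 0 \<Longrightarrow> dist t 0 < e \<Longrightarrow>
      t \<in> ball 0 r - {0} \<and> Z t \<noteq> 0 \<and> Z t \<noteq> 1 \<and> W t \<noteq> 0 \<and> dF chi eta Z W t = f t"
    unfolding eventually_at by auto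
  have "f holomorphic_on ball 0 e - {0}"
    unfolding f_def G_def Lc_def
    by (intro holomorphic_intros holomorphic_on_subset[OF assms(2)] holomorphic_on_subset[OF assms(3)]
         holomorphic_on_subset[OF holomorphic_deriv[OF assms(2)]] open_delete) (use e(2) in \<open>auto simp: dist_commute\<close>)
  hence "isolated_singularity_at f 0" using e(1) by (intro isolated_singularity_at_holomorphic[of f "ball 0 e"]) auto
  moreover have "eventually (\<lambda>t. dF chi eta Z W t = f t) (at 0)" using e by (auto simp: eventually_at)
  ultimately show ?thesis using isolated_singularity_at_cong[of "dF chi eta Z W" f 0 0] by blast
qed

lemma analytic_ball: "r > 0 \<Longrightarrow> f holomorphic_on ball 0 r \<Longrightarrow> f analytic_on {0 :: complex}"
  using analytic_at by (metis centre_in_ball open_ball)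

lemma not_critical_if_pole:
  assumes "isolated_singularity_at f 0" "is_pole f 0"
  shows "zorder f 0 \<noteq> int j"
  using isolated_pole_imp_neg_zorder[OF assms] by simp

lemma curve_deriv:
  fixes Z W :: "complex \<Rightarrow> complex"
  assumes "open A" "t \<in> A" "Z holomorphic_on A" "W holomorphic_on A" "\<And>u. u \<in> A \<Longrightarrow> (W u)\<^sup>2 = cP0 (Z u)"
  shows "2 * W t * deriv W t = poly (pderiv (cpoly P0)) (Z t) * deriv Z t"
proof -
  have DZ: "(Z has_field_derivative deriv Z t) (at t)" and DW: "(W has_field_derivative deriv W t) (at t)"
    using holomorphic_derivI[OF assms(3,1,2)] holomorphic_derivI[OF assms(4,1,2)] by auto
  have "((\<lambda>u. (W u)\<^sup>2) has_field_derivative 2 * W t * deriv W t) (at t)"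
    by (auto intro!: derivative_eq_intros DW)
  moreover have "((\<lambda>u. cP0 (Z u)) has_field_derivative poly (pderiv (cpoly P0)) (Z t) * deriv Z t) (at t)"
    by (rule DERIV_chain2[OF poly_DERIV DZ])
  hence "((\<lambda>u. (W u)\<^sup>2) has_field_derivative poly (pderiv (cpoly P0)) (Z t) * deriv Z t) (at t)"
    by (rule has_field_derivative_transform_within_open[OF _ assms(1,2)]) (simp add: assms(5))
  ultimately show ?thesis by (rule DERIV_unique)
qed

lemma pderiv_P0_nz: "cP0 z = 0 \<Longrightarrow> poly (pderiv (cpoly P0)) z \<noteq> 0"
  using P0_rsquarefree by (auto simp: rsquarefree_roots)

text \<open>The branch of \<open>sqrt P0\<close> through a point with second coordinate \<open>w\<close>.\<close>

definition sbr :: "complex \<Rightarrow> complex \<Rightarrow> complex" where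
  "sbr w z = w * csqrt (cP0 z / w\<^sup>2)"

lemma sbr_squared: "w \<noteq> 0 \<Longrightarrow> (sbr w z)\<^sup>2 = cP0 z"
  by (simp add: sbr_def power_mult_distrib)

lemma sbr_base: "w \<noteq> 0 \<Longrightarrow> w\<^sup>2 = cP0 z \<Longrightarrow> sbr w z = w"
  by (metis csqrt_1 divide_self_if mult.right_neutral power_eq_0_iff sbr_def)

lemma sbr_uminus: "sbr (- w) z = - sbr w z"
  by (simp add: sbr_def)

text \<open>The argument of \<open>csqrt\<close> equals 1 at the base point and therefore stays off
  the branch cut nearby.\<close>

lemma sbr_holomorphic:
  assumes "w \<noteq> 0" "w\<^sup>2 = cP0 z"
  obtains r where "r > 0" "sbr w holomorphic_on ball z r"
proof -
  have "((\<lambda>\<zeta>. cP0 \<zeta> / w\<^sup>2) \<longlongrightarrow> cP0 z / w\<^sup>2) (nhds z)"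
    using assms by (intro tendsto_intros tendsto_poly) (auto intro: filterlim_ident)
  moreover have "cP0 z / w\<^sup>2 = 1" unfolding assms(2)[symmetric] using assms(1) by simp
  ultimately have lim: "((\<lambda>\<zeta>. cP0 \<zeta> / w\<^sup>2) \<longlongrightarrow> 1) (nhds z)" by simp
  have "eventually (\<lambda>\<zeta>. cP0 \<zeta> / w\<^sup>2 \<in> - \<real>\<^sub>\<le>\<^sub>0) (nhds z)"
    by (rule topological_tendstoD[OF lim]) auto
  then obtain r where r: "r > 0" "\<And>\<zeta>. dist \<zeta> z < r \<Longrightarrow> cP0 \<zeta> / w\<^sup>2 \<notin> \<real>\<^sub>\<le>\<^sub>0"
    unfolding eventually_nhds_metric by auto
  have "sbr w holomorphic_on ball z r"
    unfolding sbr_def by (intro holomorphic_intros) (use r assms in \<open>auto simp: dist_commute\<close>)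
  thus ?thesis using that r by blast
qed

text \<open>One coordinate is locally injective by itself. Where \<open>w\<close> is nonzero,
  \<open>W\<close> is a function of \<open>Z\<close>. Where \<open>w = 0\<close>, the zero of
  \<open>P0\<close> is simple, so \<open>P0\<close> is locally injective and \<open>W\<close>
  determines \<open>Z\<close>. An injective holomorphic function has nonvanishing
  derivative.\<close>

lemma param_regular:
  fixes Z W :: "complex \<Rightarrow> complex"
  assumes r: "r > 0" and hol: "Z holomorphic_on ball 0 r" "W holomorphic_on ball 0 r"
    and curve: "\<And>u. u \<in> ball 0 r \<Longrightarrow> (W u)\<^sup>2 = cP0 (Z u)"
    and inj: "inj_on (\<lambda>t. (Z t, W t)) (ball 0 r)"
  shows "W 0 \<noteq> 0 \<Longrightarrow> deriv Z 0 \<noteq> 0" "W 0 = 0 \<Longrightarrow> deriv W 0 \<noteq> 0"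
proof -
  have cont: "isCont Z 0" "isCont W 0"
    using analytic_at_imp_isCont analytic_ball[OF r] hol by blast+
  have 0: "(0::complex) \<in> ball 0 r" using r by simp
  show "deriv Z 0 \<noteq> 0" if w: "W 0 \<noteq> 0"
  proof -
    obtain e where e: "e > 0" "sbr (W 0) holomorphic_on ball (Z 0) e"
      using sbr_holomorphic[OF w curve[OF 0]] by blast
    have iz: "isCont (sbr (W 0)) (Z 0)"
      using e by (meson analytic_at analytic_at_imp_isCont centre_in_ball open_ball)
    have "isCont (\<lambda>t. W t + sbr (W 0) (Z t)) 0"
      by (intro continuous_intros cont isCont_o2[OF cont(1)] iz)
    hence "((\<lambda>t. W t + sbr (W 0) (Z t)) \<longlongrightarrow> W 0 + sbr (W 0) (Z 0)) (nhds 0)"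
      by (simp add: continuous_at tendsto_nhds_iff)
    moreover have "W 0 + sbr (W 0) (Z 0) = 2 * W 0" using sbr_base[OF w curve[OF 0]] by simp
    ultimately have lim: "((\<lambda>t. W t + sbr (W 0) (Z t)) \<longlongrightarrow> 2 * W 0) (nhds 0)" by simp
    \<comment> \<open>\<open>W t\<close> is the chosen branch up to sign. The sum tends to
      \<open>2 * W 0\<close>, which is nonzero and so excludes the minus sign.\<close>
    have "eventually (\<lambda>t. W t + sbr (W 0) (Z t) \<in> - {0}) (nhds 0)"
      by (rule topological_tendstoD[OF lim]) (use w in auto)
    then obtain d where d: "d > 0" "\<And>t. dist t 0 < d \<Longrightarrow> W t + sbr (W 0) (Z t) \<noteq> 0"
      unfolding eventually_nhds_metric by auto
    define e' where "e' = min d r"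
    have We: "W t = sbr (W 0) (Z t)" if "t \<in> ball 0 e'" for t
    proof -
      have "(W t)\<^sup>2 = (sbr (W 0) (Z t))\<^sup>2" using curve[of t] that sbr_squared[OF w] by (simp add: e'_def)
      thus ?thesis using d(2)[of t] that by (auto simp: power2_eq_iff e'_def)
    qed
    have "inj_on Z (ball 0 e')"
    proof (rule inj_onI)
      fix s t assume "s \<in> ball 0 e'" "t \<in> ball 0 e'" "Z s = Z t"
      thus "s = t" using inj_onD[OF inj, of s t] We[of s] We[of t] by (simp add: e'_def)
    qed
    moreover have "Z holomorphic_on ball 0 e'" by (rule holomorphic_on_subset[OF hol(1)]) (auto simp: e'_def)
    ultimately show ?thesis using d(1) r
      by (intro holomorphic_injective_imp_regular[of Z "ball 0 e'"]) (auto simp: e'_def)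
  qed
  show "deriv W 0 \<noteq> 0" if w: "W 0 = 0"
  proof -
    have "cP0 (Z 0) = 0" using curve[OF 0] w by simp
    hence "poly (pderiv (cpoly P0)) (Z 0) \<noteq> 0" by (rule pderiv_P0_nz)
    hence "deriv cP0 (Z 0) \<noteq> 0" using DERIV_imp_deriv[OF poly_DERIV, of "cpoly P0" "Z 0"] by metis
    moreover have "cP0 holomorphic_on UNIV" by (intro holomorphic_intros)
    ultimately obtain e where e: "e > 0" "inj_on cP0 (ball (Z 0) e)"
      using has_complex_derivative_locally_injective[of cP0 UNIV "Z 0"] by auto
    have "eventually (\<lambda>t. Z t \<in> ball (Z 0) e) (nhds 0)"
      using cont(1) e(1) by (intro topological_tendstoD[where S = "ball (Z 0) e"]) (auto simp: continuous_at tendsto_nhds_iff)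
    then obtain d where d: "d > 0" "\<And>t. dist t 0 < d \<Longrightarrow> Z t \<in> ball (Z 0) e"
      unfolding eventually_nhds_metric by auto
    define e' where "e' = min d r"
    have "inj_on W (ball 0 e')"
    proof (rule inj_onI)
      fix s t assume st: "s \<in> ball 0 e'" "t \<in> ball 0 e'" "W s = W t"
      hence "cP0 (Z s) = cP0 (Z t)" using curve[of s] curve[of t] by (simp add: e'_def)
      hence "Z s = Z t" using inj_onD[OF e(2)] d(2)[of s] d(2)[of t] st by (simp add: e'_def)
      thus "s = t" using inj_onD[OF inj, of s t] st by (simp add: e'_def)
    qed
    moreover have "W holomorphic_on ball 0 e'" by (rule holomorphic_on_subset[OF hol(2)]) (auto simp: e'_def)
    ultimately show ?thesis using d(1) r
      by (intro holomorphic_injective_imp_regular[of W "ball 0 e'"]) (auto simp: e'_def)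
  qed
qed

lemma param_exists_regular:
  assumes "w\<^sup>2 = cP0 z" "w \<noteq> 0"
  shows "local_parametrization (cpoly P0) (Affine z w) (\<lambda>t. z + t) (\<lambda>t. sbr w (z + t))"
proof -
  obtain r where r: "r > 0" "sbr w holomorphic_on ball z r" using sbr_holomorphic assms by metis
  have "(\<lambda>t. sbr w (z + t)) holomorphic_on ball 0 r"
    by (rule holomorphic_on_compose_gen[OF _ r(2), of "\<lambda>t. z + t", unfolded o_def])
       (auto intro!: holomorphic_intros simp: dist_norm)
  thus ?thesis using r(1) sbr_base[OF assms(2,1)] sbr_squared[OF assms(2)]
    by (auto intro!: exI[of _ r] holomorphic_intros inj_onI)
qed

text \<open>At a branch point a square root of \<open>z' - z\<close> is a local coordinate. With
  \<open>P0 = (x - z) R\<close> and \<open>R(z)\<close> nonzero, the second coordinate is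
  \<open>t\<close> times a branch of the square root of \<open>R (z + t^2)\<close>.\<close>

lemma param_exists_branch:
  assumes z: "cP0 z = 0"
  obtains Z W where "local_parametrization (cpoly P0) (Affine z 0) Z W"
proof -
  obtain R where R: "cpoly P0 = [:-z, 1:] * R" using z unfolding poly_eq_0_iff_dvd dvd_def by blast
  have "poly (pderiv (cpoly P0)) z = poly R z" by (simp add: R pderiv_mult pderiv_pCons del: mult_pCons_left)
  hence Rz: "poly R z \<noteq> 0" using pderiv_P0_nz[OF z] by simp
  define h where "h t = csqrt (poly R z) * csqrt (poly R (z + t\<^sup>2) / poly R z)" for t
  have "((\<lambda>t. poly R (z + t\<^sup>2) / poly R z) \<longlongrightarrow> poly R (z + 0\<^sup>2) / poly R z) (nhds 0)"
    using Rz by (intro tendsto_intros tendsto_poly) (auto intro: filterlim_ident)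
  hence lim: "((\<lambda>t. poly R (z + t\<^sup>2) / poly R z) \<longlongrightarrow> 1) (nhds 0)" using Rz by simp
  have "eventually (\<lambda>t. poly R (z + t\<^sup>2) / poly R z \<in> - \<real>\<^sub>\<le>\<^sub>0) (nhds 0)"
    by (rule topological_tendstoD[OF lim]) auto
  then obtain r where r: "r > 0" "\<And>t. dist t 0 < r \<Longrightarrow> poly R (z + t\<^sup>2) / poly R z \<notin> \<real>\<^sub>\<le>\<^sub>0"
    unfolding eventually_nhds_metric by auto
  have hh: "h holomorphic_on ball 0 r"
    unfolding h_def by (intro holomorphic_intros) (use r Rz in \<open>auto simp: dist_commute\<close>)
  have h0: "h t \<noteq> 0" if "t \<in> ball 0 r" for t
    using r(2)[of t] that Rz by (auto simp: h_def)
  have "local_parametrization (cpoly P0) (Affine z 0) (\<lambda>t. z + t\<^sup>2) (\<lambda>t. t * h t)"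
    unfolding local_parametrization.simps
  proof (intro conjI exI[of _ r] ballI)
    show "(\<lambda>t. t * h t) holomorphic_on ball 0 r" by (intro holomorphic_intros hh)
    show "(t * h t)\<^sup>2 = cP0 (z + t\<^sup>2)" for t
      using Rz by (simp add: R h_def power_mult_distrib) (simp add: algebra_simps)
    show "inj_on (\<lambda>t. (z + t\<^sup>2, t * h t)) (ball 0 r)"
    proof (rule inj_onI)
      fix s t assume st: "s \<in> ball 0 r" "t \<in> ball 0 r" "(z + s\<^sup>2, s * h s) = (z + t\<^sup>2, t * h t)"
      hence "s\<^sup>2 = t\<^sup>2" by simp
      hence "h s = h t" by (simp add: h_def)
      thus "s = t" using st h0[of t] by simp
    qed
  qed (use r(1) in \<open>auto intro!: holomorphic_intros\<close>)
  thus ?thesis using that by blast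
qed

end

lemma zorder_poly_shift:
  assumes "R \<noteq> (0 :: complex poly)"
  shows "zorder (\<lambda>t. poly R (z + t)) 0 = int (order z R)"
proof -
  obtain S where S: "R = [:- z, 1:] ^ order z R * S" "\<not> [:- z, 1:] dvd S"
    using order_decomp[OF assms] by blast
  show ?thesis
  proof (rule zorder_eqI[of UNIV 0 "\<lambda>t. poly S (z + t)"])
    show "poly S (z + 0) \<noteq> 0" using S(2) by (simp add: poly_eq_0_iff_dvd)
    show "poly R (z + t) = poly S (z + t) * (t - 0) powi int (order z R)" for t
      by (subst S(1)) (simp add: poly_power power_int_def)
  qed (auto intro!: holomorphic_intros)
qed

lemma is_pole_transfer: "is_pole f z \<Longrightarrow> eventually (\<lambda>t. f t = h t) (at z) \<Longrightarrow> is_pole h z"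
  using is_pole_cong[of f h z z] by simp

lemma analytic_on_poly [analytic_intros]:
  "f analytic_on A \<Longrightarrow> (\<lambda>t. poly p (f t)) analytic_on A"
  by (induction p) (auto intro!: analytic_intros)

context spectral_curve
begin

text \<open>\<open>w\<close> times the derivative of \<open>G\<close> along the curve with respect to \<open>z\<close>.\<close>

definition E2 :: "real \<Rightarrow> real \<Rightarrow> complex \<Rightarrow> complex \<Rightarrow> complex" where
  "E2 chi eta z w = of_nat k * (1 - of_real eta) * w\<^sup>2 + Lc eta z * poly (pderiv (cpoly P0)) z / 2
     + 2 * of_real chi * (cN z + z * poly (pderiv (cpoly N)) z) * w"

text \<open>By \<open>N1\<close> a zero of \<open>G\<close> over \<open>z = 1\<close> would give
  \<open>chi^2 = 1\<close>. Inside the square, the points over \<open>z = 1\<close> are therefore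
  poles of \<open>dF\<close> and never critical.\<close>

lemma G_1_nz:
  assumes "\<bar>chi\<bar> < 1" "w\<^sup>2 = cP0 1"
  shows "G chi eta 1 w \<noteq> 0"
proof
  assume "G chi eta 1 w = 0"
  moreover have "Lc eta 1 = 2 * of_nat k" by (simp add: Lc_def)
  ultimately have "2 * (of_nat k * w + of_real chi * cN 1) = 0"
    unfolding G_def by (metis distrib_left mult.assoc mult.right_neutral)
  hence "of_nat k * w + of_real chi * cN 1 = 0" by (metis mult_eq_0_iff zero_neq_numeral)
  hence "of_nat k * w = - (of_real chi * cN 1)" by (rule eq_neg_iff_add_eq_0[THEN iffD2])
  hence "(of_nat k * w)\<^sup>2 = (of_real chi * cN 1)\<^sup>2" by (simp only: power2_minus)
  hence "(of_nat k)\<^sup>2 * cP0 1 = (of_real chi)\<^sup>2 * (cN 1)\<^sup>2" by (simp only: power_mult_distrib assms(2))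
  hence "of_real ((real k)\<^sup>2 * poly P0 1) = (of_real (chi\<^sup>2 * (poly N 1)\<^sup>2) :: complex)"
    by (simp only: poly_cpoly_1 of_real_mult of_real_power of_real_of_nat_eq)
  hence "(real k)\<^sup>2 * poly P0 1 = chi\<^sup>2 * (poly N 1)\<^sup>2" by (simp only: of_real_eq_iff)
  hence "(real k)\<^sup>2 * poly P1 1 = chi\<^sup>2 * ((real k)\<^sup>2 * poly P1 1)" using N1 by (simp add: poly_P0)
  moreover have "(real k)\<^sup>2 * poly P1 1 > 0" using P1_pos_nonneg[of 1] k_pos by simp
  ultimately have "chi\<^sup>2 = 1" by (metis mult_cancel_right1 less_irrefl)
  thus False using assms(1) by (auto simp: power2_eq_1_iff)
qed

lemma affine_param_elim:
  assumes "local_parametrization (cpoly P0) (Affine z w) Z W"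
  obtains r where "r > 0" "Z holomorphic_on ball 0 r" "W holomorphic_on ball 0 r"
    "\<And>u. u \<in> ball 0 r \<Longrightarrow> (W u)\<^sup>2 = cP0 (Z u)" "inj_on (\<lambda>t. (Z t, W t)) (ball 0 r)"
    "Z 0 = z" "W 0 = w" "w\<^sup>2 = cP0 z"
proof -
  obtain r where "r > 0" "Z holomorphic_on ball 0 r" "W holomorphic_on ball 0 r"
    "\<forall>u\<in>ball 0 r. (W u)\<^sup>2 = cP0 (Z u)" "inj_on (\<lambda>t. (Z t, W t)) (ball 0 r)" "Z 0 = z" "W 0 = w"
    using assms by auto
  moreover from this have "w\<^sup>2 = cP0 z" by fastforce
  ultimately show ?thesis using that by blast
qed

text \<open>For the last claim the derivative of \<open>G\<close> along the curve is compared with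
  \<open>E2\<close>. If \<open>w\<close> is nonzero they differ by the factor \<open>Z' / w\<close>.
  If \<open>w = 0\<close>, then \<open>Z' = 0\<close> and \<open>W'\<close> is nonzero, so both
  vanish exactly when \<open>Lc eta z\<close> does.\<close>

lemma phi_order:
  fixes chi eta :: real and z w :: complex
  assumes lp: "local_parametrization (cpoly P0) (Affine z w) Z W" and eta: "eta \<noteq> 1"
  defines "\<phi> \<equiv> \<lambda>t. G chi eta (Z t) (W t)"
  shows "\<phi> analytic_on {0}" "eventually (\<lambda>t. \<phi> t \<noteq> 0) (at 0)" "zorder \<phi> 0 \<ge> 0"
    "zorder \<phi> 0 \<ge> 1 \<longleftrightarrow> G chi eta z w = 0"
    "zorder \<phi> 0 \<ge> 2 \<longleftrightarrow> G chi eta z w = 0 \<and> E2 chi eta z w = 0"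
proof -
  obtain r where r: "r > 0" and hol: "Z holomorphic_on ball 0 r" "W holomorphic_on ball 0 r"
    and curve: "\<And>u. u \<in> ball 0 r \<Longrightarrow> (W u)\<^sup>2 = cP0 (Z u)" and inj: "inj_on (\<lambda>t. (Z t, W t)) (ball 0 r)"
    and ZW0: "Z 0 = z" "W 0 = w" and w: "w\<^sup>2 = cP0 z"
    using affine_param_elim[OF lp] by blast
  have anZW: "Z analytic_on {0}" "W analytic_on {0}" using analytic_ball[OF r] hol by auto
  show an: "\<phi> analytic_on {0}"
    unfolding \<phi>_def G_def Lc_def by (intro analytic_intros anZW)
  have "eventually (\<lambda>t. t \<in> ball 0 r - {0} \<and> Z t \<noteq> 0 \<and> Z t \<noteq> 1 \<and> W t \<noteq> 0 \<and> G chi eta (Z t) (W t) \<noteq> 0) (at 0)"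
    by (rule ev_param) (use r curve inj eta in \<open>auto intro: inj_on_subset\<close>)
  thus ev: "eventually (\<lambda>t. \<phi> t \<noteq> 0) (at 0)" unfolding \<phi>_def by eventually_elim auto
  hence fr: "frequently (\<lambda>t. \<phi> t \<noteq> 0) (at 0)" by (intro eventually_frequently) auto
  show ge0: "zorder \<phi> 0 \<ge> 0" using zorder_ge_0[OF an fr] .
  have \<phi>0: "\<phi> 0 = G chi eta z w" by (simp add: \<phi>_def ZW0)
  show z1: "zorder \<phi> 0 \<ge> 1 \<longleftrightarrow> G chi eta z w = 0"
    using zorder_pos_iff'[OF an fr] \<phi>0 by auto
  have 0: "(0::complex) \<in> ball 0 r" using r by simp
  define Z' W' where "Z' = deriv Z 0" and "W' = deriv W 0"
  have DZ: "(Z has_field_derivative Z') (at 0)" and DW: "(W has_field_derivative W') (at 0)"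
    unfolding Z'_def W'_def using holomorphic_derivI[OF hol(1) open_ball 0] holomorphic_derivI[OF hol(2) open_ball 0] by auto
  have cd: "2 * w * W' = poly (pderiv (cpoly P0)) z * Z'"
    using curve_deriv[OF open_ball 0 hol curve] by (simp add: ZW0 Z'_def W'_def)
  have "(\<phi> has_field_derivative of_nat k * (1 - of_real eta) * Z' * w + Lc eta z * W'
      + 2 * of_real chi * (Z' * cN z + z * (poly (pderiv (cpoly N)) z * Z'))) (at 0)"
    unfolding \<phi>_def G_def Lc_def
    by (rule derivative_eq_intros DERIV_chain2[OF poly_DERIV DZ] DZ DW refl)+
       (simp add: ZW0 algebra_simps)
  hence d\<phi>: "deriv \<phi> 0 = of_nat k * (1 - of_real eta) * Z' * w + Lc eta z * W'
      + 2 * of_real chi * (Z' * cN z + z * (poly (pderiv (cpoly N)) z * Z'))"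
    by (rule DERIV_imp_deriv)
  have "zorder \<phi> 0 \<ge> 2 \<longleftrightarrow> deriv \<phi> 0 = 0" if "G chi eta z w = 0"
    using deriv_nz_iff_zorder_1[OF an _ fr] that \<phi>0 by simp
  moreover have "deriv \<phi> 0 = 0 \<longleftrightarrow> E2 chi eta z w = 0"
  proof (cases "w = 0")
    case False
    hence "Z' \<noteq> 0" unfolding Z'_def using param_regular(1)[OF r hol curve inj] ZW0 by simp
    have "2 * w * deriv \<phi> 0 = 2 * of_nat k * (1 - of_real eta) * Z' * w\<^sup>2 + Lc eta z * (2 * w * W')
      + 2 * w * (2 * of_real chi * (Z' * cN z + z * (poly (pderiv (cpoly N)) z * Z')))"
      unfolding d\<phi> by (simp add: power2_eq_square algebra_simps)
    also have "\<dots> = 2 * Z' * E2 chi eta z w"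
      unfolding cd E2_def by (simp add: power2_eq_square field_simps)
    finally show ?thesis using False \<open>Z' \<noteq> 0\<close> by (metis mult_eq_0_iff zero_neq_numeral)
  next
    case True
    hence "cP0 z = 0" using w by simp
    hence pz: "poly (pderiv (cpoly P0)) z \<noteq> 0" by (rule pderiv_P0_nz)
    hence "Z' = 0" using cd True by simp
    moreover have "W' \<noteq> 0" unfolding W'_def using param_regular(2)[OF r hol curve inj] ZW0 True by simp
    ultimately show ?thesis using pz True by (simp add: d\<phi> E2_def)
  qed
  ultimately show "zorder \<phi> 0 \<ge> 2 \<longleftrightarrow> G chi eta z w = 0 \<and> E2 chi eta z w = 0"
    using z1 by auto
qed

text \<open>Away from 0, 1 and infinity \<open>dF\<close> is \<open>G\<close> times a unit. At a
  branch point the apparent pole \<open>Z' / W\<close> is cancelled by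
  \<open>2 W W' = P0'(Z) Z'\<close>.\<close>

lemma dF_regular:
  assumes lp: "local_parametrization (cpoly P0) (Affine z w) Z W" and eta: "eta \<noteq> 1"
    and z: "z \<noteq> 0" "z \<noteq> 1"
  shows "eventually (\<lambda>t. dF chi eta Z W t \<noteq> 0) (at 0)"
    "zorder (dF chi eta Z W) 0 = zorder (\<lambda>t. G chi eta (Z t) (W t)) 0"
proof -
  obtain r where r: "r > 0" and hol: "Z holomorphic_on ball 0 r" "W holomorphic_on ball 0 r"
    and curve: "\<And>u. u \<in> ball 0 r \<Longrightarrow> (W u)\<^sup>2 = cP0 (Z u)" and inj: "inj_on (\<lambda>t. (Z t, W t)) (ball 0 r)"
    and ZW0: "Z 0 = z" "W 0 = w" and w: "w\<^sup>2 = cP0 z"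
    using affine_param_elim[OF lp] by blast
  have an: "Z analytic_on {0}" "W analytic_on {0}" using analytic_ball[OF r] hol by auto
  have ev: "eventually (\<lambda>t. t \<in> ball 0 r - {0} \<and> Z t \<noteq> 0 \<and> Z t \<noteq> 1 \<and> W t \<noteq> 0 \<and> G chi eta (Z t) (W t) \<noteq> 0 \<and>
      dF chi eta Z W t = - deriv Z t * G chi eta (Z t) (W t) / (4 * Z t * (Z t - 1) * W t)) (at 0)"
    by (rule dF_ev) (use r hol curve inj eta in \<open>auto intro: inj_on_subset holomorphic_on_subset\<close>)
  obtain U where U: "U analytic_on {0}" "U 0 \<noteq> 0"
    "eventually (\<lambda>t. dF chi eta Z W t = U t * G chi eta (Z t) (W t)) (at 0)"
  proof (cases "w = 0")
    case False
    show ?thesis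
    proof (rule that)
      show "(\<lambda>t. - deriv Z t / (4 * Z t * (Z t - 1) * W t)) analytic_on {0}"
        by (intro analytic_intros an analytic_deriv) (use False z ZW0 in auto)
      show "- deriv Z 0 / (4 * Z 0 * (Z 0 - 1) * W 0) \<noteq> 0"
        using False z ZW0 param_regular(1)[OF r hol curve inj] by simp
      show "eventually (\<lambda>t. dF chi eta Z W t = - deriv Z t / (4 * Z t * (Z t - 1) * W t) * G chi eta (Z t) (W t)) (at 0)"
        using ev by eventually_elim simp
    qed
  next
    case True
    hence "cP0 z = 0" using w by simp
    hence pz: "poly (pderiv (cpoly P0)) z \<noteq> 0" by (rule pderiv_P0_nz)
    have anp: "(\<lambda>t. poly (pderiv (cpoly P0)) (Z t)) analytic_on {0}" by (intro analytic_intros an)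
    have evp: "eventually (\<lambda>t. poly (pderiv (cpoly P0)) (Z t) \<noteq> 0) (at 0)"
      by (rule analytic_at_neq_imp_eventually_neq[OF anp]) (use pz ZW0 in auto)
    show ?thesis
    proof (rule that)
      show "(\<lambda>t. - deriv W t / (2 * Z t * (Z t - 1) * poly (pderiv (cpoly P0)) (Z t))) analytic_on {0}"
        by (intro analytic_intros an analytic_deriv) (use pz z ZW0 in auto)
      show "- deriv W 0 / (2 * Z 0 * (Z 0 - 1) * poly (pderiv (cpoly P0)) (Z 0)) \<noteq> 0"
        using True pz z ZW0 param_regular(2)[OF r hol curve inj] by simp
      show "eventually (\<lambda>t. dF chi eta Z W t = - deriv W t / (2 * Z t * (Z t - 1) * poly (pderiv (cpoly P0)) (Z t)) * G chi eta (Z t) (W t)) (at 0)"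
        using ev evp
      proof eventually_elim
        case (elim t)
        define y where "y = poly (pderiv (cpoly P0)) (Z t)"
        have "2 * W t * deriv W t = y * deriv Z t"
          unfolding y_def using curve_deriv[OF open_ball _ hol curve, of t] elim by blast
        hence "deriv Z t = 2 * W t * deriv W t / y" using elim by (simp add: y_def)
        thus ?case using elim by (simp add: y_def[symmetric])
      qed
    qed
  qed
  note \<phi> = phi_order[OF lp eta, of chi]
  have evU: "eventually (\<lambda>t. U t \<noteq> 0) (at 0)"
    by (rule analytic_at_neq_imp_eventually_neq[OF U(1)]) (use U in auto)
  have evUG: "eventually (\<lambda>t. U t * G chi eta (Z t) (W t) \<noteq> 0) (at 0)"
    using evU \<phi>(2) by eventually_elim auto
  show "eventually (\<lambda>t. dF chi eta Z W t \<noteq> 0) (at 0)"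
    using evUG U(3) by eventually_elim auto
  have "zorder (dF chi eta Z W) 0 = zorder (\<lambda>t. U t * G chi eta (Z t) (W t)) 0"
    using U(3) by (intro zorder_cong) auto
  also have "\<dots> = zorder U 0 + zorder (\<lambda>t. G chi eta (Z t) (W t)) 0"
    by (rule zorder_times_analytic) (use U \<phi> evUG in auto)
  also have "zorder U 0 = 0" by (rule zorder_eq_0I) (use U in auto)
  finally show "zorder (dF chi eta Z W) 0 = zorder (\<lambda>t. G chi eta (Z t) (W t)) 0" by simp
qed

lemma dF_pole_1:
  assumes lp: "local_parametrization (cpoly P0) (Affine 1 w) Z W" and "eta \<noteq> 1" "\<bar>chi\<bar> < 1"
  shows "zorder (dF chi eta Z W) 0 \<noteq> int j"
proof -
  obtain r where r: "r > 0" and hol: "Z holomorphic_on ball 0 r" "W holomorphic_on ball 0 r"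
    and curve: "\<And>u. u \<in> ball 0 r \<Longrightarrow> (W u)\<^sup>2 = cP0 (Z u)" and inj: "inj_on (\<lambda>t. (Z t, W t)) (ball 0 r)"
    and ZW0: "Z 0 = 1" "W 0 = w" and w: "w\<^sup>2 = cP0 1"
    using affine_param_elim[OF lp] by blast
  have an: "Z analytic_on {0}" "W analytic_on {0}" using analytic_ball[OF r] hol by auto
  have "cP0 1 \<noteq> 0" using P0_pos[of 1] by simp
  hence w0: "w \<noteq> 0" using w by auto
  have ev: "eventually (\<lambda>t. t \<in> ball 0 r - {0} \<and> Z t \<noteq> 0 \<and> Z t \<noteq> 1 \<and> W t \<noteq> 0 \<and> G chi eta (Z t) (W t) \<noteq> 0 \<and>
      dF chi eta Z W t = - deriv Z t * G chi eta (Z t) (W t) / (4 * Z t * (Z t - 1) * W t)) (at 0)"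
    by (rule dF_ev) (use r hol curve inj assms in \<open>auto intro: inj_on_subset holomorphic_on_subset\<close>)
  have "isolated_singularity_at (dF chi eta Z W) 0"
    by (rule dF_isolated) (use r hol curve inj assms in \<open>auto intro: inj_on_subset holomorphic_on_subset\<close>)
  moreover have "is_pole (dF chi eta Z W) 0"
  proof -
    have "is_pole (\<lambda>t. (- deriv Z t * G chi eta (Z t) (W t) / (4 * Z t * W t)) / (Z t - 1)) 0"
    proof (rule is_pole_divide)
      have "(\<lambda>t. - deriv Z t * G chi eta (Z t) (W t) / (4 * Z t * W t)) analytic_on {0}"
        unfolding G_def Lc_def by (intro analytic_intros an analytic_deriv) (use ZW0 w0 in auto)
      thus "isCont (\<lambda>t. - deriv Z t * G chi eta (Z t) (W t) / (4 * Z t * W t)) 0"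
        by (rule analytic_at_imp_isCont)
      show "- deriv Z 0 * G chi eta (Z 0) (W 0) / (4 * Z 0 * W 0) \<noteq> 0"
        using ZW0 w0 G_1_nz[OF assms(3) w] param_regular(1)[OF r hol curve inj] by simp
      have "(\<lambda>t. Z t - 1) \<midarrow>0\<rightarrow> Z 0 - 1"
        using analytic_at_imp_isCont[OF an(1)] by (intro tendsto_intros) (simp add: isCont_def)
      moreover have "eventually (\<lambda>t. Z t - 1 \<noteq> 0) (at 0)" using ev by eventually_elim auto
      ultimately show "filterlim (\<lambda>t. Z t - 1) (at 0) (at 0)"
        by (intro filterlim_atI) (auto simp: ZW0)
    qed
    moreover have "eventually (\<lambda>t. (- deriv Z t * G chi eta (Z t) (W t) / (4 * Z t * W t)) / (Z t - 1) = dF chi eta Z W t) (at 0)"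
      using ev by eventually_elim (simp add: mult_ac)
    ultimately show ?thesis by (rule is_pole_transfer)
  qed
  ultimately show ?thesis by (rule not_critical_if_pole)
qed

text \<open>Over 0 the second coordinate is a local coordinate and \<open>z = w^2 / P1\<close>. One
  factor \<open>w\<close> remains in the denominator, and its numerator is nonzero at the point
  because \<open>Lc eta 0 = k (1 + eta)\<close>.\<close>

lemma dF_pole_0:
  assumes lp: "local_parametrization (cpoly P0) (Affine 0 w) Z W" and "eta \<noteq> 1" "eta \<noteq> -1"
  shows "zorder (dF chi eta Z W) 0 \<noteq> int j"
proof -
  obtain r where r: "r > 0" and hol: "Z holomorphic_on ball 0 r" "W holomorphic_on ball 0 r"
    and curve: "\<And>u. u \<in> ball 0 r \<Longrightarrow> (W u)\<^sup>2 = cP0 (Z u)" and inj: "inj_on (\<lambda>t. (Z t, W t)) (ball 0 r)"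
    and ZW0: "Z 0 = 0" "W 0 = w" and w: "w\<^sup>2 = cP0 0"
    using affine_param_elim[OF lp] by blast
  have an: "Z analytic_on {0}" "W analytic_on {0}" using analytic_ball[OF r] hol by auto
  have w0: "w = 0" using w by (simp add: cP0_eq)
  have pz: "poly (pderiv (cpoly P0)) 0 \<noteq> 0" by (rule pderiv_P0_nz) (simp add: cP0_eq)
  have p1z: "poly (cpoly P1) 0 \<noteq> 0" using P1_pos_nonneg[of 0] poly_cpoly_of_real[of P1 0] by (simp del: poly_cpoly_of_real)
  have ev: "eventually (\<lambda>t. t \<in> ball 0 r - {0} \<and> Z t \<noteq> 0 \<and> Z t \<noteq> 1 \<and> W t \<noteq> 0 \<and> G chi eta (Z t) (W t) \<noteq> 0 \<and>
      dF chi eta Z W t = - deriv Z t * G chi eta (Z t) (W t) / (4 * Z t * (Z t - 1) * W t)) (at 0)"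
    by (rule dF_ev) (use r hol curve inj assms in \<open>auto intro: inj_on_subset holomorphic_on_subset\<close>)
  have evp: "eventually (\<lambda>t. poly (pderiv (cpoly P0)) (Z t) \<noteq> 0) (at 0)"
    by (rule analytic_at_neq_imp_eventually_neq) (use pz ZW0 an in \<open>auto intro!: analytic_intros\<close>)
  have evp1: "eventually (\<lambda>t. poly (cpoly P1) (Z t) \<noteq> 0) (at 0)"
    by (rule analytic_at_neq_imp_eventually_neq) (use p1z ZW0 an in \<open>auto intro!: analytic_intros\<close>)
  have "isolated_singularity_at (dF chi eta Z W) 0"
    by (rule dF_isolated) (use r hol curve inj assms in \<open>auto intro: inj_on_subset holomorphic_on_subset\<close>)
  moreover have "is_pole (dF chi eta Z W) 0"
  proof -
    define f where "f t = - deriv W t * (Lc eta (Z t) * poly (cpoly P1) (Z t) + 2 * of_real chi * W t * cN (Z t))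
        / (2 * poly (pderiv (cpoly P0)) (Z t) * (Z t - 1))" for t
    have "is_pole (\<lambda>t. f t / W t) 0"
    proof (rule is_pole_divide)
      have "f analytic_on {0}"
        unfolding f_def Lc_def by (intro analytic_intros an analytic_deriv) (use ZW0 pz in auto)
      thus "isCont f 0" by (rule analytic_at_imp_isCont)
      have "Lc eta 0 \<noteq> 0" using k_pos assms(3) unfolding Lc_def
        by (simp add: add_eq_0_iff) (metis minus_minus of_real_1 of_real_eq_iff of_real_minus)
      thus "f 0 \<noteq> 0"
        using ZW0 w0 pz p1z param_regular(2)[OF r hol curve inj] by (simp add: f_def)
      have "W \<midarrow>0\<rightarrow> W 0"
        using analytic_at_imp_isCont[OF an(2)] by (simp add: isCont_def)
      moreover have "eventually (\<lambda>t. W t \<noteq> 0) (at 0)" using ev by eventually_elim auto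
      ultimately show "filterlim W (at 0) (at 0)"
        by (intro filterlim_atI) (auto simp: ZW0 w0)
    qed
    moreover have "eventually (\<lambda>t. f t / W t = dF chi eta Z W t) (at 0)"
      using ev evp evp1
    proof eventually_elim
      case (elim t)
      define y p where "y = poly (pderiv (cpoly P0)) (Z t)" and "p = poly (cpoly P1) (Z t)"
      have "2 * W t * deriv W t = y * deriv Z t"
        unfolding y_def using curve_deriv[OF open_ball _ hol curve, of t] elim by blast
      hence dZ: "deriv Z t = 2 * W t * deriv W t / y" using elim by (simp add: y_def)
      have "(W t)\<^sup>2 = Z t * p" using curve[of t] elim by (simp add: p_def cP0_eq)
      hence Zt: "Z t = (W t)\<^sup>2 / p" using elim by (simp add: p_def)
      obtain l nn v zz where *: "l = Lc eta (Z t)" "nn = cN (Z t)" "v = Z t - 1" "zz = Z t" by blast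
      have zz: "zz = (W t)\<^sup>2 / p" using Zt * by simp
      have "dF chi eta Z W t = - deriv Z t * (l * W t + 2 * of_real chi * zz * nn) / (4 * zz * v * W t)"
        using elim unfolding * G_def by simp
      also have "\<dots> = - deriv W t * (l * p + 2 * of_real chi * W t * nn) / (2 * y * v) / W t"
      proof -
        have "v \<noteq> 0" "p \<noteq> 0" "y \<noteq> 0" "W t \<noteq> 0" using elim * by (auto simp: p_def y_def)
        thus ?thesis unfolding dZ zz by (simp add: field_simps power2_eq_square)
      qed
      also have "\<dots> = f t / W t" unfolding f_def * p_def y_def by simp
      finally show ?case by simp
    qed
    ultimately show ?thesis by (rule is_pole_transfer)
  qed
  ultimately show ?thesis by (rule not_critical_if_pole)
qed

text \<open>\<open>Z' / Z\<close> has a pole. The remaining factor tends to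
  \<open>- k (1 - eta) / 4\<close>, because \<open>(N / w)^2 = N^2 / P0\<close> tends to 0 by
  degrees.\<close>

lemma dF_pole_infinity:
  assumes lp: "local_parametrization (cpoly P0) At_Infinity Z W" and "eta \<noteq> 1"
  shows "zorder (dF chi eta Z W) 0 \<noteq> int j"
proof -
  have Zinf: "filterlim Z at_infinity (at 0)" using lp by simp
  obtain r where r: "r > 0" and hol: "Z holomorphic_on (ball 0 r - {0})" "W holomorphic_on (ball 0 r - {0})"
    and curve: "\<And>u. u \<in> ball 0 r - {0} \<Longrightarrow> (W u)\<^sup>2 = cP0 (Z u)" and inj: "inj_on (\<lambda>t. (Z t, W t)) (ball 0 r - {0})"
    using lp by auto
  have ev: "eventually (\<lambda>t. t \<in> ball 0 r - {0} \<and> Z t \<noteq> 0 \<and> Z t \<noteq> 1 \<and> W t \<noteq> 0 \<and> G chi eta (Z t) (W t) \<noteq> 0 \<and>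
      dF chi eta Z W t = - deriv Z t * G chi eta (Z t) (W t) / (4 * Z t * (Z t - 1) * W t)) (at 0)"
    by (rule dF_ev) (use r hol curve inj assms in auto)
  have "isolated_singularity_at (dF chi eta Z W) 0"
    by (rule dF_isolated) (use r hol curve inj assms in auto)
  moreover have "is_pole (dF chi eta Z W) 0"
  proof -
    have poleZ: "is_pole Z 0" using Zinf by (simp add: is_pole_def)
    have isoZ: "isolated_singularity_at Z 0"
      using hol(1) r by (intro isolated_singularity_at_holomorphic[of Z "ball 0 r"]) auto
    have "is_pole (\<lambda>t. deriv Z t / Z t) 0" using is_pole_deriv_divide_is_pole[OF isoZ poleZ] .
    hence pl: "filterlim (\<lambda>t. deriv Z t / Z t) at_infinity (at 0)" by (simp add: is_pole_def)
    have i0: "((\<lambda>t. 1 / Z t) \<longlongrightarrow> 0) (at 0)"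
      using filterlim_compose[OF tendsto_inverse_0 Zinf] by (simp add: divide_inverse)
    have "((\<lambda>x. poly (cpoly N ^ 2) x / cP0 x) \<longlongrightarrow> 0) at_infinity"
    proof (rule poly_divide_tendsto_0_at_infinity)
      have "degree P0 = 2 * g + 1" using P1_pos_nonneg[of 0] by (simp add: P0_def) (metis degree_P1 degree_pCons_eq poly_0 less_irrefl mult.commute)
      thus "degree (cpoly P0) > degree (cpoly N ^ 2)"
        using degree_power_le[of "cpoly N" 2] by (simp add: mult.commute)
    qed
    hence "((\<lambda>t. poly (cpoly N ^ 2) (Z t) / cP0 (Z t)) \<longlongrightarrow> 0) (at 0)" using Zinf by (rule filterlim_compose)
    hence "((\<lambda>t. (cN (Z t) / W t)\<^sup>2) \<longlongrightarrow> 0) (at 0)"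
      by (rule Lim_transform_eventually)
         (use ev in \<open>eventually_elim, auto simp: poly_power power_divide curve\<close>)
    hence "((\<lambda>t. norm ((cN (Z t) / W t)\<^sup>2)) \<longlongrightarrow> 0) (at 0)" by (rule tendsto_norm_zero)
    hence "((\<lambda>t. sqrt (norm ((cN (Z t) / W t)\<^sup>2))) \<longlongrightarrow> sqrt 0) (at 0)" by (rule tendsto_real_sqrt)
    hence "((\<lambda>t. norm (cN (Z t) / W t)) \<longlongrightarrow> 0) (at 0)" by (simp add: norm_power)
    hence NW: "((\<lambda>t. cN (Z t) / W t) \<longlongrightarrow> 0) (at 0)" by (rule tendsto_norm_zero_cancel)
    define h where "h t = - (of_nat k * ((1 - of_real eta) + (1 + of_real eta) * (1 / Z t)) + 2 * of_real chi * (cN (Z t) / W t)) / (4 * (1 - 1 / Z t))" for t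
    have "(h \<longlongrightarrow> - (of_nat k * ((1 - of_real eta) + (1 + of_real eta) * 0) + 2 * of_real chi * 0) / (4 * (1 - 0))) (at 0)"
      unfolding h_def by (intro tendsto_intros i0 NW) auto
    moreover have "- (of_nat k * ((1 - of_real eta) + (1 + of_real eta) * 0) + 2 * of_real chi * 0) / (4 * (1 - 0)) \<noteq> (0::complex)"
      using k_pos assms(2) by simp
    ultimately have "filterlim (\<lambda>t. h t * (deriv Z t / Z t)) at_infinity (at 0)"
      using pl by (rule tendsto_mult_filterlim_at_infinity)
    hence "is_pole (\<lambda>t. h t * (deriv Z t / Z t)) 0" by (simp add: is_pole_def)
    moreover have "eventually (\<lambda>t. h t * (deriv Z t / Z t) = dF chi eta Z W t) (at 0)"
      using ev
    proof eventually_elim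
      case (elim t)
      have "h t = - (Lc eta (Z t) + 2 * of_real chi * Z t * cN (Z t) / W t) / (4 * (Z t - 1))"
      proof -
        have "Lc eta (Z t) + 2 * of_real chi * Z t * cN (Z t) / W t
          = Z t * (of_nat k * ((1 - of_real eta) + (1 + of_real eta) * (1 / Z t)) + 2 * of_real chi * (cN (Z t) / W t))"
          using elim by (simp add: Lc_def field_simps)
        moreover have "4 * (Z t - 1) = Z t * (4 * (1 - 1 / Z t))" using elim by (simp add: field_simps)
        ultimately show ?thesis using elim unfolding h_def by (metis mult_divide_mult_cancel_left mult_minus_right)
      qed
      moreover obtain X y where *: "X = Lc eta (Z t) + 2 * of_real chi * Z t * cN (Z t) / W t" "y = Z t - 1" by blast
      ultimately have h: "h t = - X / (4 * y)" by simp
      have G: "G chi eta (Z t) (W t) = W t * X" using elim by (simp add: G_def * field_simps)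
      have dFt: "dF chi eta Z W t = - deriv Z t * G chi eta (Z t) (W t) / (4 * Z t * y * W t)"
        using elim unfolding * by simp
      have "y \<noteq> 0" "W t \<noteq> 0" "Z t \<noteq> 0" using elim * by auto
      thus ?case unfolding dFt G h by (simp add: mult_ac)
    qed
    ultimately show ?thesis by (rule is_pole_transfer)
  qed
  ultimately show ?thesis by (rule not_critical_if_pole)
qed

section \<open>Critical points as zeros of \<open>G\<close>\<close>

abbreviation crit_order :: "real \<Rightarrow> real \<Rightarrow> surface_point \<Rightarrow> nat \<Rightarrow> bool" where
  "crit_order \<equiv> critical_point_of_order k \<rho> (cpoly P0)"

abbreviation crit :: "real \<Rightarrow> real \<Rightarrow> surface_point \<Rightarrow> bool" where
  "crit \<equiv> critical_point k \<rho> (cpoly P0)"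

lemma param_exists:
  assumes "w\<^sup>2 = cP0 z"
  obtains Z W where "local_parametrization (cpoly P0) (Affine z w) Z W"
proof (cases "w = 0")
  case True
  hence "cP0 z = 0" using assms by simp
  thus ?thesis using param_exists_branch[of z] that True by metis
qed (use that param_exists_regular[OF assms] in blast)

lemma crit_order_iff:
  assumes "\<bar>chi\<bar> < 1" "\<bar>eta\<bar> < 1"
  shows "crit_order chi eta (Affine z w) j \<longleftrightarrow>
     w\<^sup>2 = cP0 z \<and> z \<noteq> 0 \<and> j \<ge> 1 \<and>
     (\<exists>Z W. local_parametrization (cpoly P0) (Affine z w) Z W \<and> zorder (\<lambda>t. G chi eta (Z t) (W t)) 0 = int j)"
    (is "?lhs \<longleftrightarrow> ?rhs")
proof
  have e: "eta \<noteq> 1" "eta \<noteq> -1" using assms by auto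
  assume ?lhs
  then obtain Z W where ZW: "Affine z w \<in> spectral_surface (cpoly P0)" "j \<ge> 1"
    "local_parametrization (cpoly P0) (Affine z w) Z W" "zorder (dF chi eta Z W) 0 = int j"
    unfolding critical_point_of_order_def by blast
  have w: "w\<^sup>2 = cP0 z" using affine_param_elim[OF ZW(3)] by blast
  have z: "z \<noteq> 0" "z \<noteq> 1" using dF_pole_0 dF_pole_1 ZW e assms by blast+
  show ?rhs using w z(1) ZW dF_regular(2)[OF ZW(3) e(1) z] by metis
next
  have e: "eta \<noteq> 1" "eta \<noteq> -1" using assms by auto
  assume ?rhs
  then obtain Z W where ZW: "w\<^sup>2 = cP0 z" "z \<noteq> 0" "j \<ge> 1"
    "local_parametrization (cpoly P0) (Affine z w) Z W" "zorder (\<lambda>t. G chi eta (Z t) (W t)) 0 = int j" by blast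
  have "G chi eta z w = 0" using phi_order(4)[OF ZW(4) e(1), where chi = chi] ZW(3,5) by simp
  hence z1: "z \<noteq> 1" using G_1_nz assms ZW(1) by blast
  have "eventually (\<lambda>t. dF chi eta Z W t \<noteq> 0) (at 0)" by (rule dF_regular(1)[OF ZW(4) e(1) ZW(2) z1])
  hence "frequently (\<lambda>t. dF chi eta Z W t \<noteq> 0) (at 0)" by (intro eventually_frequently) auto
  moreover have "Affine z w \<in> spectral_surface (cpoly P0)" using ZW(1) by (auto simp: spectral_surface_def)
  moreover have "zorder (dF chi eta Z W) 0 = int j"
    using ZW(5) dF_regular(2)[OF ZW(4) e(1) ZW(2) z1, where chi = chi] by simp
  ultimately show ?lhs unfolding critical_point_of_order_def using ZW(3,4) by blast
qed

lemma not_crit_infinity: "\<bar>eta\<bar> < 1 \<Longrightarrow> \<not> crit_order chi eta At_Infinity j"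
  unfolding critical_point_of_order_def using dF_pole_infinity by (metis abs_one less_irrefl)

lemma crit_affine_iff:
  assumes "\<bar>chi\<bar> < 1" "\<bar>eta\<bar> < 1"
  shows "crit chi eta (Affine z w) \<longleftrightarrow> w\<^sup>2 = cP0 z \<and> z \<noteq> 0 \<and> G chi eta z w = 0"
proof -
  have e: "eta \<noteq> 1" using assms by auto
  show ?thesis
  proof
    assume "crit chi eta (Affine z w)"
    then obtain j where j: "crit_order chi eta (Affine z w) j" unfolding critical_point_def by blast
    then obtain Z W where "w\<^sup>2 = cP0 z" "z \<noteq> 0" "j \<ge> 1" and lp: "local_parametrization (cpoly P0) (Affine z w) Z W"
      and "zorder (\<lambda>t. G chi eta (Z t) (W t)) 0 = int j" unfolding crit_order_iff[OF assms] by blast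
    thus "w\<^sup>2 = cP0 z \<and> z \<noteq> 0 \<and> G chi eta z w = 0" using phi_order(4)[OF lp e, where chi = chi] by simp
  next
    assume *: "w\<^sup>2 = cP0 z \<and> z \<noteq> 0 \<and> G chi eta z w = 0"
    then obtain Z W where lp: "local_parametrization (cpoly P0) (Affine z w) Z W" using param_exists by blast
    have "zorder (\<lambda>t. G chi eta (Z t) (W t)) 0 \<ge> 1" using phi_order(4)[OF lp e] * by blast
    then obtain j where "zorder (\<lambda>t. G chi eta (Z t) (W t)) 0 = int j" "j \<ge> 1"
      by (intro that[of "nat (zorder (\<lambda>t. G chi eta (Z t) (W t)) 0)"]) auto
    thus "crit chi eta (Affine z w)" unfolding critical_point_def crit_order_iff[OF assms] using * lp by blast
  qed
qed

lemma crit_cases: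
  assumes "\<bar>chi\<bar> < 1" "\<bar>eta\<bar> < 1" "crit chi eta p"
  obtains z w where "p = Affine z w" "w\<^sup>2 = cP0 z" "z \<noteq> 0" "G chi eta z w = 0"
  using assms crit_affine_iff[OF assms(1,2)] not_crit_infinity[OF assms(2)] unfolding critical_point_def
  by (cases p) blast+

lemma crit_double_iff:
  assumes "\<bar>chi\<bar> < 1" "\<bar>eta\<bar> < 1"
  shows "(\<exists>j\<ge>2. crit_order chi eta (Affine z w) j) \<longleftrightarrow> w\<^sup>2 = cP0 z \<and> z \<noteq> 0 \<and> G chi eta z w = 0 \<and> E2 chi eta z w = 0"
proof -
  have e: "eta \<noteq> 1" using assms by auto
  show ?thesis
  proof
    assume "\<exists>j\<ge>2. crit_order chi eta (Affine z w) j"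
    then obtain j Z W where "w\<^sup>2 = cP0 z" "z \<noteq> 0" "j \<ge> 2" and lp: "local_parametrization (cpoly P0) (Affine z w) Z W"
      and "zorder (\<lambda>t. G chi eta (Z t) (W t)) 0 = int j" unfolding crit_order_iff[OF assms] by blast
    thus "w\<^sup>2 = cP0 z \<and> z \<noteq> 0 \<and> G chi eta z w = 0 \<and> E2 chi eta z w = 0" using phi_order(5)[OF lp e, where chi = chi] by simp
  next
    assume *: "w\<^sup>2 = cP0 z \<and> z \<noteq> 0 \<and> G chi eta z w = 0 \<and> E2 chi eta z w = 0"
    then obtain Z W where lp: "local_parametrization (cpoly P0) (Affine z w) Z W" using param_exists by blast
    have "zorder (\<lambda>t. G chi eta (Z t) (W t)) 0 \<ge> 2" using phi_order(5)[OF lp e] * by blast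
    then obtain j where "zorder (\<lambda>t. G chi eta (Z t) (W t)) 0 = int j" "j \<ge> 2"
      by (intro that[of "nat (zorder (\<lambda>t. G chi eta (Z t) (W t)) 0)"]) auto
    thus "\<exists>j\<ge>2. crit_order chi eta (Affine z w) j" unfolding crit_order_iff[OF assms] using * lp
      by (intro exI[of _ j]) auto
  qed
qed

text \<open>The order of \<open>G\<close> at a point that is not a branch point, where
  \<open>z\<close> itself serves as local coordinate.\<close>

definition zo :: "real \<Rightarrow> real \<Rightarrow> complex \<Rightarrow> complex \<Rightarrow> nat" where
  "zo chi eta z w = nat (zorder (\<lambda>t. G chi eta (z + t) (sbr w (z + t))) 0)"

lemma zo_props:
  assumes "eta \<noteq> 1" "w \<noteq> 0" "w\<^sup>2 = cP0 z"
  shows "int (zo chi eta z w) = zorder (\<lambda>t. G chi eta (z + t) (sbr w (z + t))) 0"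
    "zo chi eta z w \<ge> 1 \<longleftrightarrow> G chi eta z w = 0"
    "zo chi eta z w \<ge> 2 \<longleftrightarrow> G chi eta z w = 0 \<and> E2 chi eta z w = 0"
proof -
  note p = phi_order[OF param_exists_regular[OF assms(3,2)] assms(1), of chi]
  show "int (zo chi eta z w) = zorder (\<lambda>t. G chi eta (z + t) (sbr w (z + t))) 0"
    using p(3) by (simp add: zo_def)
  thus "zo chi eta z w \<ge> 1 \<longleftrightarrow> G chi eta z w = 0" "zo chi eta z w \<ge> 2 \<longleftrightarrow> G chi eta z w = 0 \<and> E2 chi eta z w = 0"
    using p(4,5) by linarith+
qed

text \<open>Take orders in \<open>z Q = - G(z, w) G(z, - w)\<close>. This translates multiplicities
  of zeros of \<open>Q\<close> into orders of critical points on the two sheets.\<close>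

lemma order_eq_zo:
  assumes "eta \<noteq> 1" "w \<noteq> 0" "w\<^sup>2 = cP0 z" "z \<noteq> 0"
  shows "order z (cpoly (Q chi eta)) = zo chi eta z w + zo chi eta z (- w)"
proof -
  have w': "- w \<noteq> 0" "(- w)\<^sup>2 = cP0 z" using assms by auto
  define f where "f = (\<lambda>w t. G chi eta (z + t) (sbr w (z + t)))"
  note p1 = phi_order[OF param_exists_regular[OF assms(3,2)] assms(1), of chi]
  note p2 = phi_order[OF param_exists_regular[OF w'(2,1)] assms(1), of chi]
  have Q0: "cpoly (Q chi eta) \<noteq> 0" using Q_nz[OF assms(1)] by simp
  have ev: "eventually (\<lambda>t. f w t * f (- w) t \<noteq> 0) (at 0)"
    using p1(2) p2(2) unfolding f_def by eventually_elim auto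
  have eq: "(z + t) * poly (cpoly (Q chi eta)) (z + t) = - (f w t * f (- w) t)" for t
    using cQ_factor_G[OF sbr_squared[OF assms(2), of "z + t"], of chi eta] by (simp add: f_def sbr_uminus)
  have "zorder (\<lambda>t. (z + t) * poly (cpoly (Q chi eta)) (z + t)) 0
      = zorder (\<lambda>t. z + t) 0 + zorder (\<lambda>t. poly (cpoly (Q chi eta)) (z + t)) 0"
    by (rule zorder_times_analytic) (use ev in \<open>auto intro!: analytic_intros simp: eq\<close>)
  also have "zorder (\<lambda>t. z + t) 0 = 0" by (rule zorder_eq_0I) (use assms in \<open>auto intro!: analytic_intros\<close>)
  also have "zorder (\<lambda>t. poly (cpoly (Q chi eta)) (z + t)) 0 = int (order z (cpoly (Q chi eta)))"
    by (rule zorder_poly_shift[OF Q0])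
  also have "zorder (\<lambda>t. (z + t) * poly (cpoly (Q chi eta)) (z + t)) 0 = zorder (\<lambda>t. f w t * f (- w) t) 0"
    by (simp add: eq)
  also have "\<dots> = zorder (f w) 0 + zorder (f (- w)) 0"
    by (rule zorder_times_analytic) (use p1(1) p2(1) ev in \<open>auto simp: f_def\<close>)
  finally show ?thesis
    using zo_props(1)[OF assms(1-3), of chi] zo_props(1)[OF assms(1) w', of chi] by (simp add: f_def)
qed

lemma crit_order_zo:
  assumes "\<bar>chi\<bar> < 1" "\<bar>eta\<bar> < 1" "w \<noteq> 0" "w\<^sup>2 = cP0 z" "z \<noteq> 0" "zo chi eta z w \<ge> 1"
  shows "crit_order chi eta (Affine z w) (zo chi eta z w)"
proof -
  have e: "eta \<noteq> 1" using assms by auto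
  show ?thesis
    unfolding crit_order_iff[OF assms(1,2)]
    using assms param_exists_regular[OF assms(4,3)] zo_props(1)[OF e assms(3,4), of chi, symmetric] by metis
qed

section \<open>The regions\<close>

abbreviation C0 :: "surface_point set" where
  "C0 \<equiv> {Affine z w | z w. w\<^sup>2 = cP0 z \<and> z \<in> of_real ` {0..}} \<union> {At_Infinity}"

abbreviation C :: "nat \<Rightarrow> surface_point set" where
  "C l \<equiv> {Affine z w | z w. w\<^sup>2 = cP0 z \<and> z \<in> of_real ` {a l..b l}}"

definition GF :: "(real \<times> real) set" where
  "GF = {(chi, eta) \<in> open_square. \<exists>S \<subseteq> C0. card S = 2 \<and> (\<forall>p\<in>S. crit chi eta p)}"

definition GR :: "(real \<times> real) set" where
  "GR = {(chi, eta) \<in> open_square. \<exists>p \<in> spectral_surface (cpoly P0) - (C0 \<union> (\<Union>l\<in>{1..g}. C l)). crit chi eta p}"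

definition GS :: "(real \<times> real) set" where
  "GS = {(chi, eta) \<in> open_square. \<exists>l\<in>{1..g}. \<exists>S \<subseteq> C l. card S = 4 \<and> (\<forall>p\<in>S. crit chi eta p)}"

definition EFR :: "(real \<times> real) set" where
  "EFR = {(chi, eta) \<in> open_square. \<exists>p \<in> C0. crit_order chi eta p 2} \<union> {(0, 1), (0, -1), (1, eta0), (-1, eta0)}"

definition ERS :: "(real \<times> real) set" where
  "ERS = {(chi, eta) \<in> open_square. \<exists>l\<in>{1..g}. \<exists>p \<in> C l. \<exists>j\<ge>2. crit_order chi eta p j}"

text \<open>The smooth region together with its boundary curves. A weak inequality between zero
  counts survives limits, which makes this set closed.\<close>

definition SS :: "(real \<times> real) set" where
  "SS = {(chi, eta) \<in> open_square. \<exists>l\<in>{1..g}. nK chi eta l \<ge> 4}"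

definition DD :: "(real \<times> real) set" where
  "DD = {p. m (fst p) (snd p) > 0}"

lemma open_square_iff: "(chi, eta) \<in> open_square \<longleftrightarrow> \<bar>chi\<bar> < 1 \<and> \<bar>eta\<bar> < 1"
  by (auto simp: open_square_def)

lemma square_root_cases:
  fixes w :: complex
  assumes "w\<^sup>2 = of_real y" "y \<ge> 0"
  shows "w = of_real (sqrt y) \<or> w = - of_real (sqrt y)"
proof -
  have "w\<^sup>2 = (of_real (sqrt y))\<^sup>2" using assms by (metis of_real_power real_sqrt_pow2)
  thus ?thesis by (simp add: power2_eq_iff)
qed

lemma Lc_of_real: "Lc eta (of_real y) = of_real (L eta y)"
  by (simp add: Lc_def L_def)

lemma G_of_real: "G chi eta (of_real y) (of_real v) = of_real (L eta y * v + 2 * chi * y * poly N y)"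
  by (simp add: G_def Lc_of_real)

lemma L_pos: "\<bar>eta\<bar> < 1 \<Longrightarrow> y \<ge> 0 \<Longrightarrow> L eta y > 0"
proof -
  assume "\<bar>eta\<bar> < 1" "y \<ge> 0"
  hence "(1 - eta) * y \<ge> 0" "1 + eta > 0" by auto
  thus ?thesis unfolding L_def using k_pos by simp
qed

lemma cQ_real_root: "poly (cpoly (Q chi eta)) (of_real y) = 0 \<longleftrightarrow> poly (Q chi eta) y = 0"
  by simp

lemma G_real_root:
  assumes "w\<^sup>2 = cP0 (of_real y)" "G chi eta (of_real y) w = 0" "y \<noteq> 0"
  shows "poly (Q chi eta) y = 0"
  using cQ_root_if_G[OF assms(1,2)] assms(3) by (simp only: cQ_real_root of_real_eq_0_iff) simp

lemma G_sum: "G chi eta z w + G chi eta z (- w) = 4 * of_real chi * z * cN z"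
  by (simp add: G_def)

lemma cN_of_real: "cN (of_real y) = of_real (poly N y)" by simp

lemma order_real_zo:
  assumes "eta \<noteq> 1" "w \<noteq> 0" "w\<^sup>2 = cP0 (of_real y)" "y \<noteq> 0"
  shows "order y (Q chi eta) = zo chi eta (of_real y) w + zo chi eta (of_real y) (- w)"
  using order_eq_zo[OF assms(1-3), of chi] assms(4) order_cpoly[OF Q_nz[OF assms(1)], of y chi] by simp

lemma C0_crit:
  assumes "\<bar>chi\<bar> < 1" "\<bar>eta\<bar> < 1" "p \<in> C0" "crit chi eta p"
  obtains y w where "p = Affine (of_real y) w" "y > 0" "w\<^sup>2 = cP0 (of_real y)" "w \<noteq> 0"
    "G chi eta (of_real y) w = 0" "poly (Q chi eta) y = 0" "chi \<noteq> 0"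
proof -
  obtain z w where zw: "p = Affine z w" "w\<^sup>2 = cP0 z" "z \<noteq> 0" "G chi eta z w = 0"
    using crit_cases[OF assms(1,2,4)] by blast
  then obtain y where y: "z = of_real y" "y \<ge> 0" using assms(3) by auto
  with zw have y0: "y > 0" by (cases "y = 0") auto
  have w0: "w \<noteq> 0" using zw(2) P0_pos[OF y0] y by auto
  have "chi \<noteq> 0"
  proof
    assume "chi = 0"
    hence "Lc eta z = 0" using zw(4) w0 by (simp add: G_def)
    thus False using L_pos[OF assms(2) y(2)] by (simp add: y Lc_of_real)
  qed
  thus ?thesis using that[of y w] zw y y0 w0 G_real_root[of w y chi eta] by auto
qed

lemma crit_of_real_root:
  assumes "\<bar>chi\<bar> < 1" "\<bar>eta\<bar> < 1" "poly (Q chi eta) y = 0" "y \<noteq> 0"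
  obtains w where "w\<^sup>2 = cP0 (of_real y)" "G chi eta (of_real y) w = 0" "crit chi eta (Affine (of_real y) w)"
proof -
  have "poly (cpoly (Q chi eta)) (of_real y) = 0" using assms(3) by simp
  then obtain w where "w\<^sup>2 = cP0 (of_real y)" "G chi eta (of_real y) w = 0" using G_root_of_cQ by blast
  thus ?thesis using that crit_affine_iff[OF assms(1,2)] assms(4) by (simp del: poly_cpoly_of_real)
qed

text \<open>The values of \<open>G\<close> on the two sheets add up to \<open>4 chi z N\<close>,
  which has no zero on the positive axis. Hence at most one of the two points over \<open>y\<close>
  is critical.\<close>

lemma G_other_nz:
  assumes "y > 0" "chi \<noteq> 0" "G chi eta (of_real y) w = 0"
  shows "G chi eta (of_real y) (- w) \<noteq> 0"
proof
  assume "G chi eta (of_real y) (- w) = 0"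
  hence "4 * of_real chi * of_real y * cN (of_real y) = 0" using G_sum[of chi eta "of_real y" w] assms(3) by simp
  thus False using assms N_nz_nonneg[of y] by simp
qed

text \<open>Two critical points on the oval lie over different \<open>y\<close>, so by
  \<open>count_n0_le\<close> both zeros of \<open>Q\<close> are simple; for \<open>m >= 0\<close>
  they would be minima and hence double. Conversely, a negative value of \<open>Q\<close> forces a
  zero on either side of it.\<close>

theorem GF_eq: "GF = open_square \<inter> {p. m (fst p) (snd p) < 0}"
proof (rule set_eqI, safe)
  fix chi eta assume "(chi, eta) \<in> GF"
  then obtain S where sq: "(chi, eta) \<in> open_square" and S: "S \<subseteq> C0" "card S = 2" "\<forall>p\<in>S. crit chi eta p"
    unfolding GF_def by auto
  show "(chi, eta) \<in> open_square" by fact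
  have ce: "\<bar>chi\<bar> < 1" "\<bar>eta\<bar> < 1" using sq open_square_iff by auto
  hence e: "eta \<noteq> 1" by auto
  obtain p1 p2 where p: "S = {p1, p2}" "p1 \<noteq> p2" using S(2) by (auto simp: card_2_iff)
  have mem: "p1 \<in> S" "p2 \<in> S" by (simp_all add: p(1))
  obtain y1 w1 where 1: "p1 = Affine (of_real y1) w1" "y1 > 0" "w1\<^sup>2 = cP0 (of_real y1)" "w1 \<noteq> 0"
    "G chi eta (of_real y1) w1 = 0" "poly (Q chi eta) y1 = 0" "chi \<noteq> 0"
    by (rule C0_crit[OF ce subsetD[OF S(1) mem(1)] bspec[OF S(3) mem(1)]])
  obtain y2 w2 where 2: "p2 = Affine (of_real y2) w2" "y2 > 0" "w2\<^sup>2 = cP0 (of_real y2)" "w2 \<noteq> 0"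
    "G chi eta (of_real y2) w2 = 0" "poly (Q chi eta) y2 = 0"
    by (rule C0_crit[OF ce subsetD[OF S(1) mem(2)] bspec[OF S(3) mem(2)]])
  have y12: "y1 \<noteq> y2"
  proof
    assume eq: "y1 = y2"
    hence "w2 = - w1" using 1(1,3) 2(1,3) p(2) by (metis power2_eq_iff)
    thus False using G_other_nz[OF 1(2,7,5)] 2(5) eq by simp
  qed
  have n2: "n0 chi eta \<le> 2" by (rule count_n0_le[OF 1(7) ce(2)])
  have ord: "order y1 (Q chi eta) \<noteq> 0" "order y2 (Q chi eta) \<noteq> 0"
    using 1 2 Q_nz[OF e, of chi] by (auto simp: order_root)
  have "order y1 (Q chi eta) + order y2 (Q chi eta) \<le> 2"
    using roots_in_ge_order2[OF Q_nz[OF e], of y1 "{0<..}" y2 chi] 1 2 y12 n2 by (simp add: n0_def)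
  hence o1: "order y1 (Q chi eta) < 2" using ord by linarith
  show "m (fst (chi, eta)) (snd (chi, eta)) < 0"
  proof (rule ccontr)
    assume "\<not> ?thesis"
    hence "\<forall>z>0. poly (Q chi eta) z \<ge> 0" using m_nonneg_iff[of chi eta] ce by simp
    hence "order y1 (Q chi eta) \<ge> 2"
      by (intro double_root_at_min(1)[OF Q_nz[OF e] 1(6) 1(2)]) (auto simp: abs_less_iff)
    thus False using o1 by simp
  qed
next
  fix chi eta assume sq: "(chi, eta) \<in> open_square" and m: "m (fst (chi, eta)) (snd (chi, eta)) < 0"
  have ce: "\<bar>chi\<bar> < 1" "\<bar>eta\<bar> < 1" using sq open_square_iff by auto
  hence e: "eta \<noteq> 1" "eta \<noteq> -1" by auto
  obtain z where z: "z > 0" "poly (Q chi eta) z < 0" using m m_neg_iff[of chi eta] ce by auto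
  obtain B where B: "B > 0" "\<And>z. z \<ge> B \<Longrightarrow> poly (Q chi eta) z > 0" using Q_pos_large[OF e(1)] by blast
  obtain y1 where y1: "0 < y1" "y1 < z" "poly (Q chi eta) y1 = 0"
    using poly_IVT_neg[of 0 z "Q chi eta"] z Q_0_pos[OF e(2), of chi] by auto
  obtain y2 where y2: "z < y2" "poly (Q chi eta) y2 = 0"
  proof -
    have "z < max B (z + 1)" by (simp add: less_max_iff_disj)
    thus ?thesis using that poly_IVT_pos[of z "max B (z + 1)" "Q chi eta"] z B(2)[of "max B (z + 1)"] by auto
  qed
  obtain w1 where w1: "w1\<^sup>2 = cP0 (of_real y1)" "crit chi eta (Affine (of_real y1) w1)"
    using crit_of_real_root[OF ce y1(3)] y1 by auto
  obtain w2 where w2: "w2\<^sup>2 = cP0 (of_real y2)" "crit chi eta (Affine (of_real y2) w2)"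
    using crit_of_real_root[OF ce y2(2)] y2 z by auto
  let ?S = "{Affine (of_real y1) w1, Affine (of_real y2) w2}"
  have "?S \<subseteq> C0" using w1(1) w2(1) y1 y2 z by (auto simp del: poly_cpoly_of_real)
  moreover have "card ?S = 2" using y1 y2 by (auto simp: card_2_iff)
  ultimately show "(chi, eta) \<in> GF" unfolding GF_def using sq w1(2) w2(2) by blast
qed

text \<open>Inside the square \<open>m = 0\<close> means that \<open>Q\<close> touches zero on the
  positive axis without changing sign. Such a zero has order exactly 2, since at most two zeros are
  available, and the whole order belongs to one sheet. On the boundary of the square
  \<open>m_zero_iff\<close> supplies the four conventional points.\<close>

theorem EFR_eq: "EFR = {p. m (fst p) (snd p) = 0}"
proof -
  have key: "(\<exists>p\<in>C0. crit_order chi eta p 2) \<longleftrightarrow> m chi eta = 0" if ce: "\<bar>chi\<bar> < 1" "\<bar>eta\<bar> < 1" for chi eta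
  proof
    have e: "eta \<noteq> 1" using ce by auto
    assume "\<exists>p\<in>C0. crit_order chi eta p 2"
    then obtain p where p: "p \<in> C0" "crit_order chi eta p 2" by blast
    hence "crit chi eta p" unfolding critical_point_def by blast
    then obtain y w where y: "p = Affine (of_real y) w" "y > 0" "w\<^sup>2 = cP0 (of_real y)" "w \<noteq> 0"
      "G chi eta (of_real y) w = 0" "poly (Q chi eta) y = 0" "chi \<noteq> 0"
      using C0_crit[OF ce p(1)] by blast
    have "G chi eta (of_real y) w = 0 \<and> E2 chi eta (of_real y) w = 0"
      using crit_double_iff[OF ce, of "of_real y" w] p(2) y(1) by blast
    hence "zo chi eta (of_real y) w \<ge> 2" using zo_props(3)[OF e y(4,3)] by blast
    hence o2: "order y (Q chi eta) \<ge> 2" using order_real_zo[OF e y(4,3), of chi] y(2) by simp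
    have "m chi eta \<ge> 0" using m_nonneg_of_double_root[OF y(7) _ ce(2) y(2) o2] ce by simp
    moreover have "n0 chi eta \<noteq> 0" using roots_in_pos_iff[OF Q_nz[OF e], of "{0<..}" chi] y(2,6) by (auto simp: n0_def)
    hence "\<not> m chi eta > 0" using m_pos_iff_n0[OF ce] by simp
    ultimately show "m chi eta = 0" by simp
  next
    have e: "eta \<noteq> 1" using ce by auto
    assume m0: "m chi eta = 0"
    hence chi: "chi \<noteq> 0" using m_chi_0[OF ce(2)] by auto
    have nn: "\<forall>z>0. poly (Q chi eta) z \<ge> 0" using m_nonneg_iff[of chi eta] ce m0 by simp
    obtain y where y: "y > 0" "poly (Q chi eta) y = 0" using m_pos_iff[OF ce] m0 nn by (metis less_irrefl less_le)
    have o2: "order y (Q chi eta) \<ge> 2"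
      by (rule double_root_at_min(1)[OF Q_nz[OF e] y(2,1)]) (use nn in \<open>auto simp: abs_less_iff\<close>)
    moreover have "order y (Q chi eta) \<le> 2"
      using roots_in_ge_order[OF Q_nz[OF e], of y "{0<..}" chi] y(1) count_n0_le[OF chi ce(2)] by (simp add: n0_def)
    ultimately have o: "order y (Q chi eta) = 2" by simp
    obtain w where w: "w\<^sup>2 = cP0 (of_real y)" "G chi eta (of_real y) w = 0"
      using crit_of_real_root[OF ce y(2)] y(1) by auto
    have w0: "w \<noteq> 0" using w(1) P0_pos[OF y(1)] by auto
    have "G chi eta (of_real y) (- w) \<noteq> 0" using G_other_nz[OF y(1) chi w(2)] .
    hence "zo chi eta (of_real y) (- w) = 0" using zo_props(2)[of eta "- w" "of_real y" chi] e w0 w(1) by (simp del: poly_cpoly_of_real)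
    hence "zo chi eta (of_real y) w = 2" using o order_real_zo[OF e w0 w(1), of chi] y(1) by simp
    hence "crit_order chi eta (Affine (of_real y) w) 2"
      using crit_order_zo[OF ce w0 w(1)] y(1) by auto
    moreover have "Affine (of_real y) w \<in> C0" using w(1) y(1) by (auto simp del: poly_cpoly_of_real)
    ultimately show "\<exists>p\<in>C0. crit_order chi eta p 2" by blast
  qed
  have "(chi, eta) \<in> EFR \<longleftrightarrow> m chi eta = 0" for chi eta
  proof -
    have "(chi, eta) \<in> EFR \<longleftrightarrow> (\<bar>chi\<bar> < 1 \<and> \<bar>eta\<bar> < 1 \<and> (\<exists>p\<in>C0. crit_order chi eta p 2)) \<or>
        (chi, eta) \<in> {(0, 1), (0, -1), (1, eta0), (-1, eta0)}"
      unfolding EFR_def using open_square_iff[of chi eta] by blast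
    thus ?thesis using key[of chi eta] m_zero_iff[of chi eta] by blast
  qed
  thus ?thesis by auto
qed

text \<open>The zero of \<open>L\<close>, which carries the critical points that are not branch points when \<open>chi = 0\<close>.\<close>

definition zeta :: "real \<Rightarrow> real" where "zeta eta = - (1 + eta) / (1 - eta)"

lemma L_zeta: "eta \<noteq> 1 \<Longrightarrow> L eta y = real k * (1 - eta) * (y - zeta eta)"
  by (simp add: L_def zeta_def field_simps)

lemma Lc_zeta: "eta \<noteq> 1 \<Longrightarrow> Lc eta z = of_nat k * (1 - of_real eta) * (z - of_real (zeta eta))"
proof -
  assume "eta \<noteq> 1"
  hence "1 - of_real eta \<noteq> (0::complex)" by (metis eq_iff_diff_eq_0 of_real_1 of_real_eq_iff)
  thus ?thesis by (simp add: Lc_def zeta_def field_simps)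
qed

lemma zeta_neg: "\<bar>eta\<bar> < 1 \<Longrightarrow> zeta eta < 0"
  by (simp add: zeta_def divide_less_0_iff abs_less_iff)

section \<open>The rough region, including the line \<open>chi = 0\<close>\<close>

lemma P1_nz: "P1 \<noteq> 0" using P1_pos_nonneg[of 0] by auto

lemma proots_P1: "proots P1 = (\<Sum>l\<in>{1..g}. {#a l, b l#})"
proof -
  have "proots P1 = (\<Sum>l\<in>{1..g}. proots ([:- a l, 1:] * [:- b l, 1:]))"
    unfolding P1_def using c_pos by (subst proots_smult) (auto simp: proots_prod simp del: mult_pCons_left)
  also have "\<dots> = (\<Sum>l\<in>{1..g}. {#a l, b l#})"
    by (intro sum.cong refl, subst proots_mult) auto
  finally show ?thesis .
qed

lemma roots_in_P1:
  assumes "l \<in> {1..g}"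
  shows "roots_in {a l..b l} P1 = 2"
proof -
  define F where "F M = size (filter_mset (\<lambda>r. r \<in> {a l..b l}) M)" for M
  have add: "F (M + M') = F M + F M'" "F {#} = 0" for M M' by (simp_all add: F_def)
  have sumF: "F (sum h A) = (\<Sum>j\<in>A. F (h j))" for h :: "nat \<Rightarrow> real multiset" and A
    by (induction A rule: infinite_finite_induct) (auto simp: add)
  have "roots_in {a l..b l} P1 = (\<Sum>j\<in>{1..g}. F {#a j, b j#})"
    unfolding roots_in_def proots_P1 F_def[symmetric] sumF ..
  also have "\<dots> = (\<Sum>j\<in>{1..g}. if j = l then 2 else 0)"
  proof (intro sum.cong refl)
    fix j assume j: "j \<in> {1..g}"
    show "F {#a j, b j#} = (if j = l then 2 else 0)"
    proof (cases "j = l")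
      case True
      thus ?thesis using ab[OF assms] by (simp add: F_def)
    next
      case False
      hence "a j \<notin> {a l..b l}" "b j \<notin> {a l..b l}"
        using disj[OF j assms] ab[OF j] by auto
      thus ?thesis using False by (simp add: F_def)
    qed
  qed
  finally show ?thesis using assms by simp
qed

text \<open>At \<open>chi = 0\<close> the polynomial \<open>Q\<close> is a constant times
  \<open>(z - zeta)^2 P1\<close>: the two ends of every interval and a double zero at
  \<open>zeta eta\<close>.\<close>

lemma nK_chi_0:
  assumes "l \<in> {1..g}" "eta \<noteq> 1"
  shows "nK 0 eta l = 2 + (if zeta eta \<in> {a l..b l} then 2 else 0)"
proof -
  have "Q 0 eta = smult ((real k * (1 - eta))\<^sup>2) ([:- zeta eta, 1:] * ([:- zeta eta, 1:] * P1))"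
    unfolding poly_eq_poly_eq_iff[symmetric]
    by (rule ext) (simp add: poly_Q L_zeta[OF assms(2)] power2_eq_square algebra_simps)
  moreover have "(real k * (1 - eta))\<^sup>2 \<noteq> 0" using k_pos assms(2) by simp
  ultimately have "nK 0 eta l = roots_in {a l..b l} ([:- zeta eta, 1:] * ([:- zeta eta, 1:] * P1))"
    unfolding nK_def roots_in_def by (metis proots_smult)
  moreover have "[:- zeta eta, 1:] * P1 \<noteq> 0" using P1_nz by (simp del: mult_pCons_left)
  ultimately show ?thesis
    using roots_in_mult_linear[OF P1_nz, of "{a l..b l}" "zeta eta"] roots_in_P1[OF assms(1)]
      roots_in_mult_linear[of "[:- zeta eta, 1:] * P1" "{a l..b l}" "zeta eta"]
    by (simp del: mult_pCons_left)
qed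

lemma nK_top: "l \<in> {1..g} \<Longrightarrow> nK 0 1 l = 2"
proof -
  assume l: "l \<in> {1..g}"
  have "Q 0 1 = smult ((2 * real k)\<^sup>2) P1"
    unfolding poly_eq_poly_eq_iff[symmetric]
    by (rule ext) (simp add: poly_Q L_def power2_eq_square algebra_simps)
  moreover have "(2 * real k)\<^sup>2 \<noteq> 0" using k_pos by simp
  ultimately show ?thesis using roots_in_P1[OF l]
    unfolding nK_def roots_in_def by (metis proots_smult)
qed

lemma cP0_zero_cases:
  assumes "cP0 z = 0"
  shows "z = 0 \<or> (\<exists>l\<in>{1..g}. z = of_real (a l) \<or> z = of_real (b l))"
proof -
  have "cP0 z = of_real c * z * (\<Prod>l\<in>{1..g}. (z - of_real (a l)) * (z - of_real (b l)))"
    by (simp add: P0_def P1_def poly_prod algebra_simps)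
  thus ?thesis using assms c_pos by auto
qed

lemma real_point_on_cycle:
  assumes "(0::real) \<le> y \<or> (\<exists>l\<in>{1..g}. y \<in> {a l..b l})" "w\<^sup>2 = cP0 (of_real y)"
  shows "Affine (of_real y) w \<in> C0 \<union> (\<Union>l\<in>{1..g}. C l)"
proof (cases "y \<ge> 0")
  case True
  hence "Affine (of_real y) w \<in> C0" using assms(2) by (auto simp del: poly_cpoly_of_real)
  thus ?thesis by blast
next
  case False
  then obtain l where l: "l \<in> {1..g}" "y \<in> {a l..b l}" using assms(1) by blast
  hence "Affine (of_real y) w \<in> C l" using assms(2) by (auto simp del: poly_cpoly_of_real)
  thus ?thesis using l(1) by blast
qed

lemma point_on_cycle_real:
  assumes "Affine z w \<in> C0 \<union> (\<Union>l\<in>{1..g}. C l)"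
  obtains y where "z = of_real y" "(0::real) \<le> y \<or> (\<exists>l\<in>{1..g}. y \<in> {a l..b l})"
proof -
  from assms consider "Affine z w \<in> C0" | l where "l \<in> {1..g}" "Affine z w \<in> C l" by blast
  thus ?thesis
  proof cases
    case 1
    then obtain y where "z = of_real y" "(0::real) \<le> y" by auto
    thus ?thesis using that by blast
  next
    case 2
    then obtain y where "z = of_real y" "y \<in> {a l..b l}" by blast
    thus ?thesis using that 2 by blast
  qed
qed

text \<open>For \<open>chi\<close> nonzero, all real zeros of \<open>Q\<close> lie under the cycles,
  so a critical point off the cycles is a nonreal zero. For \<open>chi = 0\<close> it can only lie
  over the real number \<open>zeta eta\<close>, in a gap where \<open>P0 < 0\<close> and
  \<open>w\<close> is imaginary.\<close>

theorem GR_eq: "GR = DD - SS"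
proof -
  have "(\<exists>p \<in> spectral_surface (cpoly P0) - (C0 \<union> (\<Union>l\<in>{1..g}. C l)). crit chi eta p)
     \<longleftrightarrow> m chi eta > 0 \<and> \<not> (\<exists>l\<in>{1..g}. nK chi eta l \<ge> 4)" (is "?lhs \<longleftrightarrow> ?rhs")
    if ce: "\<bar>chi\<bar> < 1" "\<bar>eta\<bar> < 1" for chi eta
  proof (cases "chi = 0")
    case False
    have e: "eta \<noteq> 1" "eta \<noteq> -1" using ce by auto
    have "?lhs \<longleftrightarrow> (\<exists>z. z \<notin> \<real> \<and> poly (cpoly (Q chi eta)) z = 0)"
    proof
      assume ?lhs
      then obtain p where p: "p \<notin> C0 \<union> (\<Union>l\<in>{1..g}. C l)" "crit chi eta p" by blast
      obtain z w where zw: "p = Affine z w" "w\<^sup>2 = cP0 z" "z \<noteq> 0" "G chi eta z w = 0"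
        using crit_cases[OF ce p(2)] by blast
      have Q: "poly (cpoly (Q chi eta)) z = 0" using cQ_root_if_G zw by blast
      have "z \<notin> \<real>"
      proof
        assume "z \<in> \<real>"
        then obtain y where y: "z = of_real y" by (auto elim: Reals_cases)
        hence "poly (Q chi eta) y = 0" using Q by simp
        hence "y > 0 \<or> (\<exists>l\<in>{1..g}. a l < y \<and> y < b l)" by (rule Q_root_location[OF False e(2)])
        hence "0 \<le> y \<or> (\<exists>l\<in>{1..g}. y \<in> {a l..b l})" by force
        thus False using real_point_on_cycle[of y w] p(1) zw(1,2) y by simp
      qed
      thus "\<exists>z. z \<notin> \<real> \<and> poly (cpoly (Q chi eta)) z = 0" using Q by blast
    next
      assume "\<exists>z. z \<notin> \<real> \<and> poly (cpoly (Q chi eta)) z = 0"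
      then obtain z where z: "z \<notin> \<real>" "poly (cpoly (Q chi eta)) z = 0" by blast
      then obtain w where w: "w\<^sup>2 = cP0 z" "G chi eta z w = 0" using G_root_of_cQ by blast
      have "z \<noteq> 0" using z(1) by auto
      hence "crit chi eta (Affine z w)" using crit_affine_iff[OF ce] w by blast
      moreover have "Affine z w \<notin> C0 \<union> (\<Union>l\<in>{1..g}. C l)" using z(1) point_on_cycle_real[of z w] by (metis Reals_of_real)
      moreover have "Affine z w \<in> spectral_surface (cpoly P0)" using w by (auto simp: spectral_surface_def)
      ultimately show ?lhs by blast
    qed
    also have "\<dots> \<longleftrightarrow> n0 chi eta = 0 \<and> (\<forall>l\<in>{1..g}. nK chi eta l \<le> 2)" by (rule count_nonreal[OF False ce(2)])
    also have "\<dots> \<longleftrightarrow> ?rhs" using m_pos_iff_n0[OF ce] count_nK_big(1)[OF False ce(2)] by fastforce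
    finally show ?thesis .
  next
    case True
    have e: "eta \<noteq> 1" "eta \<noteq> -1" using ce by auto
    have L: "G chi eta z w = 0 \<longleftrightarrow> z = of_real (zeta eta) \<or> w = 0" for z w
    proof -
      have "1 - of_real eta \<noteq> (0::complex)" using e(1) by (metis eq_iff_diff_eq_0 of_real_1 of_real_eq_iff)
      thus ?thesis using k_pos by (simp add: G_def True Lc_zeta[OF e(1)])
    qed
    have "?lhs \<longleftrightarrow> \<not> (\<exists>l\<in>{1..g}. zeta eta \<in> {a l..b l})"
    proof
      assume ?lhs
      then obtain p where p: "p \<notin> C0 \<union> (\<Union>l\<in>{1..g}. C l)" "crit chi eta p" by blast
      obtain z w where zw: "p = Affine z w" "w\<^sup>2 = cP0 z" "z \<noteq> 0" "G chi eta z w = 0"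
        using crit_cases[OF ce p(2)] by blast
      have "w \<noteq> 0"
      proof
        assume "w = 0"
        hence "cP0 z = 0" using zw(2) by simp
        then obtain y where "z = of_real y" "(0::real) \<le> y \<or> (\<exists>l\<in>{1..g}. y \<in> {a l..b l})"
          using cP0_zero_cases[of z] ab by (metis atLeastAtMost_iff less_imp_le of_real_0 order_refl)
        thus False using real_point_on_cycle[of y w] p(1) zw(1,2) by simp
      qed
      hence "z = of_real (zeta eta)" using zw(4) L by blast
      thus "\<not> (\<exists>l\<in>{1..g}. zeta eta \<in> {a l..b l})" using real_point_on_cycle[of "zeta eta" w] p(1) zw(1,2) by blast
    next
      assume *: "\<not> (\<exists>l\<in>{1..g}. zeta eta \<in> {a l..b l})"
      define w where "w = csqrt (cP0 (of_real (zeta eta)))"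
      have w2: "w\<^sup>2 = cP0 (of_real (zeta eta))" unfolding w_def by (rule power2_csqrt)
      have zn: "zeta eta < 0" by (rule zeta_neg[OF ce(2)])
      have "crit chi eta (Affine (of_real (zeta eta)) w)"
        using crit_affine_iff[OF ce] w2 L zn by (metis less_irrefl of_real_eq_0_iff)
      moreover have "Affine (of_real (zeta eta)) w \<notin> C0 \<union> (\<Union>l\<in>{1..g}. C l)"
        using * zn point_on_cycle_real[of "of_real (zeta eta)" w] by (metis not_le of_real_eq_iff)
      moreover have "Affine (of_real (zeta eta)) w \<in> spectral_surface (cpoly P0)" using w2 unfolding spectral_surface_def by blast
      ultimately show ?lhs by blast
    qed
    also have "\<dots> \<longleftrightarrow> ?rhs"
    proof -
      have "(4 \<le> nK chi eta l) = (zeta eta \<in> {a l..b l})" if "l \<in> {1..g}" for l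
        using nK_chi_0[OF that e(1)] True by (simp split: if_splits)
      thus ?thesis using m_chi_0[OF ce(2)] True by auto
    qed
    finally show ?thesis .
  qed
  hence "(chi, eta) \<in> GR \<longleftrightarrow> (chi, eta) \<in> DD - SS" for chi eta
    unfolding GR_def DD_def SS_def using open_square_iff[of chi eta] m_pos_square[of chi eta] by auto
  thus ?thesis by auto
qed

section \<open>Critical points on a compact cycle\<close>

lemma C_crit:
  assumes "\<bar>chi\<bar> < 1" "\<bar>eta\<bar> < 1" "chi \<noteq> 0" "l \<in> {1..g}" "p \<in> C l" "crit chi eta p"
  obtains y w where "p = Affine (of_real y) w" "a l < y" "y < b l" "w\<^sup>2 = cP0 (of_real y)" "w \<noteq> 0"
    "G chi eta (of_real y) w = 0" "poly (Q chi eta) y = 0"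
proof -
  obtain z w where zw: "p = Affine z w" "w\<^sup>2 = cP0 z" "z \<noteq> 0" "G chi eta z w = 0"
    using crit_cases[OF assms(1,2,6)] by blast
  then obtain y where y: "z = of_real y" "y \<in> {a l..b l}" using assms(5) by blast
  have y0: "y \<noteq> 0" using zw(3) y(1) by auto
  have "y \<noteq> a l \<and> y \<noteq> b l"
  proof (rule ccontr)
    assume "\<not> ?thesis"
    hence *: "y = a l \<or> y = b l" by blast
    hence "cP0 z = 0" using assms(4) y(1) by auto
    hence "w = 0" using zw(2) by simp
    hence "poly N y = 0" using zw(4) assms(3) y0 by (simp add: G_def y(1))
    thus False using * N_nz_end[OF assms(4)] by auto
  qed
  hence I: "a l < y" "y < b l" using y(2) by auto
  have "w \<noteq> 0" using zw(2) P0_pos_cycle[OF assms(4) I] y(1) by auto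
  thus ?thesis using that[of y w] zw y I G_real_root[of w y chi eta] y0 by auto
qed

definition W :: "real \<Rightarrow> real \<Rightarrow> real \<Rightarrow> complex set" where
  "W chi eta y = {w. w\<^sup>2 = cP0 (of_real y) \<and> G chi eta (of_real y) w = 0}"

definition T :: "real \<Rightarrow> real \<Rightarrow> nat \<Rightarrow> surface_point set" where
  "T chi eta l = {p \<in> C l. crit chi eta p}"

text \<open>The order of \<open>Q\<close> at \<open>y\<close> is the sum of the orders on the two
  sheets, whereas \<open>W\<close> counts each sheet with positive order once. The two agree exactly
  when no order exceeds 1, which is what \<open>E2\<close> detects.\<close>

lemma card_W:
  assumes "eta \<noteq> 1" "l \<in> {1..g}" "a l < y" "y < b l"
  shows "finite (W chi eta y)" "card (W chi eta y) \<le> order y (Q chi eta)"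
    "w \<in> W chi eta y \<Longrightarrow> E2 chi eta (of_real y) w = 0 \<Longrightarrow> card (W chi eta y) < order y (Q chi eta)"
    "(\<And>w. w \<in> W chi eta y \<Longrightarrow> E2 chi eta (of_real y) w \<noteq> 0) \<Longrightarrow> card (W chi eta y) = order y (Q chi eta)"
proof -
  define v where "v = complex_of_real (sqrt (poly P0 y))"
  have pos: "poly P0 y > 0" by (rule P0_pos_cycle[OF assms(2-4)])
  have y0: "y \<noteq> 0" using assms b_neg[OF assms(2)] by auto
  have v: "v \<noteq> 0" "v\<^sup>2 = cP0 (of_real y)" "- v \<noteq> 0" "(- v)\<^sup>2 = cP0 (of_real y)" "v \<noteq> - v"
    using pos by (auto simp: v_def simp flip: of_real_power)
  have sub: "W chi eta y \<subseteq> {v, - v}"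
  proof
    fix w assume "w \<in> W chi eta y"
    hence "w\<^sup>2 = v\<^sup>2" unfolding v(2) W_def by blast
    thus "w \<in> {v, - v}" by (simp only: power2_eq_iff) simp
  qed
  show "finite (W chi eta y)" by (rule finite_subset[OF sub]) simp
  have iW: "v \<in> W chi eta y \<longleftrightarrow> G chi eta (of_real y) v = 0" "- v \<in> W chi eta y \<longleftrightarrow> G chi eta (of_real y) (- v) = 0"
    using v by (auto simp: W_def)
  have o: "order y (Q chi eta) = zo chi eta (of_real y) v + zo chi eta (of_real y) (- v)"
    by (rule order_real_zo[OF assms(1) v(1,2) y0])
  note z1 = zo_props(2,3)[OF assms(1) v(1,2), of chi] and z2 = zo_props(2,3)[OF assms(1) v(3,4), of chi]
  have cW: "card (W chi eta y) = (if v \<in> W chi eta y then 1 else 0) + (if - v \<in> W chi eta y then 1 else 0)"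
  proof -
    have "W chi eta y = (if v \<in> W chi eta y then {v} else {}) \<union> (if - v \<in> W chi eta y then {- v} else {})"
      using sub by auto
    hence "card (W chi eta y) = card ((if v \<in> W chi eta y then {v} else {}) \<union> (if - v \<in> W chi eta y then {- v} else {}))"
      by simp
    also have "\<dots> = (if v \<in> W chi eta y then 1 else 0) + (if - v \<in> W chi eta y then 1 else 0)"
      using v(5) by auto
    finally show ?thesis .
  qed
  show "card (W chi eta y) \<le> order y (Q chi eta)"
    unfolding cW o iW z1(1)[symmetric] z2(1)[symmetric] by auto
  show "card (W chi eta y) < order y (Q chi eta)" if w: "w \<in> W chi eta y" "E2 chi eta (of_real y) w = 0"
  proof -
    have "w = v \<or> w = - v" using w(1) sub by auto
    hence "zo chi eta (of_real y) v \<ge> 2 \<or> zo chi eta (of_real y) (- v) \<ge> 2"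
      using w z1(2) z2(2) iW by auto
    thus ?thesis unfolding cW o iW z1(1)[symmetric] z2(1)[symmetric] by auto
  qed
  show "card (W chi eta y) = order y (Q chi eta)" if "\<And>w. w \<in> W chi eta y \<Longrightarrow> E2 chi eta (of_real y) w \<noteq> 0"
  proof -
    have "\<not> zo chi eta (of_real y) v \<ge> 2" "\<not> zo chi eta (of_real y) (- v) \<ge> 2"
      using that z1(2) z2(2) iW by blast+
    thus ?thesis unfolding cW o iW z1(1)[symmetric] z2(1)[symmetric] by auto
  qed
qed

text \<open>Distinct critical points are compared with zeros counted by multiplicity, one fibre at a
  time. The lower bound 2 comes from one critical point on each arc; their second coordinates have
  opposite signs.\<close>

lemma T_counts:
  assumes ce: "\<bar>chi\<bar> < 1" "\<bar>eta\<bar> < 1" and chi: "chi \<noteq> 0" and l: "l \<in> {1..g}"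
  shows "finite (T chi eta l)" "card (T chi eta l) \<ge> 2" "card (T chi eta l) \<le> nK chi eta l"
    "Affine z w \<in> T chi eta l \<Longrightarrow> E2 chi eta z w = 0 \<Longrightarrow> card (T chi eta l) < nK chi eta l"
    "(\<And>z w. Affine z w \<in> T chi eta l \<Longrightarrow> E2 chi eta z w \<noteq> 0) \<Longrightarrow> card (T chi eta l) = nK chi eta l"
proof -
  have e: "eta \<noteq> 1" using ce by auto
  define R where "R = {y \<in> {a l..b l}. poly (Q chi eta) y = 0}"
  have finR: "finite R" unfolding R_def using poly_roots_finite[OF Q_nz[OF e], of chi] by (rule rev_finite_subset) auto
  have RI: "a l < y" "y < b l" if "y \<in> R" for y
    using that Q_at_ends[OF l chi, of eta] by (auto simp: R_def less_le)
  have Teq: "T chi eta l = (\<Union>y\<in>R. Affine (of_real y) ` W chi eta y)"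
  proof (intro set_eqI iffI)
    fix p assume "p \<in> T chi eta l"
    hence "p \<in> C l" "crit chi eta p" by (auto simp: T_def)
    then obtain y w where "p = Affine (of_real y) w" "a l < y" "y < b l" "w\<^sup>2 = cP0 (of_real y)" "w \<noteq> 0"
      "G chi eta (of_real y) w = 0" "poly (Q chi eta) y = 0" by (rule C_crit[OF ce chi l])
    thus "p \<in> (\<Union>y\<in>R. Affine (of_real y) ` W chi eta y)" unfolding R_def W_def
      by (intro UN_I[of y] image_eqI[of _ _ w]) auto
  next
    fix p assume "p \<in> (\<Union>y\<in>R. Affine (of_real y) ` W chi eta y)"
    then obtain y w where y: "y \<in> R" "w \<in> W chi eta y" "p = Affine (of_real y) w" by blast
    have "y \<noteq> 0" using RI[OF y(1)] b_neg[OF l] by auto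
    hence "crit chi eta p" using y(2,3) crit_affine_iff[OF ce] by (simp add: W_def)
    moreover have "p \<in> C l" using y by (auto simp: W_def R_def)
    ultimately show "p \<in> T chi eta l" by (simp add: T_def)
  qed
  have cWy: "finite (W chi eta y)" "card (W chi eta y) \<le> order y (Q chi eta)" if "y \<in> R" for y
    using card_W(1,2)[OF e l RI[OF that]] by auto
  show fin: "finite (T chi eta l)" unfolding Teq using finR cWy by auto
  have cT: "card (T chi eta l) = (\<Sum>y\<in>R. card (W chi eta y))"
  proof -
    have "card (T chi eta l) = (\<Sum>y\<in>R. card (Affine (of_real y) ` W chi eta y))"
      unfolding Teq by (rule card_UN_disjoint) (use finR cWy in auto)
    also have "\<dots> = (\<Sum>y\<in>R. card (W chi eta y))"
      by (intro sum.cong refl card_image) (auto simp: inj_on_def)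
    finally show ?thesis .
  qed
  have nKs: "nK chi eta l = (\<Sum>y\<in>R. order y (Q chi eta))"
    unfolding nK_def R_def by (rule roots_in_eq_sum_order[OF Q_nz[OF e]])
  show "card (T chi eta l) \<le> nK chi eta l" unfolding cT nKs by (rule sum_mono) (rule cWy)
  show "card (T chi eta l) < nK chi eta l" if *: "Affine z w \<in> T chi eta l" "E2 chi eta z w = 0"
  proof -
    obtain y where y: "y \<in> R" "w \<in> W chi eta y" "z = of_real y" using *(1) unfolding Teq by auto
    show ?thesis unfolding cT nKs
    proof (rule sum_strict_mono_ex1[OF finR])
      show "\<forall>y\<in>R. card (W chi eta y) \<le> order y (Q chi eta)" using cWy by blast
      show "\<exists>y\<in>R. card (W chi eta y) < order y (Q chi eta)"
        using card_W(3)[OF e l RI[OF y(1)] y(2)] *(2) y by blast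
    qed
  qed
  show "card (T chi eta l) = nK chi eta l" if *: "\<And>z w. Affine z w \<in> T chi eta l \<Longrightarrow> E2 chi eta z w \<noteq> 0"
    unfolding cT nKs
  proof (rule sum.cong[OF refl])
    fix y assume y: "y \<in> R"
    show "card (W chi eta y) = order y (Q chi eta)"
      by (rule card_W(4)[OF e l RI[OF y]]) (use * y in \<open>auto simp: Teq\<close>)
  qed
  show "card (T chi eta l) \<ge> 2"
  proof -
    have ex: "\<exists>y. Affine (of_real y) (of_real (s * sqrt (poly P0 y))) \<in> T chi eta l \<and> poly P0 y > 0"
      if s: "s\<^sup>2 = 1" for s
    proof -
      obtain y where y: "y \<in> {a l..b l}" "L eta y * (s * sqrt (poly P0 y)) + 2 * chi * y * poly N y = 0"
        using arc_root[OF l] by blast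
      define w where "w = complex_of_real (s * sqrt (poly P0 y))"
      have "(s * sqrt (poly P0 y))\<^sup>2 = poly P0 y"
        using P0_nonneg_cycle[OF l y(1)] s by (simp add: power_mult_distrib)
      hence w2: "w\<^sup>2 = cP0 (of_real y)" unfolding w_def by (metis of_real_power poly_cpoly_of_real)
      have G0: "G chi eta (of_real y) w = 0" unfolding w_def G_of_real y(2) by simp
      have y0: "of_real y \<noteq> (0::complex)" using y(1) b_neg[OF l] by auto
      have cr: "crit chi eta (Affine (of_real y) w)" using crit_affine_iff[OF ce] w2 G0 y0 by blast
      have inC: "Affine (of_real y) w \<in> C l" using w2 y(1) by blast
      obtain y' w' where "Affine (of_real y) w = Affine (of_real y') w'" "a l < y'" "y' < b l"
        by (rule C_crit[OF ce chi l inC cr])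
      hence "poly P0 y > 0" using P0_pos_cycle[OF l, of y] by simp
      thus ?thesis using cr inC by (auto simp: T_def w_def)
    qed
    obtain y1 where y1: "Affine (of_real y1) (of_real (1 * sqrt (poly P0 y1))) \<in> T chi eta l" "poly P0 y1 > 0"
      using ex[of 1] by auto
    obtain y2 where y2: "Affine (of_real y2) (of_real ((-1) * sqrt (poly P0 y2))) \<in> T chi eta l" "poly P0 y2 > 0"
      using ex[of "-1"] by auto
    have "1 * sqrt (poly P0 y1) \<noteq> (-1) * sqrt (poly P0 y2)"
      using y1(2) y2(2) real_sqrt_gt_zero[OF y1(2)] real_sqrt_gt_zero[OF y2(2)] by linarith
    hence "complex_of_real (1 * sqrt (poly P0 y1)) \<noteq> of_real ((-1) * sqrt (poly P0 y2))"
      by (simp only: of_real_eq_iff not_False_eq_True)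
    hence "card {Affine (complex_of_real y1) (of_real (1 * sqrt (poly P0 y1))), Affine (of_real y2) (of_real ((-1) * sqrt (poly P0 y2)))} = 2"
      by (subst card_2_iff) blast
    moreover have "card {Affine (complex_of_real y1) (of_real (1 * sqrt (poly P0 y1))), Affine (of_real y2) (of_real ((-1) * sqrt (poly P0 y2)))} \<le> card (T chi eta l)"
      using y1(1) y2(1) by (intro card_mono[OF fin]) (simp only: insert_subset empty_subsetI simp_thms)
    ultimately show ?thesis by simp
  qed
qed

lemma exists_double_iff:
  assumes ce: "\<bar>chi\<bar> < 1" "\<bar>eta\<bar> < 1" and l: "l \<in> {1..g}"
  shows "(\<exists>p\<in>C l. \<exists>j\<ge>2. crit_order chi eta p j) \<longleftrightarrow>
    (\<exists>z w. Affine z w \<in> C l \<and> z \<noteq> 0 \<and> G chi eta z w = 0 \<and> E2 chi eta z w = 0)"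
  using crit_double_iff[OF ce] by blast

lemma exists_double_iff_T:
  assumes ce: "\<bar>chi\<bar> < 1" "\<bar>eta\<bar> < 1" and l: "l \<in> {1..g}"
  shows "(\<exists>p\<in>C l. \<exists>j\<ge>2. crit_order chi eta p j) \<longleftrightarrow> (\<exists>z w. Affine z w \<in> T chi eta l \<and> E2 chi eta z w = 0)"
  unfolding exists_double_iff[OF assms] T_def using crit_affine_iff[OF ce] by blast

lemma four_crit_iff:
  assumes "finite (T chi eta l)"
  shows "(\<exists>S \<subseteq> C l. card S = 4 \<and> (\<forall>p\<in>S. crit chi eta p)) \<longleftrightarrow> card (T chi eta l) \<ge> 4"
proof
  assume "\<exists>S \<subseteq> C l. card S = 4 \<and> (\<forall>p\<in>S. crit chi eta p)"
  then obtain S where "S \<subseteq> T chi eta l" "card S = 4" unfolding T_def by blast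
  thus "card (T chi eta l) \<ge> 4" using card_mono[OF assms] by metis
next
  assume "card (T chi eta l) \<ge> 4"
  then obtain S where "S \<subseteq> T chi eta l" "card S = 4" by (rule obtain_subset_with_card_n)
  thus "\<exists>S \<subseteq> C l. card S = 4 \<and> (\<forall>p\<in>S. crit chi eta p)" unfolding T_def by blast
qed

lemma chi_0_T:
  assumes "\<bar>eta\<bar> < 1" "l \<in> {1..g}"
  shows "T 0 eta l = {Affine (of_real (a l)) 0, Affine (of_real (b l)) 0} \<union>
    (if zeta eta \<in> {a l..b l} then {Affine (of_real (zeta eta)) (of_real (sqrt (poly P0 (zeta eta)))),
      Affine (of_real (zeta eta)) (- of_real (sqrt (poly P0 (zeta eta))))} else {})" (is "_ = ?R")
proof -
  have e: "eta \<noteq> 1" using assms by auto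
  have ne: "1 - of_real eta \<noteq> (0::complex)" using e by (metis eq_iff_diff_eq_0 of_real_1 of_real_eq_iff)
  have L: "G 0 eta z w = 0 \<longleftrightarrow> z = of_real (zeta eta) \<or> w = 0" for z w
    using k_pos ne by (simp add: G_def Lc_zeta[OF e])
  have cr: "crit 0 eta (Affine z w) \<longleftrightarrow> w\<^sup>2 = cP0 z \<and> z \<noteq> 0 \<and> (z = of_real (zeta eta) \<or> w = 0)" for z w
    using crit_affine_iff[of 0 eta z w] assms(1) L by simp
  show ?thesis
  proof (intro set_eqI iffI)
    fix p assume p: "p \<in> T 0 eta l"
    then obtain y w where y: "p = Affine (of_real y) w" "w\<^sup>2 = cP0 (of_real y)" "y \<in> {a l..b l}" unfolding T_def by auto
    have "crit 0 eta (Affine (of_real y) w)" using p y(1) by (simp add: T_def)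
    hence "y = zeta eta \<or> w = 0" unfolding cr by auto
    thus "p \<in> ?R"
    proof
      assume yz: "y = zeta eta"
      have "w = of_real (sqrt (poly P0 y)) \<or> w = - of_real (sqrt (poly P0 y))"
        by (rule square_root_cases) (use y P0_nonneg_cycle[OF assms(2) y(3)] in auto)
      thus ?thesis using y yz by auto
    next
      assume w0: "w = 0"
      hence "poly P0 y = 0" using y(2) by simp
      hence "y = a l \<or> y = b l" using P0_pos_cycle[OF assms(2), of y] y(3) by force
      thus ?thesis using y(1) w0 by auto
    qed
  next
    fix p assume p: "p \<in> ?R"
    have neg: "a l < 0" "b l < 0" "a l < b l" using a_neg b_neg ab assms(2) by auto
    consider "p = Affine (of_real (a l)) 0" | "p = Affine (of_real (b l)) 0"
      | s where "zeta eta \<in> {a l..b l}" "p = Affine (of_real (zeta eta)) (of_real (s * sqrt (poly P0 (zeta eta))))" "s\<^sup>2 = 1"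
      using p that(1,2) that(3)[of 1] that(3)[of "-1"] by (auto split: if_splits)
    thus "p \<in> T 0 eta l"
    proof cases
      case 1
      thus ?thesis using neg assms(2) by (auto simp: T_def cr)
    next
      case 2
      thus ?thesis using neg assms(2) by (auto simp: T_def cr)
    next
      case 3
      have "(s * sqrt (poly P0 (zeta eta)))\<^sup>2 = poly P0 (zeta eta)"
        using P0_nonneg_cycle[OF assms(2) 3(1)] 3(3) by (simp add: power_mult_distrib)
      hence "(complex_of_real (s * sqrt (poly P0 (zeta eta))))\<^sup>2 = cP0 (of_real (zeta eta))"
        by (metis of_real_power poly_cpoly_of_real)
      thus ?thesis unfolding T_def using 3(1) zeta_neg[OF assms(1)] unfolding 3(2) cr mem_Collect_eq
        by (auto simp del: poly_cpoly_of_real of_real_mult)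
    qed
  qed
qed

lemma chi_0_GS:
  assumes "\<bar>eta\<bar> < 1" "l \<in> {1..g}"
  shows "(\<exists>S \<subseteq> C l. card S = 4 \<and> (\<forall>p\<in>S. crit 0 eta p)) \<longleftrightarrow> a l < zeta eta \<and> zeta eta < b l"
proof -
  have fin: "finite (T 0 eta l)" unfolding chi_0_T[OF assms] by auto
  show ?thesis unfolding four_crit_iff[OF fin]
  proof
    assume *: "card (T 0 eta l) \<ge> 4"
    show "a l < zeta eta \<and> zeta eta < b l"
    proof (rule ccontr)
      assume "\<not> ?thesis"
      hence "T 0 eta l \<subseteq> {Affine (of_real (a l)) 0, Affine (of_real (b l)) 0}"
        unfolding chi_0_T[OF assms] using assms(2) by (cases "zeta eta = a l \<or> zeta eta = b l") auto
      hence "card (T 0 eta l) \<le> card {Affine (complex_of_real (a l)) 0, Affine (of_real (b l)) 0}" by (intro card_mono) auto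
      also have "\<dots> \<le> 2" by (simp add: card_insert_if)
      finally show False using * by simp
    qed
  next
    assume *: "a l < zeta eta \<and> zeta eta < b l"
    hence "poly P0 (zeta eta) > 0" using P0_pos_cycle[OF assms(2)] by blast
    hence "complex_of_real (sqrt (poly P0 (zeta eta))) \<noteq> 0" by simp
    hence "card (T 0 eta l) = 4" unfolding chi_0_T[OF assms] using * ab[OF assms(2)] by auto
    thus "card (T 0 eta l) \<ge> 4" by simp
  qed
qed

text \<open>The two points over \<open>zeta eta\<close> coincide only at a branch point. Elsewhere
  \<open>E2\<close> reduces to \<open>k (1 - eta) w^2\<close>, which is nonzero.\<close>

lemma chi_0_ERS:
  assumes "\<bar>eta\<bar> < 1" "l \<in> {1..g}"
  shows "(\<exists>p\<in>C l. \<exists>j\<ge>2. crit_order 0 eta p j) \<longleftrightarrow> zeta eta = a l \<or> zeta eta = b l"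
proof -
  have e: "eta \<noteq> 1" using assms by auto
  have ne: "1 - of_real eta \<noteq> (0::complex)" using e by (metis eq_iff_diff_eq_0 of_real_1 of_real_eq_iff)
  have L: "G 0 eta z w = 0 \<longleftrightarrow> z = of_real (zeta eta) \<or> w = 0" for z w
    using k_pos ne by (simp add: G_def Lc_zeta[OF e])
  have eq: "(\<exists>p\<in>C l. \<exists>j\<ge>2. crit_order 0 eta p j) \<longleftrightarrow>
    (\<exists>z w. Affine z w \<in> C l \<and> z \<noteq> 0 \<and> G 0 eta z w = 0 \<and> E2 0 eta z w = 0)"
    by (rule exists_double_iff) (use assms in auto)
  show ?thesis unfolding eq
  proof
    assume "\<exists>z w. Affine z w \<in> C l \<and> z \<noteq> 0 \<and> G 0 eta z w = 0 \<and> E2 0 eta z w = 0"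
    then obtain y w where yw: "w\<^sup>2 = cP0 (of_real y)" "y \<in> {a l..b l}" "G 0 eta (of_real y) w = 0" "E2 0 eta (of_real y) w = 0"
      by blast
    have w0: "w = 0"
    proof (rule ccontr)
      assume "w \<noteq> 0"
      hence "of_real y = complex_of_real (zeta eta)" using yw(3) L by blast
      hence "Lc eta (of_real y) = 0" unfolding Lc_zeta[OF e] by simp
      thus False using yw(4) \<open>w \<noteq> 0\<close> k_pos ne by (simp add: E2_def)
    qed
    hence p0: "cP0 (of_real y) = 0" using yw(1) by simp
    hence "poly P0 y = 0" by simp
    hence y: "y = a l \<or> y = b l" using P0_pos_cycle[OF assms(2), of y] yw(2) by force
    have "Lc eta (of_real y) = 0" using yw(4) pderiv_P0_nz[OF p0] w0 by (simp add: E2_def)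
    hence "complex_of_real y = of_real (zeta eta)" using k_pos ne unfolding Lc_zeta[OF e] by simp
    thus "zeta eta = a l \<or> zeta eta = b l" using y by auto
  next
    assume *: "zeta eta = a l \<or> zeta eta = b l"
    have "Lc eta (of_real (zeta eta)) = 0" unfolding Lc_zeta[OF e] by simp
    moreover have "poly P0 (zeta eta) = 0" using * assms(2) by auto
    moreover have "zeta eta \<in> {a l..b l}" using * ab[OF assms(2)] by auto
    ultimately show "\<exists>z w. Affine z w \<in> C l \<and> z \<noteq> 0 \<and> G 0 eta z w = 0 \<and> E2 0 eta z w = 0"
      using zeta_neg[OF assms(1)] by (intro exI[of _ "of_real (zeta eta)"] exI[of _ 0]) (auto simp: G_def E2_def)
  qed
qed

text \<open>For \<open>chi\<close> nonzero \<open>nK\<close> is 2 or 4 and the cycle has at least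
  two distinct critical points. Hence a double point forces \<open>nK = 4\<close> with fewer than
  four distinct points, and without one the two counts agree. Disjointness across cycles holds
  because only one cycle can have \<open>nK >= 4\<close>.\<close>

theorem SS_eq: "SS = GS \<union> ERS" "GS \<inter> ERS = {}"
proof -
  let ?gs = "\<lambda>chi eta l. \<exists>S \<subseteq> C l. card S = 4 \<and> (\<forall>p\<in>S. crit chi eta p)"
  let ?ers = "\<lambda>chi eta l. \<exists>p\<in>C l. \<exists>j\<ge>2. crit_order chi eta p j"
  have main: "(nK chi eta l \<ge> 4 \<longleftrightarrow> ?gs chi eta l \<or> ?ers chi eta l) \<and> \<not> (?gs chi eta l \<and> ?ers chi eta l)"
    if ce: "\<bar>chi\<bar> < 1" "\<bar>eta\<bar> < 1" and l: "l \<in> {1..g}" for chi eta l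
  proof (cases "chi = 0")
    case True
    have e: "eta \<noteq> 1" using ce by auto
    show ?thesis unfolding True chi_0_GS[OF ce(2) l] chi_0_ERS[OF ce(2) l] nK_chi_0[OF l e]
      using ab[OF l] by auto
  next
    case False
    note t = T_counts[OF ce False l]
    have nK4: "nK chi eta l > 2 \<Longrightarrow> nK chi eta l = 4" by (rule count_nK_big(1)[OF False ce(2) l])
    show ?thesis unfolding four_crit_iff[OF t(1)] exists_double_iff_T[OF ce l]
    proof (cases "\<exists>z w. Affine z w \<in> T chi eta l \<and> E2 chi eta z w = 0")
      case True
      hence "card (T chi eta l) < nK chi eta l" using t(4) by blast
      thus "(nK chi eta l \<ge> 4 \<longleftrightarrow> card (T chi eta l) \<ge> 4 \<or> (\<exists>z w. Affine z w \<in> T chi eta l \<and> E2 chi eta z w = 0)) \<and>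
        \<not> (card (T chi eta l) \<ge> 4 \<and> (\<exists>z w. Affine z w \<in> T chi eta l \<and> E2 chi eta z w = 0))"
        using True t(2) nK4 by auto
    next
      case no: False
      hence "card (T chi eta l) = nK chi eta l" using t(5) by blast
      thus "(nK chi eta l \<ge> 4 \<longleftrightarrow> card (T chi eta l) \<ge> 4 \<or> (\<exists>z w. Affine z w \<in> T chi eta l \<and> E2 chi eta z w = 0)) \<and>
        \<not> (card (T chi eta l) \<ge> 4 \<and> (\<exists>z w. Affine z w \<in> T chi eta l \<and> E2 chi eta z w = 0))"
        using no by auto
    qed
  qed
  have iff: "(chi, eta) \<in> SS \<longleftrightarrow> (chi, eta) \<in> open_square \<and> (\<exists>l\<in>{1..g}. nK chi eta l \<ge> 4)"
    "(chi, eta) \<in> GS \<longleftrightarrow> (chi, eta) \<in> open_square \<and> (\<exists>l\<in>{1..g}. ?gs chi eta l)"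
    "(chi, eta) \<in> ERS \<longleftrightarrow> (chi, eta) \<in> open_square \<and> (\<exists>l\<in>{1..g}. ?ers chi eta l)" for chi eta
    by (simp_all add: SS_def GS_def ERS_def)
  have "(chi, eta) \<in> SS \<longleftrightarrow> (chi, eta) \<in> GS \<union> ERS" for chi eta
  proof (cases "(chi, eta) \<in> open_square")
    case True
    hence ce: "\<bar>chi\<bar> < 1" "\<bar>eta\<bar> < 1" using open_square_iff by auto
    have "(\<exists>l\<in>{1..g}. nK chi eta l \<ge> 4) \<longleftrightarrow> (\<exists>l\<in>{1..g}. ?gs chi eta l \<or> ?ers chi eta l)"
      by (rule bex_cong[OF refl]) (rule main[OF ce, THEN conjunct1])
    thus ?thesis unfolding Un_iff iff by (simp only: True simp_thms bex_disj_distrib)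
  next
    case False
    thus ?thesis unfolding Un_iff iff by (simp only: simp_thms)
  qed
  thus "SS = GS \<union> ERS" by auto
  have unique: "l = l'" if "\<bar>chi\<bar> < 1" "\<bar>eta\<bar> < 1" "l \<in> {1..g}" "l' \<in> {1..g}" "nK chi eta l \<ge> 4" "nK chi eta l' \<ge> 4" for chi eta l l'
  proof (cases "chi = 0")
    case True
    have "eta \<noteq> 1" using that by auto
    hence "zeta eta \<in> {a l..b l}" "zeta eta \<in> {a l'..b l'}"
      using that(3-6) True nK_chi_0[of l eta] nK_chi_0[of l' eta] by (auto split: if_splits)
    thus ?thesis using cycle_unique that by blast
  next
    case False
    show ?thesis using count_nK_big(3)[OF False that(2,3), of l'] that by force
  qed
  have "\<not> ((chi, eta) \<in> GS \<and> (chi, eta) \<in> ERS)" for chi eta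
  proof
    assume *: "(chi, eta) \<in> GS \<and> (chi, eta) \<in> ERS"
    have "(chi, eta) \<in> open_square" using *[THEN conjunct1, unfolded iff(2)] by (rule conjunct1)
    hence ce: "\<bar>chi\<bar> < 1" "\<bar>eta\<bar> < 1" using open_square_iff by auto
    obtain l where l: "l \<in> {1..g}" "?gs chi eta l"
      using *[THEN conjunct1, unfolded iff(2), THEN conjunct2] by (rule bexE)
    obtain l' where l': "l' \<in> {1..g}" "?ers chi eta l'"
      using *[THEN conjunct2, unfolded iff(3), THEN conjunct2] by (rule bexE)
    have "nK chi eta l \<ge> 4" by (rule main[OF ce l(1), THEN conjunct1, THEN iffD2, OF disjI1, OF l(2)])
    moreover have "nK chi eta l' \<ge> 4" by (rule main[OF ce l'(1), THEN conjunct1, THEN iffD2, OF disjI2, OF l'(2)])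
    ultimately have eq: "l' = l" using unique[OF ce l(1) l'(1)] by simp
    show False by (rule notE[OF main[OF ce l(1), THEN conjunct2]], rule conjI[OF l(2) l'(2)[unfolded eq]])
  qed
  thus "GS \<inter> ERS = {}" by auto
qed

lemma SS_subset_DD: "SS \<subseteq> DD"
proof
  fix p assume "p \<in> SS"
  then obtain chi eta l where p: "p = (chi, eta)" "(chi, eta) \<in> open_square" "l \<in> {1..g}" "nK chi eta l \<ge> 4"
    unfolding SS_def by auto
  have ce: "\<bar>chi\<bar> < 1" "\<bar>eta\<bar> < 1" using p open_square_iff by auto
  have "m chi eta > 0"
  proof (cases "chi = 0")
    case True
    thus ?thesis using m_chi_0[OF ce(2)] by simp
  next
    case False
    have "n0 chi eta = 0" using count_nK_big(2)[OF False ce(2) p(3)] p(4) by simp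
    thus ?thesis using m_pos_iff_n0[OF ce] by simp
  qed
  thus "p \<in> DD" by (simp add: DD_def p)
qed

section \<open>Closedness of \<open>SS\<close>\<close>

lemma coeff_Q_tendsto:
  assumes "X \<longlonglongrightarrow> chi" "Y \<longlonglongrightarrow> eta"
  shows "(\<lambda>n. coeff (Q (X n) (Y n)) i) \<longlonglongrightarrow> coeff (Q chi eta) i"
proof -
  have Qe: "Q x y = smult ((real k * (1 + y))\<^sup>2) P1 + smult (2 * (real k * (1 + y)) * (real k * (1 - y))) (pCons 0 P1)
     + smult ((real k * (1 - y))\<^sup>2) (pCons 0 (pCons 0 P1)) - smult (4 * x\<^sup>2) (pCons 0 (N\<^sup>2))" for x y
    unfolding poly_eq_poly_eq_iff[symmetric]
    by (rule ext) (simp add: poly_Q L_def power2_eq_square algebra_simps)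
  show ?thesis unfolding Qe coeff_add coeff_diff coeff_smult by (intro tendsto_intros assms)
qed

lemma Q_nz': "\<bar>eta\<bar> \<le> 1 \<Longrightarrow> Q chi eta \<noteq> 0"
  using Q_nz[of eta chi] Q_0_pos[of eta chi] by (cases "eta = 1") auto

text \<open>At the four tangency points the two spare zeros of \<open>Q\<close> are far from the
  compact cycles: at infinity for \<open>eta = 1\<close>, at 0 for \<open>eta = -1\<close>, and at 1
  on the vertical sides.\<close>

lemma nK_boundary:
  assumes "m chi eta = 0" "l \<in> {1..g}" "\<not> (\<bar>chi\<bar> < 1 \<and> \<bar>eta\<bar> < 1)"
  shows "nK chi eta l = 2"
proof -
  from assms m_zero_iff[of chi eta] consider "chi = 0" "eta = 1" | "chi = 0" "eta = -1" | "\<bar>chi\<bar> = 1" "eta = eta0" by force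
  thus ?thesis
  proof cases
    case 1
    thus ?thesis using nK_top[OF assms(2)] by simp
  next
    case 2
    thus ?thesis using nK_chi_0[OF assms(2), of "-1"] b_neg[OF assms(2)] by (simp add: zeta_def)
  next
    case 3
    have o2: "order 1 (Q chi eta) \<ge> 2" using m_side_point(2)[OF 3(1) _ 3(2)] eta0_bound 3(2) by simp
    have "eta \<noteq> 1" using 3 eta0_bound by auto
    hence "n0 chi eta \<ge> 2" using roots_in_ge_order[OF Q_nz, of eta 1 "{0<..}" chi] o2 by (simp add: n0_def)
    thus ?thesis using count_n0_pos(2)[of chi eta l] 3 eta0_bound assms(2) by auto
  qed
qed

text \<open>Along a convergent sequence four zeros persist in the compact interval and
  \<open>m\<close> stays nonnegative. A limit on the boundary of the square would have
  \<open>m = 0\<close>, where only two zeros are left on the cycle.\<close>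

theorem closed_SS: "closed SS"
proof -
  have cl: "closed {p \<in> open_square. nK (fst p) (snd p) l \<ge> 4}" if l: "l \<in> {1..g}" for l
    unfolding closed_sequential_limits
  proof (intro allI impI, elim conjE)
    fix s p assume s: "\<forall>n. s n \<in> {p \<in> open_square. nK (fst p) (snd p) l \<ge> 4}" and lim: "s \<longlonglongrightarrow> (p :: real \<times> real)"
    define X Y where "X n = fst (s n)" and "Y n = snd (s n)" for n
    have XY: "\<bar>X n\<bar> < 1" "\<bar>Y n\<bar> < 1" "nK (X n) (Y n) l \<ge> 4" for n
      using s[rule_format, of n] open_square_iff[of "X n" "Y n"] by (auto simp: X_def Y_def)
    obtain chi eta where p: "p = (chi, eta)" by fastforce
    have limX: "X \<longlonglongrightarrow> chi" and limY: "Y \<longlonglongrightarrow> eta"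
      using tendsto_fst[OF lim] tendsto_snd[OF lim] by (simp_all add: X_def[abs_def] Y_def[abs_def] p)
    have "m chi eta \<ge> 0"
    proof -
      have "(\<lambda>n. m (fst (s n)) (snd (s n))) \<longlonglongrightarrow> m (fst p) (snd p)"
        using continuous_on_tendsto_compose[OF continuous_m lim] by simp
      moreover have "m (fst (s n)) (snd (s n)) \<ge> 0" for n
      proof -
        have "s n \<in> SS" using s[rule_format, of n] l by (auto simp: SS_def)
        thus ?thesis using SS_subset_DD by (auto simp: DD_def)
      qed
      ultimately show ?thesis by (intro LIMSEQ_le_const[of _ "m chi eta"]) (auto simp: p)
    qed
    hence sq: "\<bar>chi\<bar> \<le> 1" "\<bar>eta\<bar> \<le> 1" using m_nonneg_square by auto
    have nK4: "4 \<le> nK chi eta l"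
      unfolding nK_def
    proof (rule roots_in_limit[OF compact_Icc Q_nz'[OF sq(2)] coeff_Q_tendsto[OF limX limY]])
      show "degree (Q (X n) (Y n)) \<le> 2 * g + 2" for n by (rule degree_Q_le)
      show "Q (X n) (Y n) \<noteq> 0" for n using XY[of n] by (intro Q_nz) auto
      show "4 \<le> roots_in {a l..b l} (Q (X n) (Y n))" for n using XY(3)[of n] by (simp add: nK_def)
    qed
    have "\<bar>chi\<bar> < 1 \<and> \<bar>eta\<bar> < 1"
    proof (rule ccontr)
      assume *: "\<not> ?thesis"
      hence "m chi eta = 0" using m_pos_square[of chi eta] \<open>m chi eta \<ge> 0\<close> by fastforce
      thus False using nK_boundary[OF _ l *] nK4 by simp
    qed
    thus "p \<in> {p \<in> open_square. nK (fst p) (snd p) l \<ge> 4}" using nK4 by (simp add: p open_square_iff)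
  qed
  have "SS = (\<Union>l\<in>{1..g}. {p \<in> open_square. nK (fst p) (snd p) l \<ge> 4})" by (auto simp: SS_def)
  thus ?thesis using cl by (auto intro!: closed_UN)
qed

lemma open_DD: "open DD"
  unfolding DD_def by (intro open_Collect_less continuous_m continuous_on_const)

end

section \<open>Merging of conjugate critical points\<close>

text \<open>The leading coefficients converge to a nonzero number, so their inverses are bounded.
  For a zero of modulus \<open>R >= 1\<close> the lower terms are at most a constant times
  \<open>R^(d - 1)\<close>, which bounds \<open>R\<close>.\<close>

lemma bounded_root_sequence:
  fixes P :: "nat \<Rightarrow> real poly" and z :: "nat \<Rightarrow> complex"
  assumes conv: "\<And>i. (\<lambda>n. coeff (P n) i) \<longlonglongrightarrow> coeff Q i"
    and deg: "\<And>n. degree (P n) = d" "degree Q = d" "d > 0"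
    and root: "\<And>n. poly (cpoly (P n)) (z n) = 0"
  obtains B where "\<And>n. norm (z n) \<le> B"
proof -
  have lead: "coeff (P n) d \<noteq> 0" for n using deg(1)[of n] deg(3) by auto
  have leadQ: "coeff Q d \<noteq> 0" using deg(2,3) by auto
  have "(\<lambda>n. inverse (coeff (P n) d)) \<longlonglongrightarrow> inverse (coeff Q d)"
    by (intro tendsto_inverse conv leadQ)
  hence "Bseq (\<lambda>n. inverse (coeff (P n) d))" by (intro convergent_imp_Bseq convergentI)
  then obtain M' where M': "M' > 0" "\<And>n. norm (inverse (coeff (P n) d)) \<le> M'" by (auto elim: BseqE)
  have "\<exists>M. \<forall>i n. norm (coeff (P n) i) \<le> M i"
  proof -
    have "\<exists>M. \<forall>n. norm (coeff (P n) i) \<le> M" for i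
    proof -
      have "Bseq (\<lambda>n. coeff (P n) i)" by (rule convergent_imp_Bseq[OF convergentI[OF conv[of i]]])
      thus ?thesis by (meson BseqE)
    qed
    thus ?thesis by metis
  qed
  then obtain M where M: "\<And>i n. norm (coeff (P n) i) \<le> M i" by blast
  have "norm (z n) \<le> max 1 (M' * (\<Sum>i<d. M i))" for n
  proof (cases "norm (z n) \<ge> 1")
    case True
    define R where "R = norm (z n)"
    obtain j where j: "d = Suc j" using deg(3) by (cases d) auto
    have "0 = (\<Sum>i\<le>d. of_real (coeff (P n) i) * z n ^ i)"
      using root[of n] by (simp add: poly_altdef deg(1))
    also have "\<dots> = (\<Sum>i<d. of_real (coeff (P n) i) * z n ^ i) + of_real (coeff (P n) d) * z n ^ d"
      by (simp add: lessThan_Suc_atMost[symmetric])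
    finally have "of_real (coeff (P n) d) * z n ^ d = - (\<Sum>i<d. of_real (coeff (P n) i) * z n ^ i)"
      by (simp add: eq_neg_iff_add_eq_0 add.commute)
    hence "\<bar>coeff (P n) d\<bar> * R ^ d = norm (\<Sum>i<d. of_real (coeff (P n) i) * z n ^ i)"
      by (metis norm_minus_cancel norm_mult norm_of_real norm_power R_def)
    also have "\<dots> \<le> (\<Sum>i<d. M i * R ^ j)"
    proof (rule sum_norm_le)
      fix i assume "i \<in> {..<d}"
      hence "R ^ i \<le> R ^ j" using True j by (intro power_increasing) (auto simp: R_def)
      thus "norm (of_real (coeff (P n) i) * z n ^ i) \<le> M i * R ^ j"
        using M[of n i] by (auto simp: norm_mult norm_power R_def intro!: mult_mono order_trans[OF norm_ge_zero M[of n i, unfolded real_norm_def[symmetric]]])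
    qed
    also have "\<dots> = (\<Sum>i<d. M i) * R ^ j" by (simp add: sum_distrib_right)
    finally have "\<bar>coeff (P n) d\<bar> * R * R ^ j \<le> (\<Sum>i<d. M i) * R ^ j" by (simp add: j mult.assoc)
    moreover have "R > 0" using True unfolding R_def by linarith
    hence "R ^ j > 0" by (rule zero_less_power)
    ultimately have "\<bar>coeff (P n) d\<bar> * R \<le> (\<Sum>i<d. M i)" by (simp add: mult_le_cancel_right)
    hence "inverse \<bar>coeff (P n) d\<bar> * (\<bar>coeff (P n) d\<bar> * R) \<le> inverse \<bar>coeff (P n) d\<bar> * (\<Sum>i<d. M i)"
      by (intro mult_left_mono) auto
    also have "\<dots> \<le> M' * (\<Sum>i<d. M i)"
      using M'(2)[of n] by (intro mult_right_mono sum_nonneg) (auto intro: order_trans[OF norm_ge_zero M])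
    finally have "R \<le> M' * (\<Sum>i<d. M i)" using lead[of n] by (simp add: mult.assoc[symmetric])
    thus ?thesis by (simp add: R_def)
  qed auto
  thus ?thesis using that by blast
qed

text \<open>With \<open>f / u = (z - z0) ^ (n - e) * R\<close>, where \<open>R\<close> is real on the real line, an \<open>\<epsilon>\<close> of the
  sign of \<open>R z0\<close> leaves \<open>f / u + \<epsilon>\<close> without real zeros, but by Hurwitz's theorem not without
  zeros.\<close>

lemma nonreal_zero_of_perturbation:
  fixes f u :: "complex \<Rightarrow> complex" and z0 :: real
  assumes r: "r > 0" and hol: "f holomorphic_on ball (of_real z0) r" "u holomorphic_on ball (of_real z0) r"
    and real: "\<And>x. of_real x \<in> ball (of_real z0 :: complex) r \<Longrightarrow> f (of_real x) \<in> \<real> \<and> u (of_real x) \<in> \<real>"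
    and nz: "\<exists>w\<in>ball (of_real z0) r. f w \<noteq> 0" "\<exists>w\<in>ball (of_real z0) r. u w \<noteq> 0"
    and ord: "zorder f (of_real z0) = int n" "zorder u (of_real z0) = int e" and ne: "n > e" "even (n - e)"
    and eps: "\<epsilon>0 > 0"
  obtains \<epsilon> z where "\<bar>\<epsilon>\<bar> < \<epsilon>0" "z \<in> ball (of_real z0) r" "z \<notin> \<real>" "f z + of_real \<epsilon> * u z = 0"
proof -
  let ?z = "complex_of_real z0"
  have zb: "?z \<in> ball ?z r" using r by simp
  obtain r1 where r1: "r1 > 0" "cball ?z r1 \<subseteq> ball ?z r" "zor_poly f ?z holomorphic_on cball ?z r1"
    "\<And>w. w \<in> cball ?z r1 \<Longrightarrow> f w = zor_poly f ?z w * (w - ?z) ^ n \<and> zor_poly f ?z w \<noteq> 0"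
    using zorder_exist_zero[OF hol(1) open_ball connected_ball zb nz(1)] ord(1) by auto
  obtain r2 where r2: "r2 > 0" "cball ?z r2 \<subseteq> ball ?z r" "zor_poly u ?z holomorphic_on cball ?z r2"
    "\<And>w. w \<in> cball ?z r2 \<Longrightarrow> u w = zor_poly u ?z w * (w - ?z) ^ e \<and> zor_poly u ?z w \<noteq> 0"
    using zorder_exist_zero[OF hol(2) open_ball connected_ball zb nz(2)] ord(2) by auto
  define s where "s = min r1 r2"
  have s: "s > 0" "s \<le> r1" "s \<le> r2" using r1(1) r2(1) by (auto simp: s_def)
  have sb: "w \<in> cball ?z r1 \<and> w \<in> cball ?z r2" if "w \<in> ball ?z s" for w using that by (auto simp: s_def)
  define R where "R w = zor_poly f ?z w / zor_poly u ?z w" for w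
  have holR: "R holomorphic_on ball ?z s"
    unfolding R_def by (intro holomorphic_intros holomorphic_on_subset[OF r1(3)] holomorphic_on_subset[OF r2(3)])
      (use sb r2(4) in auto)
  have R0: "R w \<noteq> 0" if "w \<in> ball ?z s" for w using sb[OF that] r1(4) r2(4) by (simp add: R_def)
  define j where "j = n - e"
  have j: "j > 0" "even j" "n = e + j" using ne by (auto simp: j_def)
  have contR: "isCont R ?z" using holR s(1) by (meson analytic_at analytic_at_imp_isCont centre_in_ball open_ball)
  have Rreal': "R (of_real x) \<in> \<real>" if x: "of_real x \<in> ball ?z s" "x \<noteq> z0" for x
  proof -
    have xr: "of_real x \<in> ball ?z r" using sb[OF x(1)] r1(2) by blast
    have xz: "complex_of_real x - ?z \<noteq> 0" using x(2) by simp
    have "zor_poly f ?z (of_real x) = f (of_real x) / (of_real x - ?z) ^ n"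
         "zor_poly u ?z (of_real x) = u (of_real x) / (of_real x - ?z) ^ e"
      using sb[OF x(1)] r1(4)[of "of_real x"] r2(4)[of "of_real x"] xz by (simp_all add: field_simps)
    thus ?thesis unfolding R_def using real[OF xr] by (auto intro!: Reals_divide Reals_power Reals_diff)
  qed
  have "R ?z \<in> \<real>"
  proof (rule Lim_in_closed_set[OF closed_complex_Reals])
    \<comment> \<open>The factorizations give real values of \<open>R\<close> only at real points
      other than \<open>z0\<close>. The denominator \<open>n + 2\<close> keeps the approximating
      points strictly inside the ball.\<close>
    define X where "X n = z0 + s * inverse (real (Suc (n + 1)))" for n
    have X: "of_real (X n) \<in> ball ?z s" "X n \<noteq> z0" for n
    proof -
      have "inverse (real (Suc (n + 1))) < 1" by (rule inverse_less_1_iff[THEN iffD2]) simp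
      hence "s * inverse (real (Suc (n + 1))) < s * 1" using s(1) by (intro mult_strict_left_mono)
      hence "\<bar>X n - z0\<bar> < s" using s(1) by (simp add: X_def)
      hence "norm (complex_of_real (X n - z0)) < s" by (simp only: norm_of_real)
      thus "of_real (X n) \<in> ball ?z s" by (simp add: dist_norm norm_minus_commute)
      show "X n \<noteq> z0" using s(1) by (simp add: X_def)
    qed
    show "eventually (\<lambda>n. R (of_real (X n)) \<in> \<real>) sequentially" using Rreal'[OF X] by simp
    have "(\<lambda>n. z0 + s * inverse (real (Suc (n + 1)))) \<longlonglongrightarrow> z0 + s * 0"
      by (intro tendsto_intros LIMSEQ_ignore_initial_segment[OF LIMSEQ_inverse_real_of_nat])
    hence "X \<longlonglongrightarrow> z0" by (simp add: X_def[abs_def])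
    hence "(\<lambda>n. complex_of_real (X n)) \<longlonglongrightarrow> ?z" by (rule tendsto_of_real)
    thus "(\<lambda>n. R (of_real (X n))) \<longlonglongrightarrow> R ?z" by (rule isCont_tendsto_compose[OF contR])
  qed auto
  then obtain \<rho> where \<rho>: "R ?z = of_real \<rho>" by (auto elim: Reals_cases)
  have Rreal: "R (of_real x) \<in> \<real>" if "of_real x \<in> ball ?z s" for x
    using Rreal'[OF that] \<rho> by (cases "x = z0") auto
  have \<rho>0: "\<rho> \<noteq> 0" using R0[of ?z] \<rho> s(1) by auto
  define \<tau> where "\<tau> = sgn \<rho>"
  have \<tau>: "\<bar>\<tau>\<bar> = 1" "\<tau> * \<rho> > 0" "\<tau> * \<tau> = 1" using \<rho>0 by (auto simp: \<tau>_def sgn_if)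
  have "((\<lambda>w. \<tau> * Re (R w)) \<longlongrightarrow> \<tau> * Re (R ?z)) (nhds ?z)"
    using contR by (intro tendsto_intros) (simp add: continuous_at tendsto_nhds_iff)
  hence "eventually (\<lambda>w. \<tau> * Re (R w) > 0) (nhds ?z)"
    by (rule order_tendstoD) (use \<tau> \<rho> in simp)
  then obtain s1 where s1: "s1 > 0" "\<And>w. dist w ?z < s1 \<Longrightarrow> \<tau> * Re (R w) > 0"
    unfolding eventually_nhds_metric by auto
  define B where "B = ball ?z (min s s1)"
  have BI: "B \<subseteq> ball ?z s" by (auto simp: B_def)
  obtain I :: nat where I: "I > 0" "1 / real I < \<epsilon>0" using eps by (metis nat_approx_posE zero_less_Suc)
  define \<epsilon> where "\<epsilon> i = \<tau> / real (i + I)" for i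
  have eps_lt: "\<bar>\<epsilon> i\<bar> < \<epsilon>0" for i
  proof -
    have "\<bar>\<epsilon> i\<bar> = 1 / real (i + I)" using I(1) \<tau>(1) by (simp add: \<epsilon>_def abs_divide)
    also have "\<dots> \<le> 1 / real I" using I(1) by (intro divide_left_mono) auto
    finally show ?thesis using I(2) by simp
  qed
  define F where "F i w = (w - ?z) ^ j * R w + of_real (\<epsilon> i)" for i w
  define F0 where "F0 w = (w - ?z) ^ j * R w" for w
  have "\<exists>i. \<exists>w\<in>B. F i w = 0"
  proof (rule ccontr)
    assume no: "\<not> ?thesis"
    have "F0 ?z \<noteq> 0"
    proof (rule Hurwitz_no_zeros[of B F F0])
      show "F i holomorphic_on B" for i unfolding F_def by (intro holomorphic_intros holomorphic_on_subset[OF holR BI])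
      show "F0 holomorphic_on B" unfolding F0_def by (intro holomorphic_intros holomorphic_on_subset[OF holR BI])
      show "uniform_limit K F F0 sequentially" if "compact K" "K \<subseteq> B" for K
      proof (rule uniform_limitI)
        fix e :: real assume "e > 0"
        have "(\<lambda>i. \<tau> * inverse (real (i + I))) \<longlonglongrightarrow> \<tau> * 0"
          by (intro tendsto_intros LIMSEQ_ignore_initial_segment[OF lim_inverse_n])
        hence "\<epsilon> \<longlonglongrightarrow> 0" by (simp add: \<epsilon>_def[abs_def] divide_inverse)
        hence "eventually (\<lambda>i. \<bar>\<epsilon> i\<bar> < e) sequentially"
          using \<open>e > 0\<close> by (auto simp: tendsto_iff)
        thus "\<forall>\<^sub>F i in sequentially. \<forall>x\<in>K. dist (F i x) (F0 x) < e"
          by eventually_elim (simp add: F_def F0_def dist_norm)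
      qed
      show "\<not> F0 constant_on B"
      proof
        assume "F0 constant_on B"
        moreover have "?z \<in> B" using s(1) s1(1) by (simp add: B_def)
        moreover have "F0 ?z = 0" using j by (simp add: F0_def)
        ultimately have all0: "F0 w = 0" if "w \<in> B" for w using that unfolding constant_on_def by metis
        define w where "w = ?z + of_real (min s s1 / 2)"
        have "w \<in> B" "w \<noteq> ?z" using s(1) s1(1) by (auto simp: B_def w_def dist_norm)
        thus False using all0[of w] R0[of w] BI by (auto simp: F0_def)
      qed
      show "F i w \<noteq> 0" if "w \<in> B" for i w using no that by blast
    qed (use s(1) s1(1) in \<open>auto simp: B_def\<close>)
    thus False using j by (simp add: F0_def)
  qed
  then obtain i w where iw: "w \<in> B" "F i w = 0" by blast
  \<comment> \<open>At a real point of \<open>B\<close> the power \<open>(x - z0)^j\<close> is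
    nonnegative because \<open>j\<close> is even, and \<open>\<tau> * R\<close> is positive. So
    \<open>\<tau> * F i\<close> is at least \<open>1 / real (i + I)\<close> there.\<close>
  have "w \<notin> \<real>"
  proof
    assume "w \<in> \<real>"
    then obtain x where x: "w = of_real x" by (auto elim: Reals_cases)
    have "R w \<in> \<real>" unfolding x by (rule Rreal) (use iw(1) BI x in blast)
    then obtain y where y: "R w = of_real y" by (rule Reals_cases)
    have "\<tau> * y > 0" using s1(2)[of w] iw(1) y by (simp add: B_def dist_commute)
    moreover have "(x - z0) ^ j \<ge> 0" using j(2) by (rule zero_le_even_power)
    ultimately have "(x - z0) ^ j * (\<tau> * y) \<ge> 0" by (metis less_imp_le mult_nonneg_nonneg)
    moreover have "1 / real (i + I) > 0" using I(1) by simp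
    ultimately have "(x - z0) ^ j * (\<tau> * y) + 1 / real (i + I) > 0" by linarith
    moreover have "(x - z0) ^ j * y + \<epsilon> i = 0"
    proof -
      have "of_real ((x - z0) ^ j * y + \<epsilon> i) = (0 :: complex)" using iw(2) by (simp add: F_def y) (simp add: x)
      thus ?thesis by (simp only: of_real_eq_0_iff)
    qed
    hence "\<tau> * ((x - z0) ^ j * y + \<tau> / real (i + I)) = 0" by (simp add: \<epsilon>_def)
    hence "(x - z0) ^ j * (\<tau> * y) + (\<tau> * \<tau>) / real (i + I) = 0" by (simp add: algebra_simps)
    ultimately show False unfolding \<tau>(3) by simp
  qed
  moreover have "f w + of_real (\<epsilon> i) * u w = 0"
  proof -
    have ws: "w \<in> ball ?z s" using iw(1) BI by blast
    have V: "zor_poly u ?z w \<noteq> 0" using r2(4) sb[OF ws] by blast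
    have "f w + of_real (\<epsilon> i) * u w = zor_poly u ?z w * (w - ?z) ^ e * F i w"
      using r1(4)[of w] r2(4)[of w] sb[OF ws] V by (simp add: F_def R_def j(3) power_add field_simps)
    thus ?thesis using iw(2) by simp
  qed
  moreover have "w \<in> ball ?z r" using sb[of w] iw(1) BI r1(2) by blast
  ultimately show ?thesis using that[of "\<epsilon> i" w] eps_lt by blast
qed

context spectral_curve
begin

lemma cnj_G: "cnj (G chi eta z w) = G chi eta (cnj z) (cnj w)"
  by (simp add: G_def Lc_def cnj_poly_cpoly)

lemma GR_member:
  assumes "(chi, eta) \<in> open_square" "z \<notin> \<real>" "w\<^sup>2 = cP0 z" "G chi eta z w = 0"
  shows "(chi, eta) \<in> GR"
proof -
  have ce: "\<bar>chi\<bar> < 1" "\<bar>eta\<bar> < 1" using assms(1) open_square_iff by auto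
  have "z \<noteq> 0" using assms(2) by auto
  hence "crit chi eta (Affine z w)" using crit_affine_iff[OF ce] assms by blast
  moreover have "Affine z w \<notin> C0 \<union> (\<Union>l\<in>{1..g}. C l)"
  proof
    assume "Affine z w \<in> C0 \<union> (\<Union>l\<in>{1..g}. C l)"
    then obtain y where "z = of_real y" by (rule point_on_cycle_real)
    thus False using assms(2) by simp
  qed
  moreover have "Affine z w \<in> spectral_surface (cpoly P0)" using assms(3) unfolding spectral_surface_def by blast
  ultimately show ?thesis unfolding GR_def using assms(1) by blast
qed

text \<open>If \<open>z\<close> and \<open>w\<close> were both real, then
  \<open>P0(z) = w^2 >= 0\<close> would place the point on a cycle. The pair is compared with its
  conjugate, and not \<open>z\<close> alone, because for \<open>chi = 0\<close> the first coordinate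
  is real.\<close>

lemma GR_cases:
  assumes "(chi, eta) \<in> GR"
  obtains z w where "w\<^sup>2 = cP0 z" "z \<noteq> 0" "G chi eta z w = 0" "(cnj z, cnj w) \<noteq> (z, w)"
    "\<bar>chi\<bar> < 1" "\<bar>eta\<bar> < 1"
proof -
  obtain p where sq: "(chi, eta) \<in> open_square" and p: "p \<notin> C0 \<union> (\<Union>l\<in>{1..g}. C l)" "crit chi eta p"
    using assms unfolding GR_def by blast
  have ce: "\<bar>chi\<bar> < 1" "\<bar>eta\<bar> < 1" using sq open_square_iff by auto
  obtain z w where zw: "p = Affine z w" "w\<^sup>2 = cP0 z" "z \<noteq> 0" "G chi eta z w = 0"
    using crit_cases[OF ce p(2)] by blast
  have "(cnj z, cnj w) \<noteq> (z, w)"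
  proof
    assume "(cnj z, cnj w) = (z, w)"
    hence "z \<in> \<real>" "w \<in> \<real>" by (auto simp: Reals_cnj_iff)
    then obtain y v where yv: "z = of_real y" "w = of_real v" by (auto elim!: Reals_cases)
    have "of_real (v\<^sup>2) = complex_of_real (poly P0 y)" using zw(2) yv by simp
    hence "v\<^sup>2 = poly P0 y" by (simp only: of_real_eq_iff)
    hence "poly P0 y \<ge> 0" by (metis zero_le_power2)
    hence "0 \<le> y \<or> (\<exists>l\<in>{1..g}. y \<in> {a l..b l})" using P0_neg[of y] by force
    thus False using real_point_on_cycle[of y w] p(1) zw(1,2) yv(1) by simp
  qed
  thus ?thesis using that zw ce by blast
qed

lemma SS_root_real:
  assumes "(chi, eta) \<in> SS" "poly (cpoly (Q chi eta)) z = 0"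
  obtains y l where "z = of_real y" "l \<in> {1..g}" "y \<in> {a l..b l}"
proof -
  obtain l where sq: "(chi, eta) \<in> open_square" and l: "l \<in> {1..g}" "nK chi eta l \<ge> 4" using assms(1) by (auto simp: SS_def)
  have ce: "\<bar>chi\<bar> < 1" "\<bar>eta\<bar> < 1" using sq open_square_iff by auto
  hence e: "eta \<noteq> 1" "eta \<noteq> -1" by auto
  show ?thesis
  proof (cases "chi = 0")
    case False
    have big: "nK chi eta l > 2" using l(2) by simp
    have "z \<in> \<real>" using count_nK_big(4)[OF False ce(2) l(1) big] assms(2) by blast
    then obtain y where y: "z = of_real y" by (auto elim: Reals_cases)
    hence Q0: "poly (Q chi eta) y = 0" using assms(2) by simp
    have "n0 chi eta = 0" by (rule count_nK_big(2)[OF False ce(2) l(1) big])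
    hence "\<not> y > 0" using roots_in_pos_iff[OF Q_nz[OF e(1)], of "{0<..}" chi] Q0 by (auto simp: n0_def)
    then obtain l' where "l' \<in> {1..g}" "a l' < y" "y < b l'" using Q_root_location[OF False e(2) Q0] by blast
    thus ?thesis using that[OF y, of l'] by auto
  next
    case True
    have zK: "zeta eta \<in> {a l..b l}" using l nK_chi_0[OF l(1) e(1)] True by (auto split: if_splits)
    have "z \<noteq> 0"
    proof
      assume "z = 0"
      hence "poly (cpoly (Q chi eta)) (of_real 0) = 0" using assms(2) by simp
      thus False using Q_0_pos[OF e(2), of chi] by (simp only: cQ_real_root)
    qed
    have "(Lc eta z)\<^sup>2 * cP0 z = 0" using cQ_factor[of z chi eta] assms(2) True by simp
    hence "Lc eta z = 0 \<or> cP0 z = 0" by auto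
    thus ?thesis
    proof
      assume "Lc eta z = 0"
      moreover have "1 - of_real eta \<noteq> (0::complex)" using e(1) by (metis eq_iff_diff_eq_0 of_real_1 of_real_eq_iff)
      ultimately have "z = of_real (zeta eta)" using k_pos by (simp add: Lc_zeta[OF e(1)])
      thus ?thesis using that zK l(1) by blast
    next
      assume "cP0 z = 0"
      then obtain l' where l': "l' \<in> {1..g}" "z = of_real (a l') \<or> z = of_real (b l')"
        using cP0_zero_cases \<open>z \<noteq> 0\<close> by blast
      thus ?thesis using that[of "a l'" l'] that[of "b l'" l'] ab[OF l'(1)] by auto
    qed
  qed
qed

text \<open>Two conjugate critical points that merge produce a double critical point: the equation
  \<open>E2 = 0\<close> is the limit of the divided difference of \<open>G = 0\<close> on the curve.\<close>

lemma frontier_SS: "frontier SS \<subseteq> ERS"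
proof
  fix p assume p: "p \<in> frontier SS"
  obtain chi eta where pe: "p = (chi, eta)" by fastforce
  have pS: "p \<in> SS" using p closed_SS frontier_subset_closed by blast
  have "p \<in> closure (- SS)" using p by (simp add: frontier_closures)
  \<comment> \<open>\<open>DD\<close> is an open neighbourhood of \<open>p\<close>, so the
    approximating points outside \<open>SS\<close> may be taken in \<open>DD - SS\<close>, which is
    the rough region.\<close>
  hence "p \<in> closure (DD \<inter> - SS)" using open_Int_closure_subset[OF open_DD, of "- SS"] pS SS_subset_DD by blast
  hence "p \<in> closure GR" by (simp add: GR_eq Diff_eq)
  then obtain s where s: "\<And>n. s n \<in> GR" "s \<longlonglongrightarrow> p" unfolding closure_sequential by blast
  have sq: "\<bar>chi\<bar> < 1" "\<bar>eta\<bar> < 1" using pS open_square_iff by (auto simp: SS_def pe)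
  define X Y where "X n = fst (s n)" and "Y n = snd (s n)" for n
  have limX: "X \<longlonglongrightarrow> chi" and limY: "Y \<longlonglongrightarrow> eta"
    using tendsto_fst[OF s(2)] tendsto_snd[OF s(2)] by (simp_all add: X_def[abs_def] Y_def[abs_def] pe)
  have "\<exists>z w. w\<^sup>2 = cP0 z \<and> z \<noteq> 0 \<and> G (X n) (Y n) z w = 0 \<and> (cnj z, cnj w) \<noteq> (z, w) \<and> \<bar>Y n\<bar> < 1" for n
  proof -
    have "(X n, Y n) \<in> GR" using s(1)[of n] by (simp add: X_def Y_def)
    thus ?thesis by (rule GR_cases) blast
  qed
  then obtain z w where zw: "\<And>n. (w n)\<^sup>2 = cP0 (z n)" "\<And>n. z n \<noteq> 0" "\<And>n. G (X n) (Y n) (z n) (w n) = 0"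
    "\<And>n. (cnj (z n), cnj (w n)) \<noteq> (z n, w n)" "\<And>n. \<bar>Y n\<bar> < 1" by metis
  have Qz: "poly (cpoly (Q (X n) (Y n))) (z n) = 0" for n by (rule cQ_root_if_G[OF zw(1,3,2)])
  have Y1: "Y n \<noteq> 1" for n using zw(5)[of n] by auto
  have eta1: "eta \<noteq> 1" using sq by auto
  obtain B where B: "\<And>n. norm (z n) \<le> B"
    by (rule bounded_root_sequence[OF coeff_Q_tendsto[OF limX limY] degree_Q(1)[OF Y1] degree_Q(1)[OF eta1] _ Qz]) auto
  have "bounded (range (\<lambda>n. (z n, w n)))"
  proof -
    have "compact ((\<lambda>z. cP0 z) ` cball 0 B)" by (intro compact_continuous_image continuous_intros) simp
    hence "bounded ((\<lambda>z. cP0 z) ` cball 0 B)" by (rule compact_imp_bounded)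
    then obtain B' where B': "\<And>u. u \<in> cball 0 B \<Longrightarrow> norm (cP0 u) \<le> B'"
      unfolding bounded_iff by blast
    have wB: "norm (w n) \<le> B' + 1" for n
    proof -
      have "(norm (w n))\<^sup>2 \<le> B'" using B'[of "z n"] B[of n] zw(1)[of n] by (simp add: norm_power[symmetric])
      moreover have "norm (w n) \<le> (norm (w n))\<^sup>2 + 1"
      proof -
        define t where "t = norm (w n)"
        have "t \<ge> 0" by (simp add: t_def)
        moreover have "2 * t \<le> t\<^sup>2 + 1" using zero_le_power2[of "t - 1"] by (simp add: power2_eq_square algebra_simps)
        ultimately show ?thesis unfolding t_def[symmetric] by linarith
      qed
      ultimately show ?thesis by simp
    qed
    have "range (\<lambda>n. (z n, w n)) \<subseteq> cball 0 B \<times> cball 0 (B' + 1)" using B wB by auto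
    thus ?thesis by (rule bounded_subset[rotated]) (intro bounded_Times bounded_cball)
  qed
  then obtain q f where qf: "strict_mono (f :: nat \<Rightarrow> nat)" "((\<lambda>n. (z n, w n)) \<circ> f) \<longlonglongrightarrow> q"
    using bounded_imp_convergent_subsequence by metis
  define z' w' where "z' = fst q" and "w' = snd q"
  have limz: "(\<lambda>n. z (f n)) \<longlonglongrightarrow> z'" and limw: "(\<lambda>n. w (f n)) \<longlonglongrightarrow> w'"
    using tendsto_fst[OF qf(2)] tendsto_snd[OF qf(2)] by (simp_all add: o_def z'_def w'_def)
  have limX': "(\<lambda>n. X (f n)) \<longlonglongrightarrow> chi" and limY': "(\<lambda>n. Y (f n)) \<longlonglongrightarrow> eta"
    using LIMSEQ_subseq_LIMSEQ[OF limX qf(1)] LIMSEQ_subseq_LIMSEQ[OF limY qf(1)] by (simp_all add: o_def)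
  have limLc: "(\<lambda>n. Lc (Y (f n)) (z (f n))) \<longlonglongrightarrow> Lc eta z'"
    unfolding Lc_def by (intro tendsto_intros limz limY')
  have w2: "w'\<^sup>2 = cP0 z'"
  proof (rule LIMSEQ_unique)
    show "(\<lambda>n. (w (f n))\<^sup>2) \<longlonglongrightarrow> w'\<^sup>2" by (intro tendsto_intros limw)
    show "(\<lambda>n. (w (f n))\<^sup>2) \<longlonglongrightarrow> cP0 z'" unfolding zw(1) by (intro tendsto_intros limz)
  qed
  have G0: "G chi eta z' w' = 0"
  proof (rule LIMSEQ_unique)
    show "(\<lambda>n. G (X (f n)) (Y (f n)) (z (f n)) (w (f n))) \<longlonglongrightarrow> G chi eta z' w'"
      unfolding G_def by (intro tendsto_intros limLc limz limw limX')
  qed (simp add: zw(3))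
  have Q0: "poly (cpoly (Q chi eta)) z' = 0"
  proof (rule LIMSEQ_unique)
    show "(\<lambda>n. poly (cpoly (Q (X (f n)) (Y (f n)))) (z (f n))) \<longlonglongrightarrow> poly (cpoly (Q chi eta)) z'"
      unfolding poly_cQ by (intro tendsto_intros limLc limz limX')
  qed (simp add: Qz)
  obtain y l where y: "z' = of_real y" "l \<in> {1..g}" "y \<in> {a l..b l}"
    using SS_root_real[OF pS[unfolded pe] Q0] by blast
  have z0: "z' \<noteq> 0" using y b_neg[OF y(2)] by auto
  have cz: "cnj z' = z'" using y by simp
  have cw: "cnj w' = w'"
  proof -
    have "w' = of_real (sqrt (poly P0 y)) \<or> w' = - of_real (sqrt (poly P0 y))"
      by (rule square_root_cases) (use w2 y P0_nonneg_cycle[OF y(2,3)] in auto)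
    thus ?thesis by auto
  qed
  obtain F where F: "continuous_on UNIV (\<lambda>u. F (fst u) (snd u))"
    "\<And>a b. cP0 a - cP0 b = (a - b) * F a b" "\<And>a. F a a = poly (pderiv (cpoly P0)) a"
    using divided_difference[of "cpoly P0"] by blast
  obtain K where K: "continuous_on UNIV (\<lambda>u. K (fst u) (snd u))"
    "\<And>a b. poly (pCons 0 (cpoly N)) a - poly (pCons 0 (cpoly N)) b = (a - b) * K a b"
    "\<And>a. K a a = poly (pderiv (pCons 0 (cpoly N))) a"
    using divided_difference[of "pCons 0 (cpoly N)"] by blast
  \<comment> \<open>The difference of \<open>G = 0\<close> at two conjugate points, multiplied by
    \<open>v + cnj v\<close> and divided by \<open>u - cnj u\<close>. The multiplication turns
    \<open>v - cnj v\<close> into the difference of the values of \<open>P0\<close>. At a real point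
    the result is \<open>2 * E2\<close>.\<close>
  define E where "E x e u v = of_nat k * (1 - of_real e) * (v + cnj v)\<^sup>2 / 2
      + (Lc e u + Lc e (cnj u)) / 2 * F u (cnj u) + 2 * of_real x * K u (cnj u) * (v + cnj v)" for x e u v
  have E0: "E x e u v = 0" if h: "v\<^sup>2 = cP0 u" "G x e u v = 0" "(cnj u, cnj v) \<noteq> (u, v)" "e \<noteq> 1" for x e u v
  proof -
    have c2: "(cnj v)\<^sup>2 = cP0 (cnj u)" using h(1) by (metis cnj_poly_cpoly complex_cnj_power)
    have cG: "G x e (cnj u) (cnj v) = 0" using cnj_G[of x e u v] h(2) by simp
    have 1: "(v - cnj v) * (v + cnj v) = (u - cnj u) * F u (cnj u)"
      using h(1) c2 F(2)[of u "cnj u"] by (simp add: power2_eq_square algebra_simps)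
    show ?thesis
    proof (cases "u = cnj u")
      case False
      have Gd: "Lc e u * v - Lc e (cnj u) * cnj v + 2 * of_real x * ((u - cnj u) * K u (cnj u)) = 0"
      proof -
        have K2: "(u - cnj u) * K u (cnj u) = u * cN u - cnj u * cN (cnj u)" using K(2)[of u "cnj u"] by simp
        have "Lc e u * v - Lc e (cnj u) * cnj v + 2 * of_real x * ((u - cnj u) * K u (cnj u))
          = G x e u v - G x e (cnj u) (cnj v)" unfolding K2 G_def by (simp add: algebra_simps)
        thus ?thesis using h(2) cG by simp
      qed
      have Ld: "Lc e u - Lc e (cnj u) = of_nat k * (1 - of_real e) * (u - cnj u)" by (simp add: Lc_def algebra_simps)
      have "Lc e u * v - Lc e (cnj u) * cnj v = (Lc e u - Lc e (cnj u)) * (v + cnj v) / 2 + (Lc e u + Lc e (cnj u)) / 2 * (v - cnj v)"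
        by (simp add: field_simps)
      hence "0 = (v + cnj v) * ((Lc e u - Lc e (cnj u)) * (v + cnj v) / 2 + (Lc e u + Lc e (cnj u)) / 2 * (v - cnj v)
          + 2 * of_real x * ((u - cnj u) * K u (cnj u)))" using Gd by simp
      also have "\<dots> = (Lc e u - Lc e (cnj u)) * (v + cnj v)\<^sup>2 / 2 + (Lc e u + Lc e (cnj u)) / 2 * ((v - cnj v) * (v + cnj v))
          + 2 * of_real x * ((u - cnj u) * K u (cnj u)) * (v + cnj v)" by (simp add: power2_eq_square algebra_simps)
      also have "\<dots> = (u - cnj u) * E x e u v"
        unfolding 1 Ld E_def by (simp add: algebra_simps)
      finally show ?thesis using False by simp
    next
      \<comment> \<open>Both conjugate points lie over the same real \<open>u\<close>, as happens
        for \<open>chi = 0\<close>. Then \<open>v\<close> is purely imaginary, and subtracting the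
        two equations leaves \<open>Lc e u = 0\<close>.\<close>
      case True
      hence vn: "v \<noteq> cnj v" using h(3) by auto
      have "(v - cnj v) * (v + cnj v) = 0" using 1 True by simp
      hence vv: "v + cnj v = 0" using vn by simp
      have "G x e u v - G x e u (cnj v) = 0" using h(2) cG True by simp
      hence "Lc e u * (v - cnj v) = 0" by (simp add: G_def algebra_simps)
      hence "Lc e u = 0" using vn by simp
      thus ?thesis unfolding E_def vv using True by simp
    qed
  qed
  have limpair: "(\<lambda>n. (z (f n), cnj (z (f n)))) \<longlonglongrightarrow> (z', cnj z')" by (intro tendsto_intros limz)
  have limF: "(\<lambda>n. F (z (f n)) (cnj (z (f n)))) \<longlonglongrightarrow> F z' (cnj z')"
    using continuous_on_tendsto_compose[OF F(1) limpair] by simp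
  have limK: "(\<lambda>n. K (z (f n)) (cnj (z (f n)))) \<longlonglongrightarrow> K z' (cnj z')"
    using continuous_on_tendsto_compose[OF K(1) limpair] by simp
  have limLc': "(\<lambda>n. Lc (Y (f n)) (cnj (z (f n)))) \<longlonglongrightarrow> Lc eta (cnj z')"
    unfolding Lc_def by (intro tendsto_intros limz limY')
  have "(\<lambda>n. E (X (f n)) (Y (f n)) (z (f n)) (w (f n))) \<longlonglongrightarrow> E chi eta z' w'"
    unfolding E_def by (intro tendsto_intros limF limK limLc limLc' limw limX' limY') auto
  moreover have "E (X (f n)) (Y (f n)) (z (f n)) (w (f n)) = 0" for n
    by (rule E0) (use zw Y1 in auto)
  ultimately have "E chi eta z' w' = 0" by (simp add: LIMSEQ_const_iff)
  moreover have "E chi eta z' w' = 2 * E2 chi eta z' w'"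
    unfolding E_def E2_def cz cw F(3) K(3) by (simp add: pderiv_pCons power2_eq_square field_simps)
  ultimately have "E2 chi eta z' w' = 0" by simp
  hence "\<exists>j\<ge>2. crit_order chi eta (Affine z' w') j" using crit_double_iff[OF sq] w2 G0 z0 by blast
  moreover have "Affine z' w' \<in> C l" using w2 y by blast
  ultimately show "p \<in> ERS" unfolding ERS_def pe using y(2) sq open_square_iff by blast
qed

section \<open>Splitting of double critical points\<close>

lemma sbr_real:
  assumes v: "v \<noteq> 0" and x: "poly P0 x \<ge> 0"
  shows "sbr (of_real v) (of_real x) = of_real (sgn v * sqrt (poly P0 x))"
proof -
  have "csqrt (of_real (poly P0 x / v\<^sup>2)) = of_real (sqrt (poly P0 x / v\<^sup>2))"
    using x by (intro of_real_sqrt[symmetric] divide_nonneg_nonneg) auto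
  hence "sbr (of_real v) (of_real x) = of_real v * of_real (sqrt (poly P0 x / v\<^sup>2))"
    unfolding sbr_def by simp
  also have "\<dots> = of_real (v * (sqrt (poly P0 x) / \<bar>v\<bar>))" by (simp add: real_sqrt_divide)
  also have "v * (sqrt (poly P0 x) / \<bar>v\<bar>) = sgn v * sqrt (poly P0 x)" using v by (simp add: sgn_if)
  finally show ?thesis .
qed

lemma Lc_shift: "Lc (eta + e) z = Lc eta z + of_real e * (of_nat k * (1 - z))"
  by (simp add: Lc_def algebra_simps)

text \<open>The direction \<open>(1, \<beta>)\<close> is the one in which the critical point stays at \<open>y\<close>; it then ceases to
  be a double one, because \<open>D\<close> does not vanish.\<close>

lemma ERS_direction:
  assumes eta: "eta \<noteq> 1" and y: "y < 0" and v: "v \<noteq> 0" "v\<^sup>2 = poly P0 y"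
    and G0: "G chi eta (of_real y) (of_real v) = 0" and E0: "E2 chi eta (of_real y) (of_real v) = 0"
    and r: "r > 0" "sbr (of_real v) holomorphic_on ball (of_real y) r"
  obtains \<beta> D where "D \<noteq> 0"
    "((\<lambda>z. of_real \<beta> * (of_nat k * (1 - z)) * sbr (of_real v) z + 2 * z * cN z) has_field_derivative of_real D) (at (of_real y))"
    "of_real \<beta> * (of_nat k * (1 - of_real y)) * of_real v + 2 * of_real y * cN (of_real y) = 0"
    "((\<lambda>z. G chi eta z (sbr (of_real v) z)) has_field_derivative 0) (at (of_real y))"
proof -
  define S where "S = sbr (of_real v)"
  define S' where "S' = poly (pderiv P0) y / (2 * v)"
  have w2: "(complex_of_real v)\<^sup>2 = cP0 (of_real y)" using v(2) by (metis of_real_power poly_cpoly_of_real)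
  have v': "complex_of_real v \<noteq> 0" using v by simp
  have yb: "complex_of_real y \<in> ball (of_real y) r" using r by simp
  have S0: "S (of_real y) = of_real v" unfolding S_def by (rule sbr_base[OF v' w2])
  have "2 * S (of_real y) * deriv S (of_real y) = poly (pderiv (cpoly P0)) (of_real y) * deriv (\<lambda>t. t) (of_real y)"
    unfolding S_def by (rule curve_deriv[OF open_ball yb _ r(2)]) (auto simp: sbr_squared[OF v'])
  hence "2 * of_real v * deriv S (of_real y) = of_real (poly (pderiv P0) y)"
    by (simp add: S0 cpoly_pderiv[symmetric] del: cpoly_pderiv)
  hence dS: "deriv S (of_real y) = of_real S'" using v' by (simp add: S'_def field_simps)
  have DS: "(S has_field_derivative of_real S') (at (of_real y))"
    using holomorphic_derivI[OF r(2) open_ball yb, of UNIV] dS by (simp add: S_def)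
  define N' where "N' = poly (pderiv N) y"
  have cN': "poly (pderiv (cpoly N)) (of_real y) = of_real N'"
    by (simp add: N'_def cpoly_pderiv[symmetric] del: cpoly_pderiv)
  \<comment> \<open>The slope for which the perturbation vanishes at \<open>(y, v)\<close>, so that
    the critical point does not move.\<close>
  define \<beta> where "\<beta> = - 2 * y * poly N y / (real k * (1 - y) * v)"
  have k0: "real k \<noteq> 0" "1 - y \<noteq> 0" using k_pos y by auto
  have \<beta>: "\<beta> * (real k * (1 - y)) * v + 2 * y * poly N y = 0"
    using k0 v by (simp add: \<beta>_def)
  define D where "D = \<beta> * real k * ((1 - y) * S' - v) + 2 * (poly N y + y * N')"
  have DU: "((\<lambda>z. of_real \<beta> * (of_nat k * (1 - z)) * S z + 2 * z * cN z) has_field_derivative of_real D) (at (of_real y))"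
    by (rule derivative_eq_intros DS poly_DERIV refl)+ (simp add: S0 cN' D_def algebra_simps)
  define E where "E = real k * (1 - eta) * v + L eta y * S' + 2 * chi * (poly N y + y * N')"
  have DF: "((\<lambda>z. G chi eta z (S z)) has_field_derivative of_real E) (at (of_real y))"
    unfolding G_def Lc_def
    by (rule derivative_eq_intros DS poly_DERIV refl)+ (simp add: S0 cN' E_def L_def algebra_simps)
  have g0: "L eta y * v + 2 * chi * y * poly N y = 0"
    using G0 unfolding G_of_real by (simp only: of_real_eq_0_iff)
  have "E2 chi eta (of_real y) (of_real v) = of_real (v * E)"
  proof -
    have "poly (pderiv (cpoly P0)) (of_real y) = complex_of_real (2 * v * S')"
      using v by (simp add: S'_def cpoly_pderiv[symmetric] del: cpoly_pderiv)
    thus ?thesis unfolding E2_def cN' Lc_of_real by (simp add: E_def power2_eq_square algebra_simps)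
  qed
  hence E0': "E = 0" using E0 v by simp
  \<comment> \<open>If \<open>D = 0\<close>, subtracting \<open>chi\<close> times the perturbation
    from \<open>G\<close> removes \<open>N\<close> and leaves \<open>L c z\<close> times the branch,
    with \<open>c = eta - chi * \<beta>\<close>, vanishing to second order at \<open>y\<close>. Then
    both the value of \<open>L c\<close> at \<open>y\<close> and its slope \<open>k (1 - c)\<close>
    are zero, but \<open>L 1\<close> is the nonzero constant \<open>2 k\<close>.\<close>
  have "D \<noteq> 0"
  proof
    assume D0: "D = 0"
    define c where "c = eta - chi * \<beta>"
    have "real k * ((1 + y) + c * (1 - y)) * v
       = (L eta y * v + 2 * chi * y * poly N y) - chi * (\<beta> * (real k * (1 - y)) * v + 2 * y * poly N y)"
      by (simp add: c_def L_def algebra_simps)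
    hence 1: "(1 + y) + c * (1 - y) = 0" using g0 \<beta> k0 v by simp
    have "real k * ((1 - c) * v + ((1 + y) + c * (1 - y)) * S') = E - chi * D"
      by (simp add: c_def E_def D_def L_def algebra_simps)
    hence "(1 - c) * v = 0" using E0' D0 k0 1 by simp
    hence "c = 1" using v by simp
    thus False using 1 by simp
  qed
  moreover have "of_real \<beta> * (of_nat k * (1 - of_real y)) * of_real v + 2 * of_real y * cN (of_real y) = (0::complex)"
  proof -
    have "of_real (\<beta> * (real k * (1 - y)) * v + 2 * y * poly N y) = (0::complex)" unfolding \<beta> by simp
    thus ?thesis by simp
  qed
  ultimately show ?thesis using that[of D \<beta>] DU DF unfolding E0' S_def by simp
qed

lemma ERS_real_data:
  assumes "(chi, eta) \<in> ERS" "chi \<noteq> 0"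
  obtains l y v where "\<bar>chi\<bar> < 1" "\<bar>eta\<bar> < 1" "l \<in> {1..g}" "a l < y" "y < b l" "v \<noteq> 0" "v\<^sup>2 = poly P0 y"
    "G chi eta (of_real y) (of_real v) = 0" "E2 chi eta (of_real y) (of_real v) = 0"
proof -
  obtain l where sq: "(chi, eta) \<in> open_square" and l: "l \<in> {1..g}" "\<exists>p\<in>C l. \<exists>j\<ge>2. crit_order chi eta p j"
    using assms(1) unfolding ERS_def by blast
  have ce: "\<bar>chi\<bar> < 1" "\<bar>eta\<bar> < 1" using sq open_square_iff by auto
  obtain z w where zw: "Affine z w \<in> T chi eta l" "E2 chi eta z w = 0"
    using l(2) unfolding exists_double_iff_T[OF ce l(1)] by blast
  hence "Affine z w \<in> C l" "crit chi eta (Affine z w)" unfolding T_def by blast+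
  then obtain y w' where y: "Affine z w = Affine (of_real y) w'" "a l < y" "y < b l" "w'\<^sup>2 = cP0 (of_real y)" "w' \<noteq> 0"
    "G chi eta (of_real y) w' = 0" by (rule C_crit[OF ce assms(2) l(1)])
  have pos: "poly P0 y > 0" by (rule P0_pos_cycle[OF l(1) y(2,3)])
  have "w' = of_real (sqrt (poly P0 y)) \<or> w' = - of_real (sqrt (poly P0 y))"
    by (rule square_root_cases) (use y(4) pos in auto)
  then obtain v where v: "w' = of_real v" "v\<^sup>2 = poly P0 y"
  proof
    assume "w' = of_real (sqrt (poly P0 y))"
    thus ?thesis using that[of "sqrt (poly P0 y)"] pos by simp
  next
    assume "w' = - of_real (sqrt (poly P0 y))"
    thus ?thesis using that[of "- sqrt (poly P0 y)"] pos by simp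
  qed
  show ?thesis by (rule that[of l y v]) (use ce l y v zw pos in auto)
qed

lemma closure_by_direction:
  assumes "\<bar>chi\<bar> < 1" "\<bar>eta\<bar> < 1"
    and ex: "\<And>\<epsilon>0. \<epsilon>0 > 0 \<Longrightarrow> (\<And>\<epsilon>. \<bar>\<epsilon>\<bar> < \<epsilon>0 \<Longrightarrow> (chi + \<epsilon> * u1, eta + \<epsilon> * u2) \<in> open_square) \<Longrightarrow>
      \<exists>\<epsilon>. \<bar>\<epsilon>\<bar> < \<epsilon>0 \<and> (chi + \<epsilon> * u1, eta + \<epsilon> * u2) \<in> A"
  shows "(chi, eta) \<in> closure A"
proof -
  let ?f = "\<lambda>\<epsilon>::real. (chi + \<epsilon> * u1, eta + \<epsilon> * u2)"
  have cont: "isCont ?f 0" by (intro continuous_intros)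
  have lim: "(?f \<longlongrightarrow> (chi, eta)) (nhds 0)"
    using cont by (simp add: continuous_at tendsto_nhds_iff)
  have "open open_square" unfolding open_square_def by (intro open_Times) auto
  moreover have "(chi, eta) \<in> open_square" using assms open_square_iff by auto
  ultimately have "eventually (\<lambda>\<epsilon>. ?f \<epsilon> \<in> open_square) (nhds 0)" using topological_tendstoD[OF lim] by blast
  then obtain e1 where e1: "e1 > 0" "\<And>\<epsilon>. dist \<epsilon> 0 < e1 \<Longrightarrow> ?f \<epsilon> \<in> open_square" unfolding eventually_nhds_metric by auto
  show ?thesis unfolding closure_approachable
  proof (intro allI impI)
    fix e :: real assume "e > 0"
    hence "eventually (\<lambda>\<epsilon>. dist (?f \<epsilon>) (chi, eta) < e) (nhds 0)" using lim by (simp add: tendsto_iff)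
    then obtain e2 where e2: "e2 > 0" "\<And>\<epsilon>. dist \<epsilon> 0 < e2 \<Longrightarrow> dist (?f \<epsilon>) (chi, eta) < e" unfolding eventually_nhds_metric by auto
    obtain \<epsilon> where "\<bar>\<epsilon>\<bar> < min e1 e2" "?f \<epsilon> \<in> A"
      using ex[of "min e1 e2"] e1 e2(1) by auto
    thus "\<exists>y\<in>A. dist y (chi, eta) < e" using e2(2)[of \<epsilon>] by (intro bexI[of _ "?f \<epsilon>"]) auto
  qed
qed

text \<open>The direction depends on the parity of the order \<open>n\<close>. For even
  \<open>n\<close> only \<open>eta\<close> is moved, and the perturbation is nonzero at the point.
  For odd \<open>n\<close> the move is along \<open>(1, \<beta>)\<close>, where the perturbation has
  a simple zero and \<open>n - 1\<close> is even. Either way the perturbed equation acquires nonreal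
  solutions.\<close>

lemma ERS_GR_chi_nz:
  assumes "(chi, eta) \<in> ERS" "chi \<noteq> 0"
  shows "(chi, eta) \<in> closure GR"
proof -
  obtain l y v where ce: "\<bar>chi\<bar> < 1" "\<bar>eta\<bar> < 1" and l: "l \<in> {1..g}" and y: "a l < y" "y < b l"
    and v: "v \<noteq> 0" "v\<^sup>2 = poly P0 y"
    and GE: "G chi eta (of_real y) (of_real v) = 0" "E2 chi eta (of_real y) (of_real v) = 0"
    by (rule ERS_real_data[OF assms])
  have e: "eta \<noteq> 1" using ce by auto
  have w2: "(complex_of_real v)\<^sup>2 = cP0 (of_real y)" using v(2) by (metis of_real_power poly_cpoly_of_real)
  have v': "complex_of_real v \<noteq> 0" using v by simp
  have y0: "y < 0" using y b_neg[OF l] by simp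
  define S where "S = sbr (of_real v)"
  obtain r0 where r0: "r0 > 0" "S holomorphic_on ball (of_real y) r0" unfolding S_def using sbr_holomorphic[OF v' w2] by blast
  define r where "r = min r0 (min (y - a l) (b l - y))"
  have r: "r > 0" "S holomorphic_on ball (of_real y) r"
    using r0 y by (auto simp: r_def intro: holomorphic_on_subset)
  have rI: "a l < x \<and> x < b l" if "complex_of_real x \<in> ball (of_real y) r" for x
  proof -
    have "norm (complex_of_real (y - x)) < r" using that by (simp add: dist_norm)
    hence "\<bar>y - x\<bar> < r" by (simp only: norm_of_real)
    thus ?thesis by (auto simp: r_def)
  qed
  have S0: "S (of_real y) = of_real v" unfolding S_def by (rule sbr_base[OF v' w2])
  have Sreal: "S (of_real x) \<in> \<real>" if "complex_of_real x \<in> ball (of_real y) r" for x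
  proof -
    have "poly P0 x \<ge> 0" using P0_pos_cycle[OF l] rI[OF that] by fastforce
    from sbr_real[OF v(1) this] show ?thesis unfolding S_def by simp
  qed
  obtain \<beta> D where D: "D \<noteq> 0"
    "((\<lambda>z. of_real \<beta> * (of_nat k * (1 - z)) * S z + 2 * z * cN z) has_field_derivative of_real D) (at (of_real y))"
    "of_real \<beta> * (of_nat k * (1 - of_real y)) * of_real v + 2 * of_real y * cN (of_real y) = 0"
    using ERS_direction[OF e y0 v GE r[unfolded S_def]] unfolding S_def by blast
  define f where "f z = G chi eta z (S z)" for z
  define n where "n = zo chi eta (of_real y) (of_real v)"
  have n2: "n \<ge> 2" unfolding n_def using zo_props(3)[OF e v' w2] GE by blast
  have holf: "f holomorphic_on ball (of_real y) r"
    unfolding f_def G_def Lc_def by (intro holomorphic_intros r(2))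
  have ordf: "zorder f (of_real y) = int n"
  proof (cases "y = 0")
    case False
    have "zorder f (of_real y) = zorder (\<lambda>t. f (t + of_real y)) 0"
      by (rule zorder_shift)
    also have "\<dots> = int n" unfolding n_def zo_props(1)[OF e v' w2] f_def S_def by (simp add: add.commute)
    finally show ?thesis .
  qed (use y0 in simp)
  have fnz: "\<exists>w\<in>ball (of_real y) r. f w \<noteq> 0"
  proof (rule ccontr)
    assume no: "\<not> ?thesis"
    have "eventually (\<lambda>t. f (of_real y + t) \<noteq> 0) (at 0)"
      using phi_order(2)[OF param_exists_regular[OF w2 v'] e, of chi] by (simp add: f_def S_def)
    moreover have "eventually (\<lambda>t. t \<in> ball 0 r - {0}) (at (0::complex))" using r(1) by (intro eventually_at_in_open) auto
    ultimately have "eventually (\<lambda>t. False) (at (0::complex))"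
      by eventually_elim (use no in \<open>auto simp: dist_norm\<close>)
    thus False by simp
  qed
  have freal: "f (of_real x) \<in> \<real>" if "complex_of_real x \<in> ball (of_real y) r" for x
    unfolding f_def G_def Lc_of_real cN_of_real using Sreal[OF that] by (auto intro!: Reals_add Reals_mult)
  have main: "\<exists>\<epsilon>. \<bar>\<epsilon>\<bar> < \<epsilon>0 \<and> (chi + \<epsilon> * u1, eta + \<epsilon> * u2) \<in> GR"
    if u: "u holomorphic_on ball (of_real y) r" "\<And>x. complex_of_real x \<in> ball (of_real y) r \<Longrightarrow> u (of_real x) \<in> \<real>"
      "\<exists>w\<in>ball (of_real y) r. u w \<noteq> 0" "zorder u (of_real y) = int e" "e < n" "even (n - e)"
      and eq: "\<And>\<epsilon> z. f z + of_real \<epsilon> * u z = G (chi + \<epsilon> * u1) (eta + \<epsilon> * u2) z (S z)"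
      and \<epsilon>0: "\<epsilon>0 > 0" "\<And>\<epsilon>. \<bar>\<epsilon>\<bar> < \<epsilon>0 \<Longrightarrow> (chi + \<epsilon> * u1, eta + \<epsilon> * u2) \<in> open_square" for u e u1 u2 \<epsilon>0
  proof -
    have fu: "f (of_real x) \<in> \<real> \<and> u (of_real x) \<in> \<real>" if "complex_of_real x \<in> ball (of_real y) r" for x
      using freal[OF that] u(2)[OF that] by blast
    obtain \<epsilon> z where *: "\<bar>\<epsilon>\<bar> < \<epsilon>0" "z \<in> ball (of_real y) r" "z \<notin> \<real>" "f z + of_real \<epsilon> * u z = 0"
      using nonreal_zero_of_perturbation[OF r(1) holf u(1) fu fnz u(3) ordf u(4,5,6) \<epsilon>0(1)] by blast
    have "(chi + \<epsilon> * u1, eta + \<epsilon> * u2) \<in> GR"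
      by (rule GR_member[OF \<epsilon>0(2)[OF *(1)] *(3), of "S z"]) (use *(4) eq sbr_squared[OF v'] in \<open>auto simp: S_def\<close>)
    thus ?thesis using *(1) by blast
  qed
  show ?thesis
  proof (cases "even n")
    case True
    show ?thesis
    proof (rule closure_by_direction[OF ce, of 0 1])
      fix \<epsilon>0 :: real assume \<epsilon>0: "\<epsilon>0 > 0" "\<And>\<epsilon>. \<bar>\<epsilon>\<bar> < \<epsilon>0 \<Longrightarrow> (chi + \<epsilon> * 0, eta + \<epsilon> * 1) \<in> open_square"
      let ?u = "\<lambda>z. of_nat k * (1 - z) * S z"
      have hol: "?u holomorphic_on ball (of_real y) r" by (intro holomorphic_intros r(2))
      have u0: "?u (of_real y) \<noteq> 0"
      proof -
        have "1 - complex_of_real y \<noteq> 0" using y0 by (metis less_irrefl of_real_1 of_real_eq_iff right_minus_eq not_one_less_zero)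
        thus ?thesis using k_pos v' by (simp add: S0)
      qed
      show "\<exists>\<epsilon>. \<bar>\<epsilon>\<bar> < \<epsilon>0 \<and> (chi + \<epsilon> * 0, eta + \<epsilon> * 1) \<in> GR"
      proof (rule main[OF hol, of 0 0 1 \<epsilon>0])
        show "?u (of_real x) \<in> \<real>" if "complex_of_real x \<in> ball (of_real y) r" for x
          using Sreal[OF that] by (auto intro!: Reals_mult Reals_diff)
        show "\<exists>w\<in>ball (of_real y) r. ?u w \<noteq> 0" using u0 r(1) by (intro bexI[of _ "of_real y"]) auto
        show "zorder ?u (of_real y) = int 0"
          using zorder_eq_0I[of ?u "of_real y"] u0 hol r(1) by (simp add: analytic_at) (metis centre_in_ball open_ball)
        show "f z + of_real \<epsilon> * ?u z = G (chi + \<epsilon> * 0) (eta + \<epsilon> * 1) z (S z)" for \<epsilon> z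
        proof -
          have "Lc (eta + \<epsilon> * 1) z = Lc eta z + of_real \<epsilon> * (of_nat k * (1 - z))" using Lc_shift[of eta \<epsilon> z] by simp
          thus ?thesis unfolding f_def G_def by (simp only:) (simp add: algebra_simps)
        qed
      qed (use True n2 \<epsilon>0 in auto)
    qed
  next
    case False
    show ?thesis
    proof (rule closure_by_direction[OF ce, of 1 \<beta>])
      fix \<epsilon>0 :: real assume \<epsilon>0: "\<epsilon>0 > 0" "\<And>\<epsilon>. \<bar>\<epsilon>\<bar> < \<epsilon>0 \<Longrightarrow> (chi + \<epsilon> * 1, eta + \<epsilon> * \<beta>) \<in> open_square"
      let ?u = "\<lambda>z. of_real \<beta> * (of_nat k * (1 - z)) * S z + 2 * z * cN z"
      have hol: "?u holomorphic_on ball (of_real y) r" by (intro holomorphic_intros r(2))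
      have u0: "?u (of_real y) = 0" using D(3) by (simp add: S0)
      have du: "deriv ?u (of_real y) = of_real D" by (rule DERIV_imp_deriv[OF D(2)])
      show "\<exists>\<epsilon>. \<bar>\<epsilon>\<bar> < \<epsilon>0 \<and> (chi + \<epsilon> * 1, eta + \<epsilon> * \<beta>) \<in> GR"
      proof (rule main[OF hol, of 1 1 \<beta> \<epsilon>0])
        show "?u (of_real x) \<in> \<real>" if "complex_of_real x \<in> ball (of_real y) r" for x
          using Sreal[OF that] unfolding cN_of_real by (auto intro!: Reals_mult Reals_diff Reals_add)
        show "\<exists>w\<in>ball (of_real y) r. ?u w \<noteq> 0"
        proof (rule ccontr)
          assume no: "\<not> ?thesis"
          have "(?u has_field_derivative 0) (at (of_real y))"
            by (rule has_field_derivative_transform_within_open[of "\<lambda>_. 0" 0 _ "ball (of_real y) r"]) (use no r(1) in auto)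
          hence "of_real D = (0::complex)" using DERIV_unique[OF D(2)] by blast
          thus False using D(1) by simp
        qed
        show "zorder ?u (of_real y) = int 1"
          by (rule zorder_zero_eqI[OF hol open_ball]) (use r(1) u0 du D(1) in auto)
        show "f z + of_real \<epsilon> * ?u z = G (chi + \<epsilon> * 1) (eta + \<epsilon> * \<beta>) z (S z)" for \<epsilon> z
          by (simp add: f_def G_def Lc_shift algebra_simps)
        show "1 < n" using n2 by simp
      qed (use False n2 \<epsilon>0 in auto)
    qed
  qed
qed

text \<open>Along \<open>(1, \<beta>)\<close> the critical point stays at \<open>y\<close> but
  becomes simple. On its arc \<open>G\<close> has opposite signs at the two ends; if it crosses zero
  at \<open>y\<close> in the direction opposite to the overall change, there is one more zero on
  each side of \<open>y\<close>. The other arc contributes the fourth critical point.\<close>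

lemma ERS_GS_chi_nz:
  assumes "(chi, eta) \<in> ERS" "chi \<noteq> 0"
  shows "(chi, eta) \<in> closure GS"
proof -
  obtain l y v where ce: "\<bar>chi\<bar> < 1" "\<bar>eta\<bar> < 1" and l: "l \<in> {1..g}" and y: "a l < y" "y < b l"
    and v: "v \<noteq> 0" "v\<^sup>2 = poly P0 y"
    and GE: "G chi eta (of_real y) (of_real v) = 0" "E2 chi eta (of_real y) (of_real v) = 0"
    by (rule ERS_real_data[OF assms])
  have e: "eta \<noteq> 1" using ce by auto
  have w2: "(complex_of_real v)\<^sup>2 = cP0 (of_real y)" using v(2) by (metis of_real_power poly_cpoly_of_real)
  have v': "complex_of_real v \<noteq> 0" using v by simp
  have y0: "y < 0" using y b_neg[OF l] by simp
  define S where "S = sbr (of_real v)"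
  obtain r where r: "r > 0" "S holomorphic_on ball (of_real y) r" unfolding S_def using sbr_holomorphic[OF v' w2] by blast
  have S0: "S (of_real y) = of_real v" unfolding S_def by (rule sbr_base[OF v' w2])
  define \<sigma> where "\<sigma> = sgn v"
  have \<sigma>: "\<sigma> = 1 \<or> \<sigma> = -1" "\<sigma> \<noteq> 0" "\<sigma>\<^sup>2 = 1" using v by (auto simp: \<sigma>_def sgn_if)
  obtain \<beta> D where D: "D \<noteq> 0"
    "((\<lambda>z. of_real \<beta> * (of_nat k * (1 - z)) * S z + 2 * z * cN z) has_field_derivative of_real D) (at (of_real y))"
    "of_real \<beta> * (of_nat k * (1 - of_real y)) * of_real v + 2 * of_real y * cN (of_real y) = 0"
    "((\<lambda>z. G chi eta z (S z)) has_field_derivative 0) (at (of_real y))"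
    using ERS_direction[OF e y0 v GE r[unfolded S_def]] unfolding S_def by blast
  define F where "F chi' eta' x = L eta' x * (\<sigma> * sqrt (poly P0 x)) + 2 * chi' * x * poly N x" for chi' eta' x
  have contF: "continuous_on A (F chi' eta')" for A chi' eta'
    unfolding F_def L_def by (intro continuous_intros)
  have SF: "G chi' eta' (of_real x) (S (of_real x)) = of_real (F chi' eta' x)" if "poly P0 x \<ge> 0" for chi' eta' x
    unfolding S_def sbr_real[OF v(1) that] G_of_real F_def \<sigma>_def ..
  have posI: "poly P0 x > 0" if "a l < x" "x < b l" for x by (rule P0_pos_cycle[OF l that])
  define A where "A = sgn (chi * a l * poly N (a l))"
  have A: "A = 1 \<or> A = -1" using assms(2) a_neg[OF l] N_nz_end[OF l] by (auto simp: A_def sgn_if)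
  show ?thesis
  proof (rule closure_by_direction[OF ce, of 1 \<beta>])
    fix \<epsilon>0 :: real assume \<epsilon>0: "\<epsilon>0 > 0" "\<And>\<epsilon>. \<bar>\<epsilon>\<bar> < \<epsilon>0 \<Longrightarrow> (chi + \<epsilon> * 1, eta + \<epsilon> * \<beta>) \<in> open_square"
    \<comment> \<open>The sign makes \<open>A * ?F\<close> increase at \<open>y\<close>, while it
      goes from positive at \<open>a l\<close> to negative at \<open>b l\<close>. The bound by half
      of \<open>\<bar>chi\<bar>\<close> preserves the sign of \<open>chi\<close> and with it the
      signs at the ends.\<close>
    define \<epsilon> where "\<epsilon> = sgn (A * D) * (min \<epsilon>0 \<bar>chi\<bar> / 2)"
    have sAD: "sgn (A * D) = 1 \<or> sgn (A * D) = -1" using A D(1) by (auto simp: sgn_if)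
    have \<epsilon>: "\<bar>\<epsilon>\<bar> < \<epsilon>0" "\<bar>\<epsilon>\<bar> < \<bar>chi\<bar>" using sAD \<epsilon>0(1) assms(2) by (auto simp: \<epsilon>_def abs_mult)
    have \<epsilon>D: "A * (\<epsilon> * D) > 0"
    proof -
      have "A * (\<epsilon> * D) = \<bar>A * D\<bar> * (min \<epsilon>0 \<bar>chi\<bar> / 2)" unfolding \<epsilon>_def by (simp add: abs_sgn algebra_simps)
      moreover have "\<bar>A * D\<bar> > 0" "min \<epsilon>0 \<bar>chi\<bar> / 2 > 0" using A D(1) \<epsilon>0(1) assms(2) by auto
      ultimately show ?thesis by (simp only: mult_pos_pos)
    qed
    define chi' eta' where "chi' = chi + \<epsilon> * 1" and "eta' = eta + \<epsilon> * \<beta>"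
    have sq': "(chi', eta') \<in> open_square" unfolding chi'_def eta'_def by (rule \<epsilon>0(2)[OF \<epsilon>(1)])
    have ce': "\<bar>chi'\<bar> < 1" "\<bar>eta'\<bar> < 1" using sq' open_square_iff by auto
    have chi': "chi' \<noteq> 0" "sgn chi' = sgn chi" using \<epsilon>(2) by (auto simp: chi'_def sgn_if)
    let ?F = "F chi' eta'"
    have Geq: "G chi' eta' z (S z) = G chi eta z (S z) + of_real \<epsilon> * (of_real \<beta> * (of_nat k * (1 - z)) * S z + 2 * z * cN z)" for z
      by (simp add: chi'_def eta'_def G_def Lc_shift algebra_simps)
    have DG: "((\<lambda>z. G chi' eta' z (S z)) has_field_derivative of_real (\<epsilon> * D)) (at (of_real y))"
      unfolding Geq by (rule derivative_eq_intros D(2,4) refl)+ simp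
    have "((\<lambda>x::real. G chi' eta' (of_real x) (S (of_real x))) has_vector_derivative of_real (\<epsilon> * D)) (at y)"
    proof -
      have "((\<lambda>x::real. complex_of_real x) has_vector_derivative 1) (at y)"
        by (rule has_vector_derivative_of_real[of "\<lambda>x. x" 1, simplified])
      from field_vector_diff_chain_at[OF this DG] show ?thesis by (simp add: o_def)
    qed
    hence "((\<lambda>x::real. Re (G chi' eta' (of_real x) (S (of_real x)))) has_vector_derivative Re (of_real (\<epsilon> * D))) (at y)"
      by (rule bounded_linear.has_vector_derivative[OF bounded_linear_Re])
    hence "((\<lambda>x::real. Re (G chi' eta' (of_real x) (S (of_real x)))) has_real_derivative \<epsilon> * D) (at y)"
      by (simp add: has_real_derivative_iff_has_vector_derivative)
    hence DF: "(?F has_real_derivative \<epsilon> * D) (at y)"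
      by (rule has_field_derivative_transform_within_open[of _ _ _ "{a l<..<b l}"])
         (use y posI SF in \<open>auto simp: less_imp_le\<close>)
    have F0: "?F y = 0"
    proof -
      have "G chi' eta' (of_real y) (S (of_real y)) = 0" unfolding Geq[of "of_real y"] unfolding S0 GE(1) D(3) by simp
      thus ?thesis using SF[of y chi' eta'] posI[OF y] by simp
    qed
    have DA: "((\<lambda>x. A * ?F x) has_real_derivative A * (\<epsilon> * D)) (at y)" by (rule DERIV_cmult[OF DF])
    obtain d1 where d1: "d1 > 0" "\<And>h. 0 < h \<Longrightarrow> h < d1 \<Longrightarrow> A * ?F y < A * ?F (y + h)"
      using DERIV_pos_inc_right[OF DA \<epsilon>D] by blast
    obtain d2 where d2: "d2 > 0" "\<And>h. 0 < h \<Longrightarrow> h < d2 \<Longrightarrow> A * ?F (y - h) < A * ?F y"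
      using DERIV_pos_inc_left[OF DA \<epsilon>D] by blast
    define h where "h = min (min d1 d2) (min (y - a l) (b l - y)) / 2"
    have h: "0 < h" "h < d1" "h < d2" "a l < y - h" "y + h < b l"
    proof -
      define h2 where "h2 = min (min d1 d2) (min (y - a l) (b l - y))"
      have "0 < h2" "h2 \<le> d1" "h2 \<le> d2" "h2 \<le> y - a l" "h2 \<le> b l - y" "h = h2 / 2"
        using d1(1) d2(1) y by (auto simp: h2_def h_def)
      thus "0 < h" "h < d1" "h < d2" "a l < y - h" "y + h < b l" by linarith+
    qed
    have Fp: "A * ?F (y + h) > 0" "A * ?F (y - h) < 0" using d1(2) d2(2) h F0 by auto
    have Fa: "A * ?F (a l) > 0"
    proof -
      have "?F (a l) = 2 * (chi' * a l * poly N (a l))" using l by (simp add: F_def)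
      moreover have "sgn (chi' * a l * poly N (a l)) = A" unfolding A_def sgn_mult chi'(2) ..
      ultimately have "A * ?F (a l) = 2 * \<bar>chi' * a l * poly N (a l)\<bar>" by (metis abs_sgn mult.commute mult.left_commute)
      thus ?thesis using chi'(1) a_neg[OF l] N_nz_end[OF l] by auto
    qed
    have Fb: "A * ?F (b l) < 0"
    proof -
      have e1: "?F (a l) = 2 * (chi' * a l * poly N (a l))" "?F (b l) = 2 * (chi' * b l * poly N (b l))" using l by (simp_all add: F_def)
      have "(A * ?F (a l)) * (A * ?F (b l)) = (2 * A * chi')\<^sup>2 * (a l * b l) * (poly N (a l) * poly N (b l))"
        unfolding e1 by (simp add: power2_eq_square)
      also have "\<dots> < 0"
      proof (rule mult_pos_neg)
        have "2 * A * chi' \<noteq> 0" using A chi'(1) by auto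
        thus "0 < (2 * A * chi')\<^sup>2 * (a l * b l)" using a_neg[OF l] b_neg[OF l] by (intro mult_pos_pos mult_neg_neg) auto
      qed (rule N_sign_change[OF l])
      finally have "(A * ?F (a l)) * (A * ?F (b l)) < 0" .
      thus ?thesis using Fa by (metis less_imp_le mult_nonneg_nonneg not_le)
    qed
    have cA: "continuous_on U (\<lambda>x. A * ?F x)" for U by (intro continuous_intros contF)
    obtain x1 where x1: "a l \<le> x1" "x1 \<le> y - h" "A * ?F x1 = 0"
      using IVT2'[of "\<lambda>x. A * ?F x" "y - h" 0 "a l"] Fa Fp h cA by fastforce
    obtain x3 where x3: "y + h \<le> x3" "x3 \<le> b l" "A * ?F x3 = 0"
      using IVT2'[of "\<lambda>x. A * ?F x" "b l" 0 "y + h"] Fb Fp h cA by fastforce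
    obtain x4 where x4: "x4 \<in> {a l..b l}" "L eta' x4 * ((- \<sigma>) * sqrt (poly P0 x4)) + 2 * chi' * x4 * poly N x4 = 0"
      using arc_root[OF l] by blast
    have A0: "A \<noteq> 0" using A by auto
    have inT: "Affine (of_real x) (of_real (s * sqrt (poly P0 x))) \<in> T chi' eta' l \<and> poly P0 x > 0"
      if x: "x \<in> {a l..b l}" "s\<^sup>2 = 1" "L eta' x * (s * sqrt (poly P0 x)) + 2 * chi' * x * poly N x = 0" for x s
    proof -
      define w where "w = complex_of_real (s * sqrt (poly P0 x))"
      have "(s * sqrt (poly P0 x))\<^sup>2 = poly P0 x" using P0_nonneg_cycle[OF l x(1)] x(2) by (simp add: power_mult_distrib)
      hence ww: "w\<^sup>2 = cP0 (of_real x)" unfolding w_def by (metis of_real_power poly_cpoly_of_real)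
      have "G chi' eta' (of_real x) w = 0" unfolding w_def G_of_real x(3) by simp
      moreover have "complex_of_real x \<noteq> 0" using x(1) b_neg[OF l] by auto
      ultimately have cr: "crit chi' eta' (Affine (of_real x) w)" using crit_affine_iff[OF ce'] ww by blast
      have inC: "Affine (of_real x) w \<in> C l" using ww x(1) by blast
      obtain y' w' where "Affine (of_real x) w = Affine (of_real y') w'" "a l < y'" "y' < b l"
        by (rule C_crit[OF ce' chi'(1) l inC cr])
      hence "poly P0 x > 0" using posI[of x] by simp
      thus ?thesis using cr inC unfolding T_def w_def by blast
    qed
    have t1: "Affine (of_real x1) (of_real (\<sigma> * sqrt (poly P0 x1))) \<in> T chi' eta' l \<and> poly P0 x1 > 0"
      by (rule inT) (use x1 h \<sigma> A0 in \<open>auto simp: F_def\<close>)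
    have t2: "Affine (of_real y) (of_real (\<sigma> * sqrt (poly P0 y))) \<in> T chi' eta' l \<and> poly P0 y > 0"
      by (rule inT) (use y F0 \<sigma> in \<open>auto simp: F_def\<close>)
    have t3: "Affine (of_real x3) (of_real (\<sigma> * sqrt (poly P0 x3))) \<in> T chi' eta' l \<and> poly P0 x3 > 0"
      by (rule inT) (use x3 h \<sigma> A0 in \<open>auto simp: F_def\<close>)
    have t4: "Affine (of_real x4) (of_real ((- \<sigma>) * sqrt (poly P0 x4))) \<in> T chi' eta' l \<and> poly P0 x4 > 0"
      by (rule inT) (use x4 \<sigma> in auto)
    define q where "q x s = Affine (complex_of_real x) (of_real (s * sqrt (poly P0 x)))" for x s
    have qne: "q x s \<noteq> q x' s'" if "x \<noteq> x'" for x x' s s' using that by (simp add: q_def)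
    have qne4: "q x4 (- \<sigma>) \<noteq> q x \<sigma>" if "poly P0 x > 0" for x
    proof
      assume "q x4 (- \<sigma>) = q x \<sigma>"
      hence xx: "x4 = x" and "complex_of_real ((- \<sigma>) * sqrt (poly P0 x4)) = of_real (\<sigma> * sqrt (poly P0 x))" by (auto simp: q_def simp del: of_real_mult)
      hence "(- \<sigma>) * sqrt (poly P0 x4) = \<sigma> * sqrt (poly P0 x)" by (simp only: of_real_eq_iff)
      thus False using that \<sigma>(2) xx by simp
    qed
    have "{q x1 \<sigma>, q y \<sigma>, q x3 \<sigma>, q x4 (- \<sigma>)} \<subseteq> T chi' eta' l" using t1 t2 t3 t4 unfolding q_def by blast
    moreover have "card {q x1 \<sigma>, q y \<sigma>, q x3 \<sigma>, q x4 (- \<sigma>)} = 4"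
    proof -
      have "x1 \<noteq> y" "x1 \<noteq> x3" "y \<noteq> x3" using x1 x3 h by auto
      hence "q x1 \<sigma> \<noteq> q y \<sigma>" "q x1 \<sigma> \<noteq> q x3 \<sigma>" "q y \<sigma> \<noteq> q x3 \<sigma>" by (simp_all add: qne)
      moreover have "q x1 \<sigma> \<noteq> q x4 (- \<sigma>)" "q y \<sigma> \<noteq> q x4 (- \<sigma>)" "q x3 \<sigma> \<noteq> q x4 (- \<sigma>)"
        using qne4[of x1] qne4[of y] qne4[of x3] t1 t2 t3 by auto
      ultimately show ?thesis by simp
    qed
    ultimately have "card (T chi' eta' l) \<ge> 4"
      using card_mono[OF T_counts(1)[OF ce' chi'(1) l]] by metis
    hence "\<exists>S\<subseteq>C l. card S = 4 \<and> (\<forall>p\<in>S. crit chi' eta' p)"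
      by (rule four_crit_iff[OF T_counts(1)[OF ce' chi'(1) l], THEN iffD2])
    hence "(chi', eta') \<in> GS" unfolding GS_def using sq' l by blast
    thus "\<exists>\<epsilon>. \<bar>\<epsilon>\<bar> < \<epsilon>0 \<and> (chi + \<epsilon> * 1, eta + \<epsilon> * \<beta>) \<in> GS" using \<epsilon>(1) unfolding chi'_def eta'_def by blast
  qed
qed

text \<open>The line \<open>chi = 0\<close> is parametrized by \<open>h\<close>, the inverse of
  \<open>eta\<close> to \<open>zeta eta\<close>. On it the open intervals \<open>(a l, b l)\<close>
  are smooth and the gaps on the negative axis are rough, so an end of an interval is a limit of
  both.\<close>

lemma ERS_chi_0:
  assumes "(0, eta) \<in> ERS"
  shows "(0, eta) \<in> closure GR" "(0, eta) \<in> closure GS"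
proof -
  obtain l where sq: "(0, eta) \<in> open_square" and l: "l \<in> {1..g}" "\<exists>p\<in>C l. \<exists>j\<ge>2. crit_order 0 eta p j"
    using assms unfolding ERS_def by blast
  have ce: "\<bar>eta\<bar> < 1" using sq open_square_iff by auto
  have z: "zeta eta = a l \<or> zeta eta = b l" using chi_0_ERS[OF ce l(1)] l(2) by blast
  define h where "h y = (0::real, (y + 1) / (y - 1))" for y :: real
  have zh: "zeta ((y + 1) / (y - 1)) = y" "\<bar>(y + 1) / (y - 1)\<bar> < 1" if "y < 0" for y
  proof -
    show "zeta ((y + 1) / (y - 1)) = y" using that by (simp add: zeta_def field_simps)
    have "\<bar>y + 1\<bar> < \<bar>y - 1\<bar>" using that by auto
    thus "\<bar>(y + 1) / (y - 1)\<bar> < 1" using that by (simp add: abs_divide)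
  qed
  have hz: "(0, eta) = h (zeta eta)"
  proof -
    have "1 - eta \<noteq> 0" using ce by auto
    thus ?thesis by (simp add: h_def zeta_def field_simps)
  qed
  have conth: "continuous_on {..<0} h" unfolding h_def by (intro continuous_intros) auto
  have hsq: "h y \<in> open_square" if "y < 0" for y using zh(2)[OF that] by (simp add: h_def open_square_iff)
  have neg: "a l < 0" "b l < 0" "a l < b l" using a_neg b_neg ab l(1) by auto
  have GS: "h ` {a l<..<b l} \<subseteq> GS"
  proof
    fix p assume "p \<in> h ` {a l<..<b l}"
    then obtain y where y: "p = h y" "a l < y" "y < b l" by auto
    have y0: "y < 0" using y neg by simp
    have "\<exists>S \<subseteq> C l. card S = 4 \<and> (\<forall>p\<in>S. crit 0 ((y + 1) / (y - 1)) p)"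
      using chi_0_GS[OF zh(2)[OF y0] l(1)] zh(1)[OF y0] y by simp
    thus "p \<in> GS" unfolding GS_def y(1) using hsq[OF y0] l(1) unfolding h_def by blast
  qed
  have cl: "closure {a l<..<b l} = {a l..b l}" using neg by simp
  have "h ` closure {a l<..<b l} \<subseteq> closure (h ` {a l<..<b l})"
  proof (rule image_closure_subset)
    show "continuous_on (closure {a l<..<b l}) h" unfolding cl
      by (rule continuous_on_subset[OF conth]) (use neg in auto)
  qed (simp_all add: closure_subset)
  hence "h ` {a l..b l} \<subseteq> closure (h ` {a l<..<b l})" unfolding cl .
  moreover have "zeta eta \<in> {a l..b l}" using z neg by auto
  ultimately show "(0, eta) \<in> closure GS" using closure_mono[OF GS] unfolding hz by blast
  define V where "V = {y. y < 0 \<and> (\<forall>j\<in>{1..g}. y \<notin> {a j..b j})}"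
  have GR: "h ` V \<subseteq> GR"
  proof
    fix p assume "p \<in> h ` V"
    then obtain y where y: "p = h y" "y < 0" "\<forall>j\<in>{1..g}. y \<notin> {a j..b j}" by (auto simp: V_def)
    let ?e = "(y + 1) / (y - 1)"
    have e1: "?e \<noteq> 1" using zh(2)[OF y(2)] by auto
    have "nK 0 ?e j < 4" if "j \<in> {1..g}" for j
      using nK_chi_0[OF that e1] zh(1)[OF y(2)] y(3) that by simp
    hence "h y \<notin> SS" by (fastforce simp: SS_def h_def)
    moreover have "h y \<in> DD" using m_chi_0[OF zh(2)[OF y(2)]] by (simp add: DD_def h_def)
    ultimately show "p \<in> GR" unfolding GR_eq y(1) by blast
  qed
  have "zeta eta \<in> closure V"
    unfolding closure_approachable
  proof (intro allI impI)
    fix e :: real assume "e > 0"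
    define U where "U = {..<0} - (\<Union>j\<in>{1..g}-{l}. {a j..b j})"
    have "open U" unfolding U_def by (intro open_Diff closed_UN) auto
    moreover have "zeta eta \<in> U"
      unfolding U_def using z neg disj[OF l(1)] by force
    ultimately obtain d where d: "d > 0" "ball (zeta eta) d \<subseteq> U" by (meson openE)
    define t where "t = min d e / 2"
    have t: "t > 0" "t < d" "t < e" using d(1) \<open>e > 0\<close> by (auto simp: t_def)
    obtain y where y: "\<bar>y - zeta eta\<bar> = t" "y \<notin> {a l..b l}"
    proof (cases "zeta eta = a l")
      case True
      thus ?thesis using that[of "a l - t"] t by auto
    next
      case False
      thus ?thesis using that[of "b l + t"] t z by auto
    qed
    have "y \<in> U" using d(2) y(1) t by (auto simp: dist_real_def abs_minus_commute)
    hence "y \<in> V" using y(2) by (auto simp: U_def V_def)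
    thus "\<exists>y\<in>V. dist y (zeta eta) < e" using y(1) t by (auto simp: dist_real_def)
  qed
  then obtain s where s: "\<And>n. s n \<in> V" "s \<longlonglongrightarrow> zeta eta" unfolding closure_sequential by blast
  have "isCont h (zeta eta)" unfolding h_def using zeta_neg[OF ce] by (intro continuous_intros) auto
  hence "(\<lambda>n. h (s n)) \<longlonglongrightarrow> h (zeta eta)" using s(2) by (rule isCont_tendsto_compose)
  moreover have "h (s n) \<in> GR" for n using GR s(1) by blast
  ultimately show "(0, eta) \<in> closure GR" unfolding closure_sequential hz by (intro exI[of _ "\<lambda>n. h (s n)"]) simp
qed

section \<open>Closures, frontiers and separation\<close>

lemma ERS_closure: "ERS \<subseteq> closure GR" "ERS \<subseteq> closure GS"
  using ERS_GR_chi_nz ERS_GS_chi_nz ERS_chi_0 by (metis subrelI)+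

text \<open>Shrinking by a factor \<open>t < 1\<close> towards the origin changes \<open>m\<close>
  into \<open>1 - t + t * m\<close>, which is positive as soon as \<open>m >= 0\<close>.\<close>

lemma DD_closure: "p \<in> closure DD \<longleftrightarrow> m (fst p) (snd p) \<ge> 0"
proof
  assume "p \<in> closure DD"
  moreover have "closed {p. m (fst p) (snd p) \<ge> 0}" by (intro closed_Collect_le continuous_m continuous_on_const)
  moreover have "DD \<subseteq> {p. m (fst p) (snd p) \<ge> 0}" by (auto simp: DD_def)
  ultimately show "m (fst p) (snd p) \<ge> 0" using closure_minimal by blast
next
  assume p: "m (fst p) (snd p) \<ge> 0"
  define s where "s n = (1 - inverse (real (Suc n))) *\<^sub>R p" for n
  have t: "0 \<le> 1 - inverse (real (Suc n))" "1 - inverse (real (Suc n)) < 1" for n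
    by (auto simp: inverse_le_1_iff)
  have "s \<longlonglongrightarrow> (1 - 0) *\<^sub>R p" unfolding s_def by (intro tendsto_intros LIMSEQ_inverse_real_of_nat)
  moreover have "s n \<in> DD" for n
  proof -
    define t' where "t' = 1 - inverse (real (Suc n))"
    have "m (fst (s n)) (snd (s n)) = 1 - t' + t' * m (fst p) (snd p)"
      unfolding s_def t'_def[symmetric] using m_scale[of t' "fst p" "snd p"] t(1)[of n] by (simp add: t'_def)
    moreover have "t' * m (fst p) (snd p) \<ge> 0" using t(1)[of n] p unfolding t'_def by (intro mult_nonneg_nonneg)
    moreover have "t' < 1" using t(2)[of n] by (simp only: t'_def)
    ultimately show ?thesis unfolding DD_def by simp
  qed
  ultimately show "p \<in> closure DD" unfolding closure_sequential by auto
qed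

lemma closed_square_closure:
  assumes "\<bar>chi\<bar> \<le> 1" "\<bar>eta\<bar> \<le> 1" "m chi eta < 0"
  shows "(chi, eta) \<in> closure GF"
proof -
  have op: "open {p. m (fst p) (snd p) < 0}" by (intro open_Collect_less continuous_m continuous_on_const)
  have "closure open_square = {-1..1} \<times> {-1..1::real}" unfolding open_square_def by (simp add: closure_Times)
  hence "(chi, eta) \<in> closure open_square" using assms by (auto simp: abs_le_iff)
  hence "(chi, eta) \<in> closure ({p. m (fst p) (snd p) < 0} \<inter> open_square)"
    using open_Int_closure_subset[OF op, of open_square] assms(3) by auto
  thus ?thesis unfolding GF_eq by (simp add: Int_commute)
qed

text \<open>Inside the square, scaling by \<open>1 + \<epsilon>\<close> turns \<open>m = 0\<close>
  into \<open>m = - \<epsilon>\<close>. At the four boundary points this would leave the square;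
  they are approached along its sides, where \<open>m < 0\<close>, and these points in turn are
  limits of frozen points.\<close>

lemma EFR_closure_GF: "EFR \<subseteq> closure GF"
proof
  fix p assume p: "p \<in> EFR"
  obtain chi eta where pe: "p = (chi, eta)" by fastforce
  have m0: "m chi eta = 0" using p EFR_eq by (simp add: pe)
  have seq: "p \<in> closure GF" if s: "\<And>n. s n \<in> closure GF" "s \<longlonglongrightarrow> p" for s
  proof -
    have "p \<in> closure (closure GF)" unfolding closure_sequential[of p "closure GF"] using s by blast
    thus ?thesis by simp
  qed
  show "p \<in> closure GF"
  proof (cases "\<bar>chi\<bar> < 1 \<and> \<bar>eta\<bar> < 1")
    case True
    show ?thesis unfolding pe
    proof (rule closure_by_direction[of chi eta chi eta])
      fix \<epsilon>0 :: real assume \<epsilon>0: "\<epsilon>0 > 0" "\<And>\<epsilon>. \<bar>\<epsilon>\<bar> < \<epsilon>0 \<Longrightarrow> (chi + \<epsilon> * chi, eta + \<epsilon> * eta) \<in> open_square"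
      define \<epsilon> where "\<epsilon> = \<epsilon>0 / 2"
      have \<epsilon>: "0 < \<epsilon>" "\<bar>\<epsilon>\<bar> < \<epsilon>0" using \<epsilon>0(1) by (auto simp: \<epsilon>_def)
      have "m ((1 + \<epsilon>) * chi) ((1 + \<epsilon>) * eta) = - \<epsilon>" using m_scale[of "1 + \<epsilon>" chi eta] \<epsilon>(1) m0 by simp
      hence "m (chi + \<epsilon> * chi) (eta + \<epsilon> * eta) < 0" using \<epsilon>(1) by (simp add: algebra_simps)
      hence "(chi + \<epsilon> * chi, eta + \<epsilon> * eta) \<in> GF" unfolding GF_eq using \<epsilon>0(2)[OF \<epsilon>(2)] by simp
      thus "\<exists>\<epsilon>. \<bar>\<epsilon>\<bar> < \<epsilon>0 \<and> (chi + \<epsilon> * chi, eta + \<epsilon> * eta) \<in> GF" using \<epsilon>(2) by blast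
    qed (use True in auto)
  next
    case False
    hence "(chi = 0 \<and> \<bar>eta\<bar> = 1) \<or> (\<bar>chi\<bar> = 1 \<and> eta = eta0)" using m0 m_zero_iff[of chi eta] by force
    thus ?thesis
    proof (elim disjE conjE)
      assume c: "chi = 0" "\<bar>eta\<bar> = 1"
      define s where "s n = (inverse (real (Suc n)), eta)" for n
      have i: "\<bar>inverse (real (Suc n))\<bar> \<le> 1" "inverse (real (Suc n)) \<noteq> 0" for n by (auto simp: inverse_le_1_iff)
      show ?thesis
      proof (rule seq[of s])
        show "s n \<in> closure GF" for n unfolding s_def
          using closed_square_closure[of "inverse (real (Suc n))" eta] i[of n] c m_top_bottom[OF c(2) i(1)[of n]] by auto
        show "s \<longlonglongrightarrow> p" unfolding s_def pe c(1) by (intro tendsto_intros LIMSEQ_inverse_real_of_nat)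
      qed
    next
      assume c: "\<bar>chi\<bar> = 1" "eta = eta0"
      \<comment> \<open>The factor \<open>(1 - \<bar>eta0\<bar>) / 2\<close> keeps the second
        coordinate strictly between -1 and 1.\<close>
      define s where "s n = (chi, eta0 + (1 - \<bar>eta0\<bar>) / 2 * inverse (real (Suc n)))" for n
      have i: "\<bar>eta0 + (1 - \<bar>eta0\<bar>) / 2 * inverse (real (Suc n))\<bar> < 1"
        "eta0 + (1 - \<bar>eta0\<bar>) / 2 * inverse (real (Suc n)) \<noteq> eta0" for n
      proof -
        have i1: "0 < inverse (real (Suc n))" "inverse (real (Suc n)) \<le> 1" by (auto simp: inverse_le_1_iff)
        have pos: "(1 - \<bar>eta0\<bar>) / 2 > 0" using eta0_bound by simp
        have "(1 - \<bar>eta0\<bar>) / 2 * inverse (real (Suc n)) \<le> (1 - \<bar>eta0\<bar>) / 2 * 1" using pos i1 by (intro mult_left_mono) auto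
        moreover have "0 < (1 - \<bar>eta0\<bar>) / 2 * inverse (real (Suc n))" using pos i1 by (intro mult_pos_pos)
        ultimately have *: "0 < (1 - \<bar>eta0\<bar>) / 2 * inverse (real (Suc n))"
          "(1 - \<bar>eta0\<bar>) / 2 * inverse (real (Suc n)) \<le> (1 - \<bar>eta0\<bar>) / 2" by simp_all
        have "\<bar>eta0 + x\<bar> < 1 \<and> eta0 + x \<noteq> eta0" if "0 < x" "x \<le> (1 - \<bar>eta0\<bar>) / 2" for x
          using that eta0_bound by (auto simp: abs_if split: if_splits)
        from this[OF *] show "\<bar>eta0 + (1 - \<bar>eta0\<bar>) / 2 * inverse (real (Suc n))\<bar> < 1"
          "eta0 + (1 - \<bar>eta0\<bar>) / 2 * inverse (real (Suc n)) \<noteq> eta0" by blast+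
      qed
      show ?thesis
      proof (rule seq[of s])
        show "s n \<in> closure GF" for n unfolding s_def
          using closed_square_closure[of chi "eta0 + (1 - \<bar>eta0\<bar>) / 2 * inverse (real (Suc n))"] i[of n] c
            m_side_point(1)[OF c(1) i(1)[of n]] by auto
        have "(\<lambda>n. eta0 + (1 - \<bar>eta0\<bar>) / 2 * inverse (real (Suc n))) \<longlonglongrightarrow> eta0 + (1 - \<bar>eta0\<bar>) / 2 * 0"
          by (intro tendsto_intros LIMSEQ_inverse_real_of_nat)
        hence "(\<lambda>n. eta0 + (1 - \<bar>eta0\<bar>) / 2 * inverse (real (Suc n))) \<longlonglongrightarrow> eta0" by simp
        thus "s \<longlonglongrightarrow> p" unfolding s_def pe c(2) by (intro tendsto_intros)
      qed
    qed
  qed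
qed

lemma not_connected_componentI:
  assumes "open U" "open V" "U \<inter> V = {}" "X \<subseteq> U \<union> V" "x \<in> U" "y \<in> V"
  shows "\<not> connected_component X x y"
proof
  assume "connected_component X x y"
  then obtain A where A: "connected A" "A \<subseteq> X" "x \<in> A" "y \<in> A" unfolding connected_component_def by blast
  show False using connectedD[OF A(1) assms(1,2)] A assms by blast
qed

text \<open>A limit of rough points has \<open>m >= 0\<close>. If \<open>m = 0\<close> it lies on
  \<open>EFR\<close>; if \<open>m > 0\<close> and it is not rough, it belongs to \<open>SS\<close>
  and is approached from outside, hence lies on \<open>ERS\<close>. The sign of \<open>m\<close>
  separates frozen from rough points.\<close>

theorem regions:
  "frontier GR = ERS \<union> EFR" "separates EFR GR GF" "separates ERS GR GS"
  "open_square \<subseteq> GF \<union> GR \<union> GS \<union> EFR \<union> ERS"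
proof -
  have EFR_GR: "EFR \<subseteq> closure GR"
  proof
    fix p assume p: "p \<in> EFR"
    hence m0: "m (fst p) (snd p) = 0" unfolding EFR_eq by simp
    hence "p \<in> closure DD" using DD_closure by simp
    moreover have "p \<notin> SS" using SS_subset_DD m0 by (auto simp: DD_def)
    ultimately have "p \<in> closure (- SS \<inter> DD)" using open_Int_closure_subset[of "- SS" DD] closed_SS by (auto simp: open_Compl)
    thus "p \<in> closure GR" unfolding GR_eq by (simp add: Diff_eq Int_commute)
  qed
  have disj1: "EFR \<inter> GR = {}" "EFR \<inter> GF = {}" by (auto simp: EFR_eq GR_eq GF_eq DD_def)
  have disj2: "ERS \<inter> GR = {}" "ERS \<inter> GS = {}" using SS_eq by (auto simp: GR_eq)
  have openGR: "open GR" unfolding GR_eq by (intro open_Diff open_DD closed_SS)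
  have fr: "X \<subseteq> frontier A" if "X \<subseteq> closure A" "X \<inter> A = {}" for X A :: "(real \<times> real) set"
    using that interior_subset[of A] unfolding frontier_def by blast
  show "frontier GR = ERS \<union> EFR"
  proof (rule equalityI)
    show "ERS \<union> EFR \<subseteq> frontier GR"
      using fr[OF EFR_GR disj1(1)] fr[OF ERS_closure(1) disj2(1)] by blast
    show "frontier GR \<subseteq> ERS \<union> EFR"
    proof
      fix p assume "p \<in> frontier GR"
      hence p: "p \<in> closure GR" "p \<notin> GR" using openGR by (auto simp: frontier_def interior_open)
      have "m (fst p) (snd p) \<ge> 0" using p(1) DD_closure[of p] closure_mono[of GR DD] unfolding GR_eq by blast
      then consider "m (fst p) (snd p) = 0" | "p \<in> DD" by (fastforce simp: DD_def)
      thus "p \<in> ERS \<union> EFR"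
      proof cases
        case 1
        thus ?thesis by (simp add: EFR_eq)
      next
        case 2
        hence "p \<in> SS" using p(2) by (simp add: GR_eq)
        moreover have "p \<in> closure (- SS)" using p(1) closure_mono[of GR "- SS"] by (auto simp: GR_eq)
        ultimately have "p \<in> frontier SS" using closure_subset[of SS] by (auto simp: frontier_closures)
        thus ?thesis using frontier_SS by blast
      qed
    qed
  qed
  show "separates EFR GR GF"
    unfolding separates_def
  proof (intro conjI ballI disj1)
    fix p q assume "p \<in> GR" "q \<in> GF"
    hence "p \<in> DD" "q \<in> {p. m (fst p) (snd p) < 0}" by (auto simp: GR_eq GF_eq)
    thus "\<not> connected_component (- EFR) p q"
      by (intro not_connected_componentI[OF open_DD, of "{p. m (fst p) (snd p) < 0}"])
         (auto simp: EFR_eq DD_def intro!: open_Collect_less continuous_m continuous_on_const)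
  qed (use fr[OF EFR_GR disj1(1)] fr[OF EFR_closure_GF disj1(2)] in blast)
  show "separates ERS GR GS"
    unfolding separates_def
  proof (intro conjI ballI disj2)
    \<comment> \<open>Off \<open>ERS\<close> the closed set \<open>SS\<close> has no frontier
      points. So the complement of \<open>ERS\<close> is covered by two disjoint open sets, one
      containing the rough and one the smooth region.\<close>
    have int: "SS - ERS \<subseteq> interior SS"
      using frontier_SS closed_SS by (auto simp: frontier_def)
    fix p q assume "p \<in> GR" "q \<in> GS"
    hence pq: "p \<in> - SS" "q \<in> interior SS" using SS_eq int by (auto simp: GR_eq)
    show "\<not> connected_component (- ERS) p q"
    proof (rule not_connected_componentI[of "- SS" "interior SS"])
      show "open (- SS)" using closed_SS by (rule open_Compl)
      show "- SS \<inter> interior SS = {}" using interior_subset[of SS] by blast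
      show "- ERS \<subseteq> - SS \<union> interior SS" using int by blast
    qed (use pq in auto)
  qed (use fr[OF ERS_closure(1) disj2(1)] fr[OF ERS_closure(2) disj2(2)] in blast)
  show "open_square \<subseteq> GF \<union> GR \<union> GS \<union> EFR \<union> ERS"
  proof
    fix p assume p: "p \<in> open_square"
    consider "m (fst p) (snd p) < 0" | "m (fst p) (snd p) = 0" | "p \<in> DD" unfolding DD_def by fastforce
    thus "p \<in> GF \<union> GR \<union> GS \<union> EFR \<union> ERS"
      by cases (use p SS_eq in \<open>auto simp: GF_eq EFR_eq GR_eq\<close>)
  qed
qed

end

section \<open>The product of the transition matrices\<close>

text \<open>The product of the matrices \<open>z T(\<alpha> m) T(\<beta> m)\<close>, whose entries are polynomials in \<open>z\<close> with
  nonnegative coefficients. Its trace is \<open>(z - 1)\<^sup>k Tr \<Phi>\<close>, and its determinant \<open>(z - 1)\<^sup>2\<^sup>k\<close>.\<close>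

fun entries :: "(nat \<Rightarrow> real) \<Rightarrow> (nat \<Rightarrow> real) \<Rightarrow> nat list \<Rightarrow> real poly \<times> real poly \<times> real poly \<times> real poly" where
  "entries \<alpha> \<beta> [] = (1, 0, 0, 1)"
| "entries \<alpha> \<beta> (i # is) =
    (let (A, B, C, D) = entries \<alpha> \<beta> is; u = \<alpha> i; v = \<beta> i in
      ([:u / v, 1:] * A + [:u + v:] * C, [:u / v, 1:] * B + [:u + v:] * D,
       [:0, 1 / u + 1 / v:] * A + [:v / u, 1:] * C, [:0, 1 / u + 1 / v:] * B + [:v / u, 1:] * D))"

definition nonneg_poly :: "real poly \<Rightarrow> bool" where
  "nonneg_poly p \<longleftrightarrow> (\<forall>i. coeff p i \<ge> 0)"

lemma nonneg_poly_intros: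
  "nonneg_poly 0" "nonneg_poly 1"
  "nonneg_poly p \<Longrightarrow> nonneg_poly q \<Longrightarrow> nonneg_poly (p + q)"
  "nonneg_poly p \<Longrightarrow> nonneg_poly q \<Longrightarrow> nonneg_poly (p * q)"
  "x \<ge> 0 \<Longrightarrow> nonneg_poly p \<Longrightarrow> nonneg_poly (pCons x p)"
  by (auto simp: nonneg_poly_def coeff_mult coeff_pCons split: nat.split intro!: sum_nonneg mult_nonneg_nonneg)

lemma entries_det:
  assumes "\<And>i. i \<in> set is \<Longrightarrow> \<alpha> i > 0 \<and> \<beta> i > 0"
  shows "case entries \<alpha> \<beta> is of (A, B, C, D) \<Rightarrow> A * D - B * C = [:-1, 1:] ^ (2 * length is)"
  using assms
proof (induction "is")
  case (Cons i "is")
  obtain A B C D where e: "entries \<alpha> \<beta> is = (A, B, C, D)" by (cases "entries \<alpha> \<beta> is") auto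
  define u v where "u = \<alpha> i" and "v = \<beta> i"
  have uv: "u > 0" "v > 0" using Cons.prems[of i] by (auto simp: u_def v_def)
  have IH: "A * D - B * C = [:-1, 1:] ^ (2 * length is)" using Cons e by simp
  define p1 p2 p3 p4 where "p1 = [:u / v, 1:]" and "p2 = [:u + v:]" and "p3 = [:0, 1 / u + 1 / v:]" and "p4 = [:v / u, 1:]"
  have "(p1 * A + p2 * C) * (p3 * B + p4 * D) - (p1 * B + p2 * D) * (p3 * A + p4 * C) = (p1 * p4 - p2 * p3) * (A * D - B * C)"
    by (simp add: algebra_simps)
  \<comment> \<open>Both transition factors have determinant \<open>1 - 1/z\<close>, and the scaling
    by \<open>z\<close> multiplies the determinant by \<open>z^2\<close>.\<close>
  also have "p1 * p4 - p2 * p3 = [:-1, 1:]\<^sup>2"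
    using uv by (simp add: p1_def p2_def p3_def p4_def power2_eq_square field_simps)
  finally have "(p1 * A + p2 * C) * (p3 * B + p4 * D) - (p1 * B + p2 * D) * (p3 * A + p4 * C) = [:-1, 1:] ^ (2 * length (i # is))"
    unfolding IH by (simp only: power_add[symmetric]) simp
  thus ?case unfolding entries.simps e Let_def prod.case u_def[symmetric] v_def[symmetric]
      p1_def[symmetric] p2_def[symmetric] p3_def[symmetric] p4_def[symmetric] .
qed simp

text \<open>The bounds are chosen for \<open>(A - D)^2 + 4 B C\<close>: \<open>A\<close> and
  \<open>D\<close> are monic of the same degree, and \<open>B\<close> has one degree less than
  \<open>C\<close>. The empty product is exceptional, because there \<open>B = 0\<close> has degree
  0. Positive values at 0 enter the bound for \<open>eta0\<close>.\<close>

lemma entries_props: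
  assumes "\<And>i. i \<in> set is \<Longrightarrow> \<alpha> i > 0 \<and> \<beta> i > 0"
  shows "case entries \<alpha> \<beta> is of (A, B, C, D) \<Rightarrow>
    nonneg_poly A \<and> nonneg_poly B \<and> nonneg_poly C \<and> nonneg_poly D \<and>
    degree A \<le> length is \<and> degree C \<le> length is \<and> degree D \<le> length is \<and>
    coeff A (length is) = 1 \<and> coeff D (length is) = 1 \<and>
    degree B + 1 \<le> length is + (if is = [] then 1 else 0) \<and>
    poly A 0 > 0 \<and>
    (is \<noteq> [] \<longrightarrow> coeff B (length is - 1) > 0 \<and> coeff C (length is) > 0 \<and> poly B 0 > 0)"
  using assms
proof (induction "is")
  case Nil
  show ?case by (simp add: nonneg_poly_intros)
next
  case (Cons i "is")
  obtain A B C D where e: "entries \<alpha> \<beta> is = (A, B, C, D)" by (cases "entries \<alpha> \<beta> is") auto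
  define u v where "u = \<alpha> i" and "v = \<beta> i"
  have uv: "u > 0" "v > 0" using Cons.prems[of i] by (auto simp: u_def v_def)
  define L where "L = length is"
  have IH: "nonneg_poly A" "nonneg_poly B" "nonneg_poly C" "nonneg_poly D"
    "degree A \<le> L" "degree C \<le> L" "degree D \<le> L" "coeff A L = 1" "coeff D L = 1"
    "degree B + 1 \<le> L + (if is = [] then 1 else 0)" "poly A 0 > 0"
    "is \<noteq> [] \<longrightarrow> coeff B (L - 1) > 0 \<and> coeff C L > 0 \<and> poly B 0 > 0"
    using Cons e by (auto simp: L_def)
  define A' where "A' = [:u / v, 1:] * A + [:u + v:] * C"
  define B' where "B' = [:u / v, 1:] * B + [:u + v:] * D"
  define C' where "C' = [:0, 1 / u + 1 / v:] * A + [:v / u, 1:] * C"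
  define D' where "D' = [:0, 1 / u + 1 / v:] * B + [:v / u, 1:] * D"
  have e': "entries \<alpha> \<beta> (i # is) = (A', B', C', D')"
    by (simp add: e Let_def A'_def B'_def C'_def D'_def u_def v_def)
  have nn: "nonneg_poly A'" "nonneg_poly B'" "nonneg_poly C'" "nonneg_poly D'"
    unfolding A'_def B'_def C'_def D'_def using uv IH
    by (auto intro!: nonneg_poly_intros simp del: mult_pCons_left)
  have dB: "degree B \<le> L" using IH(10) by (cases "is = []") auto
  have dlin: "degree ([:x, y:] * p) \<le> Suc j" if "degree p \<le> j" for x y :: real and p j
    using degree_mult_le[of "[:x, y:]" p] that by (auto intro: order_trans)
  have dcon: "degree ([:x:] * p) \<le> Suc j" if "degree p \<le> j" for x :: real and p j
    using degree_mult_le[of "[:x:]" p] that by auto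
  have deg: "degree A' \<le> Suc L" "degree C' \<le> Suc L" "degree D' \<le> Suc L"
    unfolding A'_def C'_def D'_def using IH(5-7) dB by (auto intro!: degree_add_le dlin dcon simp del: mult_pCons_left)
  have degB: "degree B' \<le> L"
  proof (cases "is = []")
    case True
    hence "B = 0" "D = 1" using e by auto
    thus ?thesis by (simp add: B'_def)
  next
    case False
    hence "degree B \<le> L - 1" "L > 0" using IH(10) by (auto simp: L_def)
    hence "degree ([:u / v, 1:] * B) \<le> L"
      using dlin[of B "L - 1" "u / v" 1] by (simp del: mult_pCons_left)
    moreover have "degree ([:u + v:] * D) \<le> L" using IH(7) degree_mult_le[of "[:u + v:]" D] by simp
    ultimately show ?thesis unfolding B'_def by (intro degree_add_le)
  qed
  have co1: "coeff p (Suc L) = 0" if "degree p \<le> L" for p :: "real poly" using that by (intro coeff_eq_0) simp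
  have cA: "coeff A' (Suc L) = 1" unfolding A'_def using co1[of A] co1[of C] IH by simp
  have BL: "coeff B L = 0"
  proof (cases "is = []")
    case True
    thus ?thesis using e by simp
  next
    case False
    thus ?thesis using IH(10) by (intro coeff_eq_0) auto
  qed
  have cD: "coeff D' (Suc L) = 1" unfolding D'_def using co1[of B] co1[of D] IH BL dB by simp
  have cC: "coeff C' (Suc L) > 0"
  proof -
    have "coeff C L \<ge> 0" using IH(3) by (simp add: nonneg_poly_def)
    thus ?thesis unfolding C'_def using co1[of A] co1[of C] IH uv by (simp add: add_pos_nonneg)
  qed
  have cB: "coeff B' L > 0"
  proof (cases L)
    case 0
    hence "B = 0" "D = 1" using e by (auto simp: L_def)
    thus ?thesis using uv 0 by (simp add: B'_def)
  next
    case (Suc j)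
    have "coeff B' L = u / v * coeff B L + coeff B j + (u + v) * coeff D L" unfolding B'_def Suc by simp
    moreover have "coeff B j \<ge> 0" using IH(2) by (simp add: nonneg_poly_def)
    ultimately show ?thesis using BL IH(9) uv by simp
  qed
  have A0: "poly A' 0 > 0"
  proof -
    have "poly C 0 \<ge> 0" using IH(3) by (simp add: nonneg_poly_def poly_0_coeff_0)
    thus ?thesis unfolding A'_def using IH(11) uv by (simp add: add_pos_nonneg)
  qed
  have B0: "poly B' 0 > 0"
  proof -
    have "poly D 0 \<ge> 0" "poly B 0 \<ge> 0" using IH(2,4) by (simp_all add: nonneg_poly_def poly_0_coeff_0)
    moreover have "poly B 0 > 0 \<or> poly D 0 > 0" using IH(12) e by (cases "is = []") auto
    ultimately show ?thesis unfolding B'_def using uv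
      by (auto intro: add_pos_nonneg add_nonneg_pos)
  qed
  show ?case unfolding e' using nn deg degB cA cD cC cB A0 B0 by (simp add: L_def)
qed

lemma nonneg_poly_pos:
  assumes "nonneg_poly p" "coeff p j > 0" "x > 0"
  shows "poly p x > 0"
proof -
  have "j \<le> degree p" using assms(2) by (intro le_degree) simp
  moreover have "coeff p i * x ^ i \<ge> 0" for i using assms by (auto simp: nonneg_poly_def)
  ultimately show ?thesis unfolding poly_altdef
    using assms(2,3) by (intro sum_pos2[of _ j]) auto
qed

text \<open>The derivative at 1 is the sum of the coefficients weighted by their index, between 0
  and \<open>k\<close>. The top coefficient makes the lower bound strict, the constant one the
  upper. For \<open>k\<close> the number of factors and \<open>p\<close> the trace polynomial this
  gives \<open>\<bar>eta0\<bar> < 1\<close>.\<close>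

lemma nonneg_poly_deriv_bounds:
  assumes "nonneg_poly p" "degree p \<le> k" "coeff p k > 0" "k > 0" "poly p 0 > 0"
  shows "0 < poly (pderiv p) 1" "poly (pderiv p) 1 < real k * poly p 1"
proof -
  have dk: "degree p = k" using assms(2,3) le_degree[of p k] by simp
  have d: "poly (pderiv p) 1 = (\<Sum>i\<le>k. real i * coeff p i)"
  proof -
    have "poly (pderiv p) 1 = (\<Sum>i\<le>degree (pderiv p). coeff (pderiv p) i)" by (simp add: poly_altdef)
    also have "\<dots> = (\<Sum>i<k. coeff (pderiv p) i)"
      using dk assms(4) by (intro sum.cong) (auto simp: degree_pderiv)
    also have "\<dots> = (\<Sum>i<k. real (Suc i) * coeff p (Suc i))" by (simp add: coeff_pderiv)
    also have "\<dots> = (\<Sum>i\<le>k. real i * coeff p i)"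
      by (subst sum.lessThan_Suc_shift[of _ k, unfolded lessThan_Suc_atMost]) simp
    finally show ?thesis .
  qed
  have nn: "coeff p i \<ge> 0" for i using assms(1) by (simp add: nonneg_poly_def)
  show "0 < poly (pderiv p) 1" unfolding d
    by (rule sum_pos2[of _ k]) (use assms nn in auto)
  have "poly p 1 = (\<Sum>i\<le>k. coeff p i)" by (simp add: poly_altdef dk)
  hence kp: "real k * poly p 1 = (\<Sum>i\<le>k. real k * coeff p i)" by (simp add: sum_distrib_left)
  show "poly (pderiv p) 1 < real k * poly p 1" unfolding d kp
  proof (rule sum_strict_mono_ex1)
    show "\<forall>i\<in>{..k}. real i * coeff p i \<le> real k * coeff p i" using nn by (auto intro!: mult_right_mono)
    show "\<exists>i\<in>{..k}. real i * coeff p i < real k * coeff p i"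
      using assms(4,5) by (intro bexI[of _ 0]) (auto simp: poly_0_coeff_0)
  qed simp
qed

unbundle no fps_syntax

definition entry_matrix :: "real poly \<times> real poly \<times> real poly \<times> real poly \<Rightarrow> complex \<Rightarrow> complex^2^2" where
  "entry_matrix e z = (case e of (A, B, C, D) \<Rightarrow>
     vector [vector [poly (cpoly A) z, poly (cpoly B) z], vector [poly (cpoly C) z, poly (cpoly D) z]])"

lemma matrix2_eqI:
  fixes M M' :: "complex^2^2"
  assumes "M $ 1 $ 1 = M' $ 1 $ 1" "M $ 1 $ 2 = M' $ 1 $ 2" "M $ 2 $ 1 = M' $ 2 $ 1" "M $ 2 $ 2 = M' $ 2 $ 2"
  shows "M = M'"
  using assms by (simp add: vec_eq_iff forall_2)

lemma entries_matrix:
  assumes "z \<noteq> 0" "\<And>i. i \<in> set is \<Longrightarrow> \<alpha> i > 0 \<and> \<beta> i > 0"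
  shows "mat (z ^ length is) ** foldr (\<lambda>m A. transition_factor (\<alpha> m) z ** transition_factor (\<beta> m) z ** A) is (mat 1)
      = entry_matrix (entries \<alpha> \<beta> is) z"
  using assms
proof (induction "is")
  case Nil
  show ?case by (rule matrix2_eqI) (simp_all add: entry_matrix_def matrix_matrix_mult_def sum_2 mat_def)
next
  case (Cons i "is")
  obtain A B C D where e: "entries \<alpha> \<beta> is = (A, B, C, D)" by (cases "entries \<alpha> \<beta> is") auto
  define F where "F = foldr (\<lambda>m A. transition_factor (\<alpha> m) z ** transition_factor (\<beta> m) z ** A) is (mat 1)"
  have IH: "mat (z ^ length is) ** F = entry_matrix (A, B, C, D) z" using Cons e by (simp add: F_def)
  have IH': "z ^ length is * F $ 1 $ 1 = poly (cpoly A) z" "z ^ length is * F $ 1 $ 2 = poly (cpoly B) z"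
    "z ^ length is * F $ 2 $ 1 = poly (cpoly C) z" "z ^ length is * F $ 2 $ 2 = poly (cpoly D) z"
    using arg_cong[OF IH, of "\<lambda>M::complex^2^2. (M $ 1) $ 1"] arg_cong[OF IH, of "\<lambda>M::complex^2^2. (M $ 1) $ 2"]
      arg_cong[OF IH, of "\<lambda>M::complex^2^2. (M $ 2) $ 1"] arg_cong[OF IH, of "\<lambda>M::complex^2^2. (M $ 2) $ 2"]
    by (simp_all add: entry_matrix_def matrix_matrix_mult_def sum_2 mat_def)
  have uv: "complex_of_real (\<alpha> i) \<noteq> 0" "complex_of_real (\<beta> i) \<noteq> 0" using Cons.prems(2)[of i] by auto
  have fe: "foldr (\<lambda>m A. transition_factor (\<alpha> m) z ** transition_factor (\<beta> m) z ** A) (i # is) (mat 1)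
      = transition_factor (\<alpha> i) z ** transition_factor (\<beta> i) z ** F" by (simp add: F_def)
  show ?case unfolding fe
    by (rule matrix2_eqI)
      (use uv Cons.prems(1) in \<open>simp_all add: e Let_def entry_matrix_def matrix_matrix_mult_def sum_2 mat_def
        transition_factor_def IH'[symmetric] field_simps\<close>)
qed

lemma Phi_trace:
  assumes "z \<noteq> 0" "z \<noteq> 1" "\<And>i. i \<in> {1..k} \<Longrightarrow> \<alpha> i > 0 \<and> \<beta> i > 0" "entries \<alpha> \<beta> [1..<Suc k] = (A, B, C, D)"
  shows "(z - 1) ^ k * trace (Phi k \<alpha> \<beta> z) = poly (cpoly (A + D)) z"
proof -
  define F where "F = foldr (\<lambda>m A. transition_factor (\<alpha> m) z ** transition_factor (\<beta> m) z ** A) [1..<Suc k] (mat 1)"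
  have "mat (z ^ length [1..<Suc k]) ** F = entry_matrix (entries \<alpha> \<beta> [1..<Suc k]) z"
    unfolding F_def by (rule entries_matrix) (use assms(1,3) in auto)
  hence M: "mat (z ^ k) ** F = entry_matrix (A, B, C, D) z" unfolding assms(4) by (simp del: upt_Suc)
  have t: "z ^ k * F $ 1 $ 1 = poly (cpoly A) z" "z ^ k * F $ 2 $ 2 = poly (cpoly D) z"
    using arg_cong[OF M, of "\<lambda>M::complex^2^2. (M $ 1) $ 1"] arg_cong[OF M, of "\<lambda>M::complex^2^2. (M $ 2) $ 2"]
    by (simp_all add: entry_matrix_def matrix_matrix_mult_def sum_2 mat_def)
  have "trace (Phi k \<alpha> \<beta> z) = (1 / (1 - inverse z) ^ k) * (F $ 1 $ 1 + F $ 2 $ 2)"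
    unfolding Phi_def F_def[symmetric]
    by (simp add: trace_def matrix_matrix_mult_def sum_2 mat_def algebra_simps)
  moreover have "1 - inverse z = (z - 1) / z" using assms(1) by (simp add: field_simps)
  ultimately have "(z - 1) ^ k * trace (Phi k \<alpha> \<beta> z) = z ^ k * (F $ 1 $ 1 + F $ 2 $ 2)"
    using assms(1,2) by (simp add: power_divide)
  thus ?thesis using t by (simp add: distrib_left)
qed

section \<open>Factorization through known zeros\<close>

lemma prod_linear_dvd:
  fixes p :: "'a::idom poly"
  assumes "finite A" "\<And>r. r \<in> A \<Longrightarrow> poly p r = 0"
  shows "(\<Prod>r\<in>A. [:- r, 1:]) dvd p"
  using assms
proof (induction A)
  case (insert r A)
  then obtain q where q: "p = (\<Prod>r\<in>A. [:- r, 1:]) * q" by (auto elim: dvdE)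
  have "poly (\<Prod>r\<in>A. [:- r, 1:]) r \<noteq> 0" using insert by (auto simp: poly_prod)
  moreover have "poly (\<Prod>r\<in>A. [:- r, 1:]) r * poly q r = 0" using insert.prems[of r] by (simp add: q)
  ultimately have "[:- r, 1:] dvd q" by (simp add: poly_eq_0_iff_dvd)
  hence "(\<Prod>r\<in>A. [:- r, 1:]) * [:- r, 1:] dvd p" unfolding q by (rule mult_dvd_mono[OF dvd_refl])
  thus ?case using insert by (simp add: mult.commute del: mult_pCons_left mult_pCons_right)
qed simp

lemma poly_eqI_cofinite:
  fixes p q :: "complex poly"
  assumes "finite F" "\<And>z. z \<notin> F \<Longrightarrow> poly p z = poly q z"
  shows "p = q"
proof (rule ccontr)
  assume "p \<noteq> q"
  hence "finite {z. poly (p - q) z = 0}" by (intro poly_roots_finite) simp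
  hence "finite (F \<union> {z. poly (p - q) z = 0})" using assms(1) by simp
  moreover have "F \<union> {z. poly (p - q) z = 0} = UNIV" using assms(2) by auto
  ultimately show False using infinite_UNIV_char_0 by metis
qed

lemma prod_pair_up:
  fixes f :: "nat \<Rightarrow> 'a::comm_monoid_mult"
  shows "(\<Prod>i\<in>{0..2 * g}. f i) = f 0 * (\<Prod>l\<in>{1..g}. f (2 * l) * f (2 * l - 1))"
proof (induction g)
  case (Suc g)
  have "(\<Prod>i\<in>{0..2 * Suc g}. f i) = (\<Prod>i\<in>{0..2 * g}. f i) * f (2 * g + 1) * f (2 * g + 2)"
    by (simp add: mult.assoc)
  also have "\<dots> = f 0 * ((\<Prod>l\<in>{1..g}. f (2 * l) * f (2 * l - 1)) * (f (2 * Suc g) * f (2 * Suc g - 1)))"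
    unfolding Suc by (simp add: mult_ac)
  also have "(\<Prod>l\<in>{1..g}. f (2 * l) * f (2 * l - 1)) * (f (2 * Suc g) * f (2 * Suc g - 1)) = (\<Prod>l\<in>{1..Suc g}. f (2 * l) * f (2 * l - 1))"
    by (subst prod.cl_ivl_Suc) simp
  finally show ?case .
qed simp

lemma decreasing_seq:
  fixes x :: "nat \<Rightarrow> real"
  assumes "\<And>i. i < M \<Longrightarrow> x (Suc i) < x i" "i < j" "j \<le> M"
  shows "x j < x i"
  using assms(2,3)
proof (induction j)
  case (Suc j)
  have "x (Suc j) < x j" using assms(1)[of j] Suc.prems by simp
  thus ?case using Suc by (cases "i = j") auto
qed simp

context spectral_base
begin

text \<open>On each oval \<open>\<rho>\<^sup>2\<close> is real and equal to \<open>1\<close> at both branch points, so its logarithmic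
  derivative \<open>2 N dz / (w (z - 1))\<close> vanishes in between.\<close>

lemma N_root_in_cycle:
  fixes P q N :: "real poly"
  assumes k: "k \<ge> 1" and PqP0: "P\<^sup>2 - q\<^sup>2 * P0 = smult 4 ([:-1, 1:] ^ (2 * k))" and q0: "q \<noteq> 0"
    and qN: "q * N = pderiv P * [:-1, 1:] - smult (real k) P" and l: "l \<in> {1..g}"
  obtains y where "a l < y" "y < b l" "poly N y = 0"
proof -
  define s where "s y = sqrt (poly P0 y)" for y
  define u where "u y = poly P y + poly q y * s y" for y
  \<comment> \<open>This is \<open>4 * \<rho>^2\<close>. At the two branch points
    \<open>\<rho>\<close> itself is 1 or -1, possibly with different signs; its square has equal
    values, as Rolle's theorem requires.\<close>
  define f where "f y = (u y)\<^sup>2 / (y - 1) ^ (2 * k)" for y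
  have neg: "y - 1 \<noteq> 0" if "y \<in> {a l..b l}" for y using that b_neg[OF l] by auto
  have s2: "(s y)\<^sup>2 = poly P0 y" if "y \<in> {a l..b l}" for y
    unfolding s_def using P0_nonneg_cycle[OF l that] by simp
  have PQ: "(poly P y)\<^sup>2 - (poly q y)\<^sup>2 * poly P0 y = 4 * (y - 1) ^ (2 * k)" for y
    using arg_cong[OF PqP0, of "\<lambda>p. poly p y"] by (simp add: poly_power)
  have u0: "u y \<noteq> 0" if "y \<in> {a l..b l}" for y
  proof
    assume "u y = 0"
    have "u y * (poly P y - poly q y * s y) = (poly P y)\<^sup>2 - (poly q y)\<^sup>2 * (s y)\<^sup>2"
      by (simp add: u_def power2_eq_square algebra_simps)
    hence "4 * (y - 1) ^ (2 * k) = 0" using \<open>u y = 0\<close> PQ[of y] s2[OF that] by simp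
    thus False using neg[OF that] by simp
  qed
  have f_end: "f y = 4" if "y = a l \<or> y = b l" for y
  proof -
    have yK: "y \<in> {a l..b l}" using that ab[OF l] by auto
    have "poly P0 y = 0" using that l by auto
    hence "(u y)\<^sup>2 = 4 * (y - 1) ^ (2 * k)" using PQ[of y] by (simp add: u_def s_def)
    thus ?thesis using neg[OF yK] by (simp add: f_def)
  qed
  have cont: "continuous_on {a l..b l} f"
    unfolding f_def u_def s_def by (intro continuous_intros) (use neg in auto)
  define f' where "f' y = (2 * u y * (poly (pderiv P) y + (poly (pderiv q) y * s y + poly q y * (poly (pderiv P0) y / (2 * s y)))) * (y - 1)
      - 2 * real k * (u y)\<^sup>2) / (y - 1) ^ (2 * k + 1)" for y
  have Df: "(f has_real_derivative f' y) (at y)" if y: "a l < y" "y < b l" for y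
  proof -
    have pos: "poly P0 y > 0" by (rule P0_pos_cycle[OF l y])
    have ny: "y - 1 \<noteq> 0" using neg[of y] y by auto
    have Ds: "(s has_real_derivative poly (pderiv P0) y / (2 * s y)) (at y)"
      unfolding s_def using pos by (auto intro!: derivative_eq_intros poly_DERIV simp: field_simps)
    define u' where "u' = poly (pderiv P) y + (poly (pderiv q) y * s y + poly q y * (poly (pderiv P0) y / (2 * s y)))"
    have Du: "(u has_real_derivative u') (at y)"
      unfolding u_def u'_def by (rule derivative_eq_intros Ds poly_DERIV refl)+ simp
    obtain j where j: "2 * k = Suc j" using k by (cases "2 * k") auto
    have jk: "2 * real k = 1 + real j" using j by linarith
    have "(f has_real_derivative (2 * u y * u' * (y - 1) ^ Suc j - (u y)\<^sup>2 * ((1 + real j) * (y - 1) ^ j)) / ((y - 1) ^ Suc j)\<^sup>2) (at y)"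
      unfolding f_def j
      by (rule derivative_eq_intros Du refl)+ (use ny in \<open>simp_all add: power2_eq_square\<close>)
    moreover have "(2 * u y * u' * (y - 1) ^ Suc j - (u y)\<^sup>2 * ((1 + real j) * (y - 1) ^ j)) / ((y - 1) ^ Suc j)\<^sup>2 = f' y"
    proof -
      define Y where "Y = y - 1"
      have "2 * u y * u' * Y ^ Suc j - (u y)\<^sup>2 * ((1 + real j) * Y ^ j) = Y ^ j * (2 * u y * u' * Y - (1 + real j) * (u y)\<^sup>2)"
        by (simp add: algebra_simps)
      moreover have "(Y ^ Suc j)\<^sup>2 = Y ^ j * Y ^ (Suc j + 1)" by (simp add: power2_eq_square)
      moreover have "Y ^ j \<noteq> 0" using ny by (simp add: Y_def)
      ultimately show ?thesis
        unfolding f'_def u'_def[symmetric] jk j Y_def[symmetric] by (simp only: mult_divide_mult_cancel_left not_False_eq_True if_False)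
    qed
    ultimately show ?thesis by simp
  qed
  obtain y where y: "a l < y" "y < b l" "f' y = 0"
  proof -
    have "\<exists>y>a l. y < b l \<and> DERIV f y :> 0"
    proof (rule Rolle[OF ab[OF l] _ cont])
      show "f (a l) = f (b l)" using f_end by simp
      show "f differentiable (at y)" if "a l < y" "y < b l" for y
        using Df[OF that] by (auto simp: real_differentiable_def)
    qed
    thus ?thesis using that Df DERIV_unique by blast
  qed
  have yK: "y \<in> {a l..b l}" using y by auto
  have sy: "s y \<noteq> 0" using P0_pos_cycle[OF l y(1,2)] by (simp add: s_def)
  define u' where "u' = poly (pderiv P) y + (poly (pderiv q) y * s y + poly q y * (poly (pderiv P0) y / (2 * s y)))"
  have "2 * u y * (u' * (y - 1) - real k * u y) = 0"
    using y(3) neg[OF yK] unfolding f'_def u'_def[symmetric] by (simp add: power2_eq_square algebra_simps)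
  hence e1: "u' * (y - 1) = real k * u y" using u0[OF yK] by simp
  have qN': "poly q y * poly N y = poly (pderiv P) y * (y - 1) - real k * poly P y"
    using arg_cong[OF qN, of "\<lambda>p. poly p y"] by (simp add: algebra_simps)
  have NP': "poly N y * poly P y = (poly (pderiv q) y * poly P0 y + poly q y * poly (pderiv P0) y / 2) * (y - 1) - real k * (poly q y * poly P0 y)"
    using arg_cong[OF log_derivative_identity[OF k PqP0 q0 qN], of "\<lambda>p. poly p y"] by (simp add: field_simps)
  \<comment> \<open>Multiplication by \<open>s y\<close> clears the denominator of
    \<open>u'\<close>. The terms with and without \<open>s y\<close> are then given by
    \<open>qN'\<close> and \<open>NP'\<close>, and everything except \<open>N * u\<close>
    cancels.\<close>
  have "s y * (u' * (y - 1)) = s y * (poly (pderiv P) y * (y - 1)) + (poly (pderiv q) y * (s y)\<^sup>2 + poly q y * poly (pderiv P0) y / 2) * (y - 1)"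
    using sy by (simp add: u'_def power2_eq_square field_simps)
  also have "\<dots> = s y * (poly q y * poly N y + real k * poly P y) + (poly N y * poly P y + real k * (poly q y * poly P0 y))"
    unfolding s2[OF yK] qN' NP' by simp
  also have "\<dots> = poly N y * u y + real k * (s y * u y)"
    unfolding s2[OF yK, symmetric] u_def by (simp add: power2_eq_square algebra_simps)
  finally have "poly N y * u y = 0" unfolding e1 by simp
  hence "poly N y = 0" using u0[OF yK] by simp
  thus ?thesis using that y by blast
qed

end

section \<open>The given polynomials satisfy the assumptions of the locale\<close>

theorem proposition2p7:
  fixes k k' :: nat
    and \<alpha> \<beta> :: "nat \<Rightarrow> real"
    and p q p0 :: "complex poly"
    and x :: "nat \<Rightarrow> real"
  assumes "k \<ge> 1"
    and "\<And>m. m \<in> {1..k} \<Longrightarrow> \<alpha> m > 0"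
    and "\<And>m. m \<in> {1..k} \<Longrightarrow> \<beta> m > 0"
    and "(\<Prod>m=1..k. \<alpha> m) = (\<Prod>m=1..k. \<beta> m)"
    and "\<And>z. z \<noteq> 0 \<Longrightarrow> z \<noteq> 1 \<Longrightarrow>
           poly p z = ((z - 1) ^ k * trace (Phi k \<alpha> \<beta> z)) ^ 2 - 4 * (z - 1) ^ (2 * k)"
    and "p = q ^ 2 * p0"
    and "rsquarefree q" and "rsquarefree p0" and "lead_coeff q = 1"
    and "k' \<ge> 1"
    and "x 0 = 0"
    and "\<And>i. i < 2 * (k' - 1) \<Longrightarrow> x (Suc i) < x i"
    and "{z. poly p0 z = 0} = (\<lambda>i. complex_of_real (x i)) ` {0..2 * (k' - 1)}"
  shows
    "let \<rho> = rho k \<alpha> \<beta> q;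
         GF = frozen_region k \<rho> p0 x;
         GR = rough_region k \<rho> p0 x k';
         GS = smooth_region k \<rho> p0 x k';
         EFR = frozen_rough_curve k \<rho> p p0 x;
         ERS = (\<Union>l\<in>{1..k' - 1}. rough_smooth_curve k \<rho> p0 x l)
     in frontier GR = ERS \<union> EFR
        \<and> separates EFR GR GF
        \<and> separates ERS GR GS
        \<and> open_square \<subseteq> GF \<union> GR \<union> GS \<union> EFR \<union> ERS"
proof -
  obtain A B C D where e: "entries \<alpha> \<beta> [1..<Suc k] = (A, B, C, D)" by (cases "entries \<alpha> \<beta> [1..<Suc k]") auto
  have pos: "\<alpha> i > 0 \<and> \<beta> i > 0" if "i \<in> set [1..<Suc k]" for i using assms(2,3)[of i] that by auto
  have len: "length [1..<Suc k] = k" "[1..<Suc k] \<noteq> []" using assms(1) by auto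
  have det: "A * D - B * C = [:-1, 1:] ^ (2 * k)"
    using entries_det[of "[1..<Suc k]" \<alpha> \<beta>, OF pos] unfolding e len(1) by simp
  have ent: "nonneg_poly A" "nonneg_poly B" "nonneg_poly C" "nonneg_poly D" "degree A \<le> k" "degree C \<le> k" "degree D \<le> k"
    "coeff A k = 1" "coeff D k = 1" "degree B + 1 \<le> k" "poly A 0 > 0" "coeff B (k - 1) > 0" "coeff C k > 0"
    using entries_props[of "[1..<Suc k]" \<alpha> \<beta>, OF pos] len(2) unfolding e len(1) by auto
  define P where "P = A + D"
  define pr where "pr = P\<^sup>2 - smult 4 ([:-1, 1:] ^ (2 * k))"
  \<comment> \<open>The discriminant of the characteristic polynomial of a 2 by 2 matrix. In this
    form degree and leading coefficient can be read off, since the term \<open>4 B C\<close>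
    dominates.\<close>
  have pr_eq: "pr = (A - D)\<^sup>2 + smult 4 (B * C)"
  proof -
    have "smult 4 ([:-1, 1:] ^ (2 * k)) = smult 4 (A * D) - smult 4 (B * C)" unfolding det[symmetric] by (simp add: smult_diff_right)
    moreover have "P\<^sup>2 = (A - D)\<^sup>2 + smult 4 (A * D)"
      unfolding poly_eq_poly_eq_iff[symmetric] by (rule ext) (simp add: P_def power2_eq_square algebra_simps)
    ultimately show ?thesis unfolding pr_def by simp
  qed
  have P_props: "nonneg_poly P" "degree P \<le> k" "coeff P k = 2" "poly P 0 > 0"
  proof -
    show "nonneg_poly P" unfolding P_def by (intro nonneg_poly_intros ent)
    show "degree P \<le> k" unfolding P_def by (intro degree_add_le ent)
    show "coeff P k = 2" unfolding P_def using ent(8,9) by simp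
    have "poly D 0 \<ge> 0" using ent(4) by (simp add: nonneg_poly_def poly_0_coeff_0)
    thus "poly P 0 > 0" unfolding P_def using ent(11) by simp
  qed
  have P1pos: "poly P 1 > 0" by (rule nonneg_poly_pos[OF P_props(1), of k]) (use P_props(3) in auto)
  have dP: "0 < poly (pderiv P) 1" "poly (pderiv P) 1 < real k * poly P 1"
    using nonneg_poly_deriv_bounds[OF P_props(1,2) _ _ P_props(4)] P_props(3) assms(1) by auto
  have deg_pr: "degree pr = 2 * k - 1" and lead_pr: "lead_coeff pr > 0"
  proof -
    have dB: "degree B = k - 1" using ent(10,12) le_degree[of B "k - 1"] by simp
    have dC: "degree C = k" using ent(6,13) le_degree[of C k] by simp
    have BC0: "B \<noteq> 0" "C \<noteq> 0" using ent(12,13) by auto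
    have dBC: "degree (smult 4 (B * C)) = 2 * k - 1" using degree_mult_eq[OF BC0] assms(1) by (simp add: dB dC)
    \<comment> \<open>Both diagonal entries are monic of degree \<open>k\<close>, so the leading
      terms cancel.\<close>
    have "degree (A - D) < k \<or> A - D = 0"
    proof (cases "A - D = 0")
      case False
      have "degree (A - D) \<le> k" by (intro degree_diff_le ent)
      moreover have "degree (A - D) \<noteq> k" using leading_coeff_0_iff[of "A - D"] False ent(8,9) by auto
      ultimately show ?thesis by simp
    qed simp
    hence "degree ((A - D)\<^sup>2) < 2 * k - 1"
      using degree_power_le[of "A - D" 2] assms(1) by (cases "A - D = 0") auto
    hence lt: "degree ((A - D)\<^sup>2) < degree (smult 4 (B * C))" unfolding dBC .
    show "degree pr = 2 * k - 1" unfolding pr_eq degree_add_eq_right[OF lt] by (rule dBC)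
    have "lead_coeff pr = lead_coeff (smult 4 (B * C))" unfolding pr_eq by (rule lead_coeff_add_le[OF lt])
    also have "\<dots> = 4 * (coeff B (k - 1) * coeff C k)" by (simp only: lead_coeff_smult lead_coeff_mult dB dC)
    finally show "lead_coeff pr > 0" using ent(12,13) by simp
  qed
  have trP: "(z - 1) ^ k * trace (Phi k \<alpha> \<beta> z) = poly (cpoly P) z" if "z \<noteq> 0" "z \<noteq> 1" for z
    unfolding P_def by (rule Phi_trace[OF that _ e]) (use assms(2,3) in auto)
  have p_eq: "p = cpoly pr"
  proof (rule poly_eqI_cofinite[of "{0, 1}"])
    fix z :: complex assume "z \<notin> {0, 1}"
    hence z: "z \<noteq> 0" "z \<noteq> 1" by auto
    show "poly p z = poly (cpoly pr) z"
      unfolding assms(5)[OF z] trP[OF z] by (simp add: pr_def)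
  qed simp
  define g where "g = k' - 1"
  have q0: "q \<noteq> 0" using assms(9) by auto
  have p00: "p0 \<noteq> 0" using assms(8) by (auto simp: rsquarefree_def)
  define c where "c = lead_coeff pr"
  have c_pos: "c > 0" using lead_pr by (simp add: c_def)
  have "lead_coeff p = lead_coeff p0" unfolding assms(6) by (simp add: lead_coeff_mult lead_coeff_power assms(9))
  hence lead_p0: "lead_coeff p0 = of_real c" unfolding p_eq c_def by simp
  have dec: "x j < x i" if "i < j" "j \<le> 2 * g" for i j
    by (rule decreasing_seq[of "2 * g" x]) (use assms(12) that in \<open>auto simp: g_def\<close>)
  have injx: "inj_on (\<lambda>i. complex_of_real (x i)) {0..2 * g}"
  proof (rule inj_onI)
    fix i j assume ij: "i \<in> {0..2 * g}" "j \<in> {0..2 * g}" "complex_of_real (x i) = of_real (x j)"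
    thus "i = j" using dec[of i j] dec[of j i] by (cases i j rule: linorder_cases) auto
  qed
  define a b where "a l = x (2 * l)" and "b l = x (2 * l - 1)" for l
  define P1 where "P1 = smult c (\<Prod>l\<in>{1..g}. [:- a l, 1:] * [:- b l, 1:])"
  define P0 where "P0 = pCons 0 P1"
  have P0_prod: "P0 = smult c (\<Prod>i\<in>{0..2 * g}. [:- x i, 1:])"
    unfolding prod_pair_up P0_def P1_def a_def b_def assms(11) by (simp del: mult_pCons_right add: mult_smult_right)
  have p0_eq: "p0 = cpoly P0"
  proof -
    have "p0 = smult (lead_coeff p0) (\<Prod>z|poly p0 z = 0. [:- z, 1:])"
      using complex_poly_decompose_rsquarefree[OF assms(8)] by simp
    also have "\<dots> = smult (of_real c) (\<Prod>i\<in>{0..2 * g}. [:- of_real (x i), 1:])"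
      unfolding lead_p0 assms(13) g_def[symmetric] by (subst prod.reindex[OF injx]) simp
    also have "\<dots> = cpoly P0" unfolding P0_prod by simp
    finally show ?thesis .
  qed
  have ab: "a l < b l" if "l \<in> {1..g}" for l unfolding a_def b_def by (rule dec) (use that in auto)
  have b_neg: "b l < 0" if "l \<in> {1..g}" for l
    using dec[of 0 "2 * l - 1"] that assms(11) unfolding b_def by auto
  have disj0: "{a l..b l} \<inter> {a l'..b l'} = {}" if "l \<in> {1..g}" "l' \<in> {1..g}" "l < l'" for l l'
  proof -
    have "2 * l < 2 * l' - 1" "2 * l' - 1 \<le> 2 * g" using that by auto
    from dec[OF this] show ?thesis unfolding a_def b_def by auto
  qed
  have disj: "{a l..b l} \<inter> {a l'..b l'} = {}" if "l \<in> {1..g}" "l' \<in> {1..g}" "l \<noteq> l'" for l l'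
    using disj0[of l l'] disj0[of l' l] that by (cases l l' rule: linorder_cases) auto
  interpret base: spectral_base g a b c P1 P0
    by unfold_locales (use c_pos ab b_neg disj in \<open>auto simp: P1_def P0_def\<close>)
  \<comment> \<open>Since \<open>p\<close> and \<open>p0\<close> are real, the conjugate of
    \<open>q\<close> has the same square as \<open>q\<close>, so it is \<open>q\<close> or
    \<open>- q\<close>. The leading coefficient 1 rules out the sign.\<close>
  obtain qr where q_eq: "q = cpoly qr"
  proof -
    define qc where "qc = map_poly cnj q"
    have qcx: "poly qc z = cnj (poly q (cnj z))" for z unfolding qc_def by simp
    have "qc\<^sup>2 * p0 = q\<^sup>2 * p0"
      unfolding poly_eq_poly_eq_iff[symmetric]
    proof
      fix z
      have "poly (qc\<^sup>2 * p0) z = cnj (poly (q\<^sup>2 * p0) (cnj z))"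
        by (simp add: qcx p0_eq cnj_poly_cpoly poly_power)
      also have "\<dots> = poly (q\<^sup>2 * p0) z" unfolding assms(6)[symmetric] p_eq cnj_poly_cpoly by simp
      finally show "poly (qc\<^sup>2 * p0) z = poly (q\<^sup>2 * p0) z" .
    qed
    hence "qc\<^sup>2 = q\<^sup>2" using p00 by simp
    hence "qc = q \<or> qc = - q" by (simp add: power2_eq_iff)
    moreover have "coeff qc (degree q) = 1" unfolding qc_def by (simp add: coeff_map_poly assms(9))
    moreover have "coeff (- q) (degree q) = -1" by (simp add: assms(9))
    ultimately have "qc = q" by auto
    hence "coeff q i \<in> \<real>" for i
      using coeff_map_poly[of cnj q i] by (simp add: qc_def Reals_cnj_iff)
    thus ?thesis using cpoly_of_cnj_closed that by blast
  qed
  have qr0: "qr \<noteq> 0" using q0 q_eq by auto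
  have pr_fac: "pr = qr\<^sup>2 * P0"
  proof -
    have "cpoly pr = cpoly (qr\<^sup>2 * P0)" using assms(6) unfolding p_eq q_eq p0_eq by simp
    thus ?thesis by (simp only: cpoly_eq_iff)
  qed
  have PqP0: "P\<^sup>2 - qr\<^sup>2 * P0 = smult 4 ([:-1, 1:] ^ (2 * k))" unfolding pr_fac[symmetric] pr_def by simp
  define F where "F = pderiv P * [:-1, 1:] - smult (real k) P"
  have Xd: "pderiv ([:-1, 1:] ^ (2 * k)) * [:-1, 1:] = smult (2 * real k) ([:-1, 1:] ^ (2 * k) :: real poly)"
    and Xd1: "poly (pderiv ([:-1, 1:] ^ (2 * k))) 1 = (0::real)"
  proof -
    define X :: "real poly" where "X = [:-1, 1:]"
    obtain j where j: "2 * k = Suc j" "j > 0" using assms(1) by (cases "2 * k") auto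
    have jk: "2 * real k = 1 + real j" using j by linarith
    have dX: "pderiv X = 1" by (simp add: X_def pderiv_pCons)
    have "pderiv (X ^ (2 * k)) * X = smult (2 * real k) (X ^ (2 * k))"
      unfolding j(1) pderiv_power_Suc dX using jk by (simp add: mult_ac)
    thus "pderiv ([:-1, 1:] ^ (2 * k)) * [:-1, 1:] = smult (2 * real k) ([:-1, 1:] ^ (2 * k) :: real poly)"
      unfolding X_def .
    have "poly (pderiv (X ^ (2 * k))) 1 = 0"
      unfolding j(1) pderiv_power_Suc dX using j(2) by (simp add: X_def poly_power)
    thus "poly (pderiv ([:-1, 1:] ^ (2 * k))) 1 = (0::real)" unfolding X_def .
  qed
  \<comment> \<open>The derivative identity \<open>2 P F = (z - 1) pr' - 2 k pr\<close> holds
    because \<open>(z - 1)^(2 k)\<close> satisfies the equation with right side 0. The square of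
    \<open>qr\<close> divides \<open>pr\<close>, so \<open>qr\<close> divides both terms.\<close>
  have qr_dvd: "qr dvd P * F"
  proof -
    define X :: "real poly" where "X = [:-1, 1:]"
    have "pderiv pr * X - smult (2 * real k) pr = 2 * P * pderiv P * X - smult 4 (pderiv (X ^ (2 * k)) * X) - smult (2 * real k) (P\<^sup>2) + smult (2 * real k) (smult 4 (X ^ (2 * k)))"
      unfolding pr_def X_def[symmetric] power2_eq_square
      by (simp add: pderiv_diff pderiv_mult pderiv_smult smult_diff_right) (simp add: algebra_simps)
    also have "\<dots> = 2 * P * pderiv P * X - smult (2 * real k) (P\<^sup>2)"
      unfolding Xd[folded X_def] by (simp add: mult.commute)
    also have "\<dots> = smult 2 (P * F)"
      unfolding F_def X_def[symmetric] poly_eq_poly_eq_iff[symmetric]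
      by (rule ext) (simp add: power2_eq_square algebra_simps)
    finally have eq: "smult 2 (P * F) = pderiv pr * X - smult (2 * real k) pr" by simp
    have "qr dvd pr" unfolding pr_fac power2_eq_square mult.assoc by simp
    moreover have "qr dvd pderiv pr"
      unfolding pr_fac power2_eq_square pderiv_mult by (intro dvd_add dvd_mult dvd_mult2 dvd_refl)
    ultimately have "qr dvd smult 2 (P * F)" unfolding eq by (intro dvd_diff dvd_mult2 dvd_smult)
    thus ?thesis by (simp add: dvd_smult_iff)
  qed
  \<comment> \<open>A common zero of \<open>P\<close> and \<open>q\<close> would make
    \<open>(z - 1)^(2 k)\<close> vanish, hence be 1, but \<open>P(1) > 0\<close>.\<close>
  have P_root_nz: "poly (cpoly P) r \<noteq> 0" if "poly q r = 0" for r
  proof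
    assume z: "poly (cpoly P) r = 0"
    have "poly (cpoly (P\<^sup>2 - qr\<^sup>2 * P0)) r = 4 * (r - 1) ^ (2 * k)" unfolding PqP0 by (simp add: poly_power)
    hence "(r - 1) ^ (2 * k) = 0" using z that[unfolded q_eq] by (simp add: poly_power)
    hence "r = 1" by simp
    thus False using z P1pos by simp
  qed
  have "q dvd cpoly F"
  proof -
    obtain M where M: "P * F = qr * M" using qr_dvd by (auto elim: dvdE)
    have "poly (cpoly F) r = 0" if "poly q r = 0" for r
    proof -
      have "poly (cpoly P) r * poly (cpoly F) r = poly (cpoly (qr * M)) r" unfolding M[symmetric] by simp
      also have "\<dots> = 0" using that by (simp add: q_eq)
      finally show ?thesis using P_root_nz[OF that] by simp
    qed
    \<comment> \<open>The zeros of \<open>q\<close> are simple, so vanishing of \<open>F\<close> at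
      each of them is enough for divisibility.\<close>
    hence "(\<Prod>r\<in>{r. poly q r = 0}. [:- r, 1:]) dvd cpoly F"
      using q0 by (intro prod_linear_dvd) (auto simp: poly_roots_finite)
    also have "(\<Prod>r\<in>{r. poly q r = 0}. [:- r, 1:]) = q"
      using complex_poly_decompose_rsquarefree[OF assms(7)] assms(9) by simp
    finally show ?thesis .
  qed
  \<comment> \<open>Divisibility descends to the real polynomials: the remainder has smaller degree
    than \<open>qr\<close> and yet is divisible by it over the complex numbers.\<close>
  hence "cpoly qr dvd cpoly (F mod qr)"
    unfolding q_eq minus_mult_div_eq_mod[symmetric] by simp
  hence "F mod qr = 0"
    using dvd_imp_degree_le[of "cpoly qr" "cpoly (F mod qr)"] degree_mod_less[OF qr0, of F] by fastforce
  hence "qr dvd F" by (simp add: mod_eq_0_iff_dvd)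
  then obtain N where FN: "F = qr * N" by (auto elim: dvdE)
  have qN: "qr * N = pderiv P * [:-1, 1:] - smult (real k) P" using FN by (simp add: F_def)
  have F1: "poly F 1 = - real k * poly P 1" by (simp add: F_def)
  have F0: "F \<noteq> 0" using F1 P1pos assms(1) by auto
  have N0: "N \<noteq> 0" using F0 FN by auto
  have P1_nz: "P1 \<noteq> 0" using base.P1_pos_nonneg[of 0] by auto
  \<comment> \<open>The coefficients \<open>2 k\<close> of \<open>z^k\<close> in
    \<open>(z - 1) P'\<close> and \<open>k P\<close> cancel, so \<open>F\<close> has degree at most
    \<open>k - 1\<close>. Comparing degrees in \<open>pr = qr^2 P0\<close> gives
    \<open>degree qr = k - 1 - g\<close>.\<close>
  have degN: "degree N \<le> g"
  proof -
    have "degree F \<le> k"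
    proof -
      have "degree (pderiv P * [:-1, 1:]) \<le> degree (pderiv P) + 1" using degree_mult_le[of "pderiv P" "[:-1, 1:]"] by simp
      also have "\<dots> \<le> k" using P_props(2) assms(1) by (simp add: degree_pderiv)
      finally show ?thesis unfolding F_def using P_props(2) by (intro degree_diff_le) auto
    qed
    moreover have "coeff F k = 0"
    proof -
      obtain j where j: "k = Suc j" using assms(1) by (cases k) auto
      have "coeff (pderiv P) k = 0" using P_props(2) assms(1) by (intro coeff_eq_0) (auto simp: degree_pderiv)
      thus ?thesis using P_props(3) unfolding F_def j by (simp add: coeff_pderiv)
    qed
    ultimately have "degree F < k" using F0 leading_coeff_0_iff[of F] by (metis le_neq_implies_less)
    moreover have "degree F = degree qr + degree N" unfolding FN by (rule degree_mult_eq[OF qr0 N0])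
    moreover have "2 * k - 1 = 2 * degree qr + (2 * g + 1)"
    proof -
      have "degree P0 = 2 * g + 1" using P1_nz by (simp add: P0_def)
      moreover have "P0 \<noteq> 0" using P1_nz by (simp add: P0_def)
      ultimately show ?thesis unfolding deg_pr[symmetric] pr_fac using qr0 by (simp add: degree_mult_eq degree_power_eq)
    qed
    ultimately show ?thesis by linarith
  qed
  have "\<exists>y. a l < y \<and> y < b l \<and> poly N y = 0" if "l \<in> {1..g}" for l
    using base.N_root_in_cycle[OF assms(1) PqP0 qr0 qN that] by blast
  then obtain n where n: "\<And>l. l \<in> {1..g} \<Longrightarrow> a l < n l" "\<And>l. l \<in> {1..g} \<Longrightarrow> n l < b l" "\<And>l. l \<in> {1..g} \<Longrightarrow> poly N (n l) = 0"
    by metis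
  have injn: "inj_on n {1..g}"
  proof (rule inj_onI)
    fix i j assume ij: "i \<in> {1..g}" "j \<in> {1..g}" "n i = n j"
    have "n i \<in> {a i..b i}" "n i \<in> {a j..b j}" using n(1,2)[OF ij(1)] n(1,2)[OF ij(2)] ij(3) by auto
    thus "i = j" using base.cycle_unique[OF ij(1,2)] by blast
  qed
  \<comment> \<open>The \<open>g\<close> distinct zeros found in the cycles exhaust the degree of
    \<open>N\<close>, leaving a constant factor.\<close>
  obtain d where d: "d \<noteq> 0" "N = smult d (\<Prod>l\<in>{1..g}. [:- n l, 1:])"
  proof -
    have "(\<Prod>r\<in>n ` {1..g}. [:- r, 1:]) dvd N" by (rule prod_linear_dvd) (use n(3) in auto)
    hence "(\<Prod>l\<in>{1..g}. [:- n l, 1:]) dvd N" unfolding prod.reindex[OF injn] o_def .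
    then obtain M where M: "N = (\<Prod>l\<in>{1..g}. [:- n l, 1:]) * M" by (auto elim: dvdE)
    have M0: "M \<noteq> 0" "(\<Prod>l\<in>{1..g}. [:- n l, 1:]) \<noteq> (0 :: real poly)" using M N0 by auto
    have "degree (\<Prod>l\<in>{1..g}. [:- n l, 1:]) = (\<Sum>l\<in>{1..g}. degree [:- n l, 1:])"
      by (rule degree_prod_eq_sum_degree) auto
    hence "degree N = g + degree M" unfolding M degree_mult_eq[OF M0(2,1)] by simp
    hence "degree M = 0" using degN by simp
    then obtain d where "M = [:d:]" by (rule degree_eq_zeroE)
    thus ?thesis using that[of d] M M0 by (simp add: mult.commute)
  qed
  define eta0 where "eta0 = 1 / real k * Re (poly (pderiv p) 1 / poly p 1) - 1"
  have X1: "poly ([:-1, 1:] ^ (2 * k)) 1 = (0::real)" using assms(1) by (simp add: poly_power)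
  define \<pi> \<pi>' q1 q' N1 N' p1 p1' where "\<pi> = poly P 1" and "\<pi>' = poly (pderiv P) 1" and "q1 = poly qr 1"
    and "q' = poly (pderiv qr) 1" and "N1 = poly N 1" and "N' = poly (pderiv N) 1"
    and "p1 = poly P1 1" and "p1' = poly (pderiv P1) 1"
  note defs = \<pi>_def \<pi>'_def q1_def q'_def N1_def N'_def p1_def p1'_def
  have \<pi>: "\<pi> > 0" using P1pos by (simp add: \<pi>_def)
  \<comment> \<open>At 1 the term \<open>4 (z - 1)^(2 k)\<close> vanishes together with its
    derivative. So \<open>pr\<close> has the value and derivative of \<open>P^2\<close> there, and
    \<open>eta0 + 1\<close> becomes \<open>2 P'(1) / (k P(1))\<close>.\<close>
  have pr1: "poly pr 1 = \<pi>\<^sup>2" unfolding pr_def using X1 by (simp add: \<pi>_def)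
  have pr1': "poly (pderiv pr) 1 = 2 * \<pi> * \<pi>'"
    unfolding pr_def pderiv_diff pderiv_smult power2_eq_square pderiv_mult using Xd1 by (simp add: \<pi>_def \<pi>'_def)
  have e1: "q1\<^sup>2 * p1 = \<pi>\<^sup>2" using pr1 unfolding pr_fac by (simp add: P0_def q1_def p1_def)
  have e2: "2 * q1 * q' * p1 + q1\<^sup>2 * (p1 + p1') = 2 * \<pi> * \<pi>'"
    using pr1' unfolding pr_fac power2_eq_square pderiv_mult P0_def pderiv_pCons by (simp add: defs algebra_simps)
  have q1: "q1 \<noteq> 0" using e1 \<pi> by auto
  have e3: "q1 * N1 = - real k * \<pi>" using F1 unfolding FN by (simp add: defs)
  have e4: "q' * N1 + q1 * N' = (1 - real k) * \<pi>'"
  proof -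
    have "poly (pderiv (qr * N)) 1 = poly (pderiv F) 1" by (simp add: FN)
    thus ?thesis unfolding F_def pderiv_diff pderiv_smult pderiv_mult by (simp add: defs pderiv_pCons algebra_simps)
  qed
  have eta0_val: "real k * \<pi> * (eta0 + 1) = 2 * \<pi>'"
  proof -
    have "poly (pderiv p) 1 = of_real (poly (pderiv pr) 1)" "poly p 1 = of_real (poly pr 1)"
      unfolding p_eq cpoly_pderiv[symmetric] by (rule poly_cpoly_1)+
    hence "eta0 + 1 = 1 / real k * (2 * \<pi> * \<pi>' / \<pi>\<^sup>2)" by (simp add: eta0_def pr1 pr1' flip: of_real_divide)
    thus ?thesis using \<pi> assms(1) by (simp add: field_simps power2_eq_square)
  qed
  have eta0_bound: "\<bar>eta0\<bar> < 1"
  proof -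
    have "0 < real k * \<pi> * (eta0 + 1)" "real k * \<pi> * (eta0 + 1) < real k * \<pi> * 2"
      unfolding eta0_val using dP by (simp_all add: \<pi>_def \<pi>'_def)
    moreover have "real k * \<pi> > 0" using \<pi> assms(1) by simp
    ultimately have "0 < eta0 + 1" "eta0 + 1 < 2" by (simp_all only: zero_less_mult_pos mult_less_cancel_left_pos)
    thus ?thesis by simp
  qed
  have N1_eq: "N1\<^sup>2 = (real k)\<^sup>2 * p1"
  proof -
    have "q1\<^sup>2 * N1\<^sup>2 = (q1 * N1)\<^sup>2" by (simp add: power_mult_distrib)
    also have "\<dots> = q1\<^sup>2 * ((real k)\<^sup>2 * p1)" unfolding e3 using e1 by (simp add: power_mult_distrib mult.left_commute)
    finally show ?thesis using q1 by simp
  qed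
  \<comment> \<open>After multiplication by \<open>q1^2\<close> the relations from
    \<open>pr = qr^2 P0\<close> and \<open>F = qr N\<close> at 1 express everything through
    \<open>P\<close>. The terms with the derivative of \<open>qr\<close> carry the factor
    \<open>k^2 p1 - N1^2\<close>, which is zero by \<open>N1_eq\<close>.\<close>
  have eta0_eq: "(real k)\<^sup>2 * p1' - 2 * N1 * N' = (real k)\<^sup>2 * eta0 * p1"
  proof -
    have "q1\<^sup>2 * ((real k)\<^sup>2 * p1' - 2 * N1 * N') = (real k)\<^sup>2 * (q1\<^sup>2 * p1') - 2 * (q1 * N1) * (q1 * N')"
      by (simp add: power2_eq_square algebra_simps)
    also have "q1\<^sup>2 * p1' = 2 * \<pi> * \<pi>' - 2 * q1 * q' * p1 - \<pi>\<^sup>2" using e1 e2 by (simp add: algebra_simps)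
    also have "q1 * N' = (1 - real k) * \<pi>' - q' * N1" using e4 by simp
    also have "(real k)\<^sup>2 * (2 * \<pi> * \<pi>' - 2 * q1 * q' * p1 - \<pi>\<^sup>2) - 2 * (q1 * N1) * ((1 - real k) * \<pi>' - q' * N1)
      = (real k)\<^sup>2 * (2 * \<pi> * \<pi>' - \<pi>\<^sup>2) - 2 * (q1 * N1) * ((1 - real k) * \<pi>') - 2 * q1 * q' * ((real k)\<^sup>2 * p1 - N1\<^sup>2)"
      by (simp add: power2_eq_square algebra_simps)
    also have "\<dots> = real k * \<pi> * (2 * \<pi>' - real k * \<pi>)"
      unfolding N1_eq e3 by (simp add: power2_eq_square algebra_simps)
    also have "\<dots> = (real k)\<^sup>2 * eta0 * \<pi>\<^sup>2"
      unfolding eta0_val[symmetric] by (simp add: power2_eq_square algebra_simps)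
    also have "\<dots> = q1\<^sup>2 * ((real k)\<^sup>2 * eta0 * p1)" unfolding e1[symmetric] by simp
    finally show ?thesis using q1 by simp
  qed
  interpret S: spectral_curve g a b c P1 P0 k n d eta0 N P qr "rho k \<alpha> \<beta> q"
  proof unfold_locales
    show "rho k \<alpha> \<beta> q z w = (poly (cpoly P) z + poly (cpoly qr) z * w) / (2 * (z - 1) ^ k)" if "z \<noteq> 0" "z \<noteq> 1" for z w
    proof -
      have "trace (Phi k \<alpha> \<beta> z) = poly (cpoly P) z / (z - 1) ^ k" using trP[OF that] that by (simp add: field_simps)
      thus ?thesis by (simp add: rho_def q_eq add_divide_distrib)
    qed
    show "rsquarefree (cpoly P0)" using assms(8) by (simp add: p0_eq)
  qed (use assms(1) d n N1_eq eta0_bound eta0_eq PqP0 qr0 qN in \<open>simp_all add: defs\<close>)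
  have cyc0: "real_cycle p0 x 0 = S.C0" by (simp add: real_cycle_def p0_eq)
  have cycl: "real_cycle p0 x l = S.C l" if "l \<in> {1..g}" for l
  proof -
    have "closure {x (2 * l)<..<x (2 * l - 1)} = {a l..b l}" using ab[OF that] by (simp add: a_def b_def)
    thus ?thesis using that by (simp add: real_cycle_def p0_eq)
  qed
  have cycs: "real_cycles p0 x k' = S.C0 \<union> (\<Union>l\<in>{1..g}. S.C l)"
  proof -
    have "{0..k' - 1} = insert 0 {1..g}" by (auto simp: g_def)
    hence "real_cycles p0 x k' = real_cycle p0 x 0 \<union> (\<Union>l\<in>{1..g}. real_cycle p0 x l)"
      unfolding real_cycles_def by simp
    also have "\<dots> = S.C0 \<union> (\<Union>l\<in>{1..g}. S.C l)" unfolding cyc0 using cycl by simp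
    finally show ?thesis .
  qed
  have GF: "frozen_region k (rho k \<alpha> \<beta> q) p0 x = S.GF"
    unfolding frozen_region_def S.GF_def p0_eq cyc0[unfolded p0_eq] ..
  have GR: "rough_region k (rho k \<alpha> \<beta> q) p0 x k' = S.GR"
    unfolding rough_region_def S.GR_def p0_eq cycs[unfolded p0_eq] ..
  have GS: "smooth_region k (rho k \<alpha> \<beta> q) p0 x k' = S.GS"
    unfolding smooth_region_def S.GS_def g_def[symmetric] using cycl by (auto simp: p0_eq)
  have EFR: "frozen_rough_curve k (rho k \<alpha> \<beta> q) p p0 x = S.EFR"
    unfolding frozen_rough_curve_def S.EFR_def p0_eq cyc0[unfolded p0_eq] eta0_def[symmetric] Let_def ..
  have ERS: "(\<Union>l\<in>{1..k' - 1}. rough_smooth_curve k (rho k \<alpha> \<beta> q) p0 x l) = S.ERS"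
  proof -
    define R where "R chi eta l \<longleftrightarrow> (\<exists>p\<in>S.C l. \<exists>j\<ge>2. S.crit_order chi eta p j)" for chi eta l
    have "rough_smooth_curve k (rho k \<alpha> \<beta> q) p0 x l = {(chi, eta) \<in> open_square. R chi eta l}" if "l \<in> {1..g}" for l
      unfolding rough_smooth_curve_def R_def p0_eq cycl[OF that, unfolded p0_eq] ..
    moreover have "S.ERS = {(chi, eta) \<in> open_square. \<exists>l\<in>{1..g}. R chi eta l}"
      unfolding S.ERS_def R_def ..
    ultimately show ?thesis unfolding g_def[symmetric] by auto
  qed
  show ?thesis
    unfolding Let_def GF GR GS EFR ERS using S.regions by blast
qed

end
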